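(* Let $H$ be a coquasitriangular Hopf algebra over a field $k$ and let $B=P^{co H}\subseteq P$ be a Hopf-Galois extension with Hopf algebra $H$, with $P$ faithfully flat as a left $B$-module. Then the Ehresmann-Schauenburg bialgebroid $\mathcal{L}(P,H)$ has a left antipode.
   Context: Sumless Sweedler notation is used: $\Delta(h)=h_{(1)}\otimes h_{(2)}$ for coproducts and $\Delta_R(p)=p_{(0)}\otimes p_{(1)}$ for right coactions. Coquasitriangular: there is a convolution-invertible linear map $\mathcal{R}:H\otimes H\to k$ with $g_{(1)}h_{(1)}\mathcal{R}(h_{(2)}\otimes g_{(2)})=\mathcal{R}(h_{(1)}\otimes g_{(1)})h_{(2)}g_{(2)}$, $\mathcal{R}(h\otimes gf)=\mathcal{R}(h_{(1)}\otimes f)\mathcal{R}(h_{(2)}\otimes g)$, $\mathcal{R}(hg\otimes f)=\mathcal{R}(h\otimes f_{(1)})\mathcal{R}(g\otimes f_{(2)})$ for all $h,g,f\in H$. Hopf-Galois extension: a right $H$-comodule algebra $P$ with $B=\{b\in P\mid \Delta_R(b)=b\otimes 1_H\}$ such that $\mathrm{can}:P\otimes_B P\to P\otimes H$, $p\otimes_B q\mapsto p q_{(0)}\otimes q_{(1)}$, is bijective. The translation map is $\tau(h)=\mathrm{can}^{-1}(1\otimes h)\in P\otimes_BP$. $\mathcal{L}(P,H)$ is the left $B$-bialgebroid $\{p\otimes q\in P\otimes P\mid p_{(0)}\otimes q_{(0)}\otimes p_{(1)}q_{(1)}=p\otimes q\otimes 1_H\}$ (sums understood), with product $(p\otimes q)(r\otimes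 u)=pr\otimes uq$, unit $1\otimes1$, source $s(b)=b\otimes 1$, target $t(b)=1\otimes b$, coproduct $\Delta(p\otimes q)=p_{(0)}\otimes\tau(p_{(1)})\otimes q$ and counit $\epsilon(p\otimes q)=pq$. Here $\otimes_B$ on a left $B$-bialgebroid $\mathcal{L}$ means $t(b)X\otimes_BY=X\otimes_Bs(b)Y$. Left antipode of a left $B$-bialgebroid $\mathcal{L}$: an invertible linear map $S:\mathcal{L}\to\mathcal{L}$ such that for all $X\in\mathcal{L}$, $b\in B$: (1) $S(t(b)X)=S(X)s(b)$ and $S^{-1}(s(b)X)=S^{-1}(X)t(b)$; (2) $S^{-1}(X_{(2)})_{(1)}\otimes_B S^{-1}(X_{(2)})_{(2)}X_{(1)}=S^{-1}(X)\otimes_B 1$; (3) $S(X_{(1)})_{(1)}X_{(2)}\otimes_B S(X_{(1)})_{(2)}=1\otimes_B S(X)$. *)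

theory Defs
  imports "HOL-Algebra.Free_Abelian_Groups" "HOL-Algebra.Module" "HOL-Algebra.AbelCoset"
begin

section \<open>Tensor products\<close>

text \<open>
  The balanced tensor product of a right module \<open>M\<close> and a left module \<open>N\<close> over a set \<open>R\<close> of scalars
  (acting by \<open>rho\<close> on \<open>M\<close> from the right and by \<open>lam\<close> on \<open>N\<close> from the left) is the free abelian group on
  \<open>carrier M \<times> carrier N\<close> modulo the usual relations.  Its elements are cosets of formal sums.
\<close>

type_synonym ('m, 'n) tens = "(('m \<times> 'n) \<Rightarrow>\<^sub>0 int) set"

definition tensor_relators ::
  "'r set \<Rightarrow> ('m, 'c) ring_scheme \<Rightarrow> ('m \<Rightarrow> 'r \<Rightarrow> 'm) \<Rightarrow> ('n, 'd) ring_scheme \<Rightarrow> ('r \<Rightarrow> 'n \<Rightarrow> 'n) \<Rightarrow> ('m, 'n) tens"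
  where
  "tensor_relators R M rho N lam =
     {frag_of (m \<oplus>\<^bsub>M\<^esub> m', n) - frag_of (m, n) - frag_of (m', n) | m m' n.
        m \<in> carrier M \<and> m' \<in> carrier M \<and> n \<in> carrier N}
   \<union> {frag_of (m, n \<oplus>\<^bsub>N\<^esub> n') - frag_of (m, n) - frag_of (m, n') | m n n'.
        m \<in> carrier M \<and> n \<in> carrier N \<and> n' \<in> carrier N}
   \<union> {frag_of (rho m r, n) - frag_of (m, lam r n) | m r n.
        m \<in> carrier M \<and> r \<in> R \<and> n \<in> carrier N}"

text \<open>
  Only the additive part of the record is meaningful.
\<close>

definition tensor_over ::
  "'r set \<Rightarrow> ('m, 'c) ring_scheme \<Rightarrow> ('m \<Rightarrow> 'r \<Rightarrow> 'm) \<Rightarrow> ('n, 'd) ring_scheme \<Rightarrow> ('r \<Rightarrow> 'n \<Rightarrow> 'n) \<Rightarrow> ('m, 'n) tens ring"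
  where
  "tensor_over R M rho N lam =
     (let F = free_Abelian_group (carrier M \<times> carrier N);
          Q = F Mod (generate F (tensor_relators R M rho N lam))
      in \<lparr>carrier = carrier Q, monoid.mult = undefined, monoid.one = undefined,
          ring.zero = monoid.one Q, ring.add = monoid.mult Q\<rparr>)"

text \<open>
  The pure tensor \<open>m \<otimes> n\<close> in a tensor product \<open>T\<close>.  The zero element of \<open>T\<close> is the subgroup of relations
  itself, so this is the coset of the generator \<open>(m, n)\<close>.
\<close>

definition pure_tensor :: "(('m, 'n) tens, 'c) ring_scheme \<Rightarrow> 'm \<Rightarrow> 'n \<Rightarrow> ('m, 'n) tens"
    (infixl "\<boxtimes>\<index>" 75)
  where "pure_tensor T m n = (\<lambda>z. z + frag_of (m, n)) ` \<zero>\<^bsub>T\<^esub>"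

text \<open>
  \<open>sweedler A X (\<lambda>m n. f m n)\<close> is the value at \<open>X\<close> of the additive map into \<open>A\<close> induced by a balanced
  biadditive \<open>f\<close>: write \<open>X\<close> as a formal sum of pure tensors \<open>x\<^sub>1 \<otimes> x\<^sub>2\<close> and take the sum of the \<open>f x\<^sub>1 x\<^sub>2\<close>.
  For balanced biadditive \<open>f\<close> the choice of the formal sum is irrelevant; see \<open>sweedler_pure\<close> and
  \<open>sweedler_add\<close> below.  Applied to \<open>\<Delta> h\<close>, \<open>\<rho> p\<close> etc. this is sumless Sweedler notation.
\<close>

definition frag_sum :: "('a, 'c) ring_scheme \<Rightarrow> ('b \<Rightarrow> 'a) \<Rightarrow> ('b \<Rightarrow>\<^sub>0 int) \<Rightarrow> 'a"
  where "frag_sum A f x =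
    finsum A (\<lambda>z. add_pow A (Poly_Mapping.lookup x z) (f z)) (Poly_Mapping.keys x)"

definition sweedler :: "('a, 'c) ring_scheme \<Rightarrow> ('m, 'n) tens \<Rightarrow> ('m \<Rightarrow> 'n \<Rightarrow> 'a) \<Rightarrow> 'a"
  where "sweedler A X f = frag_sum A (\<lambda>(m, n). f m n) (SOME x. x \<in> X)"

lemma frag_sum_hom:
  assumes "abelian_group A" and fc: "f \<in> S \<rightarrow> carrier A"
  shows "frag_sum A f \<in> hom (free_Abelian_group S) (add_monoid A)"
    and "s \<in> S \<Longrightarrow> frag_sum A f (frag_of s) = f s"
proof -
  interpret A: abelian_group A by fact
  interpret F: comm_group "free_Abelian_group S" by (rule abelian_free_Abelian_group)
  obtain h where h: "h \<in> hom (free_Abelian_group S) (add_monoid A)" "\<And>x. x \<in> S \<Longrightarrow> h (frag_of x) = f x"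
    using comm_group.free_Abelian_group_universal[OF A.a_comm_group, of f S] fc by auto
  interpret h: group_hom "free_Abelian_group S" "add_monoid A" h
    by (simp add: group_hom.intro group_hom_axioms.intro h A.a_group)
  have *: "h (\<Sum>i\<in>I. frag_cmul (c i) (frag_of i)) = finsum A (\<lambda>i. add_pow A (c i) (f i)) I \<and>
      Poly_Mapping.keys (\<Sum>i\<in>I. frag_cmul (c i) (frag_of i)) \<subseteq> S"
    if "finite I" "I \<subseteq> S" for I and c :: "_ \<Rightarrow> int"
    using that
  proof (induction I)
    case empty
    then show ?case using h.hom_one by (simp add: free_Abelian_group_def)
  next
    case (insert i I)
    have k: "Poly_Mapping.keys (frag_cmul (c i) (frag_of i)) \<subseteq> S"
      using insert.prems keys_cmul[of "c i" "frag_of i"] by (auto simp: keys_frag_of)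
    have p: "h (frag_cmul (c i) (frag_of i)) = add_pow A (c i) (f i)"
    proof -
      have "frag_cmul (c i) (frag_of i) = frag_of i [^]\<^bsub>free_Abelian_group S\<^esub> c i"
        using insert.prems by (subst int_pow_free_Abelian_group) (auto simp: keys_frag_of)
      then have "h (frag_cmul (c i) (frag_of i)) = h (frag_of i) [^]\<^bsub>add_monoid A\<^esub> c i"
        using h.hom_int_pow insert.prems
        by (metis frag_of_in_free_Abelian_group insert_subset)
      then show ?thesis using h(2) insert.prems by (simp add: add_pow_def)
    qed
    have cl: "(\<lambda>i. add_pow A (c i) (f i)) \<in> I \<rightarrow> carrier A" "add_pow A (c i) (f i) \<in> carrier A"
      using fc insert.prems by (auto intro!: A.add.int_pow_closed)
    have "Poly_Mapping.keys (\<Sum>i\<in>insert i I. frag_cmul (c i) (frag_of i)) \<subseteq> S"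
      using insert k by (simp add: order_trans[OF keys_add])
    moreover have "h (\<Sum>i\<in>insert i I. frag_cmul (c i) (frag_of i)) =
        add_pow A (c i) (f i) \<oplus>\<^bsub>A\<^esub> finsum A (\<lambda>i. add_pow A (c i) (f i)) I"
      using insert k p hom_mult[OF h(1), of "frag_cmul (c i) (frag_of i)"
          "\<Sum>i\<in>I. frag_cmul (c i) (frag_of i)"] by (simp add: free_Abelian_group_def)
    ultimately show ?case using insert cl by (simp add: A.finsum_insert)
  qed
  have eq: "frag_sum A f x = h x" if "x \<in> carrier (free_Abelian_group S)" for x
  proof -
    have "Poly_Mapping.keys x \<subseteq> S" using that by (simp add: free_Abelian_group_def)
    moreover have "x = (\<Sum>i\<in>Poly_Mapping.keys x. frag_cmul (Poly_Mapping.lookup x i) (frag_of i))"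
      using frag_expansion[of x] by (simp add: frag_extend_def)
    ultimately show ?thesis
      using *[of "Poly_Mapping.keys x" "Poly_Mapping.lookup x"] by (simp add: frag_sum_def)
  qed
  show "frag_sum A f \<in> hom (free_Abelian_group S) (add_monoid A)"
  proof (rule homI)
    fix x y assume xy: "x \<in> carrier (free_Abelian_group S)" "y \<in> carrier (free_Abelian_group S)"
    show "frag_sum A f x \<in> carrier (add_monoid A)"
      using eq xy h.hom_closed by simp
    show "frag_sum A f (x \<otimes>\<^bsub>free_Abelian_group S\<^esub> y) = frag_sum A f x \<otimes>\<^bsub>add_monoid A\<^esub> frag_sum A f y"
      unfolding eq[OF xy(1)] eq[OF xy(2)] eq[OF F.m_closed[OF xy]] by (rule h.hom_mult[OF xy])
  qed
  show "frag_sum A f (frag_of s) = f s" if "s \<in> S"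
    using eq[of "frag_of s"] h(2)[OF that] that by simp
qed


locale balanced_pair =
  fixes R :: "'r set" and M :: "('m, 'c) ring_scheme" and rho :: "'m \<Rightarrow> 'r \<Rightarrow> 'm"
    and N :: "('n, 'd) ring_scheme" and lam :: "'r \<Rightarrow> 'n \<Rightarrow> 'n"
  assumes M: "abelian_group M" and N: "abelian_group N"
    and rho_closed: "m \<in> carrier M \<Longrightarrow> r \<in> R \<Longrightarrow> rho m r \<in> carrier M"
    and lam_closed: "r \<in> R \<Longrightarrow> n \<in> carrier N \<Longrightarrow> lam r n \<in> carrier N"
begin

abbreviation "F \<equiv> free_Abelian_group (carrier M \<times> carrier N)"
abbreviation "rels \<equiv> generate F (tensor_relators R M rho N lam)"
abbreviation "T \<equiv> tensor_over R M rho N lam"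

lemma relators_carrier: "tensor_relators R M rho N lam \<subseteq> carrier F"
proof -
  interpret M: abelian_group M by (rule M)
  interpret N: abelian_group N by (rule N)
  have d: "x - y \<in> carrier F" if "x \<in> carrier F" "y \<in> carrier F" for x y
    using that keys_diff[of x y] by (auto simp: free_Abelian_group_def)
  show ?thesis
    unfolding tensor_relators_def
    by (auto simp: rho_closed lam_closed intro!: d)
qed

lemma rels_normal: "rels \<lhd> F"
proof -
  interpret F: comm_group F by (rule abelian_free_Abelian_group)
  show ?thesis
    by (simp add: F.subgroup_imp_normal F.generate_is_subgroup relators_carrier)
qed

lemma tensor_simps:
  "carrier T = carrier (F Mod rels)" "\<zero>\<^bsub>T\<^esub> = rels" "add T = monoid.mult (F Mod rels)"
  by (simp_all add: tensor_over_def Let_def)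

lemma add_monoid_tensor: "comm_group (add_monoid T)"
proof -
  interpret F: comm_group F by (rule abelian_free_Abelian_group)
  have "comm_group (F Mod rels)"
    using F.abelian_FactGroup F.generate_is_subgroup relators_carrier by blast
  moreover have "add_monoid T = F Mod rels"
    by (simp add: tensor_simps FactGroup_def)
  ultimately show ?thesis by simp
qed

lemma abelian_group_tensor: "abelian_group T"
  using add_monoid_tensor
  by (simp add: abelian_group_def abelian_group_axioms_def abelian_monoid_def comm_group_def)

lemma pure_tensor_eq: "m \<boxtimes>\<^bsub>T\<^esub> n = rels #>\<^bsub>F\<^esub> frag_of (m, n)"
  by (auto simp: pure_tensor_def tensor_simps r_coset_def free_Abelian_group_def)

lemma pure_tensor_closed: "m \<in> carrier M \<Longrightarrow> n \<in> carrier N \<Longrightarrow> m \<boxtimes>\<^bsub>T\<^esub> n \<in> carrier T"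
  by (auto simp: tensor_simps pure_tensor_eq carrier_FactGroup)

context
  fixes A :: "('a, 'e) ring_scheme" and f :: "'m \<Rightarrow> 'n \<Rightarrow> 'a"
  assumes A: "abelian_group A"
    and f_closed: "\<And>m n. m \<in> carrier M \<Longrightarrow> n \<in> carrier N \<Longrightarrow> f m n \<in> carrier A"
    and f_add_left: "\<And>m m' n. m \<in> carrier M \<Longrightarrow> m' \<in> carrier M \<Longrightarrow> n \<in> carrier N \<Longrightarrow>
      f (m \<oplus>\<^bsub>M\<^esub> m') n = f m n \<oplus>\<^bsub>A\<^esub> f m' n"
    and f_add_right: "\<And>m n n'. m \<in> carrier M \<Longrightarrow> n \<in> carrier N \<Longrightarrow> n' \<in> carrier N \<Longrightarrow>
      f m (n \<oplus>\<^bsub>N\<^esub> n') = f m n \<oplus>\<^bsub>A\<^esub> f m n'"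
    and f_balanced: "\<And>m r n. m \<in> carrier M \<Longrightarrow> r \<in> R \<Longrightarrow> n \<in> carrier N \<Longrightarrow>
      f (rho m r) n = f m (lam r n)"
begin

private abbreviation "h \<equiv> frag_sum A (\<lambda>(m, n). f m n)"

private lemma h_hom: "group_hom F (add_monoid A) h"
proof -
  interpret A: abelian_group A by (rule A)
  show ?thesis
    unfolding group_hom_def group_hom_axioms_def
    by (intro conjI frag_sum_hom(1)[OF A] group_free_Abelian_group A.a_group) (auto simp: f_closed)
qed

private lemma h_of: "m \<in> carrier M \<Longrightarrow> n \<in> carrier N \<Longrightarrow> h (frag_of (m, n)) = f m n"
  by (subst frag_sum_hom(2)[OF A, of _ "carrier M \<times> carrier N"]) (auto simp: f_closed)

private lemma h_diff:
  assumes "x \<in> carrier F" "y \<in> carrier F"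
  shows "h (x - y) = h x \<ominus>\<^bsub>A\<^esub> h y" "x - y \<in> carrier F" "h x \<in> carrier A"
proof -
  interpret h: group_hom F "add_monoid A" h by (rule h_hom)
  show c: "x - y \<in> carrier F"
    using assms keys_diff[of x y] by (auto simp: free_Abelian_group_def)
  interpret A: abelian_group A by (rule A)
  have "h ((x - y) \<otimes>\<^bsub>F\<^esub> y) = h (x - y) \<oplus>\<^bsub>A\<^esub> h y"
    using h.hom_mult[OF c assms(2)] by simp
  then have "h x = h (x - y) \<oplus>\<^bsub>A\<^esub> h y"
    by (simp add: free_Abelian_group_def)
  moreover have "h (x - y) \<in> carrier A" "h y \<in> carrier A" and x: "h x \<in> carrier A"
    using h.hom_closed c assms by force+
  ultimately show "h (x - y) = h x \<ominus>\<^bsub>A\<^esub> h y"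
    by (simp only: A.minus_eq A.a_assoc A.a_inv_closed A.r_neg A.r_zero)
  show "h x \<in> carrier A" by (rule x)
qed

private lemma h_relators:
  assumes "x \<in> tensor_relators R M rho N lam"
  shows "h x = \<zero>\<^bsub>A\<^esub>"
proof -
  interpret A: abelian_group A by (rule A)
  interpret M: abelian_group M by (rule M)
  interpret N: abelian_group N by (rule N)
  have cancel: "a \<oplus>\<^bsub>A\<^esub> b \<ominus>\<^bsub>A\<^esub> a \<ominus>\<^bsub>A\<^esub> b = \<zero>\<^bsub>A\<^esub>" if "a \<in> carrier A" "b \<in> carrier A" for a b
    using that by (subst A.a_comm) (simp_all add: A.minus_eq A.a_assoc A.r_neg A.r_neg1 A.r_neg2)
  have F: "frag_of (m, n) \<in> carrier F" if "m \<in> carrier M" "n \<in> carrier N" for m n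
    using that by simp
  from assms consider
      m m' n where "x = frag_of (m \<oplus>\<^bsub>M\<^esub> m', n) - frag_of (m, n) - frag_of (m', n)"
        "m \<in> carrier M" "m' \<in> carrier M" "n \<in> carrier N"
    | m n n' where "x = frag_of (m, n \<oplus>\<^bsub>N\<^esub> n') - frag_of (m, n) - frag_of (m, n')"
        "m \<in> carrier M" "n \<in> carrier N" "n' \<in> carrier N"
    | m r n where "x = frag_of (rho m r, n) - frag_of (m, lam r n)"
        "m \<in> carrier M" "r \<in> R" "n \<in> carrier N"
    unfolding tensor_relators_def by blast
  then show ?thesis
  proof cases
    case 1
    then show ?thesis
      by (simp only: h_diff F M.a_closed h_of f_add_left cancel f_closed)
  next
    case 2
    then show ?thesis
      by (simp only: h_diff F N.a_closed h_of f_add_right cancel f_closed)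
  next
    case 3
    then show ?thesis
      by (simp only: h_diff F rho_closed lam_closed h_of f_balanced f_closed A.minus_eq A.r_neg)
  qed
qed

private lemma h_rels: "x \<in> rels \<Longrightarrow> h x = \<zero>\<^bsub>A\<^esub>"
proof (induction rule: generate.induct)
  case one
  interpret h: group_hom F "add_monoid A" h by (rule h_hom)
  show ?case using h.hom_one by simp
next
  case (incl x)
  then show ?case by (rule h_relators)
next
  case (inv x)
  interpret h: group_hom F "add_monoid A" h by (rule h_hom)
  have "h (inv\<^bsub>F\<^esub> x) = inv\<^bsub>add_monoid A\<^esub> \<one>\<^bsub>add_monoid A\<^esub>"
    using h.hom_inv[of x] inv relators_carrier h_relators[OF inv] by auto
  then show ?case using h.H.inv_one by simp
next
  case (eng x y)
  interpret h: group_hom F "add_monoid A" h by (rule h_hom)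
  interpret A: abelian_group A by (rule A)
  interpret F: comm_group F by (rule abelian_free_Abelian_group)
  have "x \<in> carrier F" "y \<in> carrier F"
    using eng.hyps h.G.generate_incl[OF relators_carrier] by blast+
  then show ?case using h.hom_mult[of x y] eng A.zero_closed by (simp add: A.l_zero)
qed

private lemma sweedler_coset:
  assumes x: "x \<in> carrier F"
  shows "sweedler A (rels #>\<^bsub>F\<^esub> x) f = h x"
proof -
  interpret h: group_hom F "add_monoid A" h by (rule h_hom)
  interpret A: abelian_group A by (rule A)
  interpret F: comm_group F by (rule abelian_free_Abelian_group)
  interpret rels: normal rels F by (rule rels_normal)
  have "(SOME y. y \<in> rels #>\<^bsub>F\<^esub> x) \<in> rels #>\<^bsub>F\<^esub> x"
    using group.rcos_self[OF group_free_Abelian_group x rels.is_subgroup] by (rule someI)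
  then obtain r where r: "r \<in> rels" "(SOME y. y \<in> rels #>\<^bsub>F\<^esub> x) = r \<otimes>\<^bsub>F\<^esub> x"
    unfolding r_coset_def by blast
  have "h (r \<otimes>\<^bsub>F\<^esub> x) = h r \<oplus>\<^bsub>A\<^esub> h x"
    using h.hom_mult[OF subsetD[OF rels.subset r(1)] x] by simp
  also have "\<dots> = h x"
    using h.hom_closed[OF x] by (simp only: h_rels[OF r(1)]) (simp add: A.l_zero)
  finally show ?thesis by (simp only: sweedler_def r(2))
qed

lemma sweedler_pure:
  "m \<in> carrier M \<Longrightarrow> n \<in> carrier N \<Longrightarrow> sweedler A (m \<boxtimes>\<^bsub>T\<^esub> n) f = f m n"
  by (simp add: pure_tensor_eq sweedler_coset h_of)

lemma sweedler_closed: "u \<in> carrier T \<Longrightarrow> sweedler A u f \<in> carrier A"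
  unfolding tensor_simps carrier_FactGroup
  by (elim imageE) (simp only: sweedler_coset h_diff(3))

lemma sweedler_add:
  assumes "u \<in> carrier T" "v \<in> carrier T"
  shows "sweedler A (u \<oplus>\<^bsub>T\<^esub> v) f = sweedler A u f \<oplus>\<^bsub>A\<^esub> sweedler A v f"
proof -
  interpret h: group_hom F "add_monoid A" h by (rule h_hom)
  interpret rels: normal rels F by (rule rels_normal)
  from assms obtain x y where x: "x \<in> carrier F" and u: "u = rels #>\<^bsub>F\<^esub> x"
    and y: "y \<in> carrier F" and v: "v = rels #>\<^bsub>F\<^esub> y"
    unfolding tensor_simps carrier_FactGroup by (elim imageE)
  have "u \<oplus>\<^bsub>T\<^esub> v = rels #>\<^bsub>F\<^esub> (x \<otimes>\<^bsub>F\<^esub> y)"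
    unfolding tensor_simps mult_FactGroup u v by (rule rels.rcos_sum[OF x y])
  then show ?thesis
    using h.hom_mult[OF x y] sweedler_coset[OF x] sweedler_coset[OF y] sweedler_coset[OF h.G.m_closed[OF x y]]
    unfolding u v by simp
qed

end

end


section \<open>Tensor products over a field and linear maps\<close>

definition tensor ::
  "('k, 'a) ring_scheme \<Rightarrow> ('k, 'v, 'c) module_scheme \<Rightarrow> ('k, 'w, 'd) module_scheme \<Rightarrow> ('k, ('v, 'w) tens) module"
  where
  "tensor K V W =
     (let T = tensor_over (carrier K) V (\<lambda>v c. c \<odot>\<^bsub>V\<^esub> v) W (\<lambda>c w. c \<odot>\<^bsub>W\<^esub> w)
      in \<lparr>carrier = carrier T, monoid.mult = monoid.mult T, monoid.one = monoid.one T,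
          ring.zero = ring.zero T, ring.add = ring.add T,
          smult = (\<lambda>c u. sweedler T u (\<lambda>v w. (c \<odot>\<^bsub>V\<^esub> v) \<boxtimes>\<^bsub>T\<^esub> w))\<rparr>)"

definition self_module :: "('k, 'a) ring_scheme \<Rightarrow> ('k, 'k) module"
  where "self_module K =
    \<lparr>carrier = carrier K, monoid.mult = monoid.mult K, monoid.one = monoid.one K,
     ring.zero = ring.zero K, ring.add = ring.add K, smult = monoid.mult K\<rparr>"

definition linear_map ::
  "('k, 'a) ring_scheme \<Rightarrow> ('k, 'v, 'c) module_scheme \<Rightarrow> ('k, 'w, 'd) module_scheme \<Rightarrow> ('v \<Rightarrow> 'w) \<Rightarrow> bool"
  where
  "linear_map K V W f \<longleftrightarrow>
     f \<in> carrier V \<rightarrow> carrier W \<and>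
     (\<forall>v\<in>carrier V. \<forall>w\<in>carrier V. f (v \<oplus>\<^bsub>V\<^esub> w) = f v \<oplus>\<^bsub>W\<^esub> f w) \<and>
     (\<forall>c\<in>carrier K. \<forall>v\<in>carrier V. f (c \<odot>\<^bsub>V\<^esub> v) = c \<odot>\<^bsub>W\<^esub> f v)"

text \<open>
  Associative unital, not necessarily commutative algebras (the library locale \<open>algebra\<close> is
  commutative).  The zero algebra is allowed.
\<close>

locale unital_algebra = K: field K + A: ring A + module K A
  for K :: "'k ring" and A :: "('k, 'a) module" +
  assumes smult_mult_left: "\<lbrakk>c \<in> carrier K; a \<in> carrier A; b \<in> carrier A\<rbrakk> \<Longrightarrow>
      (c \<odot>\<^bsub>A\<^esub> a) \<otimes>\<^bsub>A\<^esub> b = c \<odot>\<^bsub>A\<^esub> (a \<otimes>\<^bsub>A\<^esub> b)"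
    and smult_mult_right: "\<lbrakk>c \<in> carrier K; a \<in> carrier A; b \<in> carrier A\<rbrakk> \<Longrightarrow>
      a \<otimes>\<^bsub>A\<^esub> (c \<odot>\<^bsub>A\<^esub> b) = c \<odot>\<^bsub>A\<^esub> (a \<otimes>\<^bsub>A\<^esub> b)"


section \<open>Hopf algebras\<close>

text \<open>
  Iterated tensor products are bracketed to the right, so \<open>H \<otimes> H \<otimes> H\<close> is \<open>tensor K H (tensor K H H)\<close>.
\<close>

locale hopf_algebra = unital_algebra K H
  for K :: "'k ring" and H :: "('k, 'h) module" +
  fixes \<Delta> :: "'h \<Rightarrow> ('h, 'h) tens" and \<epsilon> :: "'h \<Rightarrow> 'k" and antip :: "'h \<Rightarrow> 'h"
  assumes comult_linear: "linear_map K H (tensor K H H) \<Delta>"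
    and counit_linear: "linear_map K H (self_module K) \<epsilon>"
    and antip_linear: "linear_map K H H antip"
    and coassoc: "h \<in> carrier H \<Longrightarrow>
      sweedler (tensor K H (tensor K H H)) (\<Delta> h) (\<lambda>h\<^sub>1 h\<^sub>2. h\<^sub>1 \<boxtimes>\<^bsub>tensor K H (tensor K H H)\<^esub> \<Delta> h\<^sub>2) =
      sweedler (tensor K H (tensor K H H)) (\<Delta> h) (\<lambda>h\<^sub>1 h\<^sub>2.
        sweedler (tensor K H (tensor K H H)) (\<Delta> h\<^sub>1) (\<lambda>a b.
          a \<boxtimes>\<^bsub>tensor K H (tensor K H H)\<^esub> (b \<boxtimes>\<^bsub>tensor K H H\<^esub> h\<^sub>2)))"
    and counit_left: "h \<in> carrier H \<Longrightarrow> sweedler H (\<Delta> h) (\<lambda>h\<^sub>1 h\<^sub>2. \<epsilon> h\<^sub>1 \<odot>\<^bsub>H\<^esub> h\<^sub>2) = h"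
    and counit_right: "h \<in> carrier H \<Longrightarrow> sweedler H (\<Delta> h) (\<lambda>h\<^sub>1 h\<^sub>2. \<epsilon> h\<^sub>2 \<odot>\<^bsub>H\<^esub> h\<^sub>1) = h"
    and comult_mult: "\<lbrakk>g \<in> carrier H; h \<in> carrier H\<rbrakk> \<Longrightarrow>
      \<Delta> (g \<otimes>\<^bsub>H\<^esub> h) =
      sweedler (tensor K H H) (\<Delta> g) (\<lambda>g\<^sub>1 g\<^sub>2. sweedler (tensor K H H) (\<Delta> h) (\<lambda>h\<^sub>1 h\<^sub>2.
        (g\<^sub>1 \<otimes>\<^bsub>H\<^esub> h\<^sub>1) \<boxtimes>\<^bsub>tensor K H H\<^esub> (g\<^sub>2 \<otimes>\<^bsub>H\<^esub> h\<^sub>2)))"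
    and comult_one: "\<Delta> \<one>\<^bsub>H\<^esub> = \<one>\<^bsub>H\<^esub> \<boxtimes>\<^bsub>tensor K H H\<^esub> \<one>\<^bsub>H\<^esub>"
    and counit_mult: "\<lbrakk>g \<in> carrier H; h \<in> carrier H\<rbrakk> \<Longrightarrow> \<epsilon> (g \<otimes>\<^bsub>H\<^esub> h) = \<epsilon> g \<otimes>\<^bsub>K\<^esub> \<epsilon> h"
    and counit_one: "\<epsilon> \<one>\<^bsub>H\<^esub> = \<one>\<^bsub>K\<^esub>"
    and antip_left: "h \<in> carrier H \<Longrightarrow>
      sweedler H (\<Delta> h) (\<lambda>h\<^sub>1 h\<^sub>2. antip h\<^sub>1 \<otimes>\<^bsub>H\<^esub> h\<^sub>2) = \<epsilon> h \<odot>\<^bsub>H\<^esub> \<one>\<^bsub>H\<^esub>"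
    and antip_right: "h \<in> carrier H \<Longrightarrow>
      sweedler H (\<Delta> h) (\<lambda>h\<^sub>1 h\<^sub>2. h\<^sub>1 \<otimes>\<^bsub>H\<^esub> antip h\<^sub>2) = \<epsilon> h \<odot>\<^bsub>H\<^esub> \<one>\<^bsub>H\<^esub>"

text \<open>
  The convolution on linear maps \<open>H \<otimes> H \<rightarrow> K\<close> is taken with respect to the tensor product coalgebra
  structure on \<open>H \<otimes> H\<close>, with counit \<open>\<epsilon> \<otimes> \<epsilon>\<close>; by linearity it is enough to test on pure tensors.
\<close>

definition convolution_inverse_forms ::
  "'k ring \<Rightarrow> ('k, 'h) module \<Rightarrow> ('h \<Rightarrow> ('h, 'h) tens) \<Rightarrow> ('h \<Rightarrow> 'k) \<Rightarrow>
   (('h, 'h) tens \<Rightarrow> 'k) \<Rightarrow> (('h, 'h) tens \<Rightarrow> 'k) \<Rightarrow> bool"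
  where
  "convolution_inverse_forms K H \<Delta> \<epsilon> f f' \<longleftrightarrow>
     linear_map K (tensor K H H) (self_module K) f \<and>
     linear_map K (tensor K H H) (self_module K) f' \<and>
     (\<forall>g\<in>carrier H. \<forall>h\<in>carrier H.
        sweedler K (\<Delta> g) (\<lambda>g\<^sub>1 g\<^sub>2. sweedler K (\<Delta> h) (\<lambda>h\<^sub>1 h\<^sub>2.
          f (g\<^sub>1 \<boxtimes>\<^bsub>tensor K H H\<^esub> h\<^sub>1) \<otimes>\<^bsub>K\<^esub> f' (g\<^sub>2 \<boxtimes>\<^bsub>tensor K H H\<^esub> h\<^sub>2))) = \<epsilon> g \<otimes>\<^bsub>K\<^esub> \<epsilon> h \<and>
        sweedler K (\<Delta> g) (\<lambda>g\<^sub>1 g\<^sub>2. sweedler K (\<Delta> h) (\<lambda>h\<^sub>1 h\<^sub>2.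
          f' (g\<^sub>1 \<boxtimes>\<^bsub>tensor K H H\<^esub> h\<^sub>1) \<otimes>\<^bsub>K\<^esub> f (g\<^sub>2 \<boxtimes>\<^bsub>tensor K H H\<^esub> h\<^sub>2))) = \<epsilon> g \<otimes>\<^bsub>K\<^esub> \<epsilon> h)"

definition coquasitriangular ::
  "'k ring \<Rightarrow> ('k, 'h) module \<Rightarrow> ('h \<Rightarrow> ('h, 'h) tens) \<Rightarrow> ('h \<Rightarrow> 'k) \<Rightarrow> bool"
  where
  "coquasitriangular K H \<Delta> \<epsilon> \<longleftrightarrow> (\<exists>\<R> \<R>'. convolution_inverse_forms K H \<Delta> \<epsilon> \<R> \<R>' \<and>
     (\<forall>g\<in>carrier H. \<forall>h\<in>carrier H.
        sweedler H (\<Delta> g) (\<lambda>g\<^sub>1 g\<^sub>2. sweedler H (\<Delta> h) (\<lambda>h\<^sub>1 h\<^sub>2.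
          \<R> (h\<^sub>2 \<boxtimes>\<^bsub>tensor K H H\<^esub> g\<^sub>2) \<odot>\<^bsub>H\<^esub> (g\<^sub>1 \<otimes>\<^bsub>H\<^esub> h\<^sub>1))) =
        sweedler H (\<Delta> g) (\<lambda>g\<^sub>1 g\<^sub>2. sweedler H (\<Delta> h) (\<lambda>h\<^sub>1 h\<^sub>2.
          \<R> (h\<^sub>1 \<boxtimes>\<^bsub>tensor K H H\<^esub> g\<^sub>1) \<odot>\<^bsub>H\<^esub> (h\<^sub>2 \<otimes>\<^bsub>H\<^esub> g\<^sub>2)))) \<and>
     (\<forall>h\<in>carrier H. \<forall>g\<in>carrier H. \<forall>f\<in>carrier H.
        \<R> (h \<boxtimes>\<^bsub>tensor K H H\<^esub> (g \<otimes>\<^bsub>H\<^esub> f)) =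
          sweedler K (\<Delta> h) (\<lambda>h\<^sub>1 h\<^sub>2. \<R> (h\<^sub>1 \<boxtimes>\<^bsub>tensor K H H\<^esub> f) \<otimes>\<^bsub>K\<^esub> \<R> (h\<^sub>2 \<boxtimes>\<^bsub>tensor K H H\<^esub> g)) \<and>
        \<R> ((h \<otimes>\<^bsub>H\<^esub> g) \<boxtimes>\<^bsub>tensor K H H\<^esub> f) =
          sweedler K (\<Delta> f) (\<lambda>f\<^sub>1 f\<^sub>2. \<R> (h \<boxtimes>\<^bsub>tensor K H H\<^esub> f\<^sub>1) \<otimes>\<^bsub>K\<^esub> \<R> (g \<boxtimes>\<^bsub>tensor K H H\<^esub> f\<^sub>2))))"


section \<open>Hopf-Galois extensions\<close>

locale comodule_algebra = hopf_algebra K H \<Delta> \<epsilon> antip + P: unital_algebra K P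
  for K :: "'k ring" and H :: "('k, 'h) module" and \<Delta> \<epsilon> antip and P :: "('k, 'p) module" +
  fixes \<rho> :: "'p \<Rightarrow> ('p, 'h) tens"
  assumes coact_linear: "linear_map K P (tensor K P H) \<rho>"
    and coact_coassoc: "p \<in> carrier P \<Longrightarrow>
      sweedler (tensor K P (tensor K H H)) (\<rho> p) (\<lambda>p\<^sub>0 p\<^sub>1. p\<^sub>0 \<boxtimes>\<^bsub>tensor K P (tensor K H H)\<^esub> \<Delta> p\<^sub>1) =
      sweedler (tensor K P (tensor K H H)) (\<rho> p) (\<lambda>p\<^sub>0 p\<^sub>1.
        sweedler (tensor K P (tensor K H H)) (\<rho> p\<^sub>0) (\<lambda>a b.
          a \<boxtimes>\<^bsub>tensor K P (tensor K H H)\<^esub> (b \<boxtimes>\<^bsub>tensor K H H\<^esub> p\<^sub>1)))"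
    and coact_counit: "p \<in> carrier P \<Longrightarrow> sweedler P (\<rho> p) (\<lambda>p\<^sub>0 p\<^sub>1. \<epsilon> p\<^sub>1 \<odot>\<^bsub>P\<^esub> p\<^sub>0) = p"
    and coact_mult: "\<lbrakk>p \<in> carrier P; q \<in> carrier P\<rbrakk> \<Longrightarrow>
      \<rho> (p \<otimes>\<^bsub>P\<^esub> q) =
      sweedler (tensor K P H) (\<rho> p) (\<lambda>p\<^sub>0 p\<^sub>1. sweedler (tensor K P H) (\<rho> q) (\<lambda>q\<^sub>0 q\<^sub>1.
        (p\<^sub>0 \<otimes>\<^bsub>P\<^esub> q\<^sub>0) \<boxtimes>\<^bsub>tensor K P H\<^esub> (p\<^sub>1 \<otimes>\<^bsub>H\<^esub> q\<^sub>1)))"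
    and coact_one: "\<rho> \<one>\<^bsub>P\<^esub> = \<one>\<^bsub>P\<^esub> \<boxtimes>\<^bsub>tensor K P H\<^esub> \<one>\<^bsub>H\<^esub>"

definition coinvariants ::
  "'k ring \<Rightarrow> ('k, 'h) module \<Rightarrow> ('k, 'p) module \<Rightarrow> ('p \<Rightarrow> ('p, 'h) tens) \<Rightarrow> ('k, 'p) module"
  where "coinvariants K H P \<rho> =
    P\<lparr>carrier := {b \<in> carrier P. \<rho> b = b \<boxtimes>\<^bsub>tensor K P H\<^esub> \<one>\<^bsub>H\<^esub>}\<rparr>"

definition tensor_coinv ::
  "'k ring \<Rightarrow> ('k, 'h) module \<Rightarrow> ('k, 'p) module \<Rightarrow> ('p \<Rightarrow> ('p, 'h) tens) \<Rightarrow> ('p, 'p) tens ring"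
  where "tensor_coinv K H P \<rho> =
    tensor_over (carrier (coinvariants K H P \<rho>)) P (monoid.mult P) P (monoid.mult P)"

definition canonical_map ::
  "'k ring \<Rightarrow> ('k, 'h) module \<Rightarrow> ('k, 'p) module \<Rightarrow> ('p \<Rightarrow> ('p, 'h) tens) \<Rightarrow> ('p, 'p) tens \<Rightarrow> ('p, 'h) tens"
  where "canonical_map K H P \<rho> u =
    sweedler (tensor K P H) u (\<lambda>p q. sweedler (tensor K P H) (\<rho> q) (\<lambda>q\<^sub>0 q\<^sub>1.
      (p \<otimes>\<^bsub>P\<^esub> q\<^sub>0) \<boxtimes>\<^bsub>tensor K P H\<^esub> q\<^sub>1))"

locale hopf_galois = comodule_algebra +
  assumes canonical_bij:
    "bij_betw (canonical_map K H P \<rho>) (carrier (tensor_coinv K H P \<rho>)) (carrier (tensor K P H))"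

definition translation_map ::
  "'k ring \<Rightarrow> ('k, 'h) module \<Rightarrow> ('k, 'p) module \<Rightarrow> ('p \<Rightarrow> ('p, 'h) tens) \<Rightarrow> 'h \<Rightarrow> ('p, 'p) tens"
  where "translation_map K H P \<rho> h =
    inv_into (carrier (tensor_coinv K H P \<rho>)) (canonical_map K H P \<rho>) (\<one>\<^bsub>P\<^esub> \<boxtimes>\<^bsub>tensor K P H\<^esub> h)"


section \<open>Faithful flatness\<close>

definition right_module ::
  "('b, 'c) ring_scheme \<Rightarrow> ('m, 'd) ring_scheme \<Rightarrow> ('m \<Rightarrow> 'b \<Rightarrow> 'm) \<Rightarrow> bool"
  where
  "right_module B M act \<longleftrightarrow> abelian_group M \<and>
     (\<forall>m\<in>carrier M. \<forall>b\<in>carrier B. act m b \<in> carrier M) \<and>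
     (\<forall>m\<in>carrier M. \<forall>m'\<in>carrier M. \<forall>b\<in>carrier B. act (m \<oplus>\<^bsub>M\<^esub> m') b = act m b \<oplus>\<^bsub>M\<^esub> act m' b) \<and>
     (\<forall>m\<in>carrier M. \<forall>b\<in>carrier B. \<forall>b'\<in>carrier B. act m (b \<oplus>\<^bsub>B\<^esub> b') = act m b \<oplus>\<^bsub>M\<^esub> act m b') \<and>
     (\<forall>m\<in>carrier M. \<forall>b\<in>carrier B. \<forall>b'\<in>carrier B. act m (b \<otimes>\<^bsub>B\<^esub> b') = act (act m b) b') \<and>
     (\<forall>m\<in>carrier M. act m \<one>\<^bsub>B\<^esub> = m)"

definition right_module_hom ::
  "('b, 'c) ring_scheme \<Rightarrow> ('m, 'd) ring_scheme \<Rightarrow> ('m \<Rightarrow> 'b \<Rightarrow> 'm) \<Rightarrow>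
   ('n, 'e) ring_scheme \<Rightarrow> ('n \<Rightarrow> 'b \<Rightarrow> 'n) \<Rightarrow> ('m \<Rightarrow> 'n) \<Rightarrow> bool"
  where
  "right_module_hom B M actM N actN f \<longleftrightarrow>
     f \<in> carrier M \<rightarrow> carrier N \<and>
     (\<forall>m\<in>carrier M. \<forall>m'\<in>carrier M. f (m \<oplus>\<^bsub>M\<^esub> m') = f m \<oplus>\<^bsub>N\<^esub> f m') \<and>
     (\<forall>m\<in>carrier M. \<forall>b\<in>carrier B. f (actM m b) = actN (f m) b)"

text \<open>
  A left module \<open>N\<close> over \<open>B\<close> (with action \<open>lam\<close>) is faithfully flat iff a sequence
  \<open>M\<^sub>1 \<rightarrow> M\<^sub>2 \<rightarrow> M\<^sub>3\<close> of right \<open>B\<close>-modules is exact precisely when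
  \<open>M\<^sub>1 \<otimes>\<^sub>B N \<rightarrow> M\<^sub>2 \<otimes>\<^sub>B N \<rightarrow> M\<^sub>3 \<otimes>\<^sub>B N\<close> is exact.

  HOL cannot quantify over all types inside a formula, so the modules range over those with carrier
  in a type \<open>'u\<close>.  This is no restriction as soon as \<open>'u\<close> admits an injection from \<open>'b set\<close>: then, up to
  isomorphism, \<open>B\<close>, its right ideals \<open>I\<close> and its cyclic modules \<open>B/I\<close> occur, exactness for
  \<open>0 \<rightarrow> I \<rightarrow> B\<close> gives flatness, and \<open>B/I \<otimes>\<^sub>B N = 0\<close> only for \<open>B/I = 0\<close> gives faithfulness.
\<close>

definition faithfully_flat ::
  "'u itself \<Rightarrow> ('b, 'c) ring_scheme \<Rightarrow> ('n, 'd) ring_scheme \<Rightarrow> ('b \<Rightarrow> 'n \<Rightarrow> 'n) \<Rightarrow> bool"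
  where
  "faithfully_flat (U :: 'u itself) B N lam \<longleftrightarrow>
     (\<forall>(M\<^sub>1 :: 'u ring) act\<^sub>1 (M\<^sub>2 :: 'u ring) act\<^sub>2 (M\<^sub>3 :: 'u ring) act\<^sub>3 f g.
        right_module B M\<^sub>1 act\<^sub>1 \<and> right_module B M\<^sub>2 act\<^sub>2 \<and> right_module B M\<^sub>3 act\<^sub>3 \<and>
        right_module_hom B M\<^sub>1 act\<^sub>1 M\<^sub>2 act\<^sub>2 f \<and> right_module_hom B M\<^sub>2 act\<^sub>2 M\<^sub>3 act\<^sub>3 g \<longrightarrow>
        (let T\<^sub>1 = tensor_over (carrier B) M\<^sub>1 act\<^sub>1 N lam;
             T\<^sub>2 = tensor_over (carrier B) M\<^sub>2 act\<^sub>2 N lam;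
             T\<^sub>3 = tensor_over (carrier B) M\<^sub>3 act\<^sub>3 N lam
         in f ` carrier M\<^sub>1 = a_kernel M\<^sub>2 M\<^sub>3 g \<longleftrightarrow>
            (\<lambda>u. sweedler T\<^sub>2 u (\<lambda>m n. f m \<boxtimes>\<^bsub>T\<^sub>2\<^esub> n)) ` carrier T\<^sub>1 =
            a_kernel T\<^sub>2 T\<^sub>3 (\<lambda>u. sweedler T\<^sub>3 u (\<lambda>m n. g m \<boxtimes>\<^bsub>T\<^sub>3\<^esub> n))))"


section \<open>Bialgebroids and left antipodes\<close>

text \<open>
  The underlying data of a left bialgebroid.  In \<open>balanced_tensor\<close>, the tensor product over the base
  identifies \<open>t(b) x \<otimes> y\<close> with \<open>x \<otimes> s(b) y\<close>.
\<close>

definition balanced_tensor ::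
  "('b, 'c) ring_scheme \<Rightarrow> ('l, 'd) ring_scheme \<Rightarrow> ('b \<Rightarrow> 'l) \<Rightarrow> ('b \<Rightarrow> 'l) \<Rightarrow> ('l, 'l) tens ring"
  where "balanced_tensor B L s t =
    tensor_over (carrier B) L (\<lambda>x b. t b \<otimes>\<^bsub>L\<^esub> x) L (\<lambda>b y. s b \<otimes>\<^bsub>L\<^esub> y)"

record ('k, 'b, 'l) bialgebroid =
  base :: "('k, 'b) module"
  total :: "('k, 'l) module"
  source :: "'b \<Rightarrow> 'l"
  target :: "'b \<Rightarrow> 'l"
  comult :: "'l \<Rightarrow> ('l, 'l) tens"
  counit :: "'l \<Rightarrow> 'b"

definition left_antipode :: "'k ring \<Rightarrow> ('k, 'b, 'l) bialgebroid \<Rightarrow> ('l \<Rightarrow> 'l) \<Rightarrow> bool"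
  where
  "left_antipode K \<L> S \<longleftrightarrow>
     (let B = base \<L>; L = total \<L>; s = source \<L>; t = target \<L>; \<Delta> = comult \<L>;
          LL = balanced_tensor B L s t;
          S' = inv_into (carrier L) S
      in linear_map K L L S \<and> bij_betw S (carrier L) (carrier L) \<and>
         (\<forall>x\<in>carrier L. \<forall>b\<in>carrier B.
            S (t b \<otimes>\<^bsub>L\<^esub> x) = S x \<otimes>\<^bsub>L\<^esub> s b \<and> S' (s b \<otimes>\<^bsub>L\<^esub> x) = S' x \<otimes>\<^bsub>L\<^esub> t b) \<and>
         (\<forall>x\<in>carrier L.
            sweedler LL (\<Delta> x) (\<lambda>x\<^sub>1 x\<^sub>2. sweedler LL (\<Delta> (S' x\<^sub>2)) (\<lambda>y\<^sub>1 y\<^sub>2.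
              y\<^sub>1 \<boxtimes>\<^bsub>LL\<^esub> (y\<^sub>2 \<otimes>\<^bsub>L\<^esub> x\<^sub>1))) = S' x \<boxtimes>\<^bsub>LL\<^esub> \<one>\<^bsub>L\<^esub>) \<and>
         (\<forall>x\<in>carrier L.
            sweedler LL (\<Delta> x) (\<lambda>x\<^sub>1 x\<^sub>2. sweedler LL (\<Delta> (S x\<^sub>1)) (\<lambda>y\<^sub>1 y\<^sub>2.
              (y\<^sub>1 \<otimes>\<^bsub>L\<^esub> x\<^sub>2) \<boxtimes>\<^bsub>LL\<^esub> y\<^sub>2)) = \<one>\<^bsub>L\<^esub> \<boxtimes>\<^bsub>LL\<^esub> S x))"


section \<open>The Ehresmann-Schauenburg bialgebroid\<close>

text \<open>\<open>P \<otimes> P\<close> with the product of \<open>P \<otimes> P\<^sup>o\<^sup>p\<close>.\<close>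

definition es_ambient :: "'k ring \<Rightarrow> ('k, 'p) module \<Rightarrow> ('k, ('p, 'p) tens) module"
  where "es_ambient K P = (tensor K P P)
    \<lparr>monoid.mult := (\<lambda>x y. sweedler (tensor K P P) x (\<lambda>p q. sweedler (tensor K P P) y (\<lambda>r u.
       (p \<otimes>\<^bsub>P\<^esub> r) \<boxtimes>\<^bsub>tensor K P P\<^esub> (u \<otimes>\<^bsub>P\<^esub> q)))),
     monoid.one := \<one>\<^bsub>P\<^esub> \<boxtimes>\<^bsub>tensor K P P\<^esub> \<one>\<^bsub>P\<^esub>\<rparr>"

definition es_total ::
  "'k ring \<Rightarrow> ('k, 'h) module \<Rightarrow> ('k, 'p) module \<Rightarrow> ('p \<Rightarrow> ('p, 'h) tens) \<Rightarrow> ('k, ('p, 'p) tens) module"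
  where "es_total K H P \<rho> = (let PPH = tensor K P (tensor K P H) in
    (es_ambient K P)\<lparr>carrier := {x \<in> carrier (tensor K P P).
       sweedler PPH x (\<lambda>p q. sweedler PPH (\<rho> p) (\<lambda>p\<^sub>0 p\<^sub>1. sweedler PPH (\<rho> q) (\<lambda>q\<^sub>0 q\<^sub>1.
         p\<^sub>0 \<boxtimes>\<^bsub>PPH\<^esub> (q\<^sub>0 \<boxtimes>\<^bsub>tensor K P H\<^esub> (p\<^sub>1 \<otimes>\<^bsub>H\<^esub> q\<^sub>1))))) =
       sweedler PPH x (\<lambda>p q. p \<boxtimes>\<^bsub>PPH\<^esub> (q \<boxtimes>\<^bsub>tensor K P H\<^esub> \<one>\<^bsub>H\<^esub>))}\<rparr>)"

definition es_source :: "'k ring \<Rightarrow> ('k, 'p) module \<Rightarrow> 'p \<Rightarrow> ('p, 'p) tens"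
  where "es_source K P b = b \<boxtimes>\<^bsub>tensor K P P\<^esub> \<one>\<^bsub>P\<^esub>"

definition es_target :: "'k ring \<Rightarrow> ('k, 'p) module \<Rightarrow> 'p \<Rightarrow> ('p, 'p) tens"
  where "es_target K P b = \<one>\<^bsub>P\<^esub> \<boxtimes>\<^bsub>tensor K P P\<^esub> b"

text \<open>
  The expression \<open>p\<^sub>0 \<otimes> \<tau>(p\<^sub>1) \<otimes> q\<close> is an element of \<open>P \<otimes> (P \<otimes>\<^sub>B P) \<otimes> P = (P \<otimes> P) \<otimes>\<^sub>B (P \<otimes> P)\<close>, where
  \<open>(p \<otimes> q b) \<otimes>\<^sub>B (r \<otimes> u) = (p \<otimes> q) \<otimes>\<^sub>B (b r \<otimes> u)\<close>, that is, \<open>t(b) x \<otimes>\<^sub>B y = x \<otimes>\<^sub>B s(b) y\<close>.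
  The coproduct of \<open>x\<close> is the element of \<open>L \<otimes>\<^sub>B L\<close> which is mapped to this expression by the map
  \<open>L \<otimes>\<^sub>B L \<rightarrow> (P \<otimes> P) \<otimes>\<^sub>B (P \<otimes> P)\<close> induced by the inclusion; for a Hopf-Galois extension with \<open>P\<close>
  faithfully flat as a left \<open>B\<close>-module it exists and is unique.
\<close>

definition es_comult ::
  "'k ring \<Rightarrow> ('k, 'h) module \<Rightarrow> ('k, 'p) module \<Rightarrow> ('p \<Rightarrow> ('p, 'h) tens) \<Rightarrow>
   ('p, 'p) tens \<Rightarrow> (('p, 'p) tens, ('p, 'p) tens) tens"
  where "es_comult K H P \<rho> x =
    (let PP = tensor K P P;
         B = coinvariants K H P \<rho>;
         LL = balanced_tensor B (es_total K H P \<rho>) (es_source K P) (es_target K P);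
         E = balanced_tensor B (es_ambient K P) (es_source K P) (es_target K P)
     in THE d. d \<in> carrier LL \<and>
          sweedler E d (\<lambda>y z. y \<boxtimes>\<^bsub>E\<^esub> z) =
          sweedler E x (\<lambda>p q. sweedler E (\<rho> p) (\<lambda>p\<^sub>0 p\<^sub>1.
            sweedler E (translation_map K H P \<rho> p\<^sub>1) (\<lambda>u v. (p\<^sub>0 \<boxtimes>\<^bsub>PP\<^esub> u) \<boxtimes>\<^bsub>E\<^esub> (v \<boxtimes>\<^bsub>PP\<^esub> q)))))"

definition es_bialgebroid ::
  "'k ring \<Rightarrow> ('k, 'h) module \<Rightarrow> ('k, 'p) module \<Rightarrow> ('p \<Rightarrow> ('p, 'h) tens) \<Rightarrow>
   ('k, 'p, ('p, 'p) tens) bialgebroid"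
  where "es_bialgebroid K H P \<rho> =
    \<lparr>base = coinvariants K H P \<rho>,
     total = es_total K H P \<rho>,
     source = es_source K P,
     target = es_target K P,
     comult = es_comult K H P \<rho>,
     counit = (\<lambda>x. sweedler P x (\<lambda>p q. p \<otimes>\<^bsub>P\<^esub> q))\<rparr>"

end

theory Submission
  imports Defs
begin

text \<open>
  The antipode is built from the form \<open>R\<close> alone: \<open>S (p \<otimes> q) = R (p\<^sub>1, q\<^sub>1) q\<^sub>0 \<otimes> p\<^sub>0\<close>, with inverse
  \<open>p \<otimes> q \<mapsto> R\<^sup>- (q\<^sub>1, p\<^sub>1) q\<^sub>0 \<otimes> p\<^sub>0\<close> for the convolution inverse \<open>R\<^sup>-\<close>.  Commutation of \<open>R\<close> with the
  products \<open>g h\<close> and \<open>h g\<close> makes both maps preserve coinvariants.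

  To compare elements of \<open>L \<otimes>\<^sub>B L\<close>, they are mapped to \<open>P \<otimes> P \<otimes> P\<close> by
  \<open>\<mu> ((p \<otimes> q) \<otimes> (r \<otimes> u)) = p \<otimes> q r \<otimes> u\<close>.  Tensoring with \<open>P\<close> over \<open>B\<close> turns \<open>\<mu>\<close> into a map with an
  explicit left inverse, because \<open>L \<otimes>\<^sub>B P \<cong> P \<otimes> P\<close> by \<open>x \<otimes> r \<mapsto> x r\<close>; by faithful flatness \<open>\<mu>\<close> is
  injective, and its image is an equalizer of two maps.  Hence \<open>p \<otimes> 1 \<otimes> q\<close> comes from a unique element of
  \<open>L \<otimes>\<^sub>B L\<close> whenever \<open>p \<otimes> q \<in> L\<close> (sums understood); this element is \<open>\<Delta> (p \<otimes> q)\<close>.  The antipode axioms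
  are verified after applying \<open>\<mu>\<close>, where they reduce to \<open>v v'\<^sub>0 \<otimes> v'\<^sub>1 = 1 \<otimes> h\<close> and
  \<open>v\<^sub>0 v' \<otimes> v\<^sub>1 = 1 \<otimes> antip h\<close> for the translation map \<open>\<tau> h = v \<otimes> v'\<close>.
\<close>

text \<open>The formula for \<open>S\<close> is the braiding of \<open>H\<close>-comodules defined
  by \<open>R\<close>, taken on \<open>P \<otimes> P\<close>. As \<open>L\<close> consists of the
  coinvariants of the diagonal coaction, an invertible comodule map of \<open>P \<otimes> P\<close>
  restricts to a bijection of \<open>L\<close>. The obstacle is the coproduct. \<open>L\<close> is
  cut out by an equation and comes without generators, so neither is it clear that
  \<open>p\<^sub>0 \<otimes> \<tau> p\<^sub>1 \<otimes> q\<close> comes from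
  \<open>L \<otimes>\<^sub>B L\<close>, nor that elements of \<open>L \<otimes>\<^sub>B L\<close>
  can be told apart in the ambient product. Both are questions about right \<open>B\<close>-modules,
  tested by tensoring with the left \<open>B\<close>-module \<open>P\<close>; the maps to which
  flatness is applied are therefore arranged to be right \<open>B\<close>-linear in the last tensor
  factor. The virtue of \<mu> is that it contracts the two legs of the translation map to a scalar,
  so the coproduct loses its implicit part. The two antipode identities are not symmetric. In one of
  them the form meets the right leg of \<tau>; in the other it meets the left leg, which produces an
  antipode, and removing it uses the coinvariance of the element once more.\<close>

section \<open>Sweedler sums and tensor products of modules\<close>

text \<open>
  \<open>sweedler\<close> with its integrand restricted to the carriers.  The congruence rule then needs no
  well-definedness assumption, so the simplifier can rewrite under nested Sweedler sums.
\<close>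

definition sw ::
  "('m, 'c) ring_scheme \<Rightarrow> ('n, 'd) ring_scheme \<Rightarrow> ('a, 'e) ring_scheme \<Rightarrow> ('m, 'n) tens \<Rightarrow> ('m \<Rightarrow> 'n \<Rightarrow> 'a) \<Rightarrow> 'a"
  where "sw M N A u f = sweedler A u (\<lambda>m n. if m \<in> carrier M \<and> n \<in> carrier N then f m n else \<zero>\<^bsub>A\<^esub>)"

lemma sw_cong [cong]:
  assumes "M = M'" "N = N'" "A = A'" "u = u'" "\<And>m n. m \<in> carrier M' \<Longrightarrow> n \<in> carrier N' \<Longrightarrow> f m n = g m n"
  shows "sw M N A u f = sw M' N' A' u' g"
proof -
  have "(\<lambda>m n. if m \<in> carrier M' \<and> n \<in> carrier N' then f m n else \<zero>\<^bsub>A'\<^esub>) =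
        (\<lambda>m n. if m \<in> carrier M' \<and> n \<in> carrier N' then g m n else \<zero>\<^bsub>A'\<^esub>)"
    using assms(5) by (intro ext) auto
  then show ?thesis unfolding sw_def assms(1-4) by simp
qed

section \<open>Sweedler sums as finite sums\<close>

lemma hom_group_hom:
  assumes "abelian_group A" "abelian_group B" "g \<in> hom (add_monoid A) (add_monoid B)"
  shows "group_hom (add_monoid A) (add_monoid B) g"
  using assms by (simp add: group_hom_def group_hom_axioms_def abelian_group.a_group)

lemma hom_add_closed:
  "g \<in> hom (add_monoid A) (add_monoid B) \<Longrightarrow> x \<in> carrier A \<Longrightarrow> g x \<in> carrier B"
  using hom_in_carrier[of g "add_monoid A" "add_monoid B" x] by simp

lemma hom_add_add:
  "g \<in> hom (add_monoid A) (add_monoid B) \<Longrightarrow> x \<in> carrier A \<Longrightarrow> y \<in> carrier A \<Longrightarrow>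
    g (x \<oplus>\<^bsub>A\<^esub> y) = g x \<oplus>\<^bsub>B\<^esub> g y"
  using hom_mult[of g "add_monoid A" "add_monoid B" x y] by simp

lemma hom_add_zero:
  assumes "abelian_group A" "abelian_group B" "g \<in> hom (add_monoid A) (add_monoid B)"
  shows "g \<zero>\<^bsub>A\<^esub> = \<zero>\<^bsub>B\<^esub>"
  using group_hom.hom_one[OF hom_group_hom[OF assms]] by simp

lemma hom_add_pow:
  assumes "abelian_group A" "abelian_group B" "g \<in> hom (add_monoid A) (add_monoid B)" "x \<in> carrier A"
  shows "g (add_pow A (n::int) x) = add_pow B n (g x)"
  using group_hom.hom_int_pow[OF hom_group_hom[OF assms(1-3)], of x n] assms(4)
  by (simp add: add_pow_def)

lemma hom_finsum:
  assumes A: "abelian_group A" and B: "abelian_group B"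
    and g: "g \<in> hom (add_monoid A) (add_monoid B)"
    and "finite I" "f \<in> I \<rightarrow> carrier A"
  shows "g (finsum A f I) = finsum B (\<lambda>i. g (f i)) I"
proof -
  interpret A: abelian_group A by fact
  interpret B: abelian_group B by fact
  show ?thesis
    using assms(4,5)
  proof (induction I)
    case empty
    then show ?case using hom_add_zero[OF A B g] by simp
  next
    case (insert i I)
    have "finsum A f I \<in> carrier A" using insert by (intro A.finsum_closed) auto
    moreover have "finsum A f (insert i I) = f i \<oplus>\<^bsub>A\<^esub> finsum A f I"
      using insert by (intro A.finsum_insert) auto
    moreover have "finsum B (\<lambda>i. g (f i)) (insert i I) = g (f i) \<oplus>\<^bsub>B\<^esub> finsum B (\<lambda>i. g (f i)) I"
      using insert by (intro B.finsum_insert) (auto intro!: hom_add_closed[OF g])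
    ultimately show ?case using insert by (simp add: hom_add_add[OF g] Pi_iff)
  qed
qed

definition tens_keys :: "('m, 'c) ring_scheme \<Rightarrow> ('n, 'd) ring_scheme \<Rightarrow> ('m, 'n) tens \<Rightarrow> ('m \<times> 'n) set"
  where "tens_keys M N u = Poly_Mapping.keys (SOME x. x \<in> u) \<inter> carrier M \<times> carrier N"

definition tens_coeff :: "('m, 'n) tens \<Rightarrow> 'm \<times> 'n \<Rightarrow> int"
  where "tens_coeff u = Poly_Mapping.lookup (SOME x. x \<in> u)"

lemma finite_tens_keys: "finite (tens_keys M N u)"
  by (simp add: tens_keys_def)

lemma tens_keysD: "z \<in> tens_keys M N u \<Longrightarrow> fst z \<in> carrier M" "z \<in> tens_keys M N u \<Longrightarrow> snd z \<in> carrier N"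
  by (auto simp: tens_keys_def)

text \<open>The chosen formal sum has finitely many keys, so a Sweedler sum is a finite sum in
  \<open>A\<close> for any integrand with values there, balanced or not. Additivity in the integrand
  and interchange of sums follow from this alone; only the dependence on \<open>u\<close> requires a
  balanced integrand.\<close>

lemma sw_eq_finsum:
  assumes "abelian_group A" and f: "\<And>m n. m \<in> carrier M \<Longrightarrow> n \<in> carrier N \<Longrightarrow> f m n \<in> carrier A"
  shows "sw M N A u f = finsum A (\<lambda>z. add_pow A (tens_coeff u z) (f (fst z) (snd z))) (tens_keys M N u)"
proof -
  interpret A: abelian_group A by fact
  let ?x = "SOME x. x \<in> u"
  let ?F = "\<lambda>z. add_pow A (Poly_Mapping.lookup ?x z)
      (case z of (m, n) \<Rightarrow> if m \<in> carrier M \<and> n \<in> carrier N then f m n else \<zero>\<^bsub>A\<^esub>)"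
  have "sw M N A u f = finsum A ?F (Poly_Mapping.keys ?x)"
    by (simp add: sw_def sweedler_def frag_sum_def)
  also have "\<dots> = finsum A ?F (tens_keys M N u)"
  proof -
    \<comment> \<open>Keys outside the carriers contribute only the default value of
      \<open>sw\<close>.\<close>
    have "?F z = \<zero>\<^bsub>A\<^esub>" if "z \<in> Poly_Mapping.keys ?x - tens_keys M N u" for z
      using that A.add.int_pow_one by (cases z) (auto simp: add_pow_def tens_keys_def split: if_splits)
    moreover have "?F z \<in> carrier A" for z
      using f by (cases z) (auto intro!: A.add.int_pow_closed)
    ultimately show ?thesis
      by (intro A.add.finprod_mono_neutral_cong_right) (auto simp: tens_keys_def)
  qed
  also have "\<dots> = finsum A (\<lambda>z. add_pow A (tens_coeff u z) (f (fst z) (snd z))) (tens_keys M N u)"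
    using f by (intro A.finsum_cong') (auto simp: tens_keys_def tens_coeff_def intro!: A.add.int_pow_closed)
  finally show ?thesis .
qed

lemma sw_closed:
  assumes "abelian_group A" "\<And>m n. m \<in> carrier M \<Longrightarrow> n \<in> carrier N \<Longrightarrow> f m n \<in> carrier A"
  shows "sw M N A u f \<in> carrier A"
proof -
  interpret A: abelian_group A by fact
  show ?thesis
    using assms(2) by (auto simp: sw_eq_finsum[OF assms] tens_keysD intro!: A.finsum_closed A.add.int_pow_closed)
qed

lemma sw_hom:
  assumes A: "abelian_group A" and B: "abelian_group B"
    and g: "g \<in> hom (add_monoid A) (add_monoid B)"
    and f: "\<And>m n. m \<in> carrier M \<Longrightarrow> n \<in> carrier N \<Longrightarrow> f m n \<in> carrier A"
  shows "g (sw M N A u f) = sw M N B u (\<lambda>m n. g (f m n))"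
proof -
  interpret A: abelian_group A by fact
  interpret B: abelian_group B by fact
  have "g (sw M N A u f) = finsum B (\<lambda>z. g (add_pow A (tens_coeff u z) (f (fst z) (snd z)))) (tens_keys M N u)"
    using f
    by (subst sw_eq_finsum[OF A], simp, subst hom_finsum[OF A B g finite_tens_keys])
      (auto simp: tens_keysD intro!: A.add.int_pow_closed)
  also have "\<dots> = finsum B (\<lambda>z. add_pow B (tens_coeff u z) (g (f (fst z) (snd z)))) (tens_keys M N u)"
    using f
    by (intro B.finsum_cong')
      (auto simp: tens_keysD hom_add_pow[OF A B g] hom_add_closed[OF g] intro!: B.add.int_pow_closed)
  also have "\<dots> = sw M N B u (\<lambda>m n. g (f m n))"
    using f by (intro sw_eq_finsum[symmetric] B) (auto simp: hom_add_closed[OF g])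
  finally show ?thesis .
qed

lemma sw_add:
  assumes A: "abelian_group A"
    and f: "\<And>m n. m \<in> carrier M \<Longrightarrow> n \<in> carrier N \<Longrightarrow> f m n \<in> carrier A"
    and g: "\<And>m n. m \<in> carrier M \<Longrightarrow> n \<in> carrier N \<Longrightarrow> g m n \<in> carrier A"
  shows "sw M N A u (\<lambda>m n. f m n \<oplus>\<^bsub>A\<^esub> g m n) = sw M N A u f \<oplus>\<^bsub>A\<^esub> sw M N A u g"
proof -
  interpret A: abelian_group A by fact
  let ?I = "tens_keys M N u" and ?c = "tens_coeff u"
  have "sw M N A u (\<lambda>m n. f m n \<oplus>\<^bsub>A\<^esub> g m n) =
      finsum A (\<lambda>z. add_pow A (?c z) (f (fst z) (snd z) \<oplus>\<^bsub>A\<^esub> g (fst z) (snd z))) ?I"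
    using f g by (intro sw_eq_finsum A) auto
  also have "\<dots> = finsum A (\<lambda>z. add_pow A (?c z) (f (fst z) (snd z)) \<oplus>\<^bsub>A\<^esub> add_pow A (?c z) (g (fst z) (snd z))) ?I"
    using f g
    by (intro A.finsum_cong') (auto simp: tens_keysD A.add.int_pow_distrib intro!: A.add.int_pow_closed)
  also have "\<dots> = sw M N A u f \<oplus>\<^bsub>A\<^esub> sw M N A u g"
    using f g
    by (subst A.finsum_addf) (auto simp: tens_keysD sw_eq_finsum A intro!: A.add.int_pow_closed)
  finally show ?thesis .
qed

lemma sw_zero:
  assumes "abelian_group A"
  shows "sw M N A u (\<lambda>m n. \<zero>\<^bsub>A\<^esub>) = \<zero>\<^bsub>A\<^esub>"
proof -
  interpret A: abelian_group A by fact
  let ?s = "sw M N A u (\<lambda>m n. \<zero>\<^bsub>A\<^esub>)"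
  have s: "?s \<in> carrier A" by (rule sw_closed) (simp_all add: assms)
  have "?s = ?s \<oplus>\<^bsub>A\<^esub> ?s"
    using sw_add[OF assms, of M N "\<lambda>m n. \<zero>\<^bsub>A\<^esub>" "\<lambda>m n. \<zero>\<^bsub>A\<^esub>" u] by simp
  then show ?thesis using s A.add.r_cancel_one' by metis
qed

lemma sw_finsum:
  assumes A: "abelian_group A"
    and "finite J" "\<And>z m n. z \<in> J \<Longrightarrow> m \<in> carrier M \<Longrightarrow> n \<in> carrier N \<Longrightarrow> h z m n \<in> carrier A"
  shows "sw M N A u (\<lambda>m n. finsum A (\<lambda>z. h z m n) J) = finsum A (\<lambda>z. sw M N A u (h z)) J"
proof -
  interpret A: abelian_group A by fact
  show ?thesis
    using assms(2,3)
  proof (induction J)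
    case empty
    then show ?case by (simp add: sw_zero A)
  next
    case (insert z J)
    have "sw M N A u (\<lambda>m n. finsum A (\<lambda>z. h z m n) (insert z J)) =
        sw M N A u (\<lambda>m n. h z m n \<oplus>\<^bsub>A\<^esub> finsum A (\<lambda>z. h z m n) J)"
      using insert by (intro sw_cong refl A.finsum_insert) auto
    also have "\<dots> = sw M N A u (h z) \<oplus>\<^bsub>A\<^esub> sw M N A u (\<lambda>m n. finsum A (\<lambda>z. h z m n) J)"
      using insert by (intro sw_add) (auto intro!: A A.finsum_closed)
    also have "\<dots> = finsum A (\<lambda>z. sw M N A u (h z)) (insert z J)"
      using insert by (subst A.finsum_insert) (auto intro!: sw_closed A)
    finally show ?case .
  qed
qed

text \<open>Fubini for two finite sums over fixed key sets. The integrand only has to take values in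
  \<open>A\<close>, so reordering nested sums never raises a question of well-definedness.\<close>

lemma sw_swap:
  assumes A: "abelian_group A"
    and f: "\<And>m n m' n'. m \<in> carrier M \<Longrightarrow> n \<in> carrier N \<Longrightarrow> m' \<in> carrier M' \<Longrightarrow> n' \<in> carrier N' \<Longrightarrow>
      f m n m' n' \<in> carrier A"
  shows "sw M N A u (\<lambda>m n. sw M' N' A u' (\<lambda>m' n'. f m n m' n')) =
    sw M' N' A u' (\<lambda>m' n'. sw M N A u (\<lambda>m n. f m n m' n'))"
proof -
  interpret A: abelian_group A by fact
  let ?I = "tens_keys M N u" and ?c = "tens_coeff u"
  have "sw M' N' A u' (\<lambda>m' n'. sw M N A u (\<lambda>m n. f m n m' n')) =
      sw M' N' A u' (\<lambda>m' n'. finsum A (\<lambda>z. add_pow A (?c z) (f (fst z) (snd z) m' n')) ?I)"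
    using f by (intro sw_cong refl sw_eq_finsum A) auto
  also have "\<dots> = finsum A (\<lambda>z. sw M' N' A u' (\<lambda>m' n'. add_pow A (?c z) (f (fst z) (snd z) m' n'))) ?I"
    using f by (intro sw_finsum A finite_tens_keys) (auto simp: tens_keysD intro!: A.add.int_pow_closed)
  also have "\<dots> = finsum A (\<lambda>z. add_pow A (?c z) (sw M' N' A u' (f (fst z) (snd z)))) ?I"
  proof (intro A.finsum_cong' refl Pi_I)
    fix z assume z: "z \<in> ?I"
    then show "add_pow A (?c z) (sw M' N' A u' (f (fst z) (snd z))) \<in> carrier A"
      using f by (intro A.add.int_pow_closed sw_closed A) (auto simp: tens_keysD)
    have "(\<lambda>x. add_pow A (?c z) x) \<in> hom (add_monoid A) (add_monoid A)"
      by (rule homI) (auto simp: A.add.int_pow_distrib intro!: A.add.int_pow_closed)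
    then show "sw M' N' A u' (\<lambda>m' n'. add_pow A (?c z) (f (fst z) (snd z) m' n')) =
        add_pow A (?c z) (sw M' N' A u' (f (fst z) (snd z)))"
      using f z by (intro sw_hom[OF A A, symmetric]) (auto simp: tens_keysD)
  qed
  also have "\<dots> = sw M N A u (\<lambda>m n. sw M' N' A u' (\<lambda>m' n'. f m n m' n'))"
    using f by (intro sw_eq_finsum[symmetric] A sw_closed) auto
  finally show ?thesis by simp
qed

section \<open>Balanced tensor products as modules over the scalars\<close>

definition bil ::
  "'k ring \<Rightarrow> ('k, 'm) module \<Rightarrow> ('k, 'n) module \<Rightarrow> ('k, 'a) module \<Rightarrow> ('m \<Rightarrow> 'n \<Rightarrow> 'a) \<Rightarrow> bool"
  where "bil K V W A f \<longleftrightarrow>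
    (\<forall>w\<in>carrier W. linear_map K V A (\<lambda>v. f v w)) \<and> (\<forall>v\<in>carrier V. linear_map K W A (\<lambda>w. f v w))"

text \<open>
  \<open>tensor_over\<close> with the scalar action of \<open>K\<close> on the left factor.  For \<open>R = carrier K\<close> this is \<open>tensor\<close>,
  so tensor products over \<open>K\<close> and over \<open>B\<close> share one development.
\<close>

definition tmod ::
  "'k ring \<Rightarrow> 'r set \<Rightarrow> ('k, 'm) module \<Rightarrow> ('m \<Rightarrow> 'r \<Rightarrow> 'm) \<Rightarrow> ('k, 'n) module \<Rightarrow> ('r \<Rightarrow> 'n \<Rightarrow> 'n) \<Rightarrow>
   ('k, ('m, 'n) tens) module"
  where "tmod K R M rho N lam =
     (let T = tensor_over R M rho N lam
      in \<lparr>carrier = carrier T, monoid.mult = monoid.mult T, monoid.one = monoid.one T,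
          ring.zero = ring.zero T, ring.add = ring.add T,
          smult = (\<lambda>c u. sweedler T u (\<lambda>m n. (c \<odot>\<^bsub>M\<^esub> m) \<boxtimes>\<^bsub>T\<^esub> n))\<rparr>)"

lemma tensor_eq_tmod:
  "tensor K V W = tmod K (carrier K) V (\<lambda>v c. c \<odot>\<^bsub>V\<^esub> v) W (\<lambda>c w. c \<odot>\<^bsub>W\<^esub> w)"
  by (simp add: tensor_def tmod_def)

definition rbil ::
  "'k ring \<Rightarrow> 'r set \<Rightarrow> ('k, 'm) module \<Rightarrow> ('m \<Rightarrow> 'r \<Rightarrow> 'm) \<Rightarrow> ('k, 'n) module \<Rightarrow> ('r \<Rightarrow> 'n \<Rightarrow> 'n) \<Rightarrow>
   ('k, 'a) module \<Rightarrow> ('m \<Rightarrow> 'n \<Rightarrow> 'a) \<Rightarrow> bool"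
  where "rbil K R M rho N lam A f \<longleftrightarrow> bil K M N A f \<and>
    (\<forall>m\<in>carrier M. \<forall>r\<in>R. \<forall>n\<in>carrier N. f (rho m r) n = f m (lam r n))"

lemma linear_mapD:
  assumes "linear_map K V W f"
  shows "v \<in> carrier V \<Longrightarrow> f v \<in> carrier W"
    and "v \<in> carrier V \<Longrightarrow> w \<in> carrier V \<Longrightarrow> f (v \<oplus>\<^bsub>V\<^esub> w) = f v \<oplus>\<^bsub>W\<^esub> f w"
    and "c \<in> carrier K \<Longrightarrow> v \<in> carrier V \<Longrightarrow> f (c \<odot>\<^bsub>V\<^esub> v) = c \<odot>\<^bsub>W\<^esub> f v"
  using assms by (auto simp: linear_map_def)

lemma linear_mapI:
  assumes "\<And>v. v \<in> carrier V \<Longrightarrow> f v \<in> carrier W"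
    and "\<And>v w. v \<in> carrier V \<Longrightarrow> w \<in> carrier V \<Longrightarrow> f (v \<oplus>\<^bsub>V\<^esub> w) = f v \<oplus>\<^bsub>W\<^esub> f w"
    and "\<And>c v. c \<in> carrier K \<Longrightarrow> v \<in> carrier V \<Longrightarrow> f (c \<odot>\<^bsub>V\<^esub> v) = c \<odot>\<^bsub>W\<^esub> f v"
  shows "linear_map K V W f"
  using assms by (auto simp: linear_map_def)

lemma linear_map_hom: "linear_map K V W f \<Longrightarrow> f \<in> hom (add_monoid V) (add_monoid W)"
  by (auto simp: linear_map_def hom_def)

lemma linear_map_comp:
  "linear_map K V W f \<Longrightarrow> linear_map K W X g \<Longrightarrow> linear_map K V X (\<lambda>v. g (f v))"
  by (auto simp: linear_map_def Pi_iff)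

lemma bilD:
  assumes "bil K V W A f"
  shows "v \<in> carrier V \<Longrightarrow> w \<in> carrier W \<Longrightarrow> f v w \<in> carrier A"
    and "v \<in> carrier V \<Longrightarrow> v' \<in> carrier V \<Longrightarrow> w \<in> carrier W \<Longrightarrow> f (v \<oplus>\<^bsub>V\<^esub> v') w = f v w \<oplus>\<^bsub>A\<^esub> f v' w"
    and "v \<in> carrier V \<Longrightarrow> w \<in> carrier W \<Longrightarrow> w' \<in> carrier W \<Longrightarrow> f v (w \<oplus>\<^bsub>W\<^esub> w') = f v w \<oplus>\<^bsub>A\<^esub> f v w'"
    and "c \<in> carrier K \<Longrightarrow> v \<in> carrier V \<Longrightarrow> w \<in> carrier W \<Longrightarrow> f (c \<odot>\<^bsub>V\<^esub> v) w = c \<odot>\<^bsub>A\<^esub> f v w"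
    and "c \<in> carrier K \<Longrightarrow> v \<in> carrier V \<Longrightarrow> w \<in> carrier W \<Longrightarrow> f v (c \<odot>\<^bsub>W\<^esub> w) = c \<odot>\<^bsub>A\<^esub> f v w"
  using assms by (auto simp: bil_def linear_map_def)

text \<open>Sums see only the additive part of the target. This is what allows the module
  \<open>tmod\<close> to stand in for the ring record produced by
  \<open>tensor_over\<close>.\<close>

lemma sweedler_add_monoid_cong:
  assumes "carrier A = carrier A'" "\<zero>\<^bsub>A\<^esub> = \<zero>\<^bsub>A'\<^esub>" "add A = add A'"
  shows "sweedler A = sweedler A'"
proof (intro ext)
  fix u :: "('m, 'n) tens" and f
  have p: "add_pow A n x = add_pow A' n x" for n :: int and x
    using assms by (simp add: add_pow_def int_pow_def nat_pow_def m_inv_def Let_def)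
  have "finsum A g I = finsum A' g I" for g :: "'m \<times> 'n \<Rightarrow> 'a" and I
    using assms by (simp add: finsum_def finprod_def)
  then show "sweedler A u f = sweedler A' u f"
    by (simp add: sweedler_def frag_sum_def p)
qed

lemma sw_add_monoid_cong:
  assumes "carrier A = carrier A'" "\<zero>\<^bsub>A\<^esub> = \<zero>\<^bsub>A'\<^esub>" "add A = add A'"
  shows "sw M N A = sw M N A'"
  unfolding sw_def[abs_def] sweedler_add_monoid_cong[OF assms] assms(2) ..

lemma pure_tensor_cong: "\<zero>\<^bsub>T\<^esub> = \<zero>\<^bsub>T'\<^esub> \<Longrightarrow> pure_tensor T = pure_tensor T'"
  by (simp add: pure_tensor_def[abs_def])

lemma tmod_simps:
  "carrier (tmod K R M rho N lam) = carrier (tensor_over R M rho N lam)"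
  "\<zero>\<^bsub>tmod K R M rho N lam\<^esub> = \<zero>\<^bsub>tensor_over R M rho N lam\<^esub>"
  "add (tmod K R M rho N lam) = add (tensor_over R M rho N lam)"
  "pure_tensor (tmod K R M rho N lam) = pure_tensor (tensor_over R M rho N lam)"
  "sweedler (tmod K R M rho N lam) = sweedler (tensor_over R M rho N lam)"
  "sw X Y (tmod K R M rho N lam) = sw X Y (tensor_over R M rho N lam)"
  by (simp_all add: tmod_def Let_def, (rule pure_tensor_cong sweedler_add_monoid_cong sw_add_monoid_cong, simp_all)+)

lemma (in balanced_pair) tensor_rep:
  assumes "u \<in> carrier T"
  obtains x where "x \<in> carrier F" "u = rels #>\<^bsub>F\<^esub> x"
  using assms unfolding tensor_simps carrier_FactGroup by (elim imageE)

text \<open>The negative of a pure tensor is again pure, with \<open>\<ominus> m\<close> in place of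
  \<open>m\<close>, so sums of pure tensors already exhaust the tensor product and no case for
  negation is needed. Induction over formal sums has a difference step, which is why the claim is
  carried for \<open>x\<close> and \<open>- x\<close> together.\<close>

lemma (in balanced_pair) tensor_induct [consumes 1, case_names pure add]:
  assumes u: "u \<in> carrier T"
    and pure: "\<And>m n. m \<in> carrier M \<Longrightarrow> n \<in> carrier N \<Longrightarrow> Q (m \<boxtimes>\<^bsub>T\<^esub> n)"
    and add: "\<And>u v. u \<in> carrier T \<Longrightarrow> v \<in> carrier T \<Longrightarrow> Q u \<Longrightarrow> Q v \<Longrightarrow> Q (u \<oplus>\<^bsub>T\<^esub> v)"
  shows "Q u"
proof -
  interpret A: abelian_group T by (rule abelian_group_tensor)
  interpret M: abelian_group M by (rule M)
  interpret N: abelian_group N by (rule N)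
  interpret F: comm_group F by (rule abelian_free_Abelian_group)
  interpret rels: normal rels F by (rule rels_normal)
  define q where "q x = rels #>\<^bsub>F\<^esub> x" for x
  have q_closed: "q x \<in> carrier T" if "x \<in> carrier F" for x
    using that by (auto simp: q_def tensor_simps carrier_FactGroup)
  have q_add: "q (x + y) = q x \<oplus>\<^bsub>T\<^esub> q y" if "x \<in> carrier F" "y \<in> carrier F" for x y
    using rels.rcos_sum[OF that] by (simp add: q_def tensor_simps)
  have q_pure: "q (frag_of (m, n)) = m \<boxtimes>\<^bsub>T\<^esub> n" for m n
    by (simp add: q_def pure_tensor_eq)
  have q_zero: "q 0 = \<zero>\<^bsub>T\<^esub>"
    using F.coset_join2[OF F.one_closed rels.is_subgroup rels.one_closed]
    by (simp add: q_def tensor_simps)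
  have pure_add: "(m \<oplus>\<^bsub>M\<^esub> m') \<boxtimes>\<^bsub>T\<^esub> n = m \<boxtimes>\<^bsub>T\<^esub> n \<oplus>\<^bsub>T\<^esub> m' \<boxtimes>\<^bsub>T\<^esub> n"
    if "m \<in> carrier M" "m' \<in> carrier M" "n \<in> carrier N" for m m' n
  proof -
    let ?d = "frag_of (m \<oplus>\<^bsub>M\<^esub> m', n) - frag_of (m, n) - frag_of (m', n)"
    have d: "?d \<in> rels"
      using that by (intro generate.incl) (auto simp: tensor_relators_def)
    then have dF: "?d \<in> carrier F" using rels.subset by blast
    have "q ?d = \<zero>\<^bsub>T\<^esub>"
      using F.coset_join2[OF dF rels.is_subgroup d] by (simp add: q_def tensor_simps)
    moreover have "q (frag_of (m \<oplus>\<^bsub>M\<^esub> m', n)) = q (?d + (frag_of (m, n) + frag_of (m', n)))"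
      by simp
    moreover have s: "frag_of (m, n) + frag_of (m', n) \<in> carrier F"
      using F.m_closed[of "frag_of (m, n)" "frag_of (m', n)"] that by simp
    moreover have "frag_of (m, n) \<in> carrier F" "frag_of (m', n) \<in> carrier F"
      using that by auto
    ultimately show ?thesis
      using q_add[OF dF s] q_closed[OF s] by (simp add: q_add q_pure)
  qed
  have zero: "\<zero>\<^bsub>M\<^esub> \<boxtimes>\<^bsub>T\<^esub> n = \<zero>\<^bsub>T\<^esub>" if "n \<in> carrier N" for n
    using pure_add[of "\<zero>\<^bsub>M\<^esub>" "\<zero>\<^bsub>M\<^esub>" n] that pure_tensor_closed[of "\<zero>\<^bsub>M\<^esub>" n]
    by (metis A.add.r_cancel_one' M.zero_closed M.l_zero)
  have Q0: "Q \<zero>\<^bsub>T\<^esub>"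
    using pure[of "\<zero>\<^bsub>M\<^esub>" "\<zero>\<^bsub>N\<^esub>"] by (simp add: zero)
  obtain x where x: "x \<in> carrier F" "u = q x"
    using u by (auto simp: q_def elim: tensor_rep)
  have "Poly_Mapping.keys x \<subseteq> carrier M \<times> carrier N"
    using x by (simp add: free_Abelian_group_def)
  then have "Q (q x) \<and> Q (q (- x)) \<and> x \<in> carrier F \<and> - x \<in> carrier F"
  proof (induction x rule: frag_induction)
    case zero
    then show ?case using Q0 by (simp add: q_zero free_Abelian_group_def)
  next
    case (one z)
    then obtain m n where z: "z = (m, n)" "m \<in> carrier M" "n \<in> carrier N" by auto
    have F: "frag_of (m, n) \<in> carrier F" "- frag_of (m, n) \<in> carrier F"
      using z by (auto simp: free_Abelian_group_def)
    have "q (- frag_of (m, n)) \<oplus>\<^bsub>T\<^esub> m \<boxtimes>\<^bsub>T\<^esub> n = \<zero>\<^bsub>T\<^esub>"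
      using q_add[OF F(2,1)] by (simp add: q_zero q_pure)
    moreover have "(\<ominus>\<^bsub>M\<^esub> m) \<boxtimes>\<^bsub>T\<^esub> n \<oplus>\<^bsub>T\<^esub> m \<boxtimes>\<^bsub>T\<^esub> n = \<zero>\<^bsub>T\<^esub>"
      using z by (simp add: pure_add[symmetric] M.l_neg zero)
    ultimately have "q (- frag_of (m, n)) = (\<ominus>\<^bsub>M\<^esub> m) \<boxtimes>\<^bsub>T\<^esub> n"
      using z q_closed[OF F(2)] pure_tensor_closed[of m n] pure_tensor_closed[of "\<ominus>\<^bsub>M\<^esub> m" n]
      by (metis A.add.m_comm A.minus_equality A.minus_minus M.a_inv_closed)
    then show ?case using pure z F by (simp add: q_pure)
  next
    case (diff a b)
    have m: "a + (- b) \<in> carrier F" "b + (- a) \<in> carrier F"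
      using F.m_closed[of a "- b"] F.m_closed[of b "- a"] diff by simp_all
    have "Q (q (a + (- b)))" "Q (q (b + (- a)))"
      using diff by (auto simp only: q_add intro!: add q_closed)
    then show ?case using m by simp
  qed
  then show ?thesis using x by simp
qed

text \<open>A coset that belongs to the tensor product consists of formal sums over the carriers, so
  cutting the integrand off outside of them changes nothing.\<close>

lemma (in balanced_pair) sweedler_eq_sw:
  assumes "u \<in> carrier T" "abelian_group A" "\<And>m n. m \<in> carrier M \<Longrightarrow> n \<in> carrier N \<Longrightarrow> f m n \<in> carrier A"
  shows "sweedler A u f = sw M N A u f"
proof -
  interpret A: abelian_group A by fact
  interpret F: comm_group F by (rule abelian_free_Abelian_group)
  interpret rels: normal rels F by (rule rels_normal)
  obtain x where x: "x \<in> carrier F" "u = rels #>\<^bsub>F\<^esub> x"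
    using assms(1) by (rule tensor_rep)
  have "(SOME y. y \<in> u) \<in> u"
    using group.rcos_self[OF group_free_Abelian_group x(1) rels.is_subgroup] x(2) by (metis someI)
  also have "u \<subseteq> carrier F"
    unfolding x(2) using rels.subset x(1) by (rule F.r_coset_subset_G)
  finally have "Poly_Mapping.keys (SOME y. y \<in> u) \<subseteq> carrier M \<times> carrier N"
    by (simp add: free_Abelian_group_def)
  then show ?thesis
    unfolding sw_def sweedler_def frag_sum_def
    using assms(3) by (intro A.finsum_cong') (auto intro!: A.add.int_pow_closed)
qed

text \<open>The assumption \<open>scalar\<close> says that scalars of \<open>K\<close> act through
  \<open>R\<close>. They can then be moved across the tensor sign, so the action defined on the left
  factor agrees with the one on the right factor. It covers both \<open>R = carrier K\<close> and
  the coinvariants.\<close>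

locale tensor_bimod =
  fixes K :: "'k ring" and R :: "'r set" and M :: "('k, 'm) module" and rho :: "'m \<Rightarrow> 'r \<Rightarrow> 'm"
    and N :: "('k, 'n) module" and lam :: "'r \<Rightarrow> 'n \<Rightarrow> 'n"
  assumes mod_M: "module K M" and mod_N: "module K N"
    and rho_linear: "r \<in> R \<Longrightarrow> linear_map K M M (\<lambda>m. rho m r)"
    and lam_linear: "r \<in> R \<Longrightarrow> linear_map K N N (lam r)"
    and scalar: "c \<in> carrier K \<Longrightarrow> \<exists>r\<in>R. (\<forall>m\<in>carrier M. rho m r = c \<odot>\<^bsub>M\<^esub> m) \<and> (\<forall>n\<in>carrier N. lam r n = c \<odot>\<^bsub>N\<^esub> n)"
begin

sublocale mod_M: module K M by (rule mod_M)
sublocale mod_N: module K N by (rule mod_N)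

sublocale balanced_pair R M rho N lam
  using rho_linear lam_linear
  by unfold_locales (auto dest: linear_mapD)

abbreviation "TM \<equiv> tmod K R M rho N lam"

lemma abelian_group_TM: "abelian_group TM"
proof -
  interpret T: abelian_group T by (rule abelian_group_tensor)
  show ?thesis
    by (rule abelian_groupI) (auto simp: tmod_simps T.a_ac intro: T.add.inv_closed T.l_neg)
qed

lemma TM_induct [consumes 1, case_names pure add]:
  assumes "u \<in> carrier TM"
    and "\<And>m n. m \<in> carrier M \<Longrightarrow> n \<in> carrier N \<Longrightarrow> Q (m \<boxtimes>\<^bsub>TM\<^esub> n)"
    and "\<And>u v. u \<in> carrier TM \<Longrightarrow> v \<in> carrier TM \<Longrightarrow> Q u \<Longrightarrow> Q v \<Longrightarrow> Q (u \<oplus>\<^bsub>TM\<^esub> v)"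
  shows "Q u"
  using assms tensor_induct[of u Q] by (simp add: tmod_simps)

lemma TM_pure_closed: "m \<in> carrier M \<Longrightarrow> n \<in> carrier N \<Longrightarrow> m \<boxtimes>\<^bsub>TM\<^esub> n \<in> carrier TM"
  using pure_tensor_closed by (simp add: tmod_simps)

lemma pure_relator:
  assumes "x + y - z \<in> rels" "x \<in> carrier F" "y \<in> carrier F" "z \<in> carrier F"
  shows "(rels #>\<^bsub>F\<^esub> x) \<oplus>\<^bsub>T\<^esub> (rels #>\<^bsub>F\<^esub> y) = rels #>\<^bsub>F\<^esub> z"
proof -
  interpret F: comm_group F by (rule abelian_free_Abelian_group)
  interpret rels: normal rels F by (rule rels_normal)
  have "x + y \<in> rels #>\<^bsub>F\<^esub> z"
    using assms(1) by (auto simp: r_coset_def intro!: bexI[of _ "x + y - z"])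
  then have "rels #>\<^bsub>F\<^esub> (x \<otimes>\<^bsub>F\<^esub> y) = rels #>\<^bsub>F\<^esub> z"
    using F.repr_independence[OF _ assms(4) rels.is_subgroup, of "x + y"] by simp
  then show ?thesis
    using rels.rcos_sum[OF assms(2,3)] by (simp add: tensor_simps)
qed

text \<open>The additive relators have the form \<open>z - x - y\<close>, while
  \<open>pure_relator\<close> asks for \<open>x + y - z\<close>.\<close>

lemma neg_rel: "x \<in> tensor_relators R M rho N lam \<Longrightarrow> - x \<in> rels"
proof -
  interpret F: comm_group F by (rule abelian_free_Abelian_group)
  assume x: "x \<in> tensor_relators R M rho N lam"
  then have "x \<in> carrier F" using relators_carrier by blast
  then show ?thesis using generate.inv[OF x, of F] by simp
qed

lemma pure_add_left:
  assumes "m \<in> carrier M" "m' \<in> carrier M" "n \<in> carrier N"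
  shows "(m \<oplus>\<^bsub>M\<^esub> m') \<boxtimes>\<^bsub>TM\<^esub> n = m \<boxtimes>\<^bsub>TM\<^esub> n \<oplus>\<^bsub>TM\<^esub> m' \<boxtimes>\<^bsub>TM\<^esub> n"
proof -
  have "frag_of (m \<oplus>\<^bsub>M\<^esub> m', n) - frag_of (m, n) - frag_of (m', n) \<in> tensor_relators R M rho N lam"
    using assms by (auto simp: tensor_relators_def)
  from neg_rel[OF this] show ?thesis
    using assms by (simp add: tmod_simps pure_tensor_eq, intro pure_relator[symmetric]) (auto simp: algebra_simps)
qed

lemma pure_add_right:
  assumes "m \<in> carrier M" "n \<in> carrier N" "n' \<in> carrier N"
  shows "m \<boxtimes>\<^bsub>TM\<^esub> (n \<oplus>\<^bsub>N\<^esub> n') = m \<boxtimes>\<^bsub>TM\<^esub> n \<oplus>\<^bsub>TM\<^esub> m \<boxtimes>\<^bsub>TM\<^esub> n'"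
proof -
  have "frag_of (m, n \<oplus>\<^bsub>N\<^esub> n') - frag_of (m, n) - frag_of (m, n') \<in> tensor_relators R M rho N lam"
    using assms by (auto simp: tensor_relators_def)
  from neg_rel[OF this] show ?thesis
    using assms by (simp add: tmod_simps pure_tensor_eq, intro pure_relator[symmetric]) (auto simp: algebra_simps)
qed

lemma pure_balanced:
  assumes "m \<in> carrier M" "r \<in> R" "n \<in> carrier N"
  shows "rho m r \<boxtimes>\<^bsub>TM\<^esub> n = m \<boxtimes>\<^bsub>TM\<^esub> lam r n"
proof -
  interpret F: comm_group F by (rule abelian_free_Abelian_group)
  interpret rels: normal rels F by (rule rels_normal)
  have "frag_of (rho m r, n) - frag_of (m, lam r n) \<in> rels"
    using assms by (intro generate.incl) (auto simp: tensor_relators_def)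
  then have "frag_of (rho m r, n) \<in> rels #>\<^bsub>F\<^esub> frag_of (m, lam r n)"
    by (auto simp: r_coset_def intro!: bexI[of _ "frag_of (rho m r, n) - frag_of (m, lam r n)"])
  then show ?thesis
    using F.repr_independence[OF _ _ rels.is_subgroup] assms lam_closed
    by (simp add: tmod_simps pure_tensor_eq)
qed

context
  fixes A :: "('k, 'a) module" and f
  assumes A: "abelian_group A" and f: "rbil K R M rho N lam A f"
begin

lemma sw_pure: "m \<in> carrier M \<Longrightarrow> n \<in> carrier N \<Longrightarrow> sw M N A (m \<boxtimes>\<^bsub>TM\<^esub> n) f = f m n"
  unfolding sw_def tmod_simps
  by (subst sweedler_pure[OF A]) (use f in \<open>auto simp: rbil_def bilD rho_closed lam_closed\<close>)

lemma sw_u_add: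
  "u \<in> carrier TM \<Longrightarrow> v \<in> carrier TM \<Longrightarrow> sw M N A (u \<oplus>\<^bsub>TM\<^esub> v) f = sw M N A u f \<oplus>\<^bsub>A\<^esub> sw M N A v f"
  unfolding sw_def tmod_simps
  by (subst sweedler_add[OF A]) (use f in \<open>auto simp: rbil_def bilD rho_closed lam_closed\<close>)

end

lemma smult_eq_sw:
  assumes "c \<in> carrier K" "u \<in> carrier TM"
  shows "c \<odot>\<^bsub>TM\<^esub> u = sw M N TM u (\<lambda>m n. (c \<odot>\<^bsub>M\<^esub> m) \<boxtimes>\<^bsub>TM\<^esub> n)"
proof -
  have "c \<odot>\<^bsub>TM\<^esub> u = sweedler TM u (\<lambda>m n. (c \<odot>\<^bsub>M\<^esub> m) \<boxtimes>\<^bsub>TM\<^esub> n)"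
    unfolding tmod_simps by (simp add: tmod_def Let_def)
  also have "\<dots> = sw M N TM u (\<lambda>m n. (c \<odot>\<^bsub>M\<^esub> m) \<boxtimes>\<^bsub>TM\<^esub> n)"
    using assms by (intro sweedler_eq_sw) (auto simp: abelian_group_TM tmod_simps(1)[where K=K, symmetric] TM_pure_closed)
  finally show ?thesis .
qed

text \<open>Scalar multiplication is defined through a chosen representative. Since
  \<open>rho\<close> commutes with scalars, its integrand is balanced, and the values on pure
  tensors and the additivity follow from the universal property.\<close>

lemma smult_pure_add:
  assumes c: "c \<in> carrier K"
  shows "m \<in> carrier M \<Longrightarrow> n \<in> carrier N \<Longrightarrow> c \<odot>\<^bsub>TM\<^esub> (m \<boxtimes>\<^bsub>TM\<^esub> n) = (c \<odot>\<^bsub>M\<^esub> m) \<boxtimes>\<^bsub>TM\<^esub> n"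
    and "u \<in> carrier TM \<Longrightarrow> v \<in> carrier TM \<Longrightarrow> c \<odot>\<^bsub>TM\<^esub> (u \<oplus>\<^bsub>TM\<^esub> v) = c \<odot>\<^bsub>TM\<^esub> u \<oplus>\<^bsub>TM\<^esub> c \<odot>\<^bsub>TM\<^esub> v"
proof -
  interpret TM: abelian_group TM by (rule abelian_group_TM)
  let ?f = "\<lambda>m n. if m \<in> carrier M \<and> n \<in> carrier N then (c \<odot>\<^bsub>M\<^esub> m) \<boxtimes>\<^bsub>TM\<^esub> n else \<zero>\<^bsub>TM\<^esub>"
  have bal: "(c \<odot>\<^bsub>M\<^esub> rho m r) \<boxtimes>\<^bsub>TM\<^esub> n = (c \<odot>\<^bsub>M\<^esub> m) \<boxtimes>\<^bsub>TM\<^esub> lam r n"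
    if "m \<in> carrier M" "r \<in> R" "n \<in> carrier N" for m r n
    using pure_balanced[of "c \<odot>\<^bsub>M\<^esub> m" r n] that c linear_mapD(3)[OF rho_linear, of r c m] by simp
  note facts = c bal rho_closed lam_closed TM_pure_closed pure_add_left pure_add_right mod_M.smult_r_distr
  show "c \<odot>\<^bsub>TM\<^esub> (m \<boxtimes>\<^bsub>TM\<^esub> n) = (c \<odot>\<^bsub>M\<^esub> m) \<boxtimes>\<^bsub>TM\<^esub> n" if "m \<in> carrier M" "n \<in> carrier N"
  proof -
    have "sweedler TM (m \<boxtimes>\<^bsub>TM\<^esub> n) ?f = (c \<odot>\<^bsub>M\<^esub> m) \<boxtimes>\<^bsub>TM\<^esub> n"
      unfolding tmod_simps(4)[where K=K]
      using that
      by (subst sweedler_pure[OF abelian_group_TM]) (simp_all add: facts tmod_simps(4)[where K=K, symmetric])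
    then show ?thesis using that c by (simp add: smult_eq_sw TM_pure_closed sw_def)
  qed
  show "c \<odot>\<^bsub>TM\<^esub> (u \<oplus>\<^bsub>TM\<^esub> v) = c \<odot>\<^bsub>TM\<^esub> u \<oplus>\<^bsub>TM\<^esub> c \<odot>\<^bsub>TM\<^esub> v"
    if uv: "u \<in> carrier TM" "v \<in> carrier TM"
  proof -
    have "sweedler TM (u \<oplus>\<^bsub>T\<^esub> v) ?f = sweedler TM u ?f \<oplus>\<^bsub>TM\<^esub> sweedler TM v ?f"
      using uv
      by (subst sweedler_add[OF abelian_group_TM]) (simp_all add: facts tmod_simps(1) TM_pure_closed[unfolded tmod_simps(1)])
    then show ?thesis using uv c TM.a_closed[OF uv]
      by (simp add: smult_eq_sw sw_def tmod_simps(3)[where K=K, symmetric])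
  qed
qed

lemma smult_TM_closed: "c \<in> carrier K \<Longrightarrow> u \<in> carrier TM \<Longrightarrow> c \<odot>\<^bsub>TM\<^esub> u \<in> carrier TM"
  by (simp add: smult_eq_sw sw_closed abelian_group_TM TM_pure_closed)

lemma pure_smult_left:
  "c \<in> carrier K \<Longrightarrow> m \<in> carrier M \<Longrightarrow> n \<in> carrier N \<Longrightarrow> (c \<odot>\<^bsub>M\<^esub> m) \<boxtimes>\<^bsub>TM\<^esub> n = c \<odot>\<^bsub>TM\<^esub> (m \<boxtimes>\<^bsub>TM\<^esub> n)"
  by (simp add: smult_pure_add)

lemma pure_smult_right:
  assumes "c \<in> carrier K" "m \<in> carrier M" "n \<in> carrier N"
  shows "m \<boxtimes>\<^bsub>TM\<^esub> (c \<odot>\<^bsub>N\<^esub> n) = c \<odot>\<^bsub>TM\<^esub> (m \<boxtimes>\<^bsub>TM\<^esub> n)"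
  using scalar[OF assms(1)] pure_balanced assms by (metis pure_smult_left)

lemma module_TM: "module K TM"
proof (rule moduleI)
  interpret TM: abelian_group TM by (rule abelian_group_TM)
  show "cring K" by (rule mod_M.R.is_cring)
  show "abelian_group TM" by (rule abelian_group_TM)
  show "c \<odot>\<^bsub>TM\<^esub> u \<in> carrier TM" if "c \<in> carrier K" "u \<in> carrier TM" for c u
    using that by (rule smult_TM_closed)
  show "c \<odot>\<^bsub>TM\<^esub> (u \<oplus>\<^bsub>TM\<^esub> v) = c \<odot>\<^bsub>TM\<^esub> u \<oplus>\<^bsub>TM\<^esub> c \<odot>\<^bsub>TM\<^esub> v"
    if "c \<in> carrier K" "u \<in> carrier TM" "v \<in> carrier TM" for c u v
    using that by (rule smult_pure_add)
  show "(c \<oplus>\<^bsub>K\<^esub> d) \<odot>\<^bsub>TM\<^esub> u = c \<odot>\<^bsub>TM\<^esub> u \<oplus>\<^bsub>TM\<^esub> d \<odot>\<^bsub>TM\<^esub> u"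
    if c: "c \<in> carrier K" "d \<in> carrier K" "u \<in> carrier TM" for c d u
    using c(3)
  proof (induction u rule: TM_induct)
    case (pure m n)
    then show ?case using c by (simp add: smult_pure_add(1) mod_M.smult_l_distr pure_add_left)
  next
    case (add u v)
    then show ?case using c by (simp add: smult_pure_add(2) TM.a_ac smult_TM_closed)
  qed
  show "(c \<otimes>\<^bsub>K\<^esub> d) \<odot>\<^bsub>TM\<^esub> u = c \<odot>\<^bsub>TM\<^esub> (d \<odot>\<^bsub>TM\<^esub> u)"
    if c: "c \<in> carrier K" "d \<in> carrier K" "u \<in> carrier TM" for c d u
    using c(3)
  proof (induction u rule: TM_induct)
    case (pure m n)
    then show ?case using c by (simp add: smult_pure_add(1) mod_M.smult_assoc1)
  next
    case (add u v)
    then show ?case using c by (simp add: smult_pure_add(2) smult_TM_closed)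
  qed
  show "\<one>\<^bsub>K\<^esub> \<odot>\<^bsub>TM\<^esub> u = u" if "u \<in> carrier TM" for u
    using that by (induction u rule: TM_induct) (simp_all add: smult_pure_add)
qed

lemma sw_u_linear:
  assumes A: "module K A" and f: "rbil K R M rho N lam A f"
  shows "linear_map K TM A (\<lambda>u. sw M N A u f)"
proof -
  interpret A: module K A by fact
  have AG: "abelian_group A" by (rule A.abelian_group_axioms)
  show ?thesis
  proof (rule linear_mapI)
    show "sw M N A u f \<in> carrier A" for u
      using f by (intro sw_closed AG) (auto simp: rbil_def bilD)
    show "sw M N A (u \<oplus>\<^bsub>TM\<^esub> v) f = sw M N A u f \<oplus>\<^bsub>A\<^esub> sw M N A v f"
      if "u \<in> carrier TM" "v \<in> carrier TM" for u v
      using that by (rule sw_u_add[OF AG f])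
    show "sw M N A (c \<odot>\<^bsub>TM\<^esub> u) f = c \<odot>\<^bsub>A\<^esub> sw M N A u f"
      if c: "c \<in> carrier K" and u: "u \<in> carrier TM" for c u
      using u
    proof (induction u rule: TM_induct)
      case (pure m n)
      then show ?case using c f by (simp add: smult_pure_add(1) sw_pure[OF AG f]) (use bilD(4)[of K M N A f] f in \<open>simp add: rbil_def\<close>)
    next
      case (add u v)
      have "sw M N A u f \<in> carrier A" for u
        using f by (intro sw_closed AG) (auto simp: rbil_def bilD)
      then show ?case
        using add c by (simp add: smult_pure_add(2) sw_u_add[OF AG f] smult_TM_closed A.smult_r_distr)
    qed
  qed
qed

text \<open>The main proof principle of the development: an identity of linear expressions in a
  tensor is checked on pure tensors, after which both sides are Sweedler sums over
  coactions.\<close>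

lemma TM_linear_eqI:
  assumes "linear_map K TM A f" "linear_map K TM A g"
    and "\<And>m n. m \<in> carrier M \<Longrightarrow> n \<in> carrier N \<Longrightarrow> f (m \<boxtimes>\<^bsub>TM\<^esub> n) = g (m \<boxtimes>\<^bsub>TM\<^esub> n)"
    and "u \<in> carrier TM"
  shows "f u = g u"
  using assms(4)
  by (induction u rule: TM_induct) (simp_all add: assms(3) linear_mapD[OF assms(1)] linear_mapD[OF assms(2)])

end

section \<open>Linearity rules for tensors over the base field\<close>

locale base_field = K: field K for K :: "'k ring"
begin

abbreviation tensor_K :: "('k, 'v) module \<Rightarrow> ('k, 'w) module \<Rightarrow> ('k, ('v, 'w) tens) module"  (infixr "\<otimes>\<^sub>K" 72)
  where "V \<otimes>\<^sub>K W \<equiv> tensor K V W"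

lemma module_imp_abelian_group [simp]: "module K V \<Longrightarrow> abelian_group V"
  by (simp add: module_def)

lemma module_self [simp]: "module K (self_module K)"
  by (rule moduleI)
    (auto simp: self_module_def K.is_cring K.l_distr K.r_distr K.m_assoc K.a_ac intro!: abelian_groupI K.add.inv_closed
      intro: K.l_neg)

lemma carrier_self_module [simp]: "carrier (self_module K) = carrier K"
  by (simp add: self_module_def)

lemma add_self_module [simp]: "add (self_module K) = add K"
  by (simp add: self_module_def)

lemma smult_self_module [simp]: "c \<odot>\<^bsub>self_module K\<^esub> d = c \<otimes>\<^bsub>K\<^esub> d"
  by (simp add: self_module_def)

lemma sweedler_self_module: "sweedler K = sweedler (self_module K)"
  by (rule sweedler_add_monoid_cong) (simp_all add: self_module_def)

lemma bil_imp_rbil: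
  "bil K V W A f \<Longrightarrow> rbil K (carrier K) V (\<lambda>v c. c \<odot>\<^bsub>V\<^esub> v) W (\<lambda>c w. c \<odot>\<^bsub>W\<^esub> w) A f"
  using bilD(4,5)[of K V W A f] by (simp add: rbil_def)

lemma smult_closed_module [simp]: "module K V \<Longrightarrow> c \<in> carrier K \<Longrightarrow> v \<in> carrier V \<Longrightarrow> c \<odot>\<^bsub>V\<^esub> v \<in> carrier V"
  by (rule module.smult_closed)

lemma add_closed_module [simp]: "module K V \<Longrightarrow> v \<in> carrier V \<Longrightarrow> w \<in> carrier V \<Longrightarrow> v \<oplus>\<^bsub>V\<^esub> w \<in> carrier V"
  by (simp add: abelian_group.axioms(1) abelian_monoid.a_closed)

lemma smult_smult [simp]:
  "module K V \<Longrightarrow> c \<in> carrier K \<Longrightarrow> d \<in> carrier K \<Longrightarrow> v \<in> carrier V \<Longrightarrow> c \<odot>\<^bsub>V\<^esub> (d \<odot>\<^bsub>V\<^esub> v) = (c \<otimes>\<^bsub>K\<^esub> d) \<odot>\<^bsub>V\<^esub> v"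
  by (simp add: module.smult_assoc1)

lemma one_smult [simp]: "module K V \<Longrightarrow> v \<in> carrier V \<Longrightarrow> \<one>\<^bsub>K\<^esub> \<odot>\<^bsub>V\<^esub> v = v"
  by (rule module.smult_one)

lemma lin_smult [simp]:
  assumes "module K V" "linear_map K X V F" "c \<in> carrier K"
  shows "linear_map K X V (\<lambda>x. c \<odot>\<^bsub>V\<^esub> F x)"
proof -
  interpret V: module K V by fact
  have "c \<odot>\<^bsub>V\<^esub> (d \<odot>\<^bsub>V\<^esub> v) = d \<odot>\<^bsub>V\<^esub> (c \<odot>\<^bsub>V\<^esub> v)" if "d \<in> carrier K" "v \<in> carrier V" for d v
    using that assms(3) by (metis V.smult_assoc1 K.m_comm)
  then show ?thesis
    using assms(3) linear_mapD[OF assms(2)] by (intro linear_mapI) (simp_all add: V.smult_r_distr)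
qed

lemma lin_id [simp]: "linear_map K X X (\<lambda>x. x)"
  by (simp add: linear_map_def)

lemma lin_smult_left [simp]:
  assumes "module K V" "linear_map K X (self_module K) F" "v \<in> carrier V"
  shows "linear_map K X V (\<lambda>x. F x \<odot>\<^bsub>V\<^esub> v)"
proof -
  interpret V: module K V by fact
  show ?thesis
    using linear_mapD[OF assms(2)] assms(3)
    by (intro linear_mapI) (simp_all add: V.smult_l_distr assms(1))
qed

lemma tensor_bimod_tensor [simp]:
  assumes "module K V" "module K W"
  shows "tensor_bimod K (carrier K) (V :: ('k, 'v) module) (\<lambda>v c. c \<odot>\<^bsub>V\<^esub> v) (W :: ('k, 'w) module) (\<lambda>c w. c \<odot>\<^bsub>W\<^esub> w)"
proof (rule tensor_bimod.intro)
  show "\<exists>r\<in>carrier K. (\<forall>m\<in>carrier V. r \<odot>\<^bsub>V\<^esub> m = c \<odot>\<^bsub>V\<^esub> m) \<and> (\<forall>n\<in>carrier W. r \<odot>\<^bsub>W\<^esub> n = c \<odot>\<^bsub>W\<^esub> n)"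
    if "c \<in> carrier K" for c
    using that by blast
qed (use assms in simp_all)

lemma module_tensor [simp]: "module K V \<Longrightarrow> module K W \<Longrightarrow> module K (V \<otimes>\<^sub>K W)"
  unfolding tensor_eq_tmod by (rule tensor_bimod.module_TM) simp

lemma tensor_pure_closed [simp]:
  "module K V \<Longrightarrow> module K W \<Longrightarrow> v \<in> carrier V \<Longrightarrow> w \<in> carrier W \<Longrightarrow> v \<boxtimes>\<^bsub>V \<otimes>\<^sub>K W\<^esub> w \<in> carrier (V \<otimes>\<^sub>K W)"
  unfolding tensor_eq_tmod by (rule tensor_bimod.TM_pure_closed) simp_all

lemma tensor_pure_lin:
  assumes "module K V" "module K W"
  shows "v \<in> carrier V \<Longrightarrow> linear_map K W (V \<otimes>\<^sub>K W) (pure_tensor (V \<otimes>\<^sub>K W) v)"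
    and "w \<in> carrier W \<Longrightarrow> linear_map K V (V \<otimes>\<^sub>K W) (\<lambda>v. v \<boxtimes>\<^bsub>V \<otimes>\<^sub>K W\<^esub> w)"
proof -
  interpret VW: tensor_bimod K "carrier K" V "\<lambda>v c. c \<odot>\<^bsub>V\<^esub> v" W "\<lambda>c w. c \<odot>\<^bsub>W\<^esub> w"
    using assms by (rule tensor_bimod_tensor)
  show "v \<in> carrier V \<Longrightarrow> linear_map K W (V \<otimes>\<^sub>K W) (pure_tensor (V \<otimes>\<^sub>K W) v)"
    unfolding tensor_eq_tmod
    by (intro linear_mapI VW.TM_pure_closed VW.pure_add_right VW.pure_smult_right)
  show "w \<in> carrier W \<Longrightarrow> linear_map K V (V \<otimes>\<^sub>K W) (\<lambda>v. v \<boxtimes>\<^bsub>V \<otimes>\<^sub>K W\<^esub> w)"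
    unfolding tensor_eq_tmod
    by (intro linear_mapI VW.TM_pure_closed VW.pure_add_left VW.pure_smult_left)
qed

lemma lin_pureL [simp]:
  "module K V \<Longrightarrow> module K W \<Longrightarrow> linear_map K X V F \<Longrightarrow> w \<in> carrier W \<Longrightarrow>
    linear_map K X (V \<otimes>\<^sub>K W) (\<lambda>x. F x \<boxtimes>\<^bsub>V \<otimes>\<^sub>K W\<^esub> w)"
  by (rule linear_map_comp[OF _ tensor_pure_lin(2)])

lemma lin_pureR [simp]:
  "module K V \<Longrightarrow> module K W \<Longrightarrow> v \<in> carrier V \<Longrightarrow> linear_map K X W F \<Longrightarrow>
    linear_map K X (V \<otimes>\<^sub>K W) (\<lambda>x. v \<boxtimes>\<^bsub>V \<otimes>\<^sub>K W\<^esub> F x)"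
  by (rule linear_map_comp[OF _ tensor_pure_lin(1)])

lemma pure_smult [simp]:
  assumes "module K V" "module K W" "c \<in> carrier K" "v \<in> carrier V" "w \<in> carrier W"
  shows "(c \<odot>\<^bsub>V\<^esub> v) \<boxtimes>\<^bsub>V \<otimes>\<^sub>K W\<^esub> w = c \<odot>\<^bsub>V \<otimes>\<^sub>K W\<^esub> (v \<boxtimes>\<^bsub>V \<otimes>\<^sub>K W\<^esub> w)"
    and "v \<boxtimes>\<^bsub>V \<otimes>\<^sub>K W\<^esub> (c \<odot>\<^bsub>W\<^esub> w) = c \<odot>\<^bsub>V \<otimes>\<^sub>K W\<^esub> (v \<boxtimes>\<^bsub>V \<otimes>\<^sub>K W\<^esub> w)"
  using linear_mapD(3)[OF tensor_pure_lin(1)[OF assms(1,2)]] linear_mapD(3)[OF tensor_pure_lin(2)[OF assms(1,2)]] assms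
  by simp_all

lemma sw_closed_module [simp]:
  "module K A \<Longrightarrow> (\<And>m n. m \<in> carrier M \<Longrightarrow> n \<in> carrier N \<Longrightarrow> f m n \<in> carrier A) \<Longrightarrow> sw M N A u f \<in> carrier A"
  by (rule sw_closed) simp

lemma sw_linear:
  assumes "linear_map K A B g" "module K A" "module K B"
    "\<And>m n. m \<in> carrier M \<Longrightarrow> n \<in> carrier N \<Longrightarrow> f m n \<in> carrier A"
  shows "g (sw M N A u f) = sw M N B u (\<lambda>m n. g (f m n))"
  using assms by (intro sw_hom linear_map_hom[OF assms(1)]) auto

text \<open>Linearity in a parameter of the integrand holds for every \<open>u\<close>. Linearity in
  the tensor over which the sum runs is \<open>lin_swu\<close>, where the integrand must be
  bilinear.\<close>

lemma lin_sw [simp]: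
  assumes A: "module K A" and f: "\<And>m n. m \<in> carrier M \<Longrightarrow> n \<in> carrier N \<Longrightarrow> linear_map K X A (\<lambda>x. f x m n)"
  shows "linear_map K X A (\<lambda>x. sw M N A u (f x))"
proof -
  interpret A: module K A by fact
  show ?thesis
  proof (rule linear_mapI)
    fix x assume x: "x \<in> carrier X"
    show "sw M N A u (f x) \<in> carrier A" using x linear_mapD(1)[OF f] A by simp
    fix y assume y: "y \<in> carrier X"
    have "sw M N A u (f (x \<oplus>\<^bsub>X\<^esub> y)) = sw M N A u (\<lambda>m n. f x m n \<oplus>\<^bsub>A\<^esub> f y m n)"
      using x y linear_mapD(2)[OF f] by (intro sw_cong refl)
    also have "\<dots> = sw M N A u (f x) \<oplus>\<^bsub>A\<^esub> sw M N A u (f y)"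
      using x y linear_mapD(1)[OF f] A by (intro sw_add) simp_all
    finally show "sw M N A u (f (x \<oplus>\<^bsub>X\<^esub> y)) = sw M N A u (f x) \<oplus>\<^bsub>A\<^esub> sw M N A u (f y)" .
  next
    fix c x assume c: "c \<in> carrier K" and x: "x \<in> carrier X"
    have "c \<odot>\<^bsub>A\<^esub> sw M N A u (f x) = sw M N A u (\<lambda>m n. c \<odot>\<^bsub>A\<^esub> f x m n)"
      using c x linear_mapD(1)[OF f] A by (intro sw_linear) auto
    also have "\<dots> = sw M N A u (f (c \<odot>\<^bsub>X\<^esub> x))"
      using c x linear_mapD(3)[OF f] by (intro sw_cong refl) simp
    finally show "sw M N A u (f (c \<odot>\<^bsub>X\<^esub> x)) = c \<odot>\<^bsub>A\<^esub> sw M N A u (f x)" ..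
  qed
qed

lemma lin_sw_tensor:
  "module K V \<Longrightarrow> module K W \<Longrightarrow> module K A \<Longrightarrow> bil K V W A f \<Longrightarrow>
    linear_map K (V \<otimes>\<^sub>K W) A (\<lambda>u. sw V W A u f)"
  unfolding tensor_eq_tmod by (rule tensor_bimod.sw_u_linear) (auto intro: bil_imp_rbil)

lemma lin_swu [simp]:
  assumes "module K V" "module K W" "module K A" "linear_map K X (V \<otimes>\<^sub>K W) F" "bil K V W A f"
  shows "linear_map K X A (\<lambda>x. sw V W A (F x) f)"
  by (rule linear_map_comp[OF assms(4) lin_sw_tensor]) fact+

lemma sw_pure_tensor [simp]:
  "module K V \<Longrightarrow> module K W \<Longrightarrow> module K A \<Longrightarrow> v \<in> carrier V \<Longrightarrow> w \<in> carrier W \<Longrightarrow> bil K V W A f \<Longrightarrow>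
    sw V W A (v \<boxtimes>\<^bsub>V \<otimes>\<^sub>K W\<^esub> w) f = f v w"
  unfolding tensor_eq_tmod by (rule tensor_bimod.sw_pure) (auto intro: bil_imp_rbil)

lemma sweedler_sw:
  "module K V \<Longrightarrow> module K W \<Longrightarrow> abelian_group A \<Longrightarrow> u \<in> carrier (V \<otimes>\<^sub>K W) \<Longrightarrow>
    (\<And>v w. v \<in> carrier V \<Longrightarrow> w \<in> carrier W \<Longrightarrow> f v w \<in> carrier A) \<Longrightarrow>
    sweedler A u f = sw V W A u f"
proof -
  assume a: "module K V" "module K W" "abelian_group A" "u \<in> carrier (V \<otimes>\<^sub>K W)"
    "\<And>v w. v \<in> carrier V \<Longrightarrow> w \<in> carrier W \<Longrightarrow> f v w \<in> carrier A"
  interpret VW: tensor_bimod K "carrier K" V "\<lambda>v c. c \<odot>\<^bsub>V\<^esub> v" W "\<lambda>c w. c \<odot>\<^bsub>W\<^esub> w"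
    using a by simp
  show ?thesis using a by (intro VW.sweedler_eq_sw) (simp_all add: tensor_eq_tmod tmod_simps)
qed

lemma tensor_eqI:
  assumes "linear_map K (V \<otimes>\<^sub>K W) A f" "linear_map K (V \<otimes>\<^sub>K W) A g" "u \<in> carrier (V \<otimes>\<^sub>K W)"
    "module K V" "module K W"
    "\<And>v w. v \<in> carrier V \<Longrightarrow> w \<in> carrier W \<Longrightarrow> f (v \<boxtimes>\<^bsub>V \<otimes>\<^sub>K W\<^esub> w) = g (v \<boxtimes>\<^bsub>V \<otimes>\<^sub>K W\<^esub> w)"
  shows "f u = g u"
  using tensor_bimod.TM_linear_eqI[OF tensor_bimod_tensor[OF assms(4,5)], folded tensor_eq_tmod, OF assms(1,2,6,3)]
  by blast

lemma sw_id [simp]: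
  assumes "u \<in> carrier (V \<otimes>\<^sub>K W)" "module K V" "module K W"
  shows "sw V W (V \<otimes>\<^sub>K W) u (pure_tensor (V \<otimes>\<^sub>K W)) = u"
  by (rule tensor_eqI[where A = "V \<otimes>\<^sub>K W", OF _ _ assms(1)]) (use assms(2,3) in \<open>simp_all add: bil_def\<close>)

lemma sw_sw:
  assumes "module K V" "module K W" "module K A"
    "\<And>m n. m \<in> carrier M \<Longrightarrow> n \<in> carrier N \<Longrightarrow> f m n \<in> carrier (V \<otimes>\<^sub>K W)" "bil K V W A g"
  shows "sw V W A (sw M N (V \<otimes>\<^sub>K W) u f) g = sw M N A u (\<lambda>m n. sw V W A (f m n) g)"
  by (rule sw_linear[OF lin_sw_tensor]) (use assms in simp_all)

lemma sw_pureL: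
  assumes "module K V" "module K W" "w \<in> carrier W"
    "\<And>m n. m \<in> carrier M \<Longrightarrow> n \<in> carrier N \<Longrightarrow> f m n \<in> carrier V"
  shows "sw M N V u f \<boxtimes>\<^bsub>V \<otimes>\<^sub>K W\<^esub> w = sw M N (V \<otimes>\<^sub>K W) u (\<lambda>m n. f m n \<boxtimes>\<^bsub>V \<otimes>\<^sub>K W\<^esub> w)"
  by (rule sw_linear[OF tensor_pure_lin(2)]) (use assms in simp_all)

lemma sw_pureR:
  assumes "module K V" "module K W" "v \<in> carrier V"
    "\<And>m n. m \<in> carrier M \<Longrightarrow> n \<in> carrier N \<Longrightarrow> f m n \<in> carrier W"
  shows "v \<boxtimes>\<^bsub>V \<otimes>\<^sub>K W\<^esub> sw M N W u f = sw M N (V \<otimes>\<^sub>K W) u (\<lambda>m n. v \<boxtimes>\<^bsub>V \<otimes>\<^sub>K W\<^esub> f m n)"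
  by (rule sw_linear[OF tensor_pure_lin(1)]) (use assms in simp_all)

lemma sw_smultR:
  assumes "module K V" "c \<in> carrier K"
    "\<And>m n. m \<in> carrier M \<Longrightarrow> n \<in> carrier N \<Longrightarrow> f m n \<in> carrier V"
  shows "c \<odot>\<^bsub>V\<^esub> sw M N V u f = sw M N V u (\<lambda>m n. c \<odot>\<^bsub>V\<^esub> f m n)"
  by (rule sw_linear[of _ _ "smult V c"]) (use assms in simp_all)

lemma sw_smultL:
  assumes "module K V" "v \<in> carrier V"
    "\<And>m n. m \<in> carrier M \<Longrightarrow> n \<in> carrier N \<Longrightarrow> f m n \<in> carrier K"
  shows "sw M N (self_module K) u f \<odot>\<^bsub>V\<^esub> v = sw M N V u (\<lambda>m n. f m n \<odot>\<^bsub>V\<^esub> v)"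
  by (rule sw_linear[of "self_module K" V "\<lambda>c. c \<odot>\<^bsub>V\<^esub> v"]) (use assms in simp_all)

text \<open>These rules move inner Sweedler sums outwards until an expression is a nest of sums over
  coactions and coproducts with a pure tensor inside. Two such nests can be compared by
  \<open>sw_swap\<close> and the Hopf algebra axioms.\<close>

lemmas sw_pull = sw_sw sw_pureL sw_pureR sw_smultR sw_smultL

lemma unital_algebraD [simp]:
  assumes "unital_algebra K A"
  shows "module K A" "a \<in> carrier A \<Longrightarrow> b \<in> carrier A \<Longrightarrow> a \<otimes>\<^bsub>A\<^esub> b \<in> carrier A" "\<one>\<^bsub>A\<^esub> \<in> carrier A"
    "a \<in> carrier A \<Longrightarrow> \<one>\<^bsub>A\<^esub> \<otimes>\<^bsub>A\<^esub> a = a" "a \<in> carrier A \<Longrightarrow> a \<otimes>\<^bsub>A\<^esub> \<one>\<^bsub>A\<^esub> = a"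
    "a \<in> carrier A \<Longrightarrow> b \<in> carrier A \<Longrightarrow> c \<in> carrier A \<Longrightarrow> (a \<otimes>\<^bsub>A\<^esub> b) \<otimes>\<^bsub>A\<^esub> c = a \<otimes>\<^bsub>A\<^esub> (b \<otimes>\<^bsub>A\<^esub> c)"
    "k \<in> carrier K \<Longrightarrow> a \<in> carrier A \<Longrightarrow> b \<in> carrier A \<Longrightarrow> (k \<odot>\<^bsub>A\<^esub> a) \<otimes>\<^bsub>A\<^esub> b = k \<odot>\<^bsub>A\<^esub> (a \<otimes>\<^bsub>A\<^esub> b)"
    "k \<in> carrier K \<Longrightarrow> a \<in> carrier A \<Longrightarrow> b \<in> carrier A \<Longrightarrow> a \<otimes>\<^bsub>A\<^esub> (k \<odot>\<^bsub>A\<^esub> b) = k \<odot>\<^bsub>A\<^esub> (a \<otimes>\<^bsub>A\<^esub> b)"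
proof -
  interpret A: unital_algebra K A by fact
  show "module K A" by (rule A.module_axioms)
  show "k \<in> carrier K \<Longrightarrow> a \<in> carrier A \<Longrightarrow> b \<in> carrier A \<Longrightarrow> (k \<odot>\<^bsub>A\<^esub> a) \<otimes>\<^bsub>A\<^esub> b = k \<odot>\<^bsub>A\<^esub> (a \<otimes>\<^bsub>A\<^esub> b)"
    "k \<in> carrier K \<Longrightarrow> a \<in> carrier A \<Longrightarrow> b \<in> carrier A \<Longrightarrow> a \<otimes>\<^bsub>A\<^esub> (k \<odot>\<^bsub>A\<^esub> b) = k \<odot>\<^bsub>A\<^esub> (a \<otimes>\<^bsub>A\<^esub> b)"
    by (rule A.smult_mult_left A.smult_mult_right; assumption)+
qed (use assms in \<open>auto simp: unital_algebra_def ring_def monoid.m_assoc monoid.l_one monoid.r_one monoid.m_closed monoid.one_closed\<close>)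

lemma lin_multL [simp]:
  assumes "unital_algebra K A" "linear_map K X A F" "a \<in> carrier A"
  shows "linear_map K X A (\<lambda>x. F x \<otimes>\<^bsub>A\<^esub> a)"
proof -
  interpret A: unital_algebra K A by fact
  show ?thesis using linear_mapD[OF assms(2)] assms(3)
    by (intro linear_mapI) (simp_all add: A.A.l_distr A.smult_mult_left)
qed

lemma lin_multR [simp]:
  assumes "unital_algebra K A" "linear_map K X A F" "a \<in> carrier A"
  shows "linear_map K X A (\<lambda>x. a \<otimes>\<^bsub>A\<^esub> F x)"
proof -
  interpret A: unital_algebra K A by fact
  show ?thesis using linear_mapD[OF assms(2)] assms(3)
    by (intro linear_mapI) (simp_all add: A.A.r_distr A.smult_mult_right)
qed

lemma lin_multR' [simp]: "unital_algebra K A \<Longrightarrow> a \<in> carrier A \<Longrightarrow> linear_map K A A (monoid.mult A a)"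
  using lin_multR[of A A "\<lambda>x. x" a] by simp

end

section \<open>Galois extensions and their coinvariants\<close>

locale galois_ext = base_field K for K :: "'k ring" +
  fixes H :: "('k, 'h) module" and \<Delta> :: "'h \<Rightarrow> ('h, 'h) tens" and \<epsilon> :: "'h \<Rightarrow> 'k" and antip :: "'h \<Rightarrow> 'h"
    and P :: "('k, 'p) module" and \<rho> :: "'p \<Rightarrow> ('p, 'h) tens"
  assumes hopf_galois: "hopf_galois K H \<Delta> \<epsilon> antip P \<rho>"
begin

abbreviation "PP \<equiv> P \<otimes>\<^sub>K P"
abbreviation "PH \<equiv> P \<otimes>\<^sub>K H"
abbreviation "PPH \<equiv> P \<otimes>\<^sub>K P \<otimes>\<^sub>K H"
abbreviation "HH \<equiv> H \<otimes>\<^sub>K H"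

lemma comodule_algebra: "comodule_algebra K H \<Delta> \<epsilon> antip P \<rho>"
  using hopf_galois by (rule hopf_galois.axioms)

lemma hopf_algebra: "hopf_algebra K H \<Delta> \<epsilon> antip"
  using comodule_algebra by (rule comodule_algebra.axioms)

lemma unital_algebra_H [simp]: "unital_algebra K H"
  using hopf_algebra by (rule hopf_algebra.axioms)

lemma unital_algebra_P [simp]: "unital_algebra K P"
  using comodule_algebra by (rule comodule_algebra.axioms)

lemma module_H [simp]: "module K H" and module_P [simp]: "module K P"
  by (rule unital_algebraD, simp)+

lemma lin_\<Delta>0 [simp]: "linear_map K H HH \<Delta>"
  using hopf_algebra by (rule hopf_algebra.comult_linear)

lemma lin_\<epsilon>0 [simp]: "linear_map K H (self_module K) \<epsilon>"
  using hopf_algebra by (rule hopf_algebra.counit_linear)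

lemma lin_antip0 [simp]: "linear_map K H H antip"
  using hopf_algebra by (rule hopf_algebra.antip_linear)

lemma lin_\<rho>0 [simp]: "linear_map K P PH \<rho>"
  using comodule_algebra by (rule comodule_algebra.coact_linear)

lemma lin_\<Delta> [simp]: "linear_map K X H F \<Longrightarrow> linear_map K X HH (\<lambda>x. \<Delta> (F x))"
  by (rule linear_map_comp[OF _ lin_\<Delta>0])

lemma hopf_closed [simp]:
  "h \<in> carrier H \<Longrightarrow> \<Delta> h \<in> carrier HH" "h \<in> carrier H \<Longrightarrow> \<epsilon> h \<in> carrier K"
  "h \<in> carrier H \<Longrightarrow> antip h \<in> carrier H" "p \<in> carrier P \<Longrightarrow> \<rho> p \<in> carrier PH"
  using linear_mapD(1)[OF lin_\<Delta>0] linear_mapD(1)[OF lin_\<epsilon>0] linear_mapD(1)[OF lin_antip0]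
    linear_mapD(1)[OF lin_\<rho>0] by simp_all

lemma linear_antip_smult [simp]:
  "c \<in> carrier K \<Longrightarrow> h \<in> carrier H \<Longrightarrow> antip (c \<odot>\<^bsub>H\<^esub> h) = c \<odot>\<^bsub>H\<^esub> antip h"
  "c \<in> carrier K \<Longrightarrow> h \<in> carrier H \<Longrightarrow> \<epsilon> (c \<odot>\<^bsub>H\<^esub> h) = c \<otimes>\<^bsub>K\<^esub> \<epsilon> h"
  "c \<in> carrier K \<Longrightarrow> h \<in> carrier H \<Longrightarrow> \<Delta> (c \<odot>\<^bsub>H\<^esub> h) = c \<odot>\<^bsub>HH\<^esub> \<Delta> h"
  "c \<in> carrier K \<Longrightarrow> p \<in> carrier P \<Longrightarrow> \<rho> (c \<odot>\<^bsub>P\<^esub> p) = c \<odot>\<^bsub>PH\<^esub> \<rho> p"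
  using linear_mapD(3)[OF lin_\<Delta>0] linear_mapD(3)[OF lin_\<epsilon>0] linear_mapD(3)[OF lin_antip0]
    linear_mapD(3)[OF lin_\<rho>0] by simp_all

section \<open>Hopf algebra and comodule axioms for arbitrary multilinear integrands\<close>

lemma sweedler_\<Delta>:
  "h \<in> carrier H \<Longrightarrow> abelian_group A \<Longrightarrow> (\<And>a b. a \<in> carrier H \<Longrightarrow> b \<in> carrier H \<Longrightarrow> f a b \<in> carrier A) \<Longrightarrow>
    sweedler A (\<Delta> h) f = sw H H A (\<Delta> h) f"
  by (rule sweedler_sw) simp_all

lemma sweedler_\<rho>:
  "p \<in> carrier P \<Longrightarrow> abelian_group A \<Longrightarrow> (\<And>a b. a \<in> carrier P \<Longrightarrow> b \<in> carrier H \<Longrightarrow> f a b \<in> carrier A) \<Longrightarrow>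
    sweedler A (\<rho> p) f = sw P H A (\<rho> p) f"
  by (rule sweedler_sw) simp_all

definition trilinear ::
  "('k, 'u) module \<Rightarrow> ('k, 'v) module \<Rightarrow> ('k, 'w) module \<Rightarrow> ('k, 'a) module \<Rightarrow> ('u \<Rightarrow> 'v \<Rightarrow> 'w \<Rightarrow> 'a) \<Rightarrow> bool"
  where "trilinear U V W A f \<longleftrightarrow>
    (\<forall>v\<in>carrier V. \<forall>w\<in>carrier W. linear_map K U A (\<lambda>u. f u v w)) \<and>
    (\<forall>u\<in>carrier U. \<forall>w\<in>carrier W. linear_map K V A (\<lambda>v. f u v w)) \<and>
    (\<forall>u\<in>carrier U. \<forall>v\<in>carrier V. linear_map K W A (\<lambda>w. f u v w))"

lemma trilinearD:
  assumes "trilinear U V W A f"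
  shows "v \<in> carrier V \<Longrightarrow> w \<in> carrier W \<Longrightarrow> linear_map K U A (\<lambda>u. f u v w)"
    "u \<in> carrier U \<Longrightarrow> w \<in> carrier W \<Longrightarrow> linear_map K V A (\<lambda>v. f u v w)"
    "u \<in> carrier U \<Longrightarrow> v \<in> carrier V \<Longrightarrow> linear_map K W A (f u v)"
  using assms by (simp_all add: trilinear_def)

text \<open>The axiom is an equation in a triple tensor product. Applying to it the linear map
  induced by a trilinear \<open>f\<close> gives a rule that rewrites inside larger sums. The counit,
  antipode and multiplicativity axioms are recast below in the same way.\<close>

lemma sw_coassoc:
  assumes h: "h \<in> carrier H" and A: "module K A" and f: "trilinear H H H A f"
  shows "sw H H A (\<Delta> h) (\<lambda>x y. sw H H A (\<Delta> y) (\<lambda>a b. f x a b)) =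
    sw H H A (\<Delta> h) (\<lambda>x y. sw H H A (\<Delta> x) (\<lambda>a b. f a b y))"
proof -
  let ?G = "\<lambda>u. sw H HH A u (\<lambda>x y. sw H H A y (\<lambda>a b. f x a b))"
  note [simp] = A trilinearD[OF f] bil_def
  have "?G (sweedler (H \<otimes>\<^sub>K H \<otimes>\<^sub>K H) (\<Delta> h) (\<lambda>h\<^sub>1 h\<^sub>2. h\<^sub>1 \<boxtimes>\<^bsub>H \<otimes>\<^sub>K H \<otimes>\<^sub>K H\<^esub> \<Delta> h\<^sub>2)) =
      ?G (sweedler (H \<otimes>\<^sub>K H \<otimes>\<^sub>K H) (\<Delta> h) (\<lambda>h\<^sub>1 h\<^sub>2.
        sweedler (H \<otimes>\<^sub>K H \<otimes>\<^sub>K H) (\<Delta> h\<^sub>1) (\<lambda>a b.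
          a \<boxtimes>\<^bsub>H \<otimes>\<^sub>K H \<otimes>\<^sub>K H\<^esub> (b \<boxtimes>\<^bsub>HH\<^esub> h\<^sub>2))))"
    using hopf_algebra.coassoc[OF hopf_algebra h] by (rule arg_cong)
  then show ?thesis using h by (simp add: sweedler_\<Delta> sw_pull)
qed

lemma sw_coact_coassoc:
  assumes p: "p \<in> carrier P" and A: "module K A" and f: "trilinear P H H A f"
  shows "sw P H A (\<rho> p) (\<lambda>x y. sw H H A (\<Delta> y) (\<lambda>a b. f x a b)) =
    sw P H A (\<rho> p) (\<lambda>x y. sw P H A (\<rho> x) (\<lambda>a b. f a b y))"
proof -
  let ?G = "\<lambda>u. sw P HH A u (\<lambda>x y. sw H H A y (\<lambda>a b. f x a b))"
  note [simp] = A trilinearD[OF f] bil_def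
  show ?thesis
    using comodule_algebra.coact_coassoc[OF comodule_algebra p, THEN arg_cong[of _ _ ?G]] p
    by (simp add: sweedler_\<Delta> sweedler_\<rho> sw_pull)
qed

lemma sw_counit:
  assumes h: "h \<in> carrier H" and A: "module K A" and f: "linear_map K H A f"
  shows "sw H H A (\<Delta> h) (\<lambda>x y. \<epsilon> x \<odot>\<^bsub>A\<^esub> f y) = f h"
    and "sw H H A (\<Delta> h) (\<lambda>x y. \<epsilon> y \<odot>\<^bsub>A\<^esub> f x) = f h"
  using hopf_algebra.counit_left[OF hopf_algebra h, THEN arg_cong[of _ _ f]]
    hopf_algebra.counit_right[OF hopf_algebra h, THEN arg_cong[of _ _ f]] h A
  by (simp_all add: sweedler_\<Delta> sw_linear[OF f] linear_mapD[OF f])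

lemma sw_coact_counit:
  assumes p: "p \<in> carrier P" and A: "module K A" and f: "linear_map K P A f"
  shows "sw P H A (\<rho> p) (\<lambda>x y. \<epsilon> y \<odot>\<^bsub>A\<^esub> f x) = f p"
  using comodule_algebra.coact_counit[OF comodule_algebra p, THEN arg_cong[of _ _ f]] p A
  by (simp add: sweedler_\<rho> sw_linear[OF f] linear_mapD[OF f])

lemma sw_antip:
  assumes h: "h \<in> carrier H" and A: "module K A" and f: "linear_map K H A f"
  shows "sw H H A (\<Delta> h) (\<lambda>x y. f (antip x \<otimes>\<^bsub>H\<^esub> y)) = \<epsilon> h \<odot>\<^bsub>A\<^esub> f \<one>\<^bsub>H\<^esub>"
    and "sw H H A (\<Delta> h) (\<lambda>x y. f (x \<otimes>\<^bsub>H\<^esub> antip y)) = \<epsilon> h \<odot>\<^bsub>A\<^esub> f \<one>\<^bsub>H\<^esub>"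
  using hopf_algebra.antip_left[OF hopf_algebra h, THEN arg_cong[of _ _ f]]
    hopf_algebra.antip_right[OF hopf_algebra h, THEN arg_cong[of _ _ f]] h A
  by (simp_all add: sweedler_\<Delta> sw_linear[OF f] linear_mapD[OF f])

lemma sw_comult_mult:
  assumes "g \<in> carrier H" "h \<in> carrier H" and A: "module K A" and f: "bil K H H A f"
  shows "sw H H A (\<Delta> (g \<otimes>\<^bsub>H\<^esub> h)) f =
    sw H H A (\<Delta> g) (\<lambda>a b. sw H H A (\<Delta> h) (\<lambda>c d. f (a \<otimes>\<^bsub>H\<^esub> c) (b \<otimes>\<^bsub>H\<^esub> d)))"
proof -
  note [simp] = f[unfolded bil_def, THEN conjunct1, rule_format] f[unfolded bil_def, THEN conjunct2, rule_format]
    bilD(1)[OF f] bil_def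
  show ?thesis
    using hopf_algebra.comult_mult[OF hopf_algebra assms(1,2)] assms(1-3)
    by (simp add: sweedler_\<Delta> sw_pull)
qed

lemma sw_coact_mult:
  assumes "p \<in> carrier P" "q \<in> carrier P" and A: "module K A" and f: "bil K P H A f"
  shows "sw P H A (\<rho> (p \<otimes>\<^bsub>P\<^esub> q)) f =
    sw P H A (\<rho> p) (\<lambda>a b. sw P H A (\<rho> q) (\<lambda>c d. f (a \<otimes>\<^bsub>P\<^esub> c) (b \<otimes>\<^bsub>H\<^esub> d)))"
proof -
  note [simp] = f[unfolded bil_def, THEN conjunct1, rule_format] f[unfolded bil_def, THEN conjunct2, rule_format]
    bilD(1)[OF f] bil_def
  show ?thesis
    using comodule_algebra.coact_mult[OF comodule_algebra assms(1,2)] assms(1-3)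
    by (simp add: sweedler_\<rho> sw_pull)
qed

lemma coact_one [simp]: "\<rho> \<one>\<^bsub>P\<^esub> = \<one>\<^bsub>P\<^esub> \<boxtimes>\<^bsub>PH\<^esub> \<one>\<^bsub>H\<^esub>"
  using comodule_algebra by (rule comodule_algebra.coact_one)

end

text \<open>From here on bilinearity is no longer an opaque hypothesis but a side condition that the
  linearity rules discharge.\<close>

declare bil_def [simp]

context galois_ext
begin

section \<open>Modules over the coinvariants\<close>

definition Bc :: "'p set" where "Bc = carrier (coinvariants K H P \<rho>)"

lemma Bc_iff: "b \<in> Bc \<longleftrightarrow> b \<in> carrier P \<and> \<rho> b = b \<boxtimes>\<^bsub>PH\<^esub> \<one>\<^bsub>H\<^esub>"
  by (auto simp: Bc_def coinvariants_def)

lemma Bc_carrier [simp]: "b \<in> Bc \<Longrightarrow> b \<in> carrier P"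
  by (simp add: Bc_iff)

lemma Bc_scalar [simp]: "c \<in> carrier K \<Longrightarrow> c \<odot>\<^bsub>P\<^esub> \<one>\<^bsub>P\<^esub> \<in> Bc"
  by (simp add: Bc_iff)

lemma Bc_closed:
  assumes "a \<in> Bc" "b \<in> Bc"
  shows "a \<oplus>\<^bsub>P\<^esub> b \<in> Bc" "a \<otimes>\<^bsub>P\<^esub> b \<in> Bc"
proof -
  have "\<rho> (a \<otimes>\<^bsub>P\<^esub> b) = sw P H PH (\<rho> (a \<otimes>\<^bsub>P\<^esub> b)) (pure_tensor PH)"
    using assms by simp
  also have "\<dots> = (a \<otimes>\<^bsub>P\<^esub> b) \<boxtimes>\<^bsub>PH\<^esub> \<one>\<^bsub>H\<^esub>"
    using assms by (subst sw_coact_mult) (auto simp: Bc_iff)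
  finally show "a \<otimes>\<^bsub>P\<^esub> b \<in> Bc" using assms by (simp add: Bc_iff)
  show "a \<oplus>\<^bsub>P\<^esub> b \<in> Bc"
    using assms linear_mapD(2)[OF lin_\<rho>0, of a b] linear_mapD(2)[OF tensor_pure_lin(2)[OF module_P module_H], of "\<one>\<^bsub>H\<^esub>" a b]
    by (simp add: Bc_iff)
qed

text \<open>A coinvariant contributes only \<open>\<one>\<close> to the \<open>H\<close>-leg of a
  product, so the coaction is linear over the coinvariants on both sides. Most balancing conditions
  below rest on this.\<close>

lemma sw_coact_coinv:
  assumes "p \<in> carrier P" "b \<in> Bc" and A: "module K A" and f: "bil K P H A f"
  shows "sw P H A (\<rho> (p \<otimes>\<^bsub>P\<^esub> b)) f = sw P H A (\<rho> p) (\<lambda>x y. f (x \<otimes>\<^bsub>P\<^esub> b) y)"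
    and "sw P H A (\<rho> (b \<otimes>\<^bsub>P\<^esub> p)) f = sw P H A (\<rho> p) (\<lambda>x y. f (b \<otimes>\<^bsub>P\<^esub> x) y)"
proof -
  note [simp] = f[unfolded bil_def, THEN conjunct1, rule_format] f[unfolded bil_def, THEN conjunct2, rule_format]
    bilD(1)[OF f] linear_map_comp[of K _ P "\<lambda>v. _ v \<otimes>\<^bsub>P\<^esub> _"]
  have [simp]: "linear_map K X A (\<lambda>v. f (F v) h)" if "linear_map K X P F" "h \<in> carrier H" for X F h
    using that by (intro linear_map_comp[of K X P F A "\<lambda>v. f v h"]) simp_all
  have [simp]: "linear_map K X A (\<lambda>v. f p (F v))" if "linear_map K X H F" "p \<in> carrier P" for X F p
    using that by (intro linear_map_comp[of K X H F A "f p"]) simp_all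
  have b: "b \<in> carrier P" "\<rho> b = b \<boxtimes>\<^bsub>PH\<^esub> \<one>\<^bsub>H\<^esub>"
    using assms(2) by (simp_all add: Bc_iff)
  show "sw P H A (\<rho> (p \<otimes>\<^bsub>P\<^esub> b)) f = sw P H A (\<rho> p) (\<lambda>x y. f (x \<otimes>\<^bsub>P\<^esub> b) y)"
    using assms(1) b A by (simp add: sw_coact_mult[OF assms(1) b(1) A f])
  show "sw P H A (\<rho> (b \<otimes>\<^bsub>P\<^esub> p)) f = sw P H A (\<rho> p) (\<lambda>x y. f (b \<otimes>\<^bsub>P\<^esub> x) y)"
    using assms(1) b A by (simp add: sw_coact_mult[OF b(1) assms(1) A f])
qed

text \<open>The last clause ties the scalars to the action of multiples of \<open>\<one>\<close> in
  \<open>P\<close>, as \<open>scalar\<close> of \<open>tensor_bimod\<close> demands.\<close>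

definition rmodB :: "('k, 'm) module \<Rightarrow> ('m \<Rightarrow> 'p \<Rightarrow> 'm) \<Rightarrow> bool"
  where "rmodB M act \<longleftrightarrow> module K M \<and> (\<forall>b\<in>Bc. linear_map K M M (\<lambda>m. act m b)) \<and>
    (\<forall>m\<in>carrier M. \<forall>b\<in>Bc. \<forall>b'\<in>Bc. act m (b \<oplus>\<^bsub>P\<^esub> b') = act m b \<oplus>\<^bsub>M\<^esub> act m b') \<and>
    (\<forall>m\<in>carrier M. \<forall>b\<in>Bc. \<forall>b'\<in>Bc. act m (b \<otimes>\<^bsub>P\<^esub> b') = act (act m b) b') \<and>
    (\<forall>m\<in>carrier M. \<forall>c\<in>carrier K. act m (c \<odot>\<^bsub>P\<^esub> \<one>\<^bsub>P\<^esub>) = c \<odot>\<^bsub>M\<^esub> m)"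

definition lmodB :: "('k, 'n) module \<Rightarrow> ('p \<Rightarrow> 'n \<Rightarrow> 'n) \<Rightarrow> bool"
  where "lmodB N lam \<longleftrightarrow> module K N \<and> (\<forall>b\<in>Bc. linear_map K N N (lam b)) \<and>
    (\<forall>n\<in>carrier N. \<forall>c\<in>carrier K. lam (c \<odot>\<^bsub>P\<^esub> \<one>\<^bsub>P\<^esub>) n = c \<odot>\<^bsub>N\<^esub> n)"

lemma rmodB_right_module:
  assumes "rmodB M act"
  shows "right_module (coinvariants K H P \<rho>) M act"
proof -
  have 1: "act m \<one>\<^bsub>P\<^esub> = m" if "m \<in> carrier M" for m
    using assms that by (auto simp: rmodB_def dest!: bspec[of _ _ m] bspec[of _ _ "\<one>\<^bsub>K\<^esub>"])
  have "act m b \<in> carrier M" "act (m \<oplus>\<^bsub>M\<^esub> m') b = act m b \<oplus>\<^bsub>M\<^esub> act m' b"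
    if "m \<in> carrier M" "m' \<in> carrier M" "b \<in> Bc" for m m' b
    using assms that linear_mapD(1,2)[of K M M "\<lambda>m. act m b"] by (simp_all add: rmodB_def)
  moreover have "add (coinvariants K H P \<rho>) = add P" "monoid.mult (coinvariants K H P \<rho>) = monoid.mult P"
    "\<one>\<^bsub>coinvariants K H P \<rho>\<^esub> = \<one>\<^bsub>P\<^esub>"
    by (simp_all add: coinvariants_def)
  ultimately show ?thesis
    using assms 1 by (simp add: right_module_def rmodB_def Bc_def[symmetric])
qed

abbreviation tensB :: "('k, 'm) module \<Rightarrow> ('m \<Rightarrow> 'p \<Rightarrow> 'm) \<Rightarrow> ('k, 'n) module \<Rightarrow> ('p \<Rightarrow> 'n \<Rightarrow> 'n) \<Rightarrow> ('k, ('m, 'n) tens) module"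
  where "tensB \<equiv> tmod K Bc"

abbreviation bilB where "bilB M act N lam A f \<equiv> rbil K Bc M act N lam A f"

lemma tensor_bimod_tensB:
  assumes "rmodB M act" "lmodB N lam"
  shows "tensor_bimod K Bc M act N lam"
proof (rule tensor_bimod.intro)
  show "\<exists>b\<in>Bc. (\<forall>m\<in>carrier M. act m b = c \<odot>\<^bsub>M\<^esub> m) \<and> (\<forall>n\<in>carrier N. lam b n = c \<odot>\<^bsub>N\<^esub> n)"
    if "c \<in> carrier K" for c
    using that assms by (intro bexI[of _ "c \<odot>\<^bsub>P\<^esub> \<one>\<^bsub>P\<^esub>"]) (simp_all add: rmodB_def lmodB_def)
qed (use assms in \<open>auto simp: rmodB_def lmodB_def\<close>)

context
  fixes M :: "('k, 'm) module" and act and N :: "('k, 'n) module" and lam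
  assumes M: "rmodB M act" and N: "lmodB N lam"
begin

lemma module_tensB [simp]: "module K (tensB M act N lam)"
  by (rule tensor_bimod.module_TM[OF tensor_bimod_tensB[OF M N]])

lemma rmodB_module: "module K M" and lmodB_module: "module K N"
  using M N by (simp_all add: rmodB_def lmodB_def)

lemma tensB_closed [simp]:
  "m \<in> carrier M \<Longrightarrow> n \<in> carrier N \<Longrightarrow> m \<boxtimes>\<^bsub>tensB M act N lam\<^esub> n \<in> carrier (tensB M act N lam)"
  by (rule tensor_bimod.TM_pure_closed[OF tensor_bimod_tensB[OF M N]])

lemma tensB_balanced:
  "m \<in> carrier M \<Longrightarrow> b \<in> Bc \<Longrightarrow> n \<in> carrier N \<Longrightarrow>
    act m b \<boxtimes>\<^bsub>tensB M act N lam\<^esub> n = m \<boxtimes>\<^bsub>tensB M act N lam\<^esub> lam b n"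
  by (rule tensor_bimod.pure_balanced[OF tensor_bimod_tensB[OF M N]])

lemma tensB_pure_smult [simp]:
  assumes "c \<in> carrier K" "m \<in> carrier M" "n \<in> carrier N"
  shows "(c \<odot>\<^bsub>M\<^esub> m) \<boxtimes>\<^bsub>tensB M act N lam\<^esub> n = c \<odot>\<^bsub>tensB M act N lam\<^esub> (m \<boxtimes>\<^bsub>tensB M act N lam\<^esub> n)"
    and "m \<boxtimes>\<^bsub>tensB M act N lam\<^esub> (c \<odot>\<^bsub>N\<^esub> n) = c \<odot>\<^bsub>tensB M act N lam\<^esub> (m \<boxtimes>\<^bsub>tensB M act N lam\<^esub> n)"
  using tensor_bimod.pure_smult_left[OF tensor_bimod_tensB[OF M N] assms]
    tensor_bimod.pure_smult_right[OF tensor_bimod_tensB[OF M N] assms] by simp_all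

lemma tensB_pure_lin:
  shows "m \<in> carrier M \<Longrightarrow> linear_map K N (tensB M act N lam) (pure_tensor (tensB M act N lam) m)"
    and "n \<in> carrier N \<Longrightarrow> linear_map K M (tensB M act N lam) (\<lambda>m. m \<boxtimes>\<^bsub>tensB M act N lam\<^esub> n)"
proof -
  interpret MN: tensor_bimod K Bc M act N lam by (rule tensor_bimod_tensB[OF M N])
  show "m \<in> carrier M \<Longrightarrow> linear_map K N (tensB M act N lam) (pure_tensor (tensB M act N lam) m)"
    by (intro linear_mapI MN.TM_pure_closed MN.pure_add_right MN.pure_smult_right)
  show "n \<in> carrier N \<Longrightarrow> linear_map K M (tensB M act N lam) (\<lambda>m. m \<boxtimes>\<^bsub>tensB M act N lam\<^esub> n)"
    by (intro linear_mapI MN.TM_pure_closed MN.pure_add_left MN.pure_smult_left)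
qed

lemma lin_tensBL [simp]:
  "linear_map K X M F \<Longrightarrow> n \<in> carrier N \<Longrightarrow>
    linear_map K X (tensB M act N lam) (\<lambda>x. F x \<boxtimes>\<^bsub>tensB M act N lam\<^esub> n)"
  by (rule linear_map_comp[OF _ tensB_pure_lin(2)])

lemma lin_tensBR [simp]:
  "m \<in> carrier M \<Longrightarrow> linear_map K X N F \<Longrightarrow>
    linear_map K X (tensB M act N lam) (\<lambda>x. m \<boxtimes>\<^bsub>tensB M act N lam\<^esub> F x)"
  by (rule linear_map_comp[OF _ tensB_pure_lin(1)])

lemma lin_tensBR' [simp]:
  "m \<in> carrier M \<Longrightarrow> linear_map K N (tensB M act N lam) (pure_tensor (tensB M act N lam) m)"
  by (rule tensB_pure_lin)

lemma sw_tensB_pure [simp]: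
  "module K A \<Longrightarrow> m \<in> carrier M \<Longrightarrow> n \<in> carrier N \<Longrightarrow> bilB M act N lam A f \<Longrightarrow>
    sw M N A (m \<boxtimes>\<^bsub>tensB M act N lam\<^esub> n) f = f m n"
  by (rule tensor_bimod.sw_pure[OF tensor_bimod_tensB[OF M N]]) simp_all

lemma lin_sw_tensB:
  "module K A \<Longrightarrow> bilB M act N lam A f \<Longrightarrow> linear_map K (tensB M act N lam) A (\<lambda>u. sw M N A u f)"
  by (rule tensor_bimod.sw_u_linear[OF tensor_bimod_tensB[OF M N]]) simp_all

lemma lin_swu_tensB:
  assumes "module K A" "linear_map K X (tensB M act N lam) F" "bilB M act N lam A f"
  shows "linear_map K X A (\<lambda>x. sw M N A (F x) f)"
  by (rule linear_map_comp[OF assms(2) lin_sw_tensB]) fact+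

lemma tensB_eqI:
  assumes "linear_map K (tensB M act N lam) A f" "linear_map K (tensB M act N lam) A g" "u \<in> carrier (tensB M act N lam)"
    "\<And>m n. m \<in> carrier M \<Longrightarrow> n \<in> carrier N \<Longrightarrow> f (m \<boxtimes>\<^bsub>tensB M act N lam\<^esub> n) = g (m \<boxtimes>\<^bsub>tensB M act N lam\<^esub> n)"
  shows "f u = g u"
  using tensor_bimod.TM_linear_eqI[OF tensor_bimod_tensB[OF M N] assms(1,2,4,3)] by blast

lemma sw_tensB_sw:
  assumes "module K A"
    "\<And>m n. m \<in> carrier M' \<Longrightarrow> n \<in> carrier N' \<Longrightarrow> f m n \<in> carrier (tensB M act N lam)" "bilB M act N lam A g"
  shows "sw M N A (sw M' N' (tensB M act N lam) u f) g = sw M' N' A u (\<lambda>m n. sw M N A (f m n) g)"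
  by (rule sw_linear[OF lin_sw_tensB]) (use assms in simp_all)

lemma sw_tensBR:
  assumes "m \<in> carrier M"
    "\<And>x y. x \<in> carrier M' \<Longrightarrow> y \<in> carrier N' \<Longrightarrow> f x y \<in> carrier N"
  shows "m \<boxtimes>\<^bsub>tensB M act N lam\<^esub> sw M' N' N u f = sw M' N' (tensB M act N lam) u (\<lambda>x y. m \<boxtimes>\<^bsub>tensB M act N lam\<^esub> f x y)"
  by (rule sw_linear[OF tensB_pure_lin(1)]) (use assms lmodB_module in simp_all)

lemma sweedler_tensB:
  assumes "abelian_group A" "u \<in> carrier (tensB M act N lam)"
    "\<And>m n. m \<in> carrier M \<Longrightarrow> n \<in> carrier N \<Longrightarrow> f m n \<in> carrier A"
  shows "sweedler A u f = sw M N A u f"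
proof -
  interpret MN: tensor_bimod K Bc M act N lam by (rule tensor_bimod_tensB[OF M N])
  show ?thesis using assms by (intro MN.sweedler_eq_sw) (simp_all add: tmod_simps)
qed

end

text \<open>For \<open>V = P\<close> and restricted to \<open>L\<close>, this is left multiplication
  by the target of \<open>b\<close>, and \<open>actL\<close> is left multiplication by its source;
  see \<open>emult_target\<close> and \<open>emult_source\<close>. The balanced product of the
  bialgebroid thus becomes an instance of \<open>tensB\<close>.\<close>

definition actR :: "('k, 'v) module \<Rightarrow> ('v, 'p) tens \<Rightarrow> 'p \<Rightarrow> ('v, 'p) tens"
  where "actR V x b = sw V P (V \<otimes>\<^sub>K P) x (\<lambda>v q. v \<boxtimes>\<^bsub>V \<otimes>\<^sub>K P\<^esub> (q \<otimes>\<^bsub>P\<^esub> b))"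

definition actL :: "'p \<Rightarrow> ('p, 'p) tens \<Rightarrow> ('p, 'p) tens"
  where "actL b x = sw P P PP x (\<lambda>r u. (b \<otimes>\<^bsub>P\<^esub> r) \<boxtimes>\<^bsub>PP\<^esub> u)"

lemma actR_closed [simp]: "module K V \<Longrightarrow> b \<in> carrier P \<Longrightarrow> actR V x b \<in> carrier (V \<otimes>\<^sub>K P)"
  by (simp add: actR_def)

lemma lin_actR [simp]:
  "module K V \<Longrightarrow> linear_map K X (V \<otimes>\<^sub>K P) F \<Longrightarrow> b \<in> carrier P \<Longrightarrow> linear_map K X (V \<otimes>\<^sub>K P) (\<lambda>x. actR V (F x) b)"
  by (simp add: actR_def)

lemma actR_pure [simp]:
  "module K V \<Longrightarrow> v \<in> carrier V \<Longrightarrow> q \<in> carrier P \<Longrightarrow> b \<in> carrier P \<Longrightarrow>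
    actR V (v \<boxtimes>\<^bsub>V \<otimes>\<^sub>K P\<^esub> q) b = v \<boxtimes>\<^bsub>V \<otimes>\<^sub>K P\<^esub> (q \<otimes>\<^bsub>P\<^esub> b)"
  by (simp add: actR_def)

lemma actL_closed [simp]: "b \<in> carrier P \<Longrightarrow> actL b x \<in> carrier PP"
  by (simp add: actL_def)

lemma lin_actL [simp]:
  "linear_map K X PP F \<Longrightarrow> b \<in> carrier P \<Longrightarrow> linear_map K X PP (\<lambda>x. actL b (F x))"
  by (simp add: actL_def)

lemma actL_pure [simp]:
  "r \<in> carrier P \<Longrightarrow> u \<in> carrier P \<Longrightarrow> b \<in> carrier P \<Longrightarrow>
    actL b (r \<boxtimes>\<^bsub>PP\<^esub> u) = (b \<otimes>\<^bsub>P\<^esub> r) \<boxtimes>\<^bsub>PP\<^esub> u"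
  by (simp add: actL_def)

lemma P_r_distr: "a \<in> carrier P \<Longrightarrow> b \<in> carrier P \<Longrightarrow> c \<in> carrier P \<Longrightarrow>
    a \<otimes>\<^bsub>P\<^esub> (b \<oplus>\<^bsub>P\<^esub> c) = a \<otimes>\<^bsub>P\<^esub> b \<oplus>\<^bsub>P\<^esub> a \<otimes>\<^bsub>P\<^esub> c"
  using linear_mapD(2)[OF lin_multR'[OF unital_algebra_P]] by simp

lemma rmodB_actR [simp]:
  assumes V: "module K V"
  shows "rmodB (V \<otimes>\<^sub>K P) (actR V)"
proof -
  have "actR V x (b \<oplus>\<^bsub>P\<^esub> b') = actR V x b \<oplus>\<^bsub>V \<otimes>\<^sub>K P\<^esub> actR V x b'" if "b \<in> Bc" "b' \<in> Bc" for x b b'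
  proof -
    have "linear_map K P (V \<otimes>\<^sub>K P) (\<lambda>b. actR V x b)"
      using V unfolding actR_def by simp
    from linear_mapD(2)[OF this, of b b'] show ?thesis using that by simp
  qed
  moreover have "actR V x (b \<otimes>\<^bsub>P\<^esub> b') = actR V (actR V x b) b'"
    if "x \<in> carrier (V \<otimes>\<^sub>K P)" "b \<in> Bc" "b' \<in> Bc" for x b b'
    by (rule tensor_eqI[OF _ _ that(1) V module_P, where A = "V \<otimes>\<^sub>K P"]) (use V that in simp_all)
  moreover have "actR V x (c \<odot>\<^bsub>P\<^esub> \<one>\<^bsub>P\<^esub>) = c \<odot>\<^bsub>V \<otimes>\<^sub>K P\<^esub> x" if "x \<in> carrier (V \<otimes>\<^sub>K P)" "c \<in> carrier K" for x c
    by (rule tensor_eqI[OF _ _ that(1) V module_P, where A = "V \<otimes>\<^sub>K P"]) (use V that in simp_all)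
  ultimately show ?thesis using V by (simp add: rmodB_def)
qed

lemma rmodB_P [simp]: "rmodB P (monoid.mult P)"
  by (simp add: rmodB_def P_r_distr)

lemma lmodB_P [simp]: "lmodB P (monoid.mult P)"
  by (simp add: lmodB_def)

lemma lmodB_actL [simp]: "lmodB PP actL"
proof -
  have "actL (c \<odot>\<^bsub>P\<^esub> \<one>\<^bsub>P\<^esub>) x = c \<odot>\<^bsub>PP\<^esub> x" if "x \<in> carrier PP" "c \<in> carrier K" for x c
    by (rule tensor_eqI[OF _ _ that(1) module_P module_P, where A = "PP"]) (use that in simp_all)
  then show ?thesis by (simp add: lmodB_def)
qed

section \<open>The canonical map, its inverse and a version with a spectator\<close>

abbreviation PBP :: "('k, ('p, 'p) tens) module"
  where "PBP \<equiv> tensB P (monoid.mult P) P (monoid.mult P)"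

definition can :: "('p, 'p) tens \<Rightarrow> ('p, 'h) tens"
  where "can t = sw P P PH t (\<lambda>p q. sw P H PH (\<rho> q) (\<lambda>a b. (p \<otimes>\<^bsub>P\<^esub> a) \<boxtimes>\<^bsub>PH\<^esub> b))"

definition caninv :: "('p, 'h) tens \<Rightarrow> ('p, 'p) tens"
  where "caninv = inv_into (carrier (tensor_coinv K H P \<rho>)) (canonical_map K H P \<rho>)"

lemma rbil_unfold [simp]:
  "rbil K R M rho N lam A f \<longleftrightarrow> bil K M N A f \<and>
    (\<forall>m\<in>carrier M. \<forall>r\<in>R. \<forall>n\<in>carrier N. f (rho m r) n = f m (lam r n))"
  by (rule rbil_def)

lemma sw_coact_coinv_left:
  assumes "p \<in> carrier P" "b \<in> Bc" "module K A" "bil K P H A f"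
  shows "sw P H A (\<rho> (b \<otimes>\<^bsub>P\<^esub> p)) f = sw P H A (\<rho> p) (\<lambda>x y. f (b \<otimes>\<^bsub>P\<^esub> x) y)"
  using sw_coact_coinv(2)[OF assms] .

lemma lin_can0 [simp]: "linear_map K PBP PH can"
  unfolding can_def by (rule lin_sw_tensB) (simp_all add: sw_coact_coinv_left)

lemma can_pure [simp]:
  assumes "p \<in> carrier P" "q \<in> carrier P"
  shows "can (p \<boxtimes>\<^bsub>PBP\<^esub> q) = sw P H PH (\<rho> q) (\<lambda>a b. (p \<otimes>\<^bsub>P\<^esub> a) \<boxtimes>\<^bsub>PH\<^esub> b)"
  using assms unfolding can_def by (subst sw_tensB_pure) (simp_all add: sw_coact_coinv_left)

lemma tensor_coinv_carrier: "carrier (tensor_coinv K H P \<rho>) = carrier PBP"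
  by (simp add: tensor_coinv_def tmod_simps Bc_def)

lemma canonical_map_eq: "t \<in> carrier PBP \<Longrightarrow> canonical_map K H P \<rho> t = can t"
  unfolding canonical_map_def can_def
  by (simp add: sweedler_tensB[OF rmodB_P lmodB_P] sweedler_\<rho>)

lemma caninv_closed [simp]: "y \<in> carrier PH \<Longrightarrow> caninv y \<in> carrier PBP"
  and can_caninv [simp]: "y \<in> carrier PH \<Longrightarrow> can (caninv y) = y"
  and caninv_can [simp]: "t \<in> carrier PBP \<Longrightarrow> caninv (can t) = t"
proof -
  have b: "bij_betw (canonical_map K H P \<rho>) (carrier PBP) (carrier PH)"
    using hopf_galois.canonical_bij[OF hopf_galois] by (simp add: tensor_coinv_carrier)
  show c: "y \<in> carrier PH \<Longrightarrow> caninv y \<in> carrier PBP"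
    using b unfolding caninv_def tensor_coinv_carrier by (metis bij_betw_def inv_into_into)
  show "can (caninv y) = y" if "y \<in> carrier PH"
    using bij_betw_inv_into_right[OF b that] canonical_map_eq[OF c[OF that]]
    by (simp add: caninv_def tensor_coinv_carrier)
  show "t \<in> carrier PBP \<Longrightarrow> caninv (can t) = t"
    using bij_betw_inv_into_left[OF b] by (simp add: caninv_def tensor_coinv_carrier canonical_map_eq)
qed

lemma linear_inverse:
  assumes f: "linear_map K V W f" and g: "\<And>y. y \<in> carrier W \<Longrightarrow> g y \<in> carrier V"
    "\<And>y. y \<in> carrier W \<Longrightarrow> f (g y) = y" "\<And>x. x \<in> carrier V \<Longrightarrow> g (f x) = x"
    and "module K V" "module K W"
  shows "linear_map K W V g"
proof (rule linear_mapI)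
  show "g (x \<oplus>\<^bsub>W\<^esub> y) = g x \<oplus>\<^bsub>V\<^esub> g y" if "x \<in> carrier W" "y \<in> carrier W" for x y
    using linear_mapD(2)[OF f, of "g x" "g y"] g that assms(5) by (metis add_closed_module)
  show "g (c \<odot>\<^bsub>W\<^esub> x) = c \<odot>\<^bsub>V\<^esub> g x" if "c \<in> carrier K" "x \<in> carrier W" for c x
    using linear_mapD(3)[OF f, of c "g x"] g that assms(5) by (metis smult_closed_module)
qed (rule g)

lemma lin_caninv0 [simp]: "linear_map K PH PBP caninv"
  by (rule linear_inverse[OF lin_can0]) simp_all

lemmas lin_swu_PBP [simp] = lin_swu_tensB[OF rmodB_P lmodB_P]
lemma translation_map_eq: "translation_map K H P \<rho> h = caninv (\<one>\<^bsub>P\<^esub> \<boxtimes>\<^bsub>PH\<^esub> h)"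
  by (simp add: translation_map_def caninv_def)

text \<open>This is \<open>can (caninv y) = y\<close> seen through a bilinear map. For
  \<open>y = \<one> \<boxtimes> h\<close> it is the first of the two rules for the translation
  map.\<close>

lemma sw_caninv:
  assumes y: "y \<in> carrier PH" and A: "module K A" and f: "bil K P H A f"
  shows "sw P P A (caninv y) (\<lambda>u v. sw P H A (\<rho> v) (\<lambda>a b. f (u \<otimes>\<^bsub>P\<^esub> a) b)) = sw P H A y f"
proof -
  have [simp]: "f p h \<in> carrier A" if "p \<in> carrier P" "h \<in> carrier H" for p h
    using that bilD(1)[OF f] by simp
  have [simp]: "linear_map K X A (\<lambda>v. f (F v) h)" if "linear_map K X P F" "h \<in> carrier H" for X :: "('k, 'x) module" and F h
    using that f by (intro linear_map_comp[of K X P F A "\<lambda>v. f v h"]) simp_all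
  have [simp]: "linear_map K X A (\<lambda>v. f p (F v))" if "linear_map K X H F" "p \<in> carrier P" for X :: "('k, 'x) module" and F p
    using that f by (intro linear_map_comp[of K X H F A "f p"]) simp_all
  have [simp]: "linear_map K H A (f p)" if "p \<in> carrier P" for p
    using that f by simp
  have "sw P P A (caninv y) (\<lambda>u v. sw P H A (\<rho> v) (\<lambda>a b. f (u \<otimes>\<^bsub>P\<^esub> a) b)) = sw P H A (can (caninv y)) f"
    unfolding can_def using A by (simp add: sw_pull)
  then show ?thesis using y by simp
qed

text \<open>Instead of computing with the translation map, \<open>caninv y\<close> is generalized to
  an arbitrary \<open>t\<close>, with \<open>can t\<close> in place of \<open>y\<close>. Both sides
  are linear in \<open>t\<close>. On \<open>p \<otimes> q\<close> the right one has
  \<open>H\<close>-leg \<open>p\<^sub>1 q\<^sub>1 (antip q\<^sub>2)\<close> beside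
  \<open>p\<^sub>0 q\<^sub>0\<close>; antipode and counit reduce it to \<open>p\<^sub>1\<close>
  beside \<open>p\<^sub>0 q\<close>.\<close>

lemma sw_caninv_left:
  assumes y: "y \<in> carrier PH" and A: "module K A" and f: "bil K P H A f"
  shows "sw P P A (caninv y) (\<lambda>u v. sw P H A (\<rho> u) (\<lambda>a b. f (a \<otimes>\<^bsub>P\<^esub> v) b)) =
    sw P H A y (\<lambda>p h. sw P H A (\<rho> p) (\<lambda>a b. f a (b \<otimes>\<^bsub>H\<^esub> antip h)))"
proof -
  note [simp] = A
  have [simp]: "f p h \<in> carrier A" if "p \<in> carrier P" "h \<in> carrier H" for p h
    using that bilD(1)[OF f] by simp
  have [simp]: "linear_map K X A (\<lambda>v. f (F v) h)" if "linear_map K X P F" "h \<in> carrier H" for X :: "('k, 'x) module" and F h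
    using that f by (intro linear_map_comp[of K X P F A "\<lambda>v. f v h"]) simp_all
  have [simp]: "linear_map K X A (\<lambda>v. f p (F v))" if "linear_map K X H F" "p \<in> carrier P" for X :: "('k, 'x) module" and F p
    using that f by (intro linear_map_comp[of K X H F A "f p"]) simp_all
  have [simp]: "linear_map K H A (f p)" if "p \<in> carrier P" for p
    using that f by simp
  let ?l = "\<lambda>t. sw P P A t (\<lambda>u v. sw P H A (\<rho> u) (\<lambda>a b. f (a \<otimes>\<^bsub>P\<^esub> v) b))"
  let ?r = "\<lambda>t. sw P H A (can t) (\<lambda>p h. sw P H A (\<rho> p) (\<lambda>a b. f a (b \<otimes>\<^bsub>H\<^esub> antip h)))"
  have "?l t = ?r t" if "t \<in> carrier PBP" for t
  proof (rule tensB_eqI[OF rmodB_P lmodB_P _ _ that])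
    show "linear_map K PBP A ?l"
      by (rule lin_sw_tensB) (simp_all add: sw_coact_coinv(1))
    show "linear_map K PBP A ?r" by simp
    fix p q assume pq [simp]: "p \<in> carrier P" "q \<in> carrier P"
    have "?l (p \<boxtimes>\<^bsub>PBP\<^esub> q) = sw P H A (\<rho> p) (\<lambda>a b. f (a \<otimes>\<^bsub>P\<^esub> q) b)"
      by (subst sw_tensB_pure) (simp_all add: sw_coact_coinv(1))
    also have "\<dots> = sw P H A (\<rho> p) (\<lambda>a b. sw P H A (\<rho> q) (\<lambda>x y. \<epsilon> y \<odot>\<^bsub>A\<^esub> f (a \<otimes>\<^bsub>P\<^esub> x) b))"
      by (intro sw_cong refl) (simp add: sw_coact_counit)
    also have "\<dots> = sw P H A (\<rho> p) (\<lambda>a b. sw P H A (\<rho> q) (\<lambda>x y. sw H H A (\<Delta> y) (\<lambda>d e. f (a \<otimes>\<^bsub>P\<^esub> x) (b \<otimes>\<^bsub>H\<^esub> (d \<otimes>\<^bsub>H\<^esub> antip e)))))"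
      by (intro sw_cong refl) (subst sw_antip(2), simp_all)
    also have "\<dots> = sw P H A (\<rho> p) (\<lambda>a b. sw P H A (\<rho> q) (\<lambda>x y. sw P H A (\<rho> x) (\<lambda>c d. f (a \<otimes>\<^bsub>P\<^esub> c) (b \<otimes>\<^bsub>H\<^esub> (d \<otimes>\<^bsub>H\<^esub> antip y)))))"
      by (intro sw_cong refl sw_coact_coassoc[of q A "\<lambda>x d e. f (_ \<otimes>\<^bsub>P\<^esub> x) (_ \<otimes>\<^bsub>H\<^esub> (d \<otimes>\<^bsub>H\<^esub> antip e))"])
        (simp_all add: trilinear_def)
    also have "\<dots> = sw P H A (\<rho> q) (\<lambda>x y. sw P H A (\<rho> p) (\<lambda>a b. sw P H A (\<rho> x) (\<lambda>c d. f (a \<otimes>\<^bsub>P\<^esub> c) (b \<otimes>\<^bsub>H\<^esub> (d \<otimes>\<^bsub>H\<^esub> antip y)))))"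
      by (rule sw_swap) simp_all
    also have "\<dots> = ?r (p \<boxtimes>\<^bsub>PBP\<^esub> q)"
      by (simp add: sw_pull sw_coact_mult)
    finally show "?l (p \<boxtimes>\<^bsub>PBP\<^esub> q) = ?r (p \<boxtimes>\<^bsub>PBP\<^esub> q)" .
  qed
  from this[OF caninv_closed[OF y]] show ?thesis using y by simp
qed

abbreviation VBP :: "('k, 'v) module \<Rightarrow> ('k, (('v, 'p) tens, 'p) tens) module"
  where "VBP V \<equiv> tensB (V \<otimes>\<^sub>K P) (actR V) P (monoid.mult P)"

lemma VBP_balanced [simp]:
  "module K V \<Longrightarrow> v \<in> carrier V \<Longrightarrow> q \<in> carrier P \<Longrightarrow> b \<in> Bc \<Longrightarrow> r \<in> carrier P \<Longrightarrow>
    (v \<boxtimes>\<^bsub>V \<otimes>\<^sub>K P\<^esub> (q \<otimes>\<^bsub>P\<^esub> b)) \<boxtimes>\<^bsub>VBP V\<^esub> r = (v \<boxtimes>\<^bsub>V \<otimes>\<^sub>K P\<^esub> q) \<boxtimes>\<^bsub>VBP V\<^esub> (b \<otimes>\<^bsub>P\<^esub> r)"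
  using tensB_balanced[OF rmodB_actR lmodB_P, of V "v \<boxtimes>\<^bsub>V \<otimes>\<^sub>K P\<^esub> q" b r] by simp

lemma lin_swu_VBP [simp]:
  assumes "module K V" "module K A" "linear_map K X (VBP V) F" "bilB (V \<otimes>\<^sub>K P) (actR V) P (monoid.mult P) A f"
  shows "linear_map K X A (\<lambda>x. sw (V \<otimes>\<^sub>K P) P A (F x) f)"
  using assms(2-) by (rule lin_swu_tensB[OF rmodB_actR[OF assms(1)] lmodB_P])

text \<open>
  The canonical map with a spectator \<open>V\<close>: \<open>(v \<otimes> q) \<otimes> r \<mapsto> v \<otimes> q r\<^sub>0 \<otimes> r\<^sub>1\<close>.
\<close>

definition canV :: "('k, 'v) module \<Rightarrow> (('v, 'p) tens, 'p) tens \<Rightarrow> ('v, ('p, 'h) tens) tens"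
  where "canV V w = sw (V \<otimes>\<^sub>K P) P (V \<otimes>\<^sub>K P \<otimes>\<^sub>K H) w (\<lambda>x r. sw V P (V \<otimes>\<^sub>K P \<otimes>\<^sub>K H) x (\<lambda>v q.
    sw P H (V \<otimes>\<^sub>K P \<otimes>\<^sub>K H) (\<rho> r) (\<lambda>a b. v \<boxtimes>\<^bsub>V \<otimes>\<^sub>K P \<otimes>\<^sub>K H\<^esub> ((q \<otimes>\<^bsub>P\<^esub> a) \<boxtimes>\<^bsub>PH\<^esub> b))))"

definition canVinv :: "('k, 'v) module \<Rightarrow> ('v, ('p, 'h) tens) tens \<Rightarrow> (('v, 'p) tens, 'p) tens"
  where "canVinv V z = sw V PH (VBP V) z (\<lambda>v y. sw P P (VBP V) (caninv y)
    (\<lambda>q r. (v \<boxtimes>\<^bsub>V \<otimes>\<^sub>K P\<^esub> q) \<boxtimes>\<^bsub>VBP V\<^esub> r))"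

lemma canV_bal:
  assumes "module K V"
  shows "bilB (V \<otimes>\<^sub>K P) (actR V) P (monoid.mult P) (V \<otimes>\<^sub>K P \<otimes>\<^sub>K H) (\<lambda>x r. sw V P (V \<otimes>\<^sub>K P \<otimes>\<^sub>K H) x (\<lambda>v q.
    sw P H (V \<otimes>\<^sub>K P \<otimes>\<^sub>K H) (\<rho> r) (\<lambda>a b. v \<boxtimes>\<^bsub>V \<otimes>\<^sub>K P \<otimes>\<^sub>K H\<^esub> ((q \<otimes>\<^bsub>P\<^esub> a) \<boxtimes>\<^bsub>PH\<^esub> b))))"
  using assms by (simp add: actR_def sw_pull sw_coact_coinv_left)

lemma lin_canV0 [simp]: "module K V \<Longrightarrow> linear_map K (VBP V) (V \<otimes>\<^sub>K P \<otimes>\<^sub>K H) (canV V)"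
  unfolding canV_def by (rule lin_sw_tensB[OF rmodB_actR lmodB_P _ canV_bal]) simp_all

lemma canV_pure [simp]:
  "module K V \<Longrightarrow> x \<in> carrier (V \<otimes>\<^sub>K P) \<Longrightarrow> r \<in> carrier P \<Longrightarrow>
    canV V (x \<boxtimes>\<^bsub>VBP V\<^esub> r) = sw V P (V \<otimes>\<^sub>K P \<otimes>\<^sub>K H) x (\<lambda>v q.
    sw P H (V \<otimes>\<^sub>K P \<otimes>\<^sub>K H) (\<rho> r) (\<lambda>a b. v \<boxtimes>\<^bsub>V \<otimes>\<^sub>K P \<otimes>\<^sub>K H\<^esub> ((q \<otimes>\<^bsub>P\<^esub> a) \<boxtimes>\<^bsub>PH\<^esub> b)))"
  unfolding canV_def by (rule sw_tensB_pure[OF rmodB_actR lmodB_P _ _ _ canV_bal]) simp_all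

lemma lin_canV [simp]:
  "module K V \<Longrightarrow> linear_map K X (VBP V) F \<Longrightarrow> linear_map K X (V \<otimes>\<^sub>K P \<otimes>\<^sub>K H) (\<lambda>x. canV V (F x))"
  by (rule linear_map_comp[OF _ lin_canV0])

lemma lin_canVinv [simp]:
  "module K V \<Longrightarrow> linear_map K X (V \<otimes>\<^sub>K P \<otimes>\<^sub>K H) F \<Longrightarrow> linear_map K X (VBP V) (\<lambda>x. canVinv V (F x))"
  unfolding canVinv_def by simp

lemma lin_canVinv0 [simp]:
  "module K V \<Longrightarrow> linear_map K (V \<otimes>\<^sub>K P \<otimes>\<^sub>K H) (VBP V) (canVinv V)"
  using lin_canVinv[of V _ "\<lambda>x. x"] by simp

lemma canVinv_pure [simp]:
  "module K V \<Longrightarrow> v \<in> carrier V \<Longrightarrow> y \<in> carrier PH \<Longrightarrow>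
    canVinv V (v \<boxtimes>\<^bsub>V \<otimes>\<^sub>K P \<otimes>\<^sub>K H\<^esub> y) = sw P P (VBP V) (caninv y) (\<lambda>q r. (v \<boxtimes>\<^bsub>V \<otimes>\<^sub>K P\<^esub> q) \<boxtimes>\<^bsub>VBP V\<^esub> r)"
  unfolding canVinv_def by simp

lemma canVinv_canV [simp]:
  assumes V: "module K V" and w: "w \<in> carrier (VBP V)"
  shows "canVinv V (canV V w) = w"
proof (rule tensB_eqI[where A = "VBP V", OF rmodB_actR[OF V] lmodB_P _ _ w])
  fix x r assume x: "x \<in> carrier (V \<otimes>\<^sub>K P)" and r: "r \<in> carrier P"
  have "canVinv V (canV V (x \<boxtimes>\<^bsub>VBP V\<^esub> r)) = x \<boxtimes>\<^bsub>VBP V\<^esub> r"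
  proof (rule tensor_eqI[where A = "VBP V", OF _ _ x V module_P])
    fix v q assume v: "v \<in> carrier V" and q: "q \<in> carrier P"
    have "canV V ((v \<boxtimes>\<^bsub>V \<otimes>\<^sub>K P\<^esub> q) \<boxtimes>\<^bsub>VBP V\<^esub> r) = v \<boxtimes>\<^bsub>V \<otimes>\<^sub>K P \<otimes>\<^sub>K H\<^esub> can (q \<boxtimes>\<^bsub>PBP\<^esub> r)"
      using V v q r by (simp add: sw_pull)
    then show "canVinv V (canV V ((v \<boxtimes>\<^bsub>V \<otimes>\<^sub>K P\<^esub> q) \<boxtimes>\<^bsub>VBP V\<^esub> r)) = (v \<boxtimes>\<^bsub>V \<otimes>\<^sub>K P\<^esub> q) \<boxtimes>\<^bsub>VBP V\<^esub> r"
      using V v q r linear_mapD(1)[OF lin_can0, of "q \<boxtimes>\<^bsub>PBP\<^esub> r"]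
      by (simp del: can_pure)
  qed (use V r in simp_all)
  then show "canVinv V (canV V (x \<boxtimes>\<^bsub>VBP V\<^esub> r)) = x \<boxtimes>\<^bsub>VBP V\<^esub> r" .
qed (use V in simp_all)

lemma canV_canVinv [simp]:
  assumes V: "module K V" and z: "z \<in> carrier (V \<otimes>\<^sub>K P \<otimes>\<^sub>K H)"
  shows "canV V (canVinv V z) = z"
proof (rule tensor_eqI[where A = "V \<otimes>\<^sub>K P \<otimes>\<^sub>K H", OF _ _ z V])
  fix v y assume v: "v \<in> carrier V" and y: "y \<in> carrier PH"
  have "canV V (sw P P (VBP V) t (\<lambda>q r. (v \<boxtimes>\<^bsub>V \<otimes>\<^sub>K P\<^esub> q) \<boxtimes>\<^bsub>VBP V\<^esub> r)) = v \<boxtimes>\<^bsub>V \<otimes>\<^sub>K P \<otimes>\<^sub>K H\<^esub> can t"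
    if "t \<in> carrier PBP" for t
    by (rule tensB_eqI[where A = "V \<otimes>\<^sub>K P \<otimes>\<^sub>K H", OF rmodB_P lmodB_P _ _ that]) (use V v in \<open>simp_all add: sw_pull\<close>)
  then show "canV V (canVinv V (v \<boxtimes>\<^bsub>V \<otimes>\<^sub>K P \<otimes>\<^sub>K H\<^esub> y)) = v \<boxtimes>\<^bsub>V \<otimes>\<^sub>K P \<otimes>\<^sub>K H\<^esub> y"
    using V v y by simp
qed (use V in simp_all)

section \<open>The Ehresmann-Schauenburg module\<close>

definition L :: "('k, ('p, 'p) tens) module" where "L = es_total K H P \<rho>"

definition codiag :: "('p, 'p) tens \<Rightarrow> ('p, ('p, 'h) tens) tens"
  where "codiag x = sw P P PPH x (\<lambda>p q. sw P H PPH (\<rho> p) (\<lambda>a b.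
    sw P H PPH (\<rho> q) (\<lambda>c d. a \<boxtimes>\<^bsub>PPH\<^esub> (c \<boxtimes>\<^bsub>PH\<^esub> (b \<otimes>\<^bsub>H\<^esub> d)))))"

definition cotriv :: "('p, 'p) tens \<Rightarrow> ('p, ('p, 'h) tens) tens"
  where "cotriv x = sw P P PPH x (\<lambda>p q. p \<boxtimes>\<^bsub>PPH\<^esub> (q \<boxtimes>\<^bsub>PH\<^esub> \<one>\<^bsub>H\<^esub>))"

lemma lin_codiag [simp]: "linear_map K X PP F \<Longrightarrow> linear_map K X PPH (\<lambda>x. codiag (F x))"
  by (simp add: codiag_def)

lemma lin_cotriv [simp]: "linear_map K X PP F \<Longrightarrow> linear_map K X PPH (\<lambda>x. cotriv (F x))"
  by (simp add: cotriv_def)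

lemma codiag_closed [simp]: "codiag x \<in> carrier PPH"
  and cotriv_closed [simp]: "cotriv x \<in> carrier PPH"
  by (simp_all add: codiag_def cotriv_def)

lemma codiag_pure: "p \<in> carrier P \<Longrightarrow> q \<in> carrier P \<Longrightarrow>
    codiag (p \<boxtimes>\<^bsub>PP\<^esub> q) = sw P H PPH (\<rho> p) (\<lambda>a b.
    sw P H PPH (\<rho> q) (\<lambda>c d. a \<boxtimes>\<^bsub>PPH\<^esub> (c \<boxtimes>\<^bsub>PH\<^esub> (b \<otimes>\<^bsub>H\<^esub> d))))"
  and cotriv_pure: "p \<in> carrier P \<Longrightarrow> q \<in> carrier P \<Longrightarrow>
    cotriv (p \<boxtimes>\<^bsub>PP\<^esub> q) = p \<boxtimes>\<^bsub>PPH\<^esub> (q \<boxtimes>\<^bsub>PH\<^esub> \<one>\<^bsub>H\<^esub>)"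
  by (simp_all add: codiag_def cotriv_def)

lemma sweedler_PP:
  "x \<in> carrier PP \<Longrightarrow> abelian_group A \<Longrightarrow> (\<And>a b. a \<in> carrier P \<Longrightarrow> b \<in> carrier P \<Longrightarrow> f a b \<in> carrier A) \<Longrightarrow>
    sweedler A x f = sw P P A x f"
  by (rule sweedler_sw) simp_all

lemma L_iff: "x \<in> carrier L \<longleftrightarrow> x \<in> carrier PP \<and> codiag x = cotriv x"
  by (auto simp: L_def es_total_def es_ambient_def Let_def codiag_def cotriv_def sweedler_PP sweedler_\<rho>)

lemma L_simps [simp]: "add L = add PP" "\<zero>\<^bsub>L\<^esub> = \<zero>\<^bsub>PP\<^esub>" "smult L = smult PP"
  by (simp_all add: L_def es_total_def es_ambient_def Let_def)

lemma L_carrier [simp]: "x \<in> carrier L \<Longrightarrow> x \<in> carrier PP"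
  by (simp add: L_iff)

lemma L_closed:
  shows "x \<in> carrier L \<Longrightarrow> y \<in> carrier L \<Longrightarrow> x \<oplus>\<^bsub>PP\<^esub> y \<in> carrier L"
    and "c \<in> carrier K \<Longrightarrow> x \<in> carrier L \<Longrightarrow> c \<odot>\<^bsub>PP\<^esub> x \<in> carrier L"
  using linear_mapD[OF lin_codiag[OF lin_id]] linear_mapD[OF lin_cotriv[OF lin_id]]
  by (simp_all add: L_iff)

lemma module_L [simp]: "module K L"
proof -
  interpret PP: module K "PP" by simp
  \<comment> \<open>\<open>L\<close> has negatives because it is closed under scalars: the negative
    of \<open>x\<close> is a scalar multiple of \<open>x\<close>.\<close>
  have "(\<ominus>\<^bsub>K\<^esub> \<one>\<^bsub>K\<^esub>) \<odot>\<^bsub>PP\<^esub> x \<oplus>\<^bsub>PP\<^esub> x = \<zero>\<^bsub>PP\<^esub>" if "x \<in> carrier PP" for x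
    using that by (metis K.a_inv_closed K.one_closed PP.smult_l_minus PP.smult_one PP.l_neg)
  moreover have z: "\<zero>\<^bsub>PP\<^esub> \<in> carrier L"
    using linear_map_hom[OF lin_codiag[OF lin_id]] linear_map_hom[OF lin_cotriv[OF lin_id]]
    by (simp add: L_iff hom_add_zero[of _ "PPH" codiag] hom_add_zero[of _ "PPH" cotriv])
  ultimately have "\<exists>y\<in>carrier L. y \<oplus>\<^bsub>PP\<^esub> x = \<zero>\<^bsub>PP\<^esub>"
    if "x \<in> carrier L" for x
    using that by (auto intro!: bexI[of _ "(\<ominus>\<^bsub>K\<^esub> \<one>\<^bsub>K\<^esub>) \<odot>\<^bsub>PP\<^esub> x"] simp: L_closed)
  moreover note z
  ultimately have "abelian_group L"
    by (intro abelian_groupI) (auto simp: L_closed PP.a_ac)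
  then show ?thesis
    by (intro moduleI) (auto simp: K.is_cring L_closed PP.smult_l_distr PP.smult_r_distr)
qed

lemma lin_from_L [simp]: "linear_map K L PP (\<lambda>x. x)"
  by (rule linear_mapI) simp_all

text \<open>The defining equation of \<open>L\<close> as a rewriting rule: adjacent
  \<open>H\<close>-legs of the two factors of \<open>x\<close> may be deleted. It is also read
  backwards, to create such legs.\<close>

lemma sw_coinv:
  assumes x: "x \<in> carrier L" and A: "module K A" and f: "trilinear P P H A f"
  shows "sw P P A x (\<lambda>p q. sw P H A (\<rho> p) (\<lambda>a b. sw P H A (\<rho> q) (\<lambda>c d. f a c (b \<otimes>\<^bsub>H\<^esub> d)))) =
    sw P P A x (\<lambda>p q. f p q \<one>\<^bsub>H\<^esub>)"
proof -
  note [simp] = A trilinearD[OF f]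
  have [simp]: "linear_map K X A (\<lambda>v. f p q (F v))" if "linear_map K X H F" "p \<in> carrier P" "q \<in> carrier P"
    for X :: "('k, 'x) module" and F p q
    using that by (intro linear_map_comp[of K X H F A "f p q"]) simp_all
  let ?G = "\<lambda>u. sw P PH A u (\<lambda>p y. sw P H A y (\<lambda>q h. f p q h))"
  have "?G (codiag x) = ?G (cotriv x)" using x by (simp add: L_iff)
  then show ?thesis using x by (simp add: codiag_def cotriv_def sw_pull)
qed

lemma actR_L [simp]:
  assumes x: "x \<in> carrier L" and b: "b \<in> Bc"
  shows "actR P x b \<in> carrier L"
proof -
  \<comment> \<open>\<open>?g\<close> multiplies the middle factor by \<open>b\<close>. Both
    \<open>codiag\<close> and \<open>cotriv\<close> intertwine it with \<open>actR\<close>, so it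
    carries the equation for \<open>x\<close> to the equation for \<open>actR P x b\<close>.\<close>
  let ?g = "\<lambda>z. sw P PH PPH z (\<lambda>p y. sw P H PPH y (\<lambda>q h.
    p \<boxtimes>\<^bsub>PPH\<^esub> ((q \<otimes>\<^bsub>P\<^esub> b) \<boxtimes>\<^bsub>PH\<^esub> h)))"
  have xP: "x \<in> carrier PP" using x by simp
  have "codiag (actR P x b) = ?g (codiag x)"
    by (rule tensor_eqI[where A = "PPH", OF _ _ xP])
      (use b in \<open>simp_all add: codiag_pure sw_pull sw_coact_coinv(1)\<close>)
  moreover have "cotriv (actR P x b) = ?g (cotriv x)"
    by (rule tensor_eqI[where A = "PPH", OF _ _ xP])
      (use b in \<open>simp_all add: cotriv_pure sw_pull\<close>)
  ultimately show ?thesis using x b by (simp add: L_iff)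
qed

lemma actL_L [simp]:
  assumes x: "x \<in> carrier L" and b: "b \<in> Bc"
  shows "actL b x \<in> carrier L"
proof -
  let ?g = "\<lambda>z. sw P PH PPH z (\<lambda>p y. (b \<otimes>\<^bsub>P\<^esub> p) \<boxtimes>\<^bsub>PPH\<^esub> y)"
  have xP: "x \<in> carrier PP" using x by simp
  have "codiag (actL b x) = ?g (codiag x)"
    by (rule tensor_eqI[where A = "PPH", OF _ _ xP])
      (use b in \<open>simp_all add: codiag_pure sw_pull sw_coact_coinv(2)\<close>)
  moreover have "cotriv (actL b x) = ?g (cotriv x)"
    by (rule tensor_eqI[where A = "PPH", OF _ _ xP])
      (use b in \<open>simp_all add: cotriv_pure sw_pull\<close>)
  ultimately show ?thesis using x b by (simp add: L_iff)
qed

lemma linear_map_LL: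
  "linear_map K PP PP F \<Longrightarrow> (\<And>x. x \<in> carrier L \<Longrightarrow> F x \<in> carrier L) \<Longrightarrow> linear_map K L L F"
  by (auto simp: linear_map_def)

lemma rmodB_L [simp]: "rmodB L (actR P)"
  using rmodB_actR[OF module_P] by (simp add: rmodB_def linear_map_LL)

lemma lmodB_L [simp]: "lmodB L actL"
  using lmodB_actL by (simp add: lmodB_def linear_map_LL)

section \<open>Multiplication from \<open>L \<otimes>\<^sub>B P\<close> to
  \<open>P \<otimes> P\<close>\<close>

abbreviation LBP :: "('k, (('p, 'p) tens, 'p) tens) module"
  where "LBP \<equiv> tensB L (actR P) P (monoid.mult P)"

lemmas lin_swu_LBP [simp] = lin_swu_tensB[OF rmodB_L lmodB_P]

definition inclLBP :: "(('p, 'p) tens, 'p) tens \<Rightarrow> (('p, 'p) tens, 'p) tens"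
  where "inclLBP w = sw L P (VBP P) w (\<lambda>x r. x \<boxtimes>\<^bsub>VBP P\<^esub> r)"

text \<open>Its bijectivity, shown later with faithful flatness, says that \<open>L\<close> becomes
  \<open>P \<otimes> P\<close> after tensoring with \<open>P\<close>; this is the source of the
  inverses constructed for \<open>mu\<close>.\<close>

definition multL :: "(('p, 'p) tens, 'p) tens \<Rightarrow> ('p, 'p) tens"
  where "multL w = sw L P PP w (\<lambda>x r. actR P x r)"

lemma lin_actR2 [simp]:
  "module K V \<Longrightarrow> linear_map K X P F \<Longrightarrow> linear_map K X (V \<otimes>\<^sub>K P) (\<lambda>b. actR V x (F b))"
  by (simp add: actR_def)

lemma lin_actR2' [simp]: "module K V \<Longrightarrow> linear_map K P (V \<otimes>\<^sub>K P) (actR V x)"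
  using lin_actR2[of V P "\<lambda>x. x"] by simp

lemma actR_actR [simp]:
  assumes V: "module K V" and x: "x \<in> carrier (V \<otimes>\<^sub>K P)" and "a \<in> carrier P" "b \<in> carrier P"
  shows "actR V (actR V x a) b = actR V x (a \<otimes>\<^bsub>P\<^esub> b)"
  by (rule tensor_eqI[where A = "V \<otimes>\<^sub>K P", OF _ _ x V module_P]) (use assms in simp_all)

lemma actR_one [simp]:
  assumes V: "module K V" and x: "x \<in> carrier (V \<otimes>\<^sub>K P)"
  shows "actR V x \<one>\<^bsub>P\<^esub> = x"
  by (rule tensor_eqI[where A = "V \<otimes>\<^sub>K P", OF _ _ x V module_P]) (use assms in simp_all)

lemma VBP_balanced': "module K V \<Longrightarrow> x \<in> carrier (V \<otimes>\<^sub>K P) \<Longrightarrow> b \<in> Bc \<Longrightarrow> r \<in> carrier P \<Longrightarrow>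
    actR V x b \<boxtimes>\<^bsub>VBP V\<^esub> r = x \<boxtimes>\<^bsub>VBP V\<^esub> (b \<otimes>\<^bsub>P\<^esub> r)"
  by (rule tensB_balanced) simp_all

lemma lin_inclLBP [simp]: "linear_map K X LBP F \<Longrightarrow> linear_map K X (VBP P) (\<lambda>x. inclLBP (F x))"
  by (simp add: inclLBP_def VBP_balanced')

lemma lin_multL [simp]: "linear_map K X LBP F \<Longrightarrow> linear_map K X PP (\<lambda>x. multL (F x))"
  by (simp add: multL_def)

lemma inclLBP_pure [simp]: "x \<in> carrier L \<Longrightarrow> r \<in> carrier P \<Longrightarrow> inclLBP (x \<boxtimes>\<^bsub>LBP\<^esub> r) = x \<boxtimes>\<^bsub>VBP P\<^esub> r"
  by (simp add: inclLBP_def VBP_balanced')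

lemma multL_pure [simp]: "x \<in> carrier L \<Longrightarrow> r \<in> carrier P \<Longrightarrow> multL (x \<boxtimes>\<^bsub>LBP\<^esub> r) = actR P x r"
  by (simp add: multL_def)

text \<open>For \<open>x = p \<otimes> q\<close> in \<open>L\<close>, the diagonal coaction of
  \<open>p \<otimes> q r\<close> has \<open>H\<close>-leg
  \<open>p\<^sub>1 q\<^sub>1 r\<^sub>1\<close>, and coinvariance deletes
  \<open>p\<^sub>1 q\<^sub>1\<close>. What remains is \<open>canV\<close> of
  \<open>x \<otimes> r\<close>. Since \<open>canV\<close> is bijective and \<open>codiag\<close>
  injective, questions about \<open>multL\<close> turn into questions about
  \<open>inclLBP\<close>.\<close>

lemma canV_inclLBP:
  assumes w: "w \<in> carrier LBP"
  shows "canV P (inclLBP w) = codiag (multL w)"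
proof (rule tensB_eqI[where A = "PPH", OF rmodB_L lmodB_P _ _ w])
  fix x r assume x: "x \<in> carrier L" and r [simp]: "r \<in> carrier P"
  have "codiag (actR P x r) = sw P P PPH x (\<lambda>p q. codiag (p \<boxtimes>\<^bsub>PP\<^esub> (q \<otimes>\<^bsub>P\<^esub> r)))"
    unfolding actR_def by (rule sw_linear) simp_all
  also have "\<dots> = sw P P PPH x (\<lambda>p q. sw P H PPH (\<rho> p) (\<lambda>a b. sw P H PPH (\<rho> q) (\<lambda>c d.
      sw P H PPH (\<rho> r) (\<lambda>e f. a \<boxtimes>\<^bsub>PPH\<^esub> ((c \<otimes>\<^bsub>P\<^esub> e) \<boxtimes>\<^bsub>PH\<^esub> ((b \<otimes>\<^bsub>H\<^esub> d) \<otimes>\<^bsub>H\<^esub> f))))))"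
    by (simp add: codiag_pure sw_coact_mult)
  also have "\<dots> = sw P P PPH x (\<lambda>p q.
      sw P H PPH (\<rho> r) (\<lambda>e f. p \<boxtimes>\<^bsub>PPH\<^esub> ((q \<otimes>\<^bsub>P\<^esub> e) \<boxtimes>\<^bsub>PH\<^esub> (\<one>\<^bsub>H\<^esub> \<otimes>\<^bsub>H\<^esub> f))))"
    by (rule sw_coinv[OF x]) (simp_all add: trilinear_def)
  finally show "canV P (inclLBP (x \<boxtimes>\<^bsub>LBP\<^esub> r)) = codiag (multL (x \<boxtimes>\<^bsub>LBP\<^esub> r))"
    using x by simp
qed simp_all

text \<open>The counit applied to the \<open>H\<close>-factor is a left inverse.\<close>

lemma codiag_inj:
  assumes "x \<in> carrier PP" "y \<in> carrier PP" "codiag x = codiag y"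
  shows "x = y"
proof -
  let ?e = "\<lambda>u. sw P PH PP u (\<lambda>p y. sw P H PP y (\<lambda>q h. \<epsilon> h \<odot>\<^bsub>PP\<^esub> (p \<boxtimes>\<^bsub>PP\<^esub> q)))"
  have "?e (codiag x) = x" if x: "x \<in> carrier PP" for x
  proof (rule tensor_eqI[where A = "PP", OF _ _ x])
    fix p q assume pq [simp]: "p \<in> carrier P" "q \<in> carrier P"
    have "?e (codiag (p \<boxtimes>\<^bsub>PP\<^esub> q)) =
        sw P H PP (\<rho> p) (\<lambda>a b. sw P H PP (\<rho> q) (\<lambda>c d. \<epsilon> d \<odot>\<^bsub>PP\<^esub> (\<epsilon> b \<odot>\<^bsub>PP\<^esub> (a \<boxtimes>\<^bsub>PP\<^esub> c))))"
      using hopf_algebra.counit_mult[OF hopf_algebra] by (simp add: codiag_pure sw_pull K.m_comm)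
    also have "\<dots> = sw P H PP (\<rho> p) (\<lambda>a b. \<epsilon> b \<odot>\<^bsub>PP\<^esub> (a \<boxtimes>\<^bsub>PP\<^esub> q))"
      by (intro sw_cong refl, subst sw_coact_counit) simp_all
    also have "\<dots> = p \<boxtimes>\<^bsub>PP\<^esub> q"
      by (subst sw_coact_counit) simp_all
    finally show "?e (codiag (p \<boxtimes>\<^bsub>PP\<^esub> q)) = p \<boxtimes>\<^bsub>PP\<^esub> q" .
  qed simp_all
  then show ?thesis using assms by metis
qed

text \<open>The functor of tensoring with \<open>P\<close> over the coinvariants, on maps, in the
  form in which \<open>faithfully_flat\<close> writes it.\<close>

definition mapB ::
  "('k, 'm) module \<Rightarrow> ('k, 'n) module \<Rightarrow> ('n \<Rightarrow> 'p \<Rightarrow> 'n) \<Rightarrow> ('m \<Rightarrow> 'n) \<Rightarrow> ('m, 'p) tens \<Rightarrow> ('n, 'p) tens"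
  where "mapB M N act f w = sw M P (tensB N act P (monoid.mult P)) w (\<lambda>m p. f m \<boxtimes>\<^bsub>tensB N act P (monoid.mult P)\<^esub> p)"

definition multV :: "('k, 'v) module \<Rightarrow> (('v, 'p) tens, 'p) tens \<Rightarrow> ('v, 'p) tens"
  where "multV V w = sw (V \<otimes>\<^sub>K P) P (V \<otimes>\<^sub>K P) w (\<lambda>x r. actR V x r)"

text \<open>
  \<open>codiag\<close> and \<open>cotriv\<close> with \<open>H\<close> moved to the middle.  Unlike \<open>codiag\<close>, \<open>diag2\<close> is right \<open>B\<close>-linear for
  the action on the last factor, so that \<open>L\<close> is an equalizer of right \<open>B\<close>-linear maps into some \<open>V \<otimes> P\<close>, to
  which \<open>canV\<close> applies after tensoring with \<open>P\<close>.
\<close>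

definition diag2 :: "('p, 'p) tens \<Rightarrow> (('p, 'h) tens, 'p) tens"
  where "diag2 x = sw P P (PH \<otimes>\<^sub>K P) x (\<lambda>p q. sw P H (PH \<otimes>\<^sub>K P) (\<rho> p) (\<lambda>a b.
    sw P H (PH \<otimes>\<^sub>K P) (\<rho> q) (\<lambda>c d. (a \<boxtimes>\<^bsub>PH\<^esub> (b \<otimes>\<^bsub>H\<^esub> d)) \<boxtimes>\<^bsub>PH \<otimes>\<^sub>K P\<^esub> c)))"

definition triv2 :: "('p, 'p) tens \<Rightarrow> (('p, 'h) tens, 'p) tens"
  where "triv2 x = sw P P (PH \<otimes>\<^sub>K P) x (\<lambda>p q. (p \<boxtimes>\<^bsub>PH\<^esub> \<one>\<^bsub>H\<^esub>) \<boxtimes>\<^bsub>PH \<otimes>\<^sub>K P\<^esub> q)"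

lemma lin_diag2 [simp]: "linear_map K X PP F \<Longrightarrow> linear_map K X (PH \<otimes>\<^sub>K P) (\<lambda>x. diag2 (F x))"
  and lin_triv2 [simp]: "linear_map K X PP F \<Longrightarrow> linear_map K X (PH \<otimes>\<^sub>K P) (\<lambda>x. triv2 (F x))"
  by (simp_all add: diag2_def triv2_def)

lemma diag_triv2_closed [simp]: "diag2 x \<in> carrier (PH \<otimes>\<^sub>K P)" "triv2 x \<in> carrier (PH \<otimes>\<^sub>K P)"
  by (simp_all add: diag2_def triv2_def)

lemma lin_diag2' [simp]: "linear_map K PP (PH \<otimes>\<^sub>K P) diag2"
  and lin_triv2' [simp]: "linear_map K PP (PH \<otimes>\<^sub>K P) triv2"
  using lin_diag2[OF lin_id] lin_triv2[OF lin_id] by simp_all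

lemma diag_triv2_pure: "p \<in> carrier P \<Longrightarrow> q \<in> carrier P \<Longrightarrow>
    diag2 (p \<boxtimes>\<^bsub>PP\<^esub> q) = sw P H (PH \<otimes>\<^sub>K P) (\<rho> p) (\<lambda>a b.
    sw P H (PH \<otimes>\<^sub>K P) (\<rho> q) (\<lambda>c d. (a \<boxtimes>\<^bsub>PH\<^esub> (b \<otimes>\<^bsub>H\<^esub> d)) \<boxtimes>\<^bsub>PH \<otimes>\<^sub>K P\<^esub> c))"
  "p \<in> carrier P \<Longrightarrow> q \<in> carrier P \<Longrightarrow>
    triv2 (p \<boxtimes>\<^bsub>PP\<^esub> q) = (p \<boxtimes>\<^bsub>PH\<^esub> \<one>\<^bsub>H\<^esub>) \<boxtimes>\<^bsub>PH \<otimes>\<^sub>K P\<^esub> q"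
  by (simp_all add: diag2_def triv2_def)

lemma L_iff_diag_triv2: "x \<in> carrier L \<longleftrightarrow> x \<in> carrier PP \<and> diag2 x = triv2 x"
proof -
  \<comment> \<open>\<open>?r\<close> and \<open>?s\<close> only permute tensor factors, so they
    exchange the two forms of the defining equation of \<open>L\<close>.\<close>
  let ?r = "\<lambda>z. sw P PH (PH \<otimes>\<^sub>K P) z (\<lambda>p y. sw P H (PH \<otimes>\<^sub>K P) y (\<lambda>q h.
    (p \<boxtimes>\<^bsub>PH\<^esub> h) \<boxtimes>\<^bsub>PH \<otimes>\<^sub>K P\<^esub> q))"
  let ?s = "\<lambda>z. sw PH P PPH z (\<lambda>y q. sw P H PPH y (\<lambda>p h.
    p \<boxtimes>\<^bsub>PPH\<^esub> (q \<boxtimes>\<^bsub>PH\<^esub> h)))"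
  have "?r (codiag x) = diag2 x" "?r (cotriv x) = triv2 x" "?s (diag2 x) = codiag x" "?s (triv2 x) = cotriv x"
    by (simp_all add: codiag_def cotriv_def diag2_def triv2_def sw_pull)
  then show ?thesis unfolding L_iff by metis
qed

lemma actR_diag_triv2:
  assumes x: "x \<in> carrier PP" and b: "b \<in> Bc"
  shows "diag2 (actR P x b) = actR PH (diag2 x) b" "triv2 (actR P x b) = actR PH (triv2 x) b"
proof -
  note [simp] = b Bc_carrier[OF b]
  have "actR PH (sw M N (PH \<otimes>\<^sub>K P) u f) b = sw M N (PH \<otimes>\<^sub>K P) u (\<lambda>m n. actR PH (f m n) b)"
    if "\<And>m n. m \<in> carrier M \<Longrightarrow> n \<in> carrier N \<Longrightarrow> f m n \<in> carrier (PH \<otimes>\<^sub>K P)"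
    for M :: "('k, 'x) module" and N :: "('k, 'y) module" and u f
    by (rule sw_linear) (simp_all add: that)
  note this [simp]
  show "diag2 (actR P x b) = actR PH (diag2 x) b"
    by (rule tensor_eqI[where A = "PH \<otimes>\<^sub>K P", OF _ _ x]) (simp_all add: diag_triv2_pure sw_coact_coinv(1))
  show "triv2 (actR P x b) = actR PH (triv2 x) b"
    by (rule tensor_eqI[where A = "PH \<otimes>\<^sub>K P", OF _ _ x]) (simp_all add: diag_triv2_pure)
qed

text \<open>The \<open>H\<close>-leg \<open>d\<close> and the first leg of \<open>f\<close> are
  consecutive in the iterated coaction of \<open>r\<close>. Coassociativity brings them into one
  coproduct, where the antipode cancels them.\<close>

lemma sw_coact_antip:
  assumes r: "r \<in> carrier P" and A: "module K A" and F: "trilinear P H H A F"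
  shows "sw P H A (\<rho> r) (\<lambda>e f. sw P H A (\<rho> e) (\<lambda>c d. sw H H A (\<Delta> f) (\<lambda>x y. F c (d \<otimes>\<^bsub>H\<^esub> antip x) y))) =
    sw P H A (\<rho> r) (\<lambda>e f. F e \<one>\<^bsub>H\<^esub> f)"
proof -
  note [simp] = A r trilinearD[OF F] trilinear_def
  have [simp]: "linear_map K X A (\<lambda>v. F p (G v) q)" if "linear_map K X H G" "p \<in> carrier P" "q \<in> carrier H"
    for X :: "('k, 'x) module" and G p q
    using that by (intro linear_map_comp[of K X H G A "\<lambda>v. F p v q"]) simp_all
  have "sw P H A (\<rho> r) (\<lambda>e f. sw P H A (\<rho> e) (\<lambda>c d. sw H H A (\<Delta> f) (\<lambda>x y. F c (d \<otimes>\<^bsub>H\<^esub> antip x) y))) =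
      sw P H A (\<rho> r) (\<lambda>c f. sw H H A (\<Delta> f) (\<lambda>d f. sw H H A (\<Delta> f) (\<lambda>x y. F c (d \<otimes>\<^bsub>H\<^esub> antip x) y)))"
    by (rule sw_coact_coassoc[symmetric]) simp_all
  also have "\<dots> = sw P H A (\<rho> r) (\<lambda>c f. sw H H A (\<Delta> f) (\<lambda>z y. sw H H A (\<Delta> z) (\<lambda>d x. F c (d \<otimes>\<^bsub>H\<^esub> antip x) y)))"
    by (intro sw_cong refl sw_coassoc) simp_all
  also have "\<dots> = sw P H A (\<rho> r) (\<lambda>c f. sw H H A (\<Delta> f) (\<lambda>z y. \<epsilon> z \<odot>\<^bsub>A\<^esub> F c \<one>\<^bsub>H\<^esub> y))"
    by (intro sw_cong refl sw_antip(2)) simp_all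
  also have "\<dots> = sw P H A (\<rho> r) (\<lambda>e f. F e \<one>\<^bsub>H\<^esub> f)"
    by (intro sw_cong refl sw_counit(1)) simp_all
  finally show ?thesis .
qed

abbreviation PHPH where "PHPH \<equiv> PH \<otimes>\<^sub>K P \<otimes>\<^sub>K H"

text \<open>
  What \<open>diag2\<close> and \<open>triv2\<close>, tensored with \<open>P\<close>, become after \<open>canV\<close>.  On \<open>z = p \<otimes> q r\<^sub>0 \<otimes> r\<^sub>1\<close> the coaction
  yields \<open>q\<^sub>1 r\<^sub>1\<close> where \<open>q\<^sub>1\<close> is wanted; the antipode cancels the factor \<open>r\<^sub>1\<close>.
\<close>

definition twist :: "('p, ('p, 'h) tens) tens \<Rightarrow> (('p, 'h) tens, ('p, 'h) tens) tens"
  where "twist z = sw P PH PHPH z (\<lambda>p y. sw P H PHPH y (\<lambda>q h.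
    sw P H PHPH (\<rho> p) (\<lambda>a b. sw P H PHPH (\<rho> q) (\<lambda>c d. sw H H PHPH (\<Delta> h) (\<lambda>x y.
      (a \<boxtimes>\<^bsub>PH\<^esub> (b \<otimes>\<^bsub>H\<^esub> (d \<otimes>\<^bsub>H\<^esub> antip x))) \<boxtimes>\<^bsub>PHPH\<^esub> (c \<boxtimes>\<^bsub>PH\<^esub> y))))))"

definition untwist :: "('p, ('p, 'h) tens) tens \<Rightarrow> (('p, 'h) tens, ('p, 'h) tens) tens"
  where "untwist z = sw P PH PHPH z (\<lambda>p y. (p \<boxtimes>\<^bsub>PH\<^esub> \<one>\<^bsub>H\<^esub>) \<boxtimes>\<^bsub>PHPH\<^esub> y)"

lemma lin_twist [simp]: "linear_map K X PPH F \<Longrightarrow> linear_map K X PHPH (\<lambda>x. twist (F x))"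
  and lin_untwist [simp]: "linear_map K X PPH F \<Longrightarrow> linear_map K X PHPH (\<lambda>x. untwist (F x))"
  by (simp_all add: twist_def untwist_def)

text \<open>On \<open>codiag (p \<otimes> q)\<close> the twist creates the factor
  \<open>p\<^sub>1 q\<^sub>1 (antip (p\<^sub>2 q\<^sub>2))\<close>, which collapses to a counit. The
  long part of the calculation brings the separate coactions of \<open>p\<close> and
  \<open>q\<close> into the order in which this factor is visible.\<close>

lemma twist_codiag:
  assumes z: "z \<in> carrier PP"
  shows "twist (codiag z) = untwist (codiag z)"
proof (rule tensor_eqI[where A = PHPH, OF _ _ z])
  fix p q assume pq [simp]: "p \<in> carrier P" "q \<in> carrier P"
  let ?T = "\<lambda>a x c y. (a \<boxtimes>\<^bsub>PH\<^esub> x) \<boxtimes>\<^bsub>PHPH\<^esub> (c \<boxtimes>\<^bsub>PH\<^esub> y)"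
  note [simp] = trilinear_def
  have "twist (codiag (p \<boxtimes>\<^bsub>PP\<^esub> q)) =
    sw P H PHPH (\<rho> p) (\<lambda>a b. sw P H PHPH (\<rho> q) (\<lambda>c d. sw P H PHPH (\<rho> a) (\<lambda>a0 a1. sw P H PHPH (\<rho> c) (\<lambda>c0 c1.
      sw H H PHPH (\<Delta> (b \<otimes>\<^bsub>H\<^esub> d)) (\<lambda>x y. ?T a0 (a1 \<otimes>\<^bsub>H\<^esub> (c1 \<otimes>\<^bsub>H\<^esub> antip x)) c0 y)))))"
    by (simp add: codiag_pure twist_def sw_pull)
  also have "\<dots> = sw P H PHPH (\<rho> p) (\<lambda>a b. sw P H PHPH (\<rho> a) (\<lambda>a0 a1. sw P H PHPH (\<rho> q) (\<lambda>c d. sw P H PHPH (\<rho> c) (\<lambda>c0 c1.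
      sw H H PHPH (\<Delta> (b \<otimes>\<^bsub>H\<^esub> d)) (\<lambda>x y. ?T a0 (a1 \<otimes>\<^bsub>H\<^esub> (c1 \<otimes>\<^bsub>H\<^esub> antip x)) c0 y)))))"
    by (intro sw_cong refl sw_swap) simp_all
  also have "\<dots> = sw P H PHPH (\<rho> p) (\<lambda>a b. sw P H PHPH (\<rho> a) (\<lambda>a0 a1. sw P H PHPH (\<rho> q) (\<lambda>c d. sw H H PHPH (\<Delta> d) (\<lambda>c1 d.
      sw H H PHPH (\<Delta> (b \<otimes>\<^bsub>H\<^esub> d)) (\<lambda>x y. ?T a0 (a1 \<otimes>\<^bsub>H\<^esub> (c1 \<otimes>\<^bsub>H\<^esub> antip x)) c y)))))"
    by (intro sw_cong refl sw_coact_coassoc[symmetric]) simp_all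
  also have "\<dots> = sw P H PHPH (\<rho> p) (\<lambda>a b. sw H H PHPH (\<Delta> b) (\<lambda>a1 b. sw P H PHPH (\<rho> q) (\<lambda>c d. sw H H PHPH (\<Delta> d) (\<lambda>c1 d.
      sw H H PHPH (\<Delta> (b \<otimes>\<^bsub>H\<^esub> d)) (\<lambda>x y. ?T a (a1 \<otimes>\<^bsub>H\<^esub> (c1 \<otimes>\<^bsub>H\<^esub> antip x)) c y)))))"
    by (intro sw_coact_coassoc[symmetric]) simp_all
  also have "\<dots> = sw P H PHPH (\<rho> p) (\<lambda>a b. sw P H PHPH (\<rho> q) (\<lambda>c d. sw H H PHPH (\<Delta> b) (\<lambda>a1 b. sw H H PHPH (\<Delta> d) (\<lambda>c1 d.
      sw H H PHPH (\<Delta> (b \<otimes>\<^bsub>H\<^esub> d)) (\<lambda>x y. ?T a ((a1 \<otimes>\<^bsub>H\<^esub> c1) \<otimes>\<^bsub>H\<^esub> antip x) c y)))))"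
    by (intro sw_cong refl, subst sw_swap) simp_all
  \<comment> \<open>The coproducts of \<open>b\<close> and \<open>d\<close> now stand side by side
    and recombine into the coproduct of their product, so that the antipode axiom applies once, to
    \<open>b \<otimes> d\<close> as a whole.\<close>
  also have "\<dots> = sw P H PHPH (\<rho> p) (\<lambda>a b. sw P H PHPH (\<rho> q) (\<lambda>c d. sw H H PHPH (\<Delta> (b \<otimes>\<^bsub>H\<^esub> d)) (\<lambda>u v.
      sw H H PHPH (\<Delta> v) (\<lambda>x y. ?T a (u \<otimes>\<^bsub>H\<^esub> antip x) c y))))"
    by (intro sw_cong refl sw_comult_mult[symmetric]) simp_all
  also have "\<dots> = sw P H PHPH (\<rho> p) (\<lambda>a b. sw P H PHPH (\<rho> q) (\<lambda>c d. sw H H PHPH (\<Delta> (b \<otimes>\<^bsub>H\<^esub> d)) (\<lambda>w y.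
      sw H H PHPH (\<Delta> w) (\<lambda>u x. ?T a (u \<otimes>\<^bsub>H\<^esub> antip x) c y))))"
    by (intro sw_cong refl sw_coassoc) simp_all
  also have "\<dots> = sw P H PHPH (\<rho> p) (\<lambda>a b. sw P H PHPH (\<rho> q) (\<lambda>c d. sw H H PHPH (\<Delta> (b \<otimes>\<^bsub>H\<^esub> d)) (\<lambda>w y.
      \<epsilon> w \<odot>\<^bsub>PHPH\<^esub> ?T a \<one>\<^bsub>H\<^esub> c y)))"
    by (intro sw_cong refl sw_antip(2)) simp_all
  also have "\<dots> = sw P H PHPH (\<rho> p) (\<lambda>a b. sw P H PHPH (\<rho> q) (\<lambda>c d. ?T a \<one>\<^bsub>H\<^esub> c (b \<otimes>\<^bsub>H\<^esub> d)))"
    by (intro sw_cong refl sw_counit(1)) simp_all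
  also have "\<dots> = untwist (codiag (p \<boxtimes>\<^bsub>PP\<^esub> q))"
    by (simp add: codiag_pure untwist_def sw_pull)
  finally show "twist (codiag (p \<boxtimes>\<^bsub>PP\<^esub> q)) = untwist (codiag (p \<boxtimes>\<^bsub>PP\<^esub> q))" .
qed simp_all

abbreviation tmap2 where "tmap2 \<equiv> mapB PP (PH \<otimes>\<^sub>K P) (actR PH)"

lemma canV_tmap2:
  assumes w: "w \<in> carrier (VBP P)"
  shows "canV PH (tmap2 diag2 w) = twist (canV P w)"
    and "canV PH (tmap2 triv2 w) = untwist (canV P w)"
proof -
  have lin: "linear_map K (VBP P) (VBP PH) (tmap2 diag2)" "linear_map K (VBP P) (VBP PH) (tmap2 triv2)"
    unfolding mapB_def by (rule lin_sw_tensB; simp add: VBP_balanced' actR_diag_triv2)+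
  have pure: "tmap2 diag2 (x \<boxtimes>\<^bsub>VBP P\<^esub> r) = diag2 x \<boxtimes>\<^bsub>VBP PH\<^esub> r" "tmap2 triv2 (x \<boxtimes>\<^bsub>VBP P\<^esub> r) = triv2 x \<boxtimes>\<^bsub>VBP PH\<^esub> r"
    if "x \<in> carrier PP" "r \<in> carrier P" for x r
    unfolding mapB_def using that by (simp_all add: VBP_balanced' actR_diag_triv2)
  note [simp] = linear_map_comp[OF lin(1) lin_canV0] linear_map_comp[OF lin(2) lin_canV0]
  show "canV PH (tmap2 triv2 w) = untwist (canV P w)"
  proof (rule tensB_eqI[where A = PHPH, OF rmodB_actR lmodB_P _ _ w])
    fix x r assume x: "x \<in> carrier PP" and r [simp]: "r \<in> carrier P"
    show "canV PH (tmap2 triv2 (x \<boxtimes>\<^bsub>VBP P\<^esub> r)) = untwist (canV P (x \<boxtimes>\<^bsub>VBP P\<^esub> r))"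
      using x by (simp add: pure triv2_def untwist_def sw_pull)
  qed simp_all
  show "canV PH (tmap2 diag2 w) = twist (canV P w)"
  proof (rule tensB_eqI[where A = PHPH, OF rmodB_actR lmodB_P _ _ w])
    fix x r assume x: "x \<in> carrier PP" and r [simp]: "r \<in> carrier P"
    have "canV PH (diag2 x \<boxtimes>\<^bsub>VBP PH\<^esub> r) = twist (canV P (x \<boxtimes>\<^bsub>VBP P\<^esub> r))"
    proof (rule tensor_eqI[where A = PHPH, OF _ _ x])
      fix p q assume pq [simp]: "p \<in> carrier P" "q \<in> carrier P"
      let ?T = "\<lambda>a x c y. (a \<boxtimes>\<^bsub>PH\<^esub> x) \<boxtimes>\<^bsub>PHPH\<^esub> (c \<boxtimes>\<^bsub>PH\<^esub> y)"
      have "twist (canV P ((p \<boxtimes>\<^bsub>PP\<^esub> q) \<boxtimes>\<^bsub>VBP P\<^esub> r)) =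
        sw P H PHPH (\<rho> r) (\<lambda>e f. sw P H PHPH (\<rho> p) (\<lambda>a b. sw P H PHPH (\<rho> q) (\<lambda>c d. sw P H PHPH (\<rho> e) (\<lambda>c' d'.
          sw H H PHPH (\<Delta> f) (\<lambda>x y. ?T a (b \<otimes>\<^bsub>H\<^esub> (d \<otimes>\<^bsub>H\<^esub> (d' \<otimes>\<^bsub>H\<^esub> antip x))) (c \<otimes>\<^bsub>P\<^esub> c') y)))))"
        by (simp add: twist_def sw_pull sw_coact_mult)
      also have "\<dots> = sw P H PHPH (\<rho> p) (\<lambda>a b. sw P H PHPH (\<rho> r) (\<lambda>e f. sw P H PHPH (\<rho> q) (\<lambda>c d. sw P H PHPH (\<rho> e) (\<lambda>c' d'.
          sw H H PHPH (\<Delta> f) (\<lambda>x y. ?T a (b \<otimes>\<^bsub>H\<^esub> (d \<otimes>\<^bsub>H\<^esub> (d' \<otimes>\<^bsub>H\<^esub> antip x))) (c \<otimes>\<^bsub>P\<^esub> c') y)))))"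
        by (rule sw_swap) simp_all
      also have "\<dots> = sw P H PHPH (\<rho> p) (\<lambda>a b. sw P H PHPH (\<rho> q) (\<lambda>c d. sw P H PHPH (\<rho> r) (\<lambda>e f. sw P H PHPH (\<rho> e) (\<lambda>c' d'.
          sw H H PHPH (\<Delta> f) (\<lambda>x y. ?T a (b \<otimes>\<^bsub>H\<^esub> (d \<otimes>\<^bsub>H\<^esub> (d' \<otimes>\<^bsub>H\<^esub> antip x))) (c \<otimes>\<^bsub>P\<^esub> c') y)))))"
        by (intro sw_cong refl sw_swap) simp_all
      also have "\<dots> = sw P H PHPH (\<rho> p) (\<lambda>a b. sw P H PHPH (\<rho> q) (\<lambda>c d. sw P H PHPH (\<rho> r) (\<lambda>e f.
          ?T a (b \<otimes>\<^bsub>H\<^esub> (d \<otimes>\<^bsub>H\<^esub> \<one>\<^bsub>H\<^esub>)) (c \<otimes>\<^bsub>P\<^esub> e) f)))"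
        by (intro sw_cong refl sw_coact_antip[of r PHPH "\<lambda>e x y. ?T _ (_ \<otimes>\<^bsub>H\<^esub> (_ \<otimes>\<^bsub>H\<^esub> x)) (_ \<otimes>\<^bsub>P\<^esub> e) y"])
          (simp_all add: trilinear_def)
      also have "\<dots> = canV PH (diag2 (p \<boxtimes>\<^bsub>PP\<^esub> q) \<boxtimes>\<^bsub>VBP PH\<^esub> r)"
        by (simp add: diag_triv2_pure sw_pull)
      finally show "canV PH (diag2 (p \<boxtimes>\<^bsub>PP\<^esub> q) \<boxtimes>\<^bsub>VBP PH\<^esub> r) =
          twist (canV P ((p \<boxtimes>\<^bsub>PP\<^esub> q) \<boxtimes>\<^bsub>VBP P\<^esub> r))" by simp
    qed simp_all
    then show "canV PH (tmap2 diag2 (x \<boxtimes>\<^bsub>VBP P\<^esub> r)) = twist (canV P (x \<boxtimes>\<^bsub>VBP P\<^esub> r))"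
      using x by (simp add: pure)
  qed simp_all
qed

text \<open>The candidate for the preimage of \<open>z\<close> under \<open>multL\<close> is
  \<open>canVinv P (codiag z)\<close>, as \<open>canV_inclLBP\<close> dictates. It is shown here to
  satisfy the equation of \<open>L\<close> tensored with \<open>P\<close>; flatness will turn this
  into membership in the image of \<open>inclLBP\<close>.\<close>

lemma tmap2_eq:
  assumes z: "z \<in> carrier PP"
  shows "tmap2 diag2 (canVinv P (codiag z)) = tmap2 triv2 (canVinv P (codiag z))"
proof -
  let ?w = "canVinv P (codiag z)"
  have w: "?w \<in> carrier (VBP P)"
    using linear_mapD(1)[OF lin_canVinv0[OF module_P] codiag_closed] .
  have c: "tmap2 diag2 ?w \<in> carrier (VBP PH)" "tmap2 triv2 ?w \<in> carrier (VBP PH)"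
    by (simp_all add: mapB_def)
  have "canV PH (tmap2 diag2 ?w) = canV PH (tmap2 triv2 ?w)"
    using canV_tmap2[OF w] twist_codiag[OF z] by simp
  then have "canVinv PH (canV PH (tmap2 diag2 ?w)) = canVinv PH (canV PH (tmap2 triv2 ?w))"
    by simp
  then show ?thesis using c by simp
qed

end

section \<open>Faithful flatness\<close>

text \<open>Lists form an infinite type even over a single letter, so their square has the same
  cardinality. Hence the encoding target is a list type, stable under the pairing that tensor
  products require.\<close>

lemma ex_inj_list_pair: "\<exists>f :: 'c list \<times> 'c list \<Rightarrow> 'c list. inj f"
proof -
  have "|UNIV \<times> UNIV :: ('c list \<times> 'c list) set| =o |UNIV :: 'c list set|"
    by (rule card_of_Times_same_infinite) (rule infinite_UNIV_listI)
  then have "|UNIV \<times> UNIV :: ('c list \<times> 'c list) set| \<le>o |UNIV :: 'c list set|"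
    by (rule ordIso_imp_ordLeq)
  then obtain f :: "'c list \<times> 'c list \<Rightarrow> 'c list" where "inj_on f (UNIV \<times> UNIV)"
    unfolding card_of_ordLeq[symmetric] by blast
  then show ?thesis by (intro exI[of _ f]) simp
qed

lemma ex_inj_list_list: "\<exists>f :: 'c list list \<Rightarrow> 'c list. inj f"
proof -
  obtain pr :: "'c list \<times> 'c list \<Rightarrow> 'c list" where pr: "inj pr"
    using ex_inj_list_pair by blast
  define en where "en = (\<lambda>n. replicate n (undefined :: 'c))"
  have en: "en m = en n \<longleftrightarrow> m = n" for m n by (metis en_def length_replicate)
  define enc where "enc xs = rec_list [] (\<lambda>x _ r. pr (x, r)) xs" for xs
  have enc_simps: "enc (x # xs) = pr (x, enc xs)" for x xs by (simp add: enc_def)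
  have enc: "length xs = length ys \<Longrightarrow> enc xs = enc ys \<Longrightarrow> xs = ys" for xs ys
    by (induction xs ys rule: list_induct2) (auto simp: enc_simps dest: injD[OF pr])
  \<comment> \<open>Nested pairs alone do not show where a list ends, because the code
    \<open>[]\<close> of the empty list may also be a value of \<open>pr\<close>. The length is
    recorded to remove the ambiguity.\<close>
  have "inj (\<lambda>xs. pr (en (length xs), enc xs))"
    by (rule injI) (auto dest!: injD[OF pr] simp: en intro: enc)
  then show ?thesis by blast
qed

text \<open>An element of the tensor product is an infinite set of formal sums, but it is determined
  by one list of pairs whose pure tensors add up to it. Choosing such a list embeds the tensor
  product into lists of pairs, which in turn embed into \<open>'z list\<close>.\<close>

lemma (in balanced_pair) tensor_small:
  fixes g :: "'m \<Rightarrow> 'z list" and h :: "'n \<Rightarrow> 'z list"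
  assumes g: "inj_on g (carrier M)" and h: "inj_on h (carrier N)"
  shows "\<exists>f :: ('m, 'n) tens \<Rightarrow> 'z list. inj_on f (carrier T)"
proof -
  interpret A: abelian_group T by (rule abelian_group_tensor)
  define val where "val xs = foldr (\<lambda>z r. fst z \<boxtimes>\<^bsub>T\<^esub> snd z \<oplus>\<^bsub>T\<^esub> r) xs \<zero>\<^bsub>T\<^esub>" for xs
  have val_closed: "val xs \<in> carrier T" if "set xs \<subseteq> carrier M \<times> carrier N" for xs
    using that by (induction xs) (auto simp: val_def pure_tensor_closed)
  have val_append: "val (xs @ ys) = val xs \<oplus>\<^bsub>T\<^esub> val ys"
    if "set xs \<subseteq> carrier M \<times> carrier N" "set ys \<subseteq> carrier M \<times> carrier N" for xs ys
    using that(1)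
  proof (induction xs)
    case Nil
    then show ?case using val_closed[OF that(2)] by (simp add: val_def)
  next
    case (Cons z xs)
    then show ?case
      using val_closed[of xs] val_closed[OF that(2)] by (auto simp: val_def A.a_assoc pure_tensor_closed)
  qed
  have ex: "\<exists>xs. set xs \<subseteq> carrier M \<times> carrier N \<and> val xs = u" if "u \<in> carrier T" for u
    using that
  proof (induction u rule: tensor_induct)
    case (pure m n)
    then show ?case
      by (intro exI[of _ "[(m, n)]"]) (simp add: val_def pure_tensor_closed)
  next
    case (add u v)
    then obtain xs ys where "set xs \<subseteq> carrier M \<times> carrier N" "val xs = u"
      "set ys \<subseteq> carrier M \<times> carrier N" "val ys = v" by blast
    then show ?case by (intro exI[of _ "xs @ ys"]) (auto simp: val_append)
  qed
  define s where "s u = (SOME xs. set xs \<subseteq> carrier M \<times> carrier N \<and> val xs = u)" for u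
  have s: "set (s u) \<subseteq> carrier M \<times> carrier N \<and> val (s u) = u" if "u \<in> carrier T" for u
    unfolding s_def using ex[OF that] by (rule someI_ex)
  obtain pr :: "'z list \<times> 'z list \<Rightarrow> 'z list" where pr: "inj pr"
    using ex_inj_list_pair by blast
  obtain en :: "'z list list \<Rightarrow> 'z list" where en: "inj en"
    using ex_inj_list_list by blast
  let ?c = "\<lambda>z. pr (g (fst z), h (snd z))"
  have c: "inj_on ?c (carrier M \<times> carrier N)"
  proof (rule inj_onI)
    fix x y assume xy: "x \<in> carrier M \<times> carrier N" "y \<in> carrier M \<times> carrier N" "?c x = ?c y"
    then have "g (fst x) = g (fst y)" "h (snd x) = h (snd y)" using injD[OF pr] by blast+
    then show "x = y" using xy inj_onD[OF g] inj_onD[OF h] by (metis mem_Times_iff prod.expand)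
  qed
  have "inj_on (\<lambda>u. en (map ?c (s u))) (carrier T)"
  proof (rule inj_onI)
    fix u v assume uv: "u \<in> carrier T" "v \<in> carrier T" "en (map ?c (s u)) = en (map ?c (s v))"
    have "map ?c (s u) = map ?c (s v)" using en uv(3) by (rule injD)
    moreover have "inj_on ?c (set (s u) \<union> set (s v))"
      using s[OF uv(1)] s[OF uv(2)] by (intro inj_on_subset[OF c]) simp
    ultimately have "s u = s v" by (simp add: inj_on_map_eq_map)
    then show "u = v" using s[OF uv(1)] s[OF uv(2)] by metis
  qed
  then show ?thesis by blast
qed

lemma tensor_over_record_cong:
  assumes "carrier M = carrier M'" "add M = add M'"
  shows "tensor_over R M rho N lam = tensor_over R M' rho N lam"
  using assms by (simp add: tensor_over_def tensor_relators_def)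

locale galois_ff = galois_ext K H \<Delta> \<epsilon> antip P \<rho>
  for K :: "'k ring" and H :: "('k, 'h) module" and \<Delta> \<epsilon> antip and P :: "('k, 'p) module" and \<rho> +
  assumes faithfully_flat:
    "faithfully_flat TYPE(('p \<times> 'h) list set set) (coinvariants K H P \<rho>) P (\<lambda>b p. b \<otimes>\<^bsub>P\<^esub> p)"
begin

text \<open>
  The type over which \<open>faithfully_flat\<close> quantifies is fixed.  A module whose carrier injects into
  \<open>('p \<times> 'h) list\<close> can be transported there, and since tensor products of such modules are again of this kind,
  all modules occurring here qualify.
\<close>

definition small :: "('k, 'm) module \<Rightarrow> bool"
  where "small M \<longleftrightarrow> (\<exists>g :: 'm \<Rightarrow> ('p \<times> 'h) list. inj_on g (carrier M))"

lemma small_tensB: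
  assumes "small M" "small N" "rmodB M act" "lmodB N lam"
  shows "small (tensB M act N lam)"
proof -
  interpret MN: tensor_bimod K Bc M act N lam by (rule tensor_bimod_tensB[OF assms(3,4)])
  obtain g :: "_ \<Rightarrow> ('p \<times> 'h) list" and h :: "_ \<Rightarrow> ('p \<times> 'h) list"
    where gh: "inj_on g (carrier M)" "inj_on h (carrier N)"
    using assms(1,2) unfolding small_def by blast
  show ?thesis
    unfolding small_def tmod_simps by (rule MN.tensor_small[OF gh])
qed

lemma small_tensor:
  assumes "small V" "small W" "module K V" "module K W"
  shows "small (V \<otimes>\<^sub>K W)"
proof -
  interpret VW: tensor_bimod K "carrier K" V "\<lambda>v c. c \<odot>\<^bsub>V\<^esub> v" W "\<lambda>c w. c \<odot>\<^bsub>W\<^esub> w"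
    using assms(3,4) by (rule tensor_bimod_tensor)
  obtain g :: "_ \<Rightarrow> ('p \<times> 'h) list" and h :: "_ \<Rightarrow> ('p \<times> 'h) list"
    where gh: "inj_on g (carrier V)" "inj_on h (carrier W)"
    using assms(1,2) unfolding small_def by blast
  show ?thesis
    unfolding small_def tensor_eq_tmod tmod_simps by (rule VW.tensor_small[OF gh])
qed

lemma small_P: "small P"
  unfolding small_def by (rule exI[of _ "\<lambda>p. [(p, undefined)]"]) (simp add: inj_on_def)

lemma small_H: "small H"
  unfolding small_def by (rule exI[of _ "\<lambda>h. [(undefined, h)]"]) (simp add: inj_on_def)

lemma small_L: "small L"
proof -
  have "small PP" by (rule small_tensor) (simp_all add: small_P)
  then obtain g :: "_ \<Rightarrow> ('p \<times> 'h) list" where "inj_on g (carrier PP)"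
    unfolding small_def by blast
  then have "inj_on g (carrier L)" by (rule inj_on_subset) (auto intro: L_carrier)
  then show ?thesis unfolding small_def by blast
qed

section \<open>Exactness under tensoring with \<open>P\<close>\<close>

definition homB :: "('k, 'm) module \<Rightarrow> ('m \<Rightarrow> 'p \<Rightarrow> 'm) \<Rightarrow> ('k, 'n) module \<Rightarrow> ('n \<Rightarrow> 'p \<Rightarrow> 'n) \<Rightarrow> ('m \<Rightarrow> 'n) \<Rightarrow> bool"
  where "homB M act N act' f \<longleftrightarrow> linear_map K M N f \<and> (\<forall>m\<in>carrier M. \<forall>b\<in>Bc. f (act m b) = act' (f m) b)"

abbreviation tensP :: "('k, 'm) module \<Rightarrow> ('m \<Rightarrow> 'p \<Rightarrow> 'm) \<Rightarrow> ('k, ('m, 'p) tens) module"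
  where "tensP M act \<equiv> tensB M act P (monoid.mult P)"

lemma homB_bal:
  assumes "rmodB N act'" "homB M act N act' f"
  shows "bilB M act P (monoid.mult P) (tensP N act') (\<lambda>m p. f m \<boxtimes>\<^bsub>tensP N act'\<^esub> p)"
  using assms(2) linear_mapD(1)[of K M N f] tensB_balanced[OF assms(1) lmodB_P]
  by (simp add: homB_def lin_tensBL[OF assms(1) lmodB_P] lin_tensBR'[OF assms(1) lmodB_P])

lemma mapB_linear:
  assumes "rmodB M act" "rmodB N act'" "homB M act N act' f"
  shows "linear_map K (tensP M act) (tensP N act') (mapB M N act' f)"
  unfolding mapB_def
  by (rule lin_sw_tensB[OF assms(1) lmodB_P]) (use homB_bal[OF assms(2,3)] module_tensB[OF assms(2) lmodB_P] in simp_all)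

lemma mapB_pure:
  assumes "rmodB M act" "rmodB N act'" "homB M act N act' f" "m \<in> carrier M" "p \<in> carrier P"
  shows "mapB M N act' f (m \<boxtimes>\<^bsub>tensP M act\<^esub> p) = f m \<boxtimes>\<^bsub>tensP N act'\<^esub> p"
  unfolding mapB_def
  by (rule sw_tensB_pure[OF assms(1) lmodB_P _ assms(4,5)])
    (use homB_bal[OF assms(2,3)] module_tensB[OF assms(2) lmodB_P] in simp_all)

lemma mapB_cong: "(\<And>m. m \<in> carrier M \<Longrightarrow> f m = g m) \<Longrightarrow> mapB M N act f = mapB M N act g"
  by (rule ext) (simp add: mapB_def)

lemma mapB_comp:
  assumes M: "rmodB M a" and N: "rmodB N a'" and X: "rmodB X a''"
    and f: "homB M a N a' f" and g: "homB N a' X a'' g" and u: "u \<in> carrier (tensP M a)"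
  shows "mapB N X a'' g (mapB M N a' f u) = mapB M X a'' (\<lambda>m. g (f m)) u"
proof -
  have gf: "homB M a X a'' (\<lambda>m. g (f m))"
    using f g linear_map_comp[of K M N f X g] linear_mapD(1)[of K M N f] by (simp add: homB_def)
  show ?thesis
  proof (rule tensB_eqI[where A = "tensP X a''", OF M lmodB_P _ _ u])
    show "linear_map K (tensP M a) (tensP X a'') (\<lambda>u. mapB N X a'' g (mapB M N a' f u))"
      by (rule linear_map_comp[OF mapB_linear[OF M N f] mapB_linear[OF N X g]])
    show "linear_map K (tensP M a) (tensP X a'') (mapB M X a'' (\<lambda>m. g (f m)))"
      by (rule mapB_linear[OF M X gf])
    fix m p assume "m \<in> carrier M" "p \<in> carrier P"
    then show "mapB N X a'' g (mapB M N a' f (m \<boxtimes>\<^bsub>tensP M a\<^esub> p)) = mapB M X a'' (\<lambda>m. g (f m)) (m \<boxtimes>\<^bsub>tensP M a\<^esub> p)"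
      using f linear_mapD(1)[of K M N f]
      by (simp add: mapB_pure[OF M N f] mapB_pure[OF N X g] mapB_pure[OF M X gf] homB_def)
  qed
qed

lemma mapB_id:
  assumes M: "rmodB M a" and u: "u \<in> carrier (tensP M a)" and f: "\<And>m. m \<in> carrier M \<Longrightarrow> f m = m"
  shows "mapB M M a f u = u"
proof -
  have h: "homB M a M a (\<lambda>m. m)" by (simp add: homB_def)
  have "mapB M M a (\<lambda>m. m) u = u"
    by (rule tensB_eqI[where A = "tensP M a", OF M lmodB_P mapB_linear[OF M M h] _ u])
      (simp_all add: mapB_pure[OF M M h])
  then show ?thesis using mapB_cong[of M f "\<lambda>m. m"] f by simp
qed

lemma ff_same_type:
  fixes M1 M2 M3 :: "('k, ('p \<times> 'h) list set set) module"
  assumes M: "rmodB M1 a1" "rmodB M2 a2" "rmodB M3 a3"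
    and f: "homB M1 a1 M2 a2 f" and g: "homB M2 a2 M3 a3 g"
  shows "f ` carrier M1 = {m \<in> carrier M2. g m = \<zero>\<^bsub>M3\<^esub>} \<longleftrightarrow>
    mapB M1 M2 a2 f ` carrier (tensP M1 a1) =
    {u \<in> carrier (tensP M2 a2). mapB M2 M3 a3 g u = \<zero>\<^bsub>tensP M3 a3\<^esub>}"
proof -
  let ?B = "coinvariants K H P \<rho>"
  \<comment> \<open>The flatness hypothesis speaks of ring records. Truncation drops the scalars and
    leaves carrier and addition, hence the tensor products, as they are.\<close>
  let ?t = "\<lambda>M :: ('k, ('p \<times> 'h) list set set) module. ring.truncate M"
  have tr: "carrier (?t M) = carrier M" "add (?t M) = add M" "\<zero>\<^bsub>?t M\<^esub> = \<zero>\<^bsub>M\<^esub>" for M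
    by (simp_all add: ring.truncate_def)
  have rm: "right_module ?B (?t M) a" if "rmodB M a" for M a
  proof -
    interpret M: module K M using that by (simp add: rmodB_def)
    have "abelian_group (?t M)"
      by (rule abelian_groupI) (auto simp: tr M.a_ac intro: M.add.inv_closed M.l_neg)
    then show ?thesis using rmodB_right_module[OF that] by (simp add: right_module_def tr)
  qed
  have hom: "right_module_hom ?B (?t M) a (?t N) a' f" if "homB M a N a' f" for M a N a' f
    using that by (auto simp: right_module_hom_def tr homB_def linear_map_def Bc_def)
  have T: "tensor_over (carrier ?B) (?t M) a P (\<lambda>b p. b \<otimes>\<^bsub>P\<^esub> p) = tensor_over Bc M a P (monoid.mult P)" for M a
    by (simp add: Bc_def tensor_over_record_cong[of "?t M" M] tr)
  have sw: "sweedler (tensor_over Bc N a' P (monoid.mult P)) u (\<lambda>m n. f m \<boxtimes>\<^bsub>tensor_over Bc N a' P (monoid.mult P)\<^esub> n) =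
      mapB M N a' f u"
    if "rmodB M a" "rmodB N a'" "homB M a N a' f" "u \<in> carrier (tensor_over Bc M a P (monoid.mult P))" for M a N a' f u
  proof -
    have "sweedler (tensP N a') u (\<lambda>m n. f m \<boxtimes>\<^bsub>tensP N a'\<^esub> n) = mapB M N a' f u"
      unfolding mapB_def using that linear_mapD(1)[of K M N f]
      by (intro sweedler_tensB[OF that(1) lmodB_P])
        (auto simp: homB_def tmod_simps(1)[where K = K, symmetric] intro!: tensB_closed[OF that(2) lmodB_P] module_imp_abelian_group module_tensB)
    then show ?thesis by (simp add: tmod_simps)
  qed
  have "right_module ?B (?t M1) a1 \<and> right_module ?B (?t M2) a2 \<and> right_module ?B (?t M3) a3 \<and>
      right_module_hom ?B (?t M1) a1 (?t M2) a2 f \<and> right_module_hom ?B (?t M2) a2 (?t M3) a3 g"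
    by (intro conjI rm hom M f g)
  note faithfully_flat[unfolded faithfully_flat_def Let_def, rule_format, OF this, unfolded T]
  moreover have "(\<lambda>u. sweedler (tensor_over Bc M2 a2 P (monoid.mult P)) u (\<lambda>m n. f m \<boxtimes>\<^bsub>tensor_over Bc M2 a2 P (monoid.mult P)\<^esub> n)) `
        carrier (tensor_over Bc M1 a1 P (monoid.mult P)) = mapB M1 M2 a2 f ` carrier (tensP M1 a1)"
    by (rule image_cong) (simp_all only: sw[OF M(1,2) f] tmod_simps(1))
  moreover have "a_kernel (tensor_over Bc M2 a2 P (monoid.mult P)) (tensor_over Bc M3 a3 P (monoid.mult P))
        (\<lambda>u. sweedler (tensor_over Bc M3 a3 P (monoid.mult P)) u (\<lambda>m n. g m \<boxtimes>\<^bsub>tensor_over Bc M3 a3 P (monoid.mult P)\<^esub> n)) =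
      {u \<in> carrier (tensP M2 a2). mapB M2 M3 a3 g u = \<zero>\<^bsub>tensP M3 a3\<^esub>}"
    unfolding a_kernel_def' tmod_simps(1,2) by (rule Collect_cong, rule conj_cong) (simp_all only: sw[OF M(2,3) g])
  ultimately show ?thesis unfolding a_kernel_def' tr by simp
qed

end

text \<open>Exactness is an equality of an image with a kernel, so it can be moved along bijections
  by pure set theory. The three terms play different roles: on the first, surjectivity of
  \<open>d1\<close> suffices; the second needs a bijection; the third only a map that detects
  zero.\<close>

lemma exact_transport:
  assumes e1: "\<And>x. x \<in> A1 \<Longrightarrow> e1 x \<in> B1" "\<And>x. x \<in> B1 \<Longrightarrow> d1 x \<in> A1" "\<And>x. x \<in> A1 \<Longrightarrow> d1 (e1 x) = x"
    and e2: "\<And>x. x \<in> A2 \<Longrightarrow> e2 x \<in> B2" "\<And>x. x \<in> B2 \<Longrightarrow> d2 x \<in> A2" "\<And>x. x \<in> A2 \<Longrightarrow> d2 (e2 x) = x"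
      "\<And>x. x \<in> B2 \<Longrightarrow> e2 (d2 x) = x"
    and e3: "\<And>y. y \<in> A3 \<Longrightarrow> e3 y = z' \<longleftrightarrow> y = z"
    and f: "\<And>x. x \<in> A1 \<Longrightarrow> f x \<in> A2" and g: "\<And>x. x \<in> A2 \<Longrightarrow> g x \<in> A3"
    and f': "\<And>x. x \<in> B1 \<Longrightarrow> f' x = e2 (f (d1 x))" and g': "\<And>x. x \<in> B2 \<Longrightarrow> g' x = e3 (g (d2 x))"
  shows "f' ` B1 = {x \<in> B2. g' x = z'} \<longleftrightarrow> f ` A1 = {x \<in> A2. g x = z}"
proof -
  have "f' ` B1 = e2 ` f ` A1"
  proof (intro equalityI subsetI)
    fix y assume "y \<in> f' ` B1"
    then show "y \<in> e2 ` f ` A1" using f' e1 by auto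
  next
    fix y assume "y \<in> e2 ` f ` A1"
    then obtain x where "x \<in> A1" "y = e2 (f x)" by blast
    then have "y = f' (e1 x)" "e1 x \<in> B1" using f' e1 by simp_all
    then show "y \<in> f' ` B1" by blast
  qed
  moreover have "{x \<in> B2. g' x = z'} = e2 ` {x \<in> A2. g x = z}"
  proof (intro equalityI subsetI)
    fix x assume x: "x \<in> {x \<in> B2. g' x = z'}"
    then have "e3 (g (d2 x)) = z'" using g'[symmetric, of x] by simp
    then have "d2 x \<in> {x \<in> A2. g x = z}" "x = e2 (d2 x)"
      using x e3[OF g[OF e2(2)], of x] e2(2,4) by simp_all
    then show "x \<in> e2 ` {x \<in> A2. g x = z}" by blast
  next
    fix y assume "y \<in> e2 ` {x \<in> A2. g x = z}"
    then obtain x where x: "x \<in> A2" "g x = z" "y = e2 x" by blast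
    then show "y \<in> {x \<in> B2. g' x = z'}" using g'[OF e2(1)] e3[OF g, of x] e2(1,3) by simp
  qed
  moreover have "inj_on e2 A2" using e2(3) by (rule inj_on_inverseI)
  moreover have "f ` A1 \<subseteq> A2" "{x \<in> A2. g x = z} \<subseteq> A2" using f by auto
  ultimately show ?thesis by (simp add: inj_on_image_eq_iff)
qed

context galois_ff
begin

lemma homB_linear: "homB M a N a' f \<Longrightarrow> linear_map K M N f"
  by (simp add: homB_def)

lemma homB_closed: "homB M a N a' f \<Longrightarrow> m \<in> carrier M \<Longrightarrow> f m \<in> carrier N"
  using linear_mapD(1)[OF homB_linear] .

lemma homB_comp: "homB M a N a' f \<Longrightarrow> homB N a' X a'' g \<Longrightarrow> homB M a X a'' (\<lambda>m. g (f m))"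
  using linear_map_comp[of K M N f X g] linear_mapD(1)[of K M N f] by (simp add: homB_def)

lemma linear_zero_iff:
  assumes e: "linear_map K M N e" and "module K M" "module K N"
    and d: "\<And>m. m \<in> carrier M \<Longrightarrow> d (e m) = m" and m: "m \<in> carrier M"
  shows "e m = \<zero>\<^bsub>N\<^esub> \<longleftrightarrow> m = \<zero>\<^bsub>M\<^esub>"
proof -
  interpret M: module K M by fact
  have "e \<zero>\<^bsub>M\<^esub> = \<zero>\<^bsub>N\<^esub>"
    using assms by (intro hom_add_zero linear_map_hom[OF e]) simp_all
  then show ?thesis using d m M.zero_closed by metis
qed

lemma ex_transport:
  fixes M :: "('k, 'm) module"
  assumes M: "rmodB M a" and "small M"
  shows "\<exists>(M' :: ('k, ('p \<times> 'h) list set set) module) a' e d. rmodB M' a' \<and> homB M a M' a' e \<and> homB M' a' M a d \<and>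
    (\<forall>m\<in>carrier M. d (e m) = m) \<and> (\<forall>x\<in>carrier M'. e (d x) = x)"
proof -
  obtain g0 :: "'m \<Rightarrow> ('p \<times> 'h) list" where g0: "inj_on g0 (carrier M)"
    using assms(2) unfolding small_def by blast
  \<comment> \<open>Double singletons reach the type fixed by the flatness hypothesis. Any injection
    into it would serve, since all operations are transported along \<open>e\<close>.\<close>
  define e :: "'m \<Rightarrow> ('p \<times> 'h) list set set" where "e m = {{g0 m}}" for m
  have e: "inj_on e (carrier M)" using g0 by (auto simp: inj_on_def e_def)
  define d where "d = inv_into (carrier M) e"
  define M' :: "('k, ('p \<times> 'h) list set set) module" where "M' = \<lparr>carrier = e ` carrier M, monoid.mult = undefined, monoid.one = undefined,
    ring.zero = e \<zero>\<^bsub>M\<^esub>, ring.add = \<lambda>x y. e (d x \<oplus>\<^bsub>M\<^esub> d y), smult = \<lambda>c x. e (c \<odot>\<^bsub>M\<^esub> d x)\<rparr>"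
  define a' where "a' = (\<lambda>x b. e (a (d x) b))"
  interpret M: module K M using M by (simp add: rmodB_def)
  have de [simp]: "d (e m) = m" if "m \<in> carrier M" for m
    using that e by (simp add: d_def)
  have M'_simps [simp]: "carrier M' = e ` carrier M" "\<zero>\<^bsub>M'\<^esub> = e \<zero>\<^bsub>M\<^esub>" "x \<oplus>\<^bsub>M'\<^esub> y = e (d x \<oplus>\<^bsub>M\<^esub> d y)"
    "c \<odot>\<^bsub>M'\<^esub> x = e (c \<odot>\<^bsub>M\<^esub> d x)" for x y c
    by (simp_all add: M'_def)
  have neg: "\<exists>y\<in>carrier M. e (y \<oplus>\<^bsub>M\<^esub> m) = e \<zero>\<^bsub>M\<^esub>" if "m \<in> carrier M" for m
    using that by (intro bexI[of _ "\<ominus>\<^bsub>M\<^esub> m"]) (simp_all add: M.l_neg)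
  have "abelian_group M'"
    by (rule abelian_groupI) (use neg in \<open>auto simp: M.a_ac\<close>)
  then have modM': "module K M'"
    by (rule moduleI[OF K.is_cring]) (auto simp: M.smult_l_distr M.smult_r_distr smult_smult[OF M.module_axioms])
  have a [simp]: "a m b \<in> carrier M" if "m \<in> carrier M" "b \<in> Bc" for m b
    using M that linear_mapD(1)[of K M M "\<lambda>m. a m b"] by (simp add: rmodB_def)
  have "linear_map K M' M' (\<lambda>x. a' x b)" if "b \<in> Bc" for b
    using M that linear_mapD(2,3)[of K M M "\<lambda>m. a m b"]
    by (intro linear_mapI) (auto simp: rmodB_def a'_def)
  then have "rmodB M' a'"
    using M modM' by (auto simp: rmodB_def a'_def)
  moreover have "homB M a M' a' e" "homB M' a' M a d"
    by (auto simp: homB_def a'_def linear_map_def)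
  ultimately show ?thesis
    by (intro exI[of _ M'] exI[of _ a'] exI[of _ e] exI[of _ d]) auto
qed

lemma mapB_inverse:
  assumes M: "rmodB M a" and N: "rmodB N b" and e: "homB M a N b e" and d: "homB N b M a d"
    and de: "\<And>m. m \<in> carrier M \<Longrightarrow> d (e m) = m" and u: "u \<in> carrier (tensP M a)"
  shows "mapB N M a d (mapB M N b e u) = u"
  unfolding mapB_comp[OF M N M e d u] by (rule mapB_id[OF M u de])

text \<open>Each module is replaced by a copy in the fixed type. As \<open>mapB\<close> is
  functorial, the isomorphisms with the copies stay mutually inverse after tensoring, so exactness
  is transported once for the given sequence and once for the tensored one, with
  \<open>ff_same_type\<close> in between.\<close>

lemma ff_exact:
  assumes M: "rmodB M1 a1" "rmodB M2 a2" "rmodB M3 a3" and small: "small M1" "small M2" "small M3"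
    and f: "homB M1 a1 M2 a2 f" and g: "homB M2 a2 M3 a3 g"
  shows "f ` carrier M1 = {m \<in> carrier M2. g m = \<zero>\<^bsub>M3\<^esub>} \<longleftrightarrow>
    mapB M1 M2 a2 f ` carrier (tensP M1 a1) =
    {u \<in> carrier (tensP M2 a2). mapB M2 M3 a3 g u = \<zero>\<^bsub>tensP M3 a3\<^esub>}"
proof -
  obtain N1 :: "('k, ('p \<times> 'h) list set set) module" and b1 e1 d1 where 1: "rmodB N1 b1" "homB M1 a1 N1 b1 e1" "homB N1 b1 M1 a1 d1"
    "\<And>m. m \<in> carrier M1 \<Longrightarrow> d1 (e1 m) = m" "\<And>x. x \<in> carrier N1 \<Longrightarrow> e1 (d1 x) = x"
    by (rule ex_transport[OF M(1) small(1), THEN exE]) (elim exE conjE, rule that, (assumption | erule bspec)+)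
  obtain N2 :: "('k, ('p \<times> 'h) list set set) module" and b2 e2 d2 where 2: "rmodB N2 b2" "homB M2 a2 N2 b2 e2" "homB N2 b2 M2 a2 d2"
    "\<And>m. m \<in> carrier M2 \<Longrightarrow> d2 (e2 m) = m" "\<And>x. x \<in> carrier N2 \<Longrightarrow> e2 (d2 x) = x"
    by (rule ex_transport[OF M(2) small(2), THEN exE]) (elim exE conjE, rule that, (assumption | erule bspec)+)
  obtain N3 :: "('k, ('p \<times> 'h) list set set) module" and b3 e3 d3 where 3: "rmodB N3 b3" "homB M3 a3 N3 b3 e3" "homB N3 b3 M3 a3 d3"
    "\<And>m. m \<in> carrier M3 \<Longrightarrow> d3 (e3 m) = m" "\<And>x. x \<in> carrier N3 \<Longrightarrow> e3 (d3 x) = x"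
    by (rule ex_transport[OF M(3) small(3), THEN exE]) (elim exE conjE, rule that, (assumption | erule bspec)+)
  note mods = rmodB_module[OF M(1) lmodB_P] rmodB_module[OF M(2) lmodB_P] rmodB_module[OF M(3) lmodB_P]
    rmodB_module[OF 1(1) lmodB_P] rmodB_module[OF 2(1) lmodB_P] rmodB_module[OF 3(1) lmodB_P]
  let ?f' = "\<lambda>x. e2 (f (d1 x))" and ?g' = "\<lambda>x. e3 (g (d2 x))"
  have fd: "homB N1 b1 M2 a2 (\<lambda>x. f (d1 x))" and gd: "homB N2 b2 M3 a3 (\<lambda>x. g (d2 x))"
    by (rule homB_comp[OF 1(3) f] homB_comp[OF 2(3) g])+
  have f': "homB N1 b1 N2 b2 ?f'" and g': "homB N2 b2 N3 b3 ?g'"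
    by (rule homB_comp[OF fd 2(2)] homB_comp[OF gd 3(2)])+
  have "f ` carrier M1 = {m \<in> carrier M2. g m = \<zero>\<^bsub>M3\<^esub>} \<longleftrightarrow> ?f' ` carrier N1 = {x \<in> carrier N2. ?g' x = \<zero>\<^bsub>N3\<^esub>}"
    by (rule exact_transport[where ?e1.0 = e1 and ?d1.0 = d1 and ?e2.0 = e2 and ?d2.0 = d2 and ?e3.0 = e3 and ?A3.0 = "carrier M3", symmetric])
      (rule homB_closed[OF 1(2)] homB_closed[OF 1(3)] 1(4) homB_closed[OF 2(2)] homB_closed[OF 2(3)] 2(4,5)
        homB_closed[OF f] homB_closed[OF g] linear_zero_iff[OF homB_linear[OF 3(2)] mods(3,6) 3(4)] refl; assumption)+
  also have "\<dots> \<longleftrightarrow> mapB N1 N2 b2 ?f' ` carrier (tensP N1 b1) =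
      {u \<in> carrier (tensP N2 b2). mapB N2 N3 b3 ?g' u = \<zero>\<^bsub>tensP N3 b3\<^esub>}"
    by (rule ff_same_type[OF 1(1) 2(1) 3(1) f' g'])
  also have "\<dots> \<longleftrightarrow> mapB M1 M2 a2 f ` carrier (tensP M1 a1) =
      {u \<in> carrier (tensP M2 a2). mapB M2 M3 a3 g u = \<zero>\<^bsub>tensP M3 a3\<^esub>}"
  proof (rule exact_transport[where ?e1.0 = "mapB M1 N1 b1 e1" and ?d1.0 = "mapB N1 M1 a1 d1"
        and ?e2.0 = "mapB M2 N2 b2 e2" and ?d2.0 = "mapB N2 M2 a2 d2" and ?e3.0 = "mapB M3 N3 b3 e3"
        and ?A3.0 = "carrier (tensP M3 a3)"])
    show "mapB M3 N3 b3 e3 y = \<zero>\<^bsub>tensP N3 b3\<^esub> \<longleftrightarrow> y = \<zero>\<^bsub>tensP M3 a3\<^esub>" if "y \<in> carrier (tensP M3 a3)" for y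
      by (rule linear_zero_iff[OF mapB_linear[OF M(3) 3(1,2)] module_tensB[OF M(3) lmodB_P] module_tensB[OF 3(1) lmodB_P] _ that, of "mapB N3 M3 a3 d3"])
        (rule mapB_inverse[OF M(3) 3(1,2,3,4)])
    show "mapB N1 N2 b2 ?f' x = mapB M2 N2 b2 e2 (mapB M1 M2 a2 f (mapB N1 M1 a1 d1 x))"
      if "x \<in> carrier (tensP N1 b1)" for x
      unfolding mapB_comp[OF 1(1) M(1,2) 1(3) f that] mapB_comp[OF 1(1) M(2) 2(1) fd 2(2) that] ..
    show "mapB N2 N3 b3 ?g' x = mapB M3 N3 b3 e3 (mapB M2 M3 a3 g (mapB N2 M2 a2 d2 x))"
      if "x \<in> carrier (tensP N2 b2)" for x
      unfolding mapB_comp[OF 2(1) M(2,3) 2(3) g that] mapB_comp[OF 2(1) M(3) 3(1) gd 3(2) that] ..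
  qed (rule linear_mapD(1)[OF mapB_linear[OF M(1) 1(1,2)]] linear_mapD(1)[OF mapB_linear[OF 1(1) M(1) 1(3)]]
      linear_mapD(1)[OF mapB_linear[OF M(2) 2(1,2)]] linear_mapD(1)[OF mapB_linear[OF 2(1) M(2) 2(3)]]
      linear_mapD(1)[OF mapB_linear[OF M(1,2) f]] linear_mapD(1)[OF mapB_linear[OF M(2,3) g]]
      mapB_inverse[OF M(1) 1(1,2,3,4)] mapB_inverse[OF M(2) 2(1,2,3,4)] mapB_inverse[OF 2(1) M(2) 2(3,2,5)]; assumption)+
  finally show ?thesis .
qed

lemma lin_diff:
  assumes "linear_map K M N f" "linear_map K M N g" "module K N"
  shows "linear_map K M N (\<lambda>m. f m \<ominus>\<^bsub>N\<^esub> g m)"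
proof -
  interpret N: module K N by fact
  show ?thesis
    using linear_mapD[OF assms(1)] linear_mapD[OF assms(2)]
    by (intro linear_mapI) (simp_all add: N.minus_eq N.minus_add N.a_ac N.smult_r_distr N.smult_r_minus)
qed

lemma minus_zero_iff:
  assumes "module K N" "a \<in> carrier N" "b \<in> carrier N"
  shows "a \<ominus>\<^bsub>N\<^esub> b = \<zero>\<^bsub>N\<^esub> \<longleftrightarrow> a = b"
proof -
  interpret N: module K N by fact
  show ?thesis
    using assms(2,3) N.minus_equality[of a "\<ominus>\<^bsub>N\<^esub> b"] by (auto simp: N.minus_eq N.r_neg)
qed

text \<open>An equalizer is the kernel of the difference; the difference of right
  \<open>B\<close>-linear maps is of the same kind, and \<open>mapB\<close> respects it.\<close>

lemma ff_equalizer: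
  assumes M: "rmodB M1 a1" "rmodB M2 a2" "rmodB M3 a3" and small: "small M1" "small M2" "small M3"
    and f: "homB M1 a1 M2 a2 f" and g: "homB M2 a2 M3 a3 g" and h: "homB M2 a2 M3 a3 h"
  shows "f ` carrier M1 = {m \<in> carrier M2. g m = h m} \<longleftrightarrow>
    mapB M1 M2 a2 f ` carrier (tensP M1 a1) =
    {u \<in> carrier (tensP M2 a2). mapB M2 M3 a3 g u = mapB M2 M3 a3 h u}"
proof -
  interpret M3: module K M3 using M(3) by (simp add: rmodB_def)
  interpret T3: module K "tensP M3 a3" by (rule module_tensB[OF M(3) lmodB_P])
  let ?g = "\<lambda>m. g m \<ominus>\<^bsub>M3\<^esub> h m"
  have ac: "linear_map K M3 M3 (\<lambda>m. a3 m b)" if "b \<in> Bc" for b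
    using M(3) that by (simp add: rmodB_def)
  have am: "a3 (x \<ominus>\<^bsub>M3\<^esub> y) b = a3 x b \<ominus>\<^bsub>M3\<^esub> a3 y b" if "x \<in> carrier M3" "y \<in> carrier M3" "b \<in> Bc" for x y b
  proof -
    interpret group_hom "add_monoid M3" "add_monoid M3" "\<lambda>m. a3 m b"
      by (rule hom_group_hom[OF _ _ linear_map_hom[OF ac[OF that(3)]]]) (rule M3.abelian_group_axioms)+
    show ?thesis
      using that hom_inv[of y] linear_mapD(1,2)[OF ac[OF that(3)]] by (simp add: M3.minus_eq a_inv_def)
  qed
  have gh: "homB M2 a2 M3 a3 ?g"
    using g h by (auto simp: homB_def am linear_mapD intro!: lin_diff M3.module_axioms)
  have diff: "mapB M2 M3 a3 ?g u = mapB M2 M3 a3 g u \<ominus>\<^bsub>tensP M3 a3\<^esub> mapB M2 M3 a3 h u"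
    if "u \<in> carrier (tensP M2 a2)" for u
  proof (rule tensB_eqI[where A = "tensP M3 a3", OF M(2) lmodB_P mapB_linear[OF M(2,3) gh]
        lin_diff[OF mapB_linear[OF M(2,3) g] mapB_linear[OF M(2,3) h] module_tensB[OF M(3) lmodB_P]] that])
    fix m p assume mp: "m \<in> carrier M2" "p \<in> carrier P"
    interpret group_hom "add_monoid M3" "add_monoid (tensP M3 a3)" "\<lambda>m. m \<boxtimes>\<^bsub>tensP M3 a3\<^esub> p"
      by (rule hom_group_hom[OF M3.abelian_group_axioms T3.abelian_group_axioms linear_map_hom[OF tensB_pure_lin(2)[OF M(3) lmodB_P mp(2)]]])
    show "mapB M2 M3 a3 ?g (m \<boxtimes>\<^bsub>tensP M2 a2\<^esub> p) =
        mapB M2 M3 a3 g (m \<boxtimes>\<^bsub>tensP M2 a2\<^esub> p) \<ominus>\<^bsub>tensP M3 a3\<^esub> mapB M2 M3 a3 h (m \<boxtimes>\<^bsub>tensP M2 a2\<^esub> p)"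
      using mp hom_inv[of "h m"] homB_closed[OF g] homB_closed[OF h]
        linear_mapD(2)[OF tensB_pure_lin(2)[OF M(3) lmodB_P mp(2)]]
      unfolding mapB_pure[OF M(2,3) gh mp] mapB_pure[OF M(2,3) g mp] mapB_pure[OF M(2,3) h mp]
      by (simp add: M3.minus_eq T3.minus_eq a_inv_def)
  qed
  have "{m \<in> carrier M2. ?g m = \<zero>\<^bsub>M3\<^esub>} = {m \<in> carrier M2. g m = h m}"
    using homB_closed[OF g] homB_closed[OF h] by (auto simp: minus_zero_iff[OF M3.module_axioms])
  moreover have "{u \<in> carrier (tensP M2 a2). mapB M2 M3 a3 ?g u = \<zero>\<^bsub>tensP M3 a3\<^esub>} =
      {u \<in> carrier (tensP M2 a2). mapB M2 M3 a3 g u = mapB M2 M3 a3 h u}"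
    using linear_mapD(1)[OF mapB_linear[OF M(2,3) g]] linear_mapD(1)[OF mapB_linear[OF M(2,3) h]]
    by (intro Collect_cong conj_cong refl) (simp add: diff minus_zero_iff[OF T3.module_axioms])
  ultimately show ?thesis using ff_exact[OF M small f gh] by simp
qed

text \<open>Injectivity is exactness with the zero endomorphism of \<open>M\<close> as the first
  map. In this form \<open>ff_exact\<close> applies without a zero module having to be
  constructed.\<close>

lemma linear_inj_iff:
  assumes f: "linear_map K M N f" and "module K M" "module K N"
  shows "inj_on f (carrier M) \<longleftrightarrow> (\<lambda>_. \<zero>\<^bsub>M\<^esub>) ` carrier M = {m \<in> carrier M. f m = \<zero>\<^bsub>N\<^esub>}"
proof -
  interpret M: module K M by fact
  interpret N: module K N by fact
  interpret group_hom "add_monoid M" "add_monoid N" f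
    by (rule hom_group_hom[OF M.abelian_group_axioms N.abelian_group_axioms linear_map_hom[OF f]])
  have "(\<lambda>_. \<zero>\<^bsub>M\<^esub>) ` carrier M = {\<zero>\<^bsub>M\<^esub>}" using M.zero_closed by blast
  then show ?thesis
    using inj_iff_trivial_ker by (auto simp: kernel_def)
qed

lemma ff_inj:
  assumes M: "rmodB M1 a1" "rmodB M2 a2" and small: "small M1" "small M2"
    and f: "homB M1 a1 M2 a2 f"
  shows "inj_on f (carrier M1) \<longleftrightarrow> inj_on (mapB M1 M2 a2 f) (carrier (tensP M1 a1))"
proof -
  interpret M1: module K M1 using M(1) by (simp add: rmodB_def)
  have M2: "module K M2" using M(2) by (simp add: rmodB_def)
  have T: "module K (tensP M1 a1)" "module K (tensP M2 a2)"
    by (rule module_tensB[OF M(1) lmodB_P] module_tensB[OF M(2) lmodB_P])+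
  interpret T1: module K "tensP M1 a1" by (rule T)
  have z: "a1 \<zero>\<^bsub>M1\<^esub> b = \<zero>\<^bsub>M1\<^esub>" if "b \<in> Bc" for b
    using M(1) that by (intro hom_add_zero linear_map_hom) (auto simp: rmodB_def M1.abelian_group_axioms)
  have z0: "homB M1 a1 M1 a1 (\<lambda>_. \<zero>\<^bsub>M1\<^esub>)"
    by (auto simp: homB_def z linear_map_def)
  have "mapB M1 M1 a1 (\<lambda>_. \<zero>\<^bsub>M1\<^esub>) u = \<zero>\<^bsub>tensP M1 a1\<^esub>" if "u \<in> carrier (tensP M1 a1)" for u
  proof (rule tensB_eqI[where A = "tensP M1 a1", OF M(1) lmodB_P mapB_linear[OF M(1,1) z0] _ that])
    show "linear_map K (tensP M1 a1) (tensP M1 a1) (\<lambda>u. \<zero>\<^bsub>tensP M1 a1\<^esub>)"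
      by (simp add: linear_map_def)
    fix m p assume mp: "m \<in> carrier M1" "p \<in> carrier P"
    have "\<zero>\<^bsub>M1\<^esub> \<boxtimes>\<^bsub>tensP M1 a1\<^esub> p = \<zero>\<^bsub>tensP M1 a1\<^esub>"
      by (rule hom_add_zero[OF M1.abelian_group_axioms T1.abelian_group_axioms linear_map_hom[OF tensB_pure_lin(2)[OF M(1) lmodB_P mp(2)]]])
    then show "mapB M1 M1 a1 (\<lambda>_. \<zero>\<^bsub>M1\<^esub>) (m \<boxtimes>\<^bsub>tensP M1 a1\<^esub> p) = \<zero>\<^bsub>tensP M1 a1\<^esub>"
      using mp by (simp add: mapB_pure[OF M(1,1) z0])
  qed
  then have "mapB M1 M1 a1 (\<lambda>_. \<zero>\<^bsub>M1\<^esub>) ` carrier (tensP M1 a1) = (\<lambda>_. \<zero>\<^bsub>tensP M1 a1\<^esub>) ` carrier (tensP M1 a1)"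
    by (intro image_cong) simp_all
  then show ?thesis
    using ff_exact[OF M(1,1,2) small(1,1,2) z0 f]
    by (simp only: linear_inj_iff[OF homB_linear[OF f] M1.module_axioms M2] linear_inj_iff[OF mapB_linear[OF M f] T])
qed

section \<open>The isomorphism of \<open>L \<otimes>\<^sub>B P\<close> with
  \<open>P \<otimes> P\<close>\<close>

lemma homB_incl: "homB L (actR P) PP (actR P) (\<lambda>x. x)"
  by (simp add: homB_def)

lemma inclLBP_mapB: "inclLBP = mapB L PP (actR P) (\<lambda>x. x)"
  by (rule ext) (simp add: inclLBP_def mapB_def)

lemma homB_diag2: "homB PP (actR P) (PH \<otimes>\<^sub>K P) (actR PH) diag2"
  and homB_triv2: "homB PP (actR P) (PH \<otimes>\<^sub>K P) (actR PH) triv2"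
  by (simp_all add: homB_def actR_diag_triv2)

lemma small_VP: "small V \<Longrightarrow> module K V \<Longrightarrow> small (V \<otimes>\<^sub>K P)"
  by (rule small_tensor) (simp_all add: small_P)

lemma small_VH: "small V \<Longrightarrow> module K V \<Longrightarrow> small (V \<otimes>\<^sub>K H)"
  by (rule small_tensor) (simp_all add: small_H)

lemma inclLBP_inj: "inj_on inclLBP (carrier LBP)"
  using ff_inj[OF rmodB_L rmodB_actR[OF module_P] small_L small_VP[OF small_P module_P] homB_incl]
  unfolding inclLBP_mapB by (simp only: inj_on_id2)

text \<open>\<open>L\<close> is the equalizer of the right \<open>B\<close>-linear maps
  \<open>diag2\<close> and \<open>triv2\<close>, and flatness preserves equalizers. This makes
  membership in the image of \<open>L \<otimes>\<^sub>B P\<close> a checkable equation.\<close>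

lemma inclLBP_image: "inclLBP ` carrier LBP = {u \<in> carrier (VBP P). tmap2 diag2 u = tmap2 triv2 u}"
proof -
  have "(\<lambda>x. x) ` carrier L = {m \<in> carrier PP. diag2 m = triv2 m}"
    unfolding image_ident by (rule Set.set_eqI) (simp only: L_iff_diag_triv2 mem_Collect_eq)
  moreover have "small PP" "small (PH \<otimes>\<^sub>K P)"
    by (intro small_VP small_VH small_P module_P module_tensor module_H)+
  ultimately show ?thesis
    unfolding inclLBP_mapB
    using ff_equalizer[OF rmodB_L rmodB_actR[OF module_P] rmodB_actR[OF module_tensor[OF module_P module_H]]
        small_L _ _ homB_incl homB_diag2 homB_triv2] by (simp only:)
qed

lemma inclLBP_closed: "w \<in> carrier LBP \<Longrightarrow> inclLBP w \<in> carrier (VBP P)"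
  using linear_mapD(1)[OF lin_inclLBP[OF lin_id]] .

lemma multL_closed [simp]: "w \<in> carrier LBP \<Longrightarrow> multL w \<in> carrier PP"
  using linear_mapD(1)[OF lin_multL[OF lin_id]] .

text \<open>By \<open>canV_inclLBP\<close>, \<open>multL w\<close> determines
  \<open>canV P (inclLBP w)\<close> and hence \<open>inclLBP w\<close>; flatness makes
  \<open>inclLBP\<close> injective.\<close>

lemma multL_inj: "inj_on multL (carrier LBP)"
proof (rule inj_onI)
  fix w w' assume w: "w \<in> carrier LBP" "w' \<in> carrier LBP" "multL w = multL w'"
  have "canV P (inclLBP w) = canV P (inclLBP w')"
    unfolding canV_inclLBP[OF w(1)] canV_inclLBP[OF w(2)] w(3) ..
  then have "canVinv P (canV P (inclLBP w)) = canVinv P (canV P (inclLBP w'))" by (rule arg_cong)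
  then have "inclLBP w = inclLBP w'"
    unfolding canVinv_canV[OF module_P inclLBP_closed[OF w(1)]] canVinv_canV[OF module_P inclLBP_closed[OF w(2)]] .
  then show "w = w'" using w(1,2) by (rule inj_onD[OF inclLBP_inj])
qed

text \<open>The preimage is the element of \<open>tmap2_eq\<close>. It comes from some
  \<open>w\<close> by \<open>inclLBP_image\<close>, and injectivity of \<open>codiag\<close>
  identifies \<open>multL w\<close> with \<open>z\<close>.\<close>

lemma multL_surj:
  assumes z: "z \<in> carrier PP"
  shows "\<exists>w\<in>carrier LBP. multL w = z"
proof -
  have c: "canVinv P (codiag z) \<in> carrier (VBP P)"
    by (rule linear_mapD(1)[OF lin_canVinv0[OF module_P] codiag_closed])
  then have "canVinv P (codiag z) \<in> inclLBP ` carrier LBP"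
    unfolding inclLBP_image using tmap2_eq[OF z] by (intro CollectI conjI)
  then obtain w where w: "w \<in> carrier LBP" "canVinv P (codiag z) = inclLBP w" by (rule imageE)
  have "codiag (multL w) = codiag z"
    unfolding canV_inclLBP[OF w(1), symmetric] w(2)[symmetric] by simp
  then have "multL w = z" by (rule codiag_inj[OF multL_closed[OF w(1)] z])
  with w(1) show ?thesis by (intro bexI)
qed

lemma multL_image: "multL ` carrier LBP = carrier PP"
  using multL_surj multL_closed by blast

definition multLinv :: "('p, 'p) tens \<Rightarrow> (('p, 'p) tens, 'p) tens"
  where "multLinv = inv_into (carrier LBP) multL"

lemma multLinv_closed [simp]: "z \<in> carrier PP \<Longrightarrow> multLinv z \<in> carrier LBP"
  and multL_multLinv [simp]: "z \<in> carrier PP \<Longrightarrow> multL (multLinv z) = z"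
  and multLinv_multL [simp]: "w \<in> carrier LBP \<Longrightarrow> multLinv (multL w) = w"
  using multL_image multL_inj inv_into_into[of z multL "carrier LBP"] f_inv_into_f[of z multL "carrier LBP"]
  by (simp_all add: multLinv_def)

lemma lin_multLinv0 [simp]: "linear_map K PP LBP multLinv"
  by (rule linear_inverse[OF lin_multL[OF lin_id]]) simp_all

lemma lin_multLinv [simp]: "linear_map K X PP F \<Longrightarrow> linear_map K X LBP (\<lambda>x. multLinv (F x))"
  by (rule linear_map_comp[OF _ lin_multLinv0])

lemma multLinv_actR [simp]: "x \<in> carrier L \<Longrightarrow> r \<in> carrier P \<Longrightarrow> multLinv (actR P x r) = x \<boxtimes>\<^bsub>LBP\<^esub> r"
  using multLinv_multL[of "x \<boxtimes>\<^bsub>LBP\<^esub> r"] by (simp del: multLinv_multL)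

lemma actL_actR:
  assumes x: "x \<in> carrier PP" and "b \<in> carrier P" "r \<in> carrier P"
  shows "actL b (actR P x r) = actR P (actL b x) r"
  by (rule tensor_eqI[where A = "PP", OF _ _ x]) (use assms in simp_all)

lemma LBP_balanced: "x \<in> carrier L \<Longrightarrow> b \<in> Bc \<Longrightarrow> r \<in> carrier P \<Longrightarrow>
    actR P x b \<boxtimes>\<^bsub>LBP\<^esub> r = x \<boxtimes>\<^bsub>LBP\<^esub> (b \<otimes>\<^bsub>P\<^esub> r)"
  by (rule tensB_balanced) simp_all

lemma lin_actL_L [simp]: "linear_map K X L F \<Longrightarrow> b \<in> Bc \<Longrightarrow> linear_map K X L (\<lambda>x. actL b (F x))"
  and lin_actR_L [simp]: "linear_map K X L F \<Longrightarrow> b \<in> Bc \<Longrightarrow> linear_map K X L (\<lambda>x. actR P (F x) b)"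
  by (rule linear_map_comp, assumption, rule linear_map_LL, simp_all)+

text \<open>Multiplying the first leg from the left commutes with \<open>multL\<close>, which only
  touches the second leg, and hence with the inverse. This makes the construction of
  \<open>unmu\<close> independent of the representative of \<open>multLinv y\<close>.\<close>

lemma multLinv_actL:
  assumes z: "z \<in> carrier PP" and b: "b \<in> Bc"
  shows "multLinv (actL b z) = sw L P LBP (multLinv z) (\<lambda>x r. actL b x \<boxtimes>\<^bsub>LBP\<^esub> r)"
proof -
  note [simp] = b Bc_carrier[OF b]
  let ?a = "\<lambda>w. sw L P LBP w (\<lambda>x r. actL b x \<boxtimes>\<^bsub>LBP\<^esub> r)"
  have bal: "bilB L (actR P) P (monoid.mult P) LBP (\<lambda>x r. actL b x \<boxtimes>\<^bsub>LBP\<^esub> r)"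
    using b by (simp add: actL_actR LBP_balanced)
  have lin: "linear_map K LBP LBP ?a"
    by (rule lin_sw_tensB[OF rmodB_L lmodB_P _ bal]) simp
  have "multL (?a w) = actL b (multL w)" if w: "w \<in> carrier LBP" for w
  proof (rule tensB_eqI[where A = "PP", OF rmodB_L lmodB_P _ _ w])
    show "linear_map K LBP PP (\<lambda>w. multL (?a w))" using lin by (rule lin_multL)
    fix x r assume xr: "x \<in> carrier L" "r \<in> carrier P"
    have "?a (x \<boxtimes>\<^bsub>LBP\<^esub> r) = actL b x \<boxtimes>\<^bsub>LBP\<^esub> r"
      using xr by (intro sw_tensB_pure[OF rmodB_L lmodB_P _ _ _ bal]) simp_all
    then show "multL (?a (x \<boxtimes>\<^bsub>LBP\<^esub> r)) = actL b (multL (x \<boxtimes>\<^bsub>LBP\<^esub> r))"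
      using xr by (simp add: actL_actR)
  qed simp
  from this[of "multLinv z"] have "multL (?a (multLinv z)) = actL b z" using z by simp
  then have "multLinv (multL (?a (multLinv z))) = multLinv (actL b z)" by simp
  then show ?thesis using linear_mapD(1)[OF lin multLinv_closed[OF z]] by simp
qed

section \<open>The map \<open>mu\<close> on \<open>L \<otimes>\<^sub>B L\<close> and its
  injectivity\<close>

abbreviation LL :: "('k, (('p, 'p) tens, ('p, 'p) tens) tens) module"
  where "LL \<equiv> tensB L (actR P) L actL"

lemmas lin_swu_LL [simp] = lin_swu_tensB[OF rmodB_L lmodB_L]

lemma LL_balanced: "x \<in> carrier L \<Longrightarrow> b \<in> Bc \<Longrightarrow> y \<in> carrier L \<Longrightarrow>
    actR P x b \<boxtimes>\<^bsub>LL\<^esub> y = x \<boxtimes>\<^bsub>LL\<^esub> actL b y"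
  by (rule tensB_balanced) simp_all

text \<open>The action is on the outermost right leg, which \<open>mu\<close> leaves in the last
  place. It makes \<open>LL\<close> a right \<open>B\<close>-module and \<open>mu\<close> right
  \<open>B\<close>-linear, so flatness can be applied to \<open>mu\<close>.\<close>

definition actLL :: "(('p, 'p) tens, ('p, 'p) tens) tens \<Rightarrow> 'p \<Rightarrow> (('p, 'p) tens, ('p, 'p) tens) tens"
  where "actLL d b = sw L L LL d (\<lambda>x y. x \<boxtimes>\<^bsub>LL\<^esub> actR P y b)"

lemma lin_actLL [simp]: "linear_map K X LL F \<Longrightarrow> b \<in> Bc \<Longrightarrow> linear_map K X LL (\<lambda>d. actLL (F d) b)"
  unfolding actLL_def by (simp add: LL_balanced actL_actR)

lemma actLL_pure [simp]: "x \<in> carrier L \<Longrightarrow> y \<in> carrier L \<Longrightarrow> b \<in> Bc \<Longrightarrow>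
    actLL (x \<boxtimes>\<^bsub>LL\<^esub> y) b = x \<boxtimes>\<^bsub>LL\<^esub> actR P y b"
  unfolding actLL_def by (simp add: LL_balanced actL_actR)

lemma rmodB_LL [simp]: "rmodB LL actLL"
proof -
  have "actLL d (b \<oplus>\<^bsub>P\<^esub> b') = actLL d b \<oplus>\<^bsub>LL\<^esub> actLL d b'" if "b \<in> Bc" "b' \<in> Bc" for d b b'
  proof -
    have "x \<boxtimes>\<^bsub>LL\<^esub> actR P y (b \<oplus>\<^bsub>P\<^esub> b') = x \<boxtimes>\<^bsub>LL\<^esub> actR P y b \<oplus>\<^bsub>LL\<^esub> x \<boxtimes>\<^bsub>LL\<^esub> actR P y b'"
      if xy: "x \<in> carrier L" "y \<in> carrier L" for x y
      using xy \<open>b \<in> Bc\<close> \<open>b' \<in> Bc\<close> linear_mapD(2)[OF lin_actR2'[OF module_P], of b b']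
        linear_mapD(2)[OF tensB_pure_lin(1)[OF rmodB_L lmodB_L xy(1)], of "actR P y b" "actR P y b'"]
      by simp
    then have "actLL d (b \<oplus>\<^bsub>P\<^esub> b') = sw L L LL d (\<lambda>x y. x \<boxtimes>\<^bsub>LL\<^esub> actR P y b \<oplus>\<^bsub>LL\<^esub> x \<boxtimes>\<^bsub>LL\<^esub> actR P y b')"
      unfolding actLL_def by (intro sw_cong refl)
    also have "\<dots> = actLL d b \<oplus>\<^bsub>LL\<^esub> actLL d b'"
      unfolding actLL_def using that by (intro sw_add) simp_all
    finally show ?thesis .
  qed
  moreover have "actLL d (b \<otimes>\<^bsub>P\<^esub> b') = actLL (actLL d b) b'"
    if "d \<in> carrier LL" "b \<in> Bc" "b' \<in> Bc" for d b b'
    by (rule tensB_eqI[where A = LL, OF rmodB_L lmodB_L _ _ that(1)]) (use that Bc_closed in simp_all)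
  moreover have "actLL d (c \<odot>\<^bsub>P\<^esub> \<one>\<^bsub>P\<^esub>) = c \<odot>\<^bsub>LL\<^esub> d" if "d \<in> carrier LL" "c \<in> carrier K" for d c
  proof (rule tensB_eqI[where A = LL, OF rmodB_L lmodB_L _ _ that(1)])
    fix x y assume xy: "x \<in> carrier L" "y \<in> carrier L"
    have "actR P y (c \<odot>\<^bsub>P\<^esub> \<one>\<^bsub>P\<^esub>) = c \<odot>\<^bsub>PP\<^esub> y"
      using rmodB_actR[OF module_P] xy that by (simp add: rmodB_def)
    then show "actLL (x \<boxtimes>\<^bsub>LL\<^esub> y) (c \<odot>\<^bsub>P\<^esub> \<one>\<^bsub>P\<^esub>) = c \<odot>\<^bsub>LL\<^esub> (x \<boxtimes>\<^bsub>LL\<^esub> y)"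
      using xy that tensB_pure_smult(2)[OF rmodB_L lmodB_L that(2) xy] by simp
  qed (use that in simp_all)
  ultimately show ?thesis by (simp add: rmodB_def module_tensB[OF rmodB_L lmodB_L])
qed

text \<open>Bracketed to the left, so that it is of the form \<open>V \<otimes>\<^sub>K P\<close>
  with \<open>V = PP\<close> and everything about \<open>actR\<close> and \<open>canV\<close>
  applies.\<close>

abbreviation PPP :: "('k, (('p, 'p) tens, 'p) tens) module" where "PPP \<equiv> PP \<otimes>\<^sub>K P"

definition mu :: "(('p, 'p) tens, ('p, 'p) tens) tens \<Rightarrow> (('p, 'p) tens, 'p) tens"
  where "mu d = sw L L PPP d (\<lambda>x y. sw P P PPP y (\<lambda>r u. actR P x r \<boxtimes>\<^bsub>PPP\<^esub> u))"

lemma mu_bal: "bilB L (actR P) L actL PPP (\<lambda>x y. sw P P PPP y (\<lambda>r u. actR P x r \<boxtimes>\<^bsub>PPP\<^esub> u))"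
  by (simp add: actL_def sw_pull)

lemma lin_mu [simp]: "linear_map K X LL F \<Longrightarrow> linear_map K X PPP (\<lambda>d. mu (F d))"
  unfolding mu_def by (rule lin_swu_tensB[OF rmodB_L lmodB_L _ _ mu_bal]) simp_all

lemma mu_pure [simp]: "x \<in> carrier L \<Longrightarrow> y \<in> carrier L \<Longrightarrow>
    mu (x \<boxtimes>\<^bsub>LL\<^esub> y) = sw P P PPP y (\<lambda>r u. actR P x r \<boxtimes>\<^bsub>PPP\<^esub> u)"
  unfolding mu_def by (rule sw_tensB_pure[OF rmodB_L lmodB_L _ _ _ mu_bal]) simp_all

lemma lin_mu0 [simp]: "linear_map K LL PPP mu"
  using lin_mu[OF lin_id] by simp

lemma mu_closed [simp]: "mu d \<in> carrier PPP"
  by (simp add: mu_def)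

lemma actR_sw:
  assumes "module K V" "b \<in> carrier P" "\<And>m n. m \<in> carrier M \<Longrightarrow> n \<in> carrier N \<Longrightarrow> f m n \<in> carrier (V \<otimes>\<^sub>K P)"
  shows "actR V (sw M N (V \<otimes>\<^sub>K P) u f) b = sw M N (V \<otimes>\<^sub>K P) u (\<lambda>m n. actR V (f m n) b)"
  by (rule sw_linear) (use assms in simp_all)

lemma homB_mu: "homB LL actLL PPP (actR PP) mu"
proof -
  have "mu (actLL d b) = actR PP (mu d) b" if "d \<in> carrier LL" "b \<in> Bc" for d b
  proof (rule tensB_eqI[where A = PPP, OF rmodB_L lmodB_L _ _ that(1)])
    fix x y assume xy: "x \<in> carrier L" "y \<in> carrier L"
    then show "mu (actLL (x \<boxtimes>\<^bsub>LL\<^esub> y) b) = actR PP (mu (x \<boxtimes>\<^bsub>LL\<^esub> y)) b"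
      using that by (simp add: actR_sw) (simp add: actR_def[of P y] sw_pull)
  qed (use that in simp_all)
  then show ?thesis by (simp add: homB_def)
qed

abbreviation LLBP :: "('k, ((('p, 'p) tens, ('p, 'p) tens) tens, 'p) tens) module"
  where "LLBP \<equiv> tensB LL actLL P (monoid.mult P)"

lemma LLBP_balanced: "x \<in> carrier L \<Longrightarrow> y \<in> carrier L \<Longrightarrow> b \<in> Bc \<Longrightarrow> r \<in> carrier P \<Longrightarrow>
    (x \<boxtimes>\<^bsub>LL\<^esub> actR P y b) \<boxtimes>\<^bsub>LLBP\<^esub> r = (x \<boxtimes>\<^bsub>LL\<^esub> y) \<boxtimes>\<^bsub>LLBP\<^esub> (b \<otimes>\<^bsub>P\<^esub> r)"
  using tensB_balanced[OF rmodB_LL lmodB_P, of "x \<boxtimes>\<^bsub>LL\<^esub> y" b r] by simp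

definition unmu1 :: "('p, 'p) tens \<Rightarrow> (('p, 'p) tens, 'p) tens \<Rightarrow> ((('p, 'p) tens, ('p, 'p) tens) tens, 'p) tens"
  where "unmu1 x w = sw L P LLBP w (\<lambda>y v. (x \<boxtimes>\<^bsub>LL\<^esub> y) \<boxtimes>\<^bsub>LLBP\<^esub> v)"

lemma unmu1_bal: "x \<in> carrier L \<Longrightarrow> bilB L (actR P) P (monoid.mult P) LLBP (\<lambda>y v. (x \<boxtimes>\<^bsub>LL\<^esub> y) \<boxtimes>\<^bsub>LLBP\<^esub> v)"
  by (simp add: LLBP_balanced)

lemma lin_unmu1R [simp]: "x \<in> carrier L \<Longrightarrow> linear_map K X LBP F \<Longrightarrow> linear_map K X LLBP (\<lambda>w. unmu1 x (F w))"
  unfolding unmu1_def by (rule lin_swu_tensB[OF rmodB_L lmodB_P _ _ unmu1_bal]) simp_all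

lemma lin_unmu1L [simp]: "linear_map K X L F \<Longrightarrow> linear_map K X LLBP (\<lambda>x. unmu1 (F x) w)"
  unfolding unmu1_def by simp

lemma lin_unmu1L' [simp]: "linear_map K L LLBP (\<lambda>x. unmu1 x w)"
  by simp

lemma unmu1_pure [simp]: "x \<in> carrier L \<Longrightarrow> y \<in> carrier L \<Longrightarrow> v \<in> carrier P \<Longrightarrow>
    unmu1 x (y \<boxtimes>\<^bsub>LBP\<^esub> v) = (x \<boxtimes>\<^bsub>LL\<^esub> y) \<boxtimes>\<^bsub>LLBP\<^esub> v"
  unfolding unmu1_def by (rule sw_tensB_pure[OF rmodB_L lmodB_P _ _ _ unmu1_bal]) simp_all

lemma unmu1_closed [simp]: "x \<in> carrier L \<Longrightarrow> unmu1 x w \<in> carrier LLBP"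
  unfolding unmu1_def by simp

lemma unmu1_balanced:
  assumes x: "x \<in> carrier L" and b: "b \<in> Bc" and z: "z \<in> carrier PP"
  shows "unmu1 (actR P x b) (multLinv z) = unmu1 x (multLinv (actL b z))"
proof -
  have "unmu1 x (sw L P LBP w (\<lambda>y r. actL b y \<boxtimes>\<^bsub>LBP\<^esub> r)) = sw L P LLBP w (\<lambda>y r. unmu1 x (actL b y \<boxtimes>\<^bsub>LBP\<^esub> r))" for w
    by (rule sw_linear) (use x b in simp_all)
  then show ?thesis
    using x b z by (simp add: multLinv_actL) (simp add: unmu1_def LL_balanced)
qed

text \<open>
  Inverse to \<open>\<mu> \<otimes>\<^sub>B P\<close> followed by multiplication: for \<open>y = x r\<close> and \<open>r \<otimes> u = y' v\<close> with \<open>x, y' \<in> L\<close>,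
  \<open>y \<otimes> u\<close> is sent to \<open>(x \<otimes> y') \<otimes> v\<close>.
\<close>

definition unmu :: "(('p, 'p) tens, 'p) tens \<Rightarrow> ((('p, 'p) tens, ('p, 'p) tens) tens, 'p) tens"
  where "unmu z = sw PP P LLBP z (\<lambda>y u. sw L P LLBP (multLinv y) (\<lambda>x r. unmu1 x (multLinv (r \<boxtimes>\<^bsub>PP\<^esub> u))))"

lemma lin_unmu [simp]: "linear_map K X PPP F \<Longrightarrow> linear_map K X LLBP (\<lambda>x. unmu (F x))"
  unfolding unmu_def by (rule lin_swu) (simp_all add: unmu1_balanced)

lemma lin_unmu0 [simp]: "linear_map K PPP LLBP unmu"
  using lin_unmu[OF lin_id] by simp

lemma unmu_pure [simp]: "y \<in> carrier PP \<Longrightarrow> u \<in> carrier P \<Longrightarrow>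
    unmu (y \<boxtimes>\<^bsub>PPP\<^esub> u) = sw L P LLBP (multLinv y) (\<lambda>x r. unmu1 x (multLinv (r \<boxtimes>\<^bsub>PP\<^esub> u)))"
  unfolding unmu_def by (rule sw_pure_tensor) (simp_all add: unmu1_balanced)

lemma mapB_mu_lin: "linear_map K LLBP (VBP PP) (mapB LL PPP (actR PP) mu)"
  and mapB_mu_pure: "d \<in> carrier LL \<Longrightarrow> p \<in> carrier P \<Longrightarrow>
    mapB LL PPP (actR PP) mu (d \<boxtimes>\<^bsub>LLBP\<^esub> p) = mu d \<boxtimes>\<^bsub>VBP PP\<^esub> p"
  using mapB_linear[OF rmodB_LL rmodB_actR homB_mu] mapB_pure[OF rmodB_LL rmodB_actR homB_mu] by simp_all

lemma lin_multV [simp]: "module K V \<Longrightarrow> linear_map K X (VBP V) F \<Longrightarrow> linear_map K X (V \<otimes>\<^sub>K P) (\<lambda>x. multV V (F x))"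
  unfolding multV_def by simp

lemma multV_pure [simp]: "module K V \<Longrightarrow> x \<in> carrier (V \<otimes>\<^sub>K P) \<Longrightarrow> r \<in> carrier P \<Longrightarrow> multV V (x \<boxtimes>\<^bsub>VBP V\<^esub> r) = actR V x r"
  unfolding multV_def by (rule sw_tensB_pure) simp_all

text \<open>From \<open>(x \<otimes> y) \<otimes> v\<close> with \<open>y = r \<otimes> u\<close>,
  the map \<open>mu\<close> and the multiplication produce \<open>x r \<otimes> u v\<close>. Now
  \<open>multLinv\<close> splits \<open>x r\<close> into \<open>x \<otimes> r\<close>; the freed
  \<open>r\<close> joins \<open>u v\<close> to form \<open>y v\<close>, which
  \<open>multLinv\<close> splits into \<open>y \<otimes> v\<close>.\<close>

lemma unmu_multV:
  assumes w: "w \<in> carrier LLBP"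
  shows "unmu (multV PP (mapB LL PPP (actR PP) mu w)) = w"
proof (rule tensB_eqI[where A = LLBP, OF rmodB_LL lmodB_P _ _ w])
  show "linear_map K LLBP LLBP (\<lambda>w. unmu (multV PP (mapB LL PPP (actR PP) mu w)))"
    by (intro lin_unmu lin_multV mapB_mu_lin) simp
  fix d v assume d: "d \<in> carrier LL" and v: "v \<in> carrier P"
  have "unmu (actR PP (mu d) v) = d \<boxtimes>\<^bsub>LLBP\<^esub> v"
  proof (rule tensB_eqI[where A = LLBP, OF rmodB_L lmodB_L _ _ d])
    fix x y assume x: "x \<in> carrier L" and y: "y \<in> carrier L"
    have "unmu (actR PP (mu (x \<boxtimes>\<^bsub>LL\<^esub> y)) v) =
        unmu (sw P P PPP y (\<lambda>r u. actR P x r \<boxtimes>\<^bsub>PPP\<^esub> (u \<otimes>\<^bsub>P\<^esub> v)))"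
      using x y v by (simp add: actR_sw)
    also have "\<dots> = sw P P LLBP y (\<lambda>r u. unmu (actR P x r \<boxtimes>\<^bsub>PPP\<^esub> (u \<otimes>\<^bsub>P\<^esub> v)))"
      using x v by (intro sw_linear) simp_all
    also have "\<dots> = sw P P LLBP y (\<lambda>r u. unmu1 x (multLinv (r \<boxtimes>\<^bsub>PP\<^esub> (u \<otimes>\<^bsub>P\<^esub> v))))"
      using x v by (intro sw_cong refl) (simp, subst sw_tensB_pure[OF rmodB_L lmodB_P], simp_all add: unmu1_balanced)
    also have "\<dots> = unmu1 x (multLinv (actR P y v))"
    proof -
      have "linear_map K PP LLBP (\<lambda>z. unmu1 x (multLinv z))" using x by simp
      from sw_linear[OF this, of P P "\<lambda>r u. r \<boxtimes>\<^bsub>PP\<^esub> (u \<otimes>\<^bsub>P\<^esub> v)" y] show ?thesis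
        using v by (simp add: actR_def)
    qed
    also have "\<dots> = (x \<boxtimes>\<^bsub>LL\<^esub> y) \<boxtimes>\<^bsub>LLBP\<^esub> v" using x y v by simp
    finally show "unmu (actR PP (mu (x \<boxtimes>\<^bsub>LL\<^esub> y)) v) = (x \<boxtimes>\<^bsub>LL\<^esub> y) \<boxtimes>\<^bsub>LLBP\<^esub> v" .
  qed (use v in simp_all)
  then show "unmu (multV PP (mapB LL PPP (actR PP) mu (d \<boxtimes>\<^bsub>LLBP\<^esub> v))) = d \<boxtimes>\<^bsub>LLBP\<^esub> v"
    using d v by (simp add: mapB_mu_pure)
qed simp

lemma small_LL: "small LL"
  by (rule small_tensB) (simp_all add: small_L)

lemma small_PPP: "small PPP"
  by (intro small_VP small_P) simp_all

text \<open>The left inverse is available after tensoring with \<open>P\<close>; faithful flatness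
  carries injectivity back to \<open>mu\<close> itself.\<close>

lemma mu_inj: "inj_on mu (carrier LL)"
proof -
  have "inj_on (mapB LL PPP (actR PP) mu) (carrier LLBP)"
    by (rule inj_on_inverseI[where g = "\<lambda>w. unmu (multV PP w)"]) (rule unmu_multV)
  then show ?thesis
    using ff_inj[OF rmodB_LL rmodB_actR small_LL small_PPP homB_mu] by simp
qed

section \<open>The image of \<open>mu\<close>\<close>

abbreviation "PP_H \<equiv> PP \<otimes>\<^sub>K H"
abbreviation "PPPH \<equiv> PP \<otimes>\<^sub>K P \<otimes>\<^sub>K H"
abbreviation "PPHP \<equiv> PP_H \<otimes>\<^sub>K P"

text \<open>The diagonal coaction of the threefold product with \<open>H\<close> last, the place
  where \<open>canV PP\<close> puts it. It plays for \<open>mu\<close> the role that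
  \<open>codiag\<close> plays for \<open>multL\<close>.\<close>

definition codiag3 :: "(('p, 'p) tens, 'p) tens \<Rightarrow> (('p, 'p) tens, ('p, 'h) tens) tens"
  where "codiag3 z = sw PP P PPPH z (\<lambda>y u. sw P PH PPPH (codiag y) (\<lambda>p w. sw P H PPPH w (\<lambda>q h.
    sw P H PPPH (\<rho> u) (\<lambda>e f. (p \<boxtimes>\<^bsub>PP\<^esub> q) \<boxtimes>\<^bsub>PPPH\<^esub> (e \<boxtimes>\<^bsub>PH\<^esub> (h \<otimes>\<^bsub>H\<^esub> f))))))"

text \<open>
  The diagonal coaction on \<open>P \<otimes> P \<otimes> P\<close>, with \<open>H\<close> moved before the last factor as for \<open>diag2\<close>.  The image
  of \<open>\<mu>\<close> is the equalizer of \<open>diag3\<close> and \<open>triv3\<close>.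
\<close>

definition diag3 :: "(('p, 'p) tens, 'p) tens \<Rightarrow> ((('p, 'p) tens, 'h) tens, 'p) tens"
  where "diag3 z = sw PP P PPHP z (\<lambda>y u. sw P PH PPHP (codiag y) (\<lambda>p w. sw P H PPHP w (\<lambda>q h.
    sw P H PPHP (\<rho> u) (\<lambda>e f. ((p \<boxtimes>\<^bsub>PP\<^esub> q) \<boxtimes>\<^bsub>PP_H\<^esub> (h \<otimes>\<^bsub>H\<^esub> f)) \<boxtimes>\<^bsub>PPHP\<^esub> e))))"

definition triv3 :: "(('p, 'p) tens, 'p) tens \<Rightarrow> ((('p, 'p) tens, 'h) tens, 'p) tens"
  where "triv3 z = sw PP P PPHP z (\<lambda>y u. (y \<boxtimes>\<^bsub>PP_H\<^esub> \<one>\<^bsub>H\<^esub>) \<boxtimes>\<^bsub>PPHP\<^esub> u)"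

lemma lin_codiag' [simp]: "linear_map K PP PPH codiag"
  using lin_codiag[OF lin_id] by simp

lemma lin_codiag3 [simp]: "linear_map K X PPP F \<Longrightarrow> linear_map K X PPPH (\<lambda>x. codiag3 (F x))"
  and lin_diag3 [simp]: "linear_map K X PPP F \<Longrightarrow> linear_map K X PPHP (\<lambda>x. diag3 (F x))"
  and lin_triv3 [simp]: "linear_map K X PPP F \<Longrightarrow> linear_map K X PPHP (\<lambda>x. triv3 (F x))"
  by (simp_all add: codiag3_def diag3_def triv3_def)

lemma lin_diag3' [simp]: "linear_map K PPP PPHP diag3" and lin_triv3' [simp]: "linear_map K PPP PPHP triv3"
  using lin_diag3[OF lin_id] lin_triv3[OF lin_id] by simp_all

lemma diag_triv3_closed [simp]: "diag3 z \<in> carrier PPHP" "triv3 z \<in> carrier PPHP"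
  by (simp_all add: diag3_def triv3_def)

lemma diag_triv3_pure:
  assumes "y \<in> carrier PP" "u \<in> carrier P"
  shows "diag3 (y \<boxtimes>\<^bsub>PPP\<^esub> u) = sw P PH PPHP (codiag y) (\<lambda>p w. sw P H PPHP w (\<lambda>q h.
      sw P H PPHP (\<rho> u) (\<lambda>e f. ((p \<boxtimes>\<^bsub>PP\<^esub> q) \<boxtimes>\<^bsub>PP_H\<^esub> (h \<otimes>\<^bsub>H\<^esub> f)) \<boxtimes>\<^bsub>PPHP\<^esub> e)))"
    and "triv3 (y \<boxtimes>\<^bsub>PPP\<^esub> u) = (y \<boxtimes>\<^bsub>PP_H\<^esub> \<one>\<^bsub>H\<^esub>) \<boxtimes>\<^bsub>PPHP\<^esub> u"
    and "codiag3 (y \<boxtimes>\<^bsub>PPP\<^esub> u) = sw P PH PPPH (codiag y) (\<lambda>p w. sw P H PPPH w (\<lambda>q h.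
      sw P H PPPH (\<rho> u) (\<lambda>e f. (p \<boxtimes>\<^bsub>PP\<^esub> q) \<boxtimes>\<^bsub>PPPH\<^esub> (e \<boxtimes>\<^bsub>PH\<^esub> (h \<otimes>\<^bsub>H\<^esub> f)))))"
  using assms by (simp_all add: diag3_def triv3_def codiag3_def)

lemma diag_triv3_actR:
  assumes z: "z \<in> carrier PPP" and b: "b \<in> Bc"
  shows "diag3 (actR PP z b) = actR PP_H (diag3 z) b" "triv3 (actR PP z b) = actR PP_H (triv3 z) b"
proof -
  note [simp] = b Bc_carrier[OF b]
  show "diag3 (actR PP z b) = actR PP_H (diag3 z) b"
    by (rule tensor_eqI[where A = PPHP, OF _ _ z]) (simp_all add: diag_triv3_pure actR_sw sw_coact_coinv(1))
  show "triv3 (actR PP z b) = actR PP_H (triv3 z) b"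
    by (rule tensor_eqI[where A = PPHP, OF _ _ z]) (simp_all add: diag_triv3_pure)
qed

lemma homB_diag3: "homB PPP (actR PP) PPHP (actR PP_H) diag3" and homB_triv3: "homB PPP (actR PP) PPHP (actR PP_H) triv3"
  by (simp_all add: homB_def diag_triv3_actR)

abbreviation "tmap3 \<equiv> mapB PPP PPHP (actR PP_H)"
abbreviation "mapmu \<equiv> mapB LL PPP (actR PP) mu"

text \<open>The value of \<open>canV PP_H\<close> carries two \<open>H\<close>-factors, one from
  \<open>diag3\<close> or \<open>triv3\<close> and one from the coaction of the extra element of
  \<open>P\<close>. They are merged here by multiplication.\<close>

definition collect3 :: "((('p, 'p) tens, 'h) tens, ('p, 'h) tens) tens \<Rightarrow> (('p, 'p) tens, ('p, 'h) tens) tens"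
  where "collect3 z = sw PP_H PH PPPH z (\<lambda>x s. sw PP H PPPH x (\<lambda>y h. sw P H PPPH s (\<lambda>e f.
    y \<boxtimes>\<^bsub>PPPH\<^esub> (e \<boxtimes>\<^bsub>PH\<^esub> (h \<otimes>\<^bsub>H\<^esub> f)))))"

lemma lin_collect3 [simp]: "linear_map K X (PP_H \<otimes>\<^sub>K P \<otimes>\<^sub>K H) F \<Longrightarrow> linear_map K X PPPH (\<lambda>x. collect3 (F x))"
  by (simp add: collect3_def)

lemma tmap3_lin: "linear_map K (VBP PP) (VBP PP_H) (tmap3 diag3)" "linear_map K (VBP PP) (VBP PP_H) (tmap3 triv3)"
  and tmap3_pure: "z \<in> carrier PPP \<Longrightarrow> p \<in> carrier P \<Longrightarrow> tmap3 diag3 (z \<boxtimes>\<^bsub>VBP PP\<^esub> p) = diag3 z \<boxtimes>\<^bsub>VBP PP_H\<^esub> p"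
    "z \<in> carrier PPP \<Longrightarrow> p \<in> carrier P \<Longrightarrow> tmap3 triv3 (z \<boxtimes>\<^bsub>VBP PP\<^esub> p) = triv3 z \<boxtimes>\<^bsub>VBP PP_H\<^esub> p"
  using mapB_linear[OF rmodB_actR rmodB_actR homB_diag3] mapB_linear[OF rmodB_actR rmodB_actR homB_triv3]
    mapB_pure[OF rmodB_actR rmodB_actR homB_diag3] mapB_pure[OF rmodB_actR rmodB_actR homB_triv3] by simp_all

text \<open>Apply \<open>canV PP_H\<close> and then \<open>collect3\<close> to both sides of
  \<open>eq\<close>. On the \<open>diag3\<close> side the merged \<open>H\<close>-leg is the full
  diagonal coaction of the multiplied element; on the \<open>triv3\<close> side the leg
  \<open>\<one>\<close> disappears and \<open>canV PP w\<close> is left.\<close>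

lemma canV_kernel3:
  assumes w: "w \<in> carrier (VBP PP)" and eq: "tmap3 diag3 w = tmap3 triv3 w"
  shows "canV PP w = codiag3 (multV PP w)"
proof -
  have "collect3 (canV PP_H (tmap3 diag3 w)) = codiag3 (multV PP w)"
  proof (rule tensB_eqI[where A = PPPH, OF rmodB_actR lmodB_P _ _ w])
    show "linear_map K (VBP PP) PPPH (\<lambda>w. collect3 (canV PP_H (tmap3 diag3 w)))"
      by (intro lin_collect3 lin_canV tmap3_lin) simp
    fix x r assume x: "x \<in> carrier PPP" and r: "r \<in> carrier P"
    have "collect3 (canV PP_H (diag3 x \<boxtimes>\<^bsub>VBP PP_H\<^esub> r)) = codiag3 (actR PP x r)"
    proof (rule tensor_eqI[where A = PPPH, OF _ _ x])
      fix y u assume "y \<in> carrier PP" "u \<in> carrier P"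
      then show "collect3 (canV PP_H (diag3 (y \<boxtimes>\<^bsub>PPP\<^esub> u) \<boxtimes>\<^bsub>VBP PP_H\<^esub> r)) = codiag3 (actR PP (y \<boxtimes>\<^bsub>PPP\<^esub> u) r)"
        using r by (simp add: diag_triv3_pure collect3_def sw_pull sw_coact_mult)
    qed (use r in simp_all)
    then show "collect3 (canV PP_H (tmap3 diag3 (x \<boxtimes>\<^bsub>VBP PP\<^esub> r))) = codiag3 (multV PP (x \<boxtimes>\<^bsub>VBP PP\<^esub> r))"
      using x r by (simp add: tmap3_pure del: canV_pure)
  qed simp_all
  moreover have "collect3 (canV PP_H (tmap3 triv3 w)) = canV PP w"
  proof (rule tensB_eqI[where A = PPPH, OF rmodB_actR lmodB_P _ _ w])
    show "linear_map K (VBP PP) PPPH (\<lambda>w. collect3 (canV PP_H (tmap3 triv3 w)))"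
      by (intro lin_collect3 lin_canV tmap3_lin) simp
    fix x r assume x: "x \<in> carrier PPP" and r: "r \<in> carrier P"
    have "collect3 (canV PP_H (triv3 x \<boxtimes>\<^bsub>VBP PP_H\<^esub> r)) = canV PP (x \<boxtimes>\<^bsub>VBP PP\<^esub> r)"
    proof (rule tensor_eqI[where A = PPPH, OF _ _ x])
      fix y u assume "y \<in> carrier PP" "u \<in> carrier P"
      then show "collect3 (canV PP_H (triv3 (y \<boxtimes>\<^bsub>PPP\<^esub> u) \<boxtimes>\<^bsub>VBP PP_H\<^esub> r)) = canV PP ((y \<boxtimes>\<^bsub>PPP\<^esub> u) \<boxtimes>\<^bsub>VBP PP\<^esub> r)"
        using r by (simp add: diag_triv3_pure collect3_def sw_pull)
    qed (use r in simp_all)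
    then show "collect3 (canV PP_H (tmap3 triv3 (x \<boxtimes>\<^bsub>VBP PP\<^esub> r))) = canV PP (x \<boxtimes>\<^bsub>VBP PP\<^esub> r)"
      using x r by (simp add: tmap3_pure del: canV_pure)
  qed simp_all
  ultimately show ?thesis using eq by simp
qed

lemma canV_mapmu_unmu1:
  assumes x: "x \<in> carrier L" and w: "w \<in> carrier LBP"
  shows "canV PP (mapmu (unmu1 x w)) =
    sw P PH PPPH (canV P (inclLBP w)) (\<lambda>r s. actR P x r \<boxtimes>\<^bsub>PPPH\<^esub> s)"
proof (rule tensB_eqI[where A = PPPH, OF rmodB_L lmodB_P _ _ w])
  show "linear_map K LBP PPPH (\<lambda>w. canV PP (mapmu (unmu1 x w)))"
    by (intro lin_canV linear_map_comp[OF _ mapB_mu_lin] lin_unmu1R x lin_id) simp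
  fix y v assume y: "y \<in> carrier L" and v: "v \<in> carrier P"
  show "canV PP (mapmu (unmu1 x (y \<boxtimes>\<^bsub>LBP\<^esub> v))) =
      sw P PH PPPH (canV P (inclLBP (y \<boxtimes>\<^bsub>LBP\<^esub> v))) (\<lambda>r s. actR P x r \<boxtimes>\<^bsub>PPPH\<^esub> s)"
    using x y v by (simp add: mapB_mu_pure sw_pull)
qed (use x in simp_all)

text \<open>With \<open>canV_kernel3\<close>, this shows that \<open>unmu\<close> inverts
  \<open>mapmu\<close> on the equalizer. The element \<open>multLinv y\<close> cannot be evaluated
  directly, so the calculation is made for an arbitrary element of \<open>LBP\<close> in its place;
  \<open>canV_inclLBP\<close> then restores \<open>codiag y\<close>, as
  \<open>multL (multLinv y) = y\<close>.\<close>

lemma canV_mapmu_unmu: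
  assumes z: "z \<in> carrier PPP"
  shows "canV PP (mapmu (unmu z)) = codiag3 z"
proof -
  have lin: "linear_map K LLBP PPPH (\<lambda>t. canV PP (mapmu t))"
    by (intro lin_canV linear_map_comp[OF _ mapB_mu_lin] lin_id) simp
  show ?thesis
  proof (rule tensor_eqI[where A = PPPH, OF _ _ z])
    show "linear_map K PPP PPPH (\<lambda>z. canV PP (mapmu (unmu z)))"
      by (rule linear_map_comp[OF lin_unmu0 lin])
    fix y u assume y: "y \<in> carrier PP" and u [simp]: "u \<in> carrier P"
    have "canV PP (mapmu (unmu (y \<boxtimes>\<^bsub>PPP\<^esub> u))) =
        sw L P PPPH (multLinv y) (\<lambda>x r. canV PP (mapmu (unmu1 x (multLinv (r \<boxtimes>\<^bsub>PP\<^esub> u)))))"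
      unfolding unmu_pure[OF y u] by (rule sw_linear[OF lin]) simp_all
    also have "\<dots> = sw L P PPPH (multLinv y) (\<lambda>x r. sw P H PPPH (\<rho> r) (\<lambda>a b. sw P H PPPH (\<rho> u) (\<lambda>c d.
        actR P x a \<boxtimes>\<^bsub>PPPH\<^esub> (c \<boxtimes>\<^bsub>PH\<^esub> (b \<otimes>\<^bsub>H\<^esub> d)))))"
      by (intro sw_cong refl) (simp add: canV_mapmu_unmu1 canV_inclLBP codiag_pure sw_pull)
    also have "\<dots> = sw P PH PPPH (canV P (inclLBP (multLinv y))) (\<lambda>p w. sw P H PPPH w (\<lambda>q h.
      sw P H PPPH (\<rho> u) (\<lambda>e f. (p \<boxtimes>\<^bsub>PP\<^esub> q) \<boxtimes>\<^bsub>PPPH\<^esub> (e \<boxtimes>\<^bsub>PH\<^esub> (h \<otimes>\<^bsub>H\<^esub> f)))))"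
      (is "?l (multLinv y) = ?r (multLinv y)")
    proof (rule tensB_eqI[where A = PPPH and f = ?l and g = ?r, OF rmodB_L lmodB_P])
      have bal: "bilB L (actR P) P (monoid.mult P) PPPH (\<lambda>x r. sw P H PPPH (\<rho> r) (\<lambda>a b. sw P H PPPH (\<rho> u) (\<lambda>c d.
          actR P x a \<boxtimes>\<^bsub>PPPH\<^esub> (c \<boxtimes>\<^bsub>PH\<^esub> (b \<otimes>\<^bsub>H\<^esub> d)))))"
        by (simp add: sw_coact_coinv_left)
      show "linear_map K LBP PPPH ?l"
        by (rule lin_sw_tensB[OF rmodB_L lmodB_P _ bal]) simp
      fix x r assume x: "x \<in> carrier L" and r [simp]: "r \<in> carrier P"
      have xP: "x \<in> carrier PP" using x by simp
      have "?l (x \<boxtimes>\<^bsub>LBP\<^esub> r) = sw P H PPPH (\<rho> r) (\<lambda>a b. sw P H PPPH (\<rho> u) (\<lambda>c d.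
          actR P x a \<boxtimes>\<^bsub>PPPH\<^esub> (c \<boxtimes>\<^bsub>PH\<^esub> (b \<otimes>\<^bsub>H\<^esub> d))))"
        by (rule sw_tensB_pure[OF rmodB_L lmodB_P _ x r bal]) simp
      also have "\<dots> = sw P PH PPPH (canV P (x \<boxtimes>\<^bsub>VBP P\<^esub> r)) (\<lambda>p w. sw P H PPPH w (\<lambda>q h.
          sw P H PPPH (\<rho> u) (\<lambda>e f. (p \<boxtimes>\<^bsub>PP\<^esub> q) \<boxtimes>\<^bsub>PPPH\<^esub> (e \<boxtimes>\<^bsub>PH\<^esub> (h \<otimes>\<^bsub>H\<^esub> f)))))"
        by (rule tensor_eqI[where A = PPPH, OF _ _ xP]) (simp_all add: sw_pull)
      finally show "?l (x \<boxtimes>\<^bsub>LBP\<^esub> r) = ?r (x \<boxtimes>\<^bsub>LBP\<^esub> r)" using x by simp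
    qed (use y in simp_all)
    also have "\<dots> = codiag3 (y \<boxtimes>\<^bsub>PPP\<^esub> u)"
      using y by (simp add: canV_inclLBP diag_triv3_pure)
    finally show "canV PP (mapmu (unmu (y \<boxtimes>\<^bsub>PPP\<^esub> u))) = codiag3 (y \<boxtimes>\<^bsub>PPP\<^esub> u)" .
  qed simp_all
qed

lemma codiag_actR_L:
  assumes "x \<in> carrier L" "r \<in> carrier P"
  shows "codiag (actR P x r) = canV P (x \<boxtimes>\<^bsub>VBP P\<^esub> r)"
  using canV_inclLBP[of "x \<boxtimes>\<^bsub>LBP\<^esub> r"] assms by (simp del: canV_pure)

text \<open>The \<open>H\<close>-legs of \<open>x\<close> stand together before those of
  \<open>y\<close>. Coinvariance of \<open>x\<close> deletes the first group, through
  \<open>codiag_actR_L\<close>, and coinvariance of \<open>y\<close> deletes the second.\<close>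

lemma diag3_mu:
  assumes d: "d \<in> carrier LL"
  shows "diag3 (mu d) = triv3 (mu d)"
proof (rule tensB_eqI[where A = PPHP, OF rmodB_L lmodB_L _ _ d])
  fix x y assume x: "x \<in> carrier L" and y: "y \<in> carrier L"
  have "diag3 (mu (x \<boxtimes>\<^bsub>LL\<^esub> y)) = sw P P PPHP y (\<lambda>r u. diag3 (actR P x r \<boxtimes>\<^bsub>PPP\<^esub> u))"
    unfolding mu_pure[OF x y] by (rule sw_linear) simp_all
  also have "\<dots> = sw P P PPHP y (\<lambda>r u. sw P P PPHP x (\<lambda>p q. sw P H PPHP (\<rho> r) (\<lambda>a b. sw P H PPHP (\<rho> u) (\<lambda>e f.
      ((p \<boxtimes>\<^bsub>PP\<^esub> (q \<otimes>\<^bsub>P\<^esub> a)) \<boxtimes>\<^bsub>PP_H\<^esub> (b \<otimes>\<^bsub>H\<^esub> f)) \<boxtimes>\<^bsub>PPHP\<^esub> e))))"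
    using x by (intro sw_cong refl) (simp add: diag_triv3_pure codiag_actR_L sw_pull)
  also have "\<dots> = sw P P PPHP x (\<lambda>p q. sw P P PPHP y (\<lambda>r u. sw P H PPHP (\<rho> r) (\<lambda>a b. sw P H PPHP (\<rho> u) (\<lambda>e f.
      ((p \<boxtimes>\<^bsub>PP\<^esub> (q \<otimes>\<^bsub>P\<^esub> a)) \<boxtimes>\<^bsub>PP_H\<^esub> (b \<otimes>\<^bsub>H\<^esub> f)) \<boxtimes>\<^bsub>PPHP\<^esub> e))))"
    by (rule sw_swap) simp_all
  also have "\<dots> = sw P P PPHP x (\<lambda>p q. sw P P PPHP y (\<lambda>r u.
      ((p \<boxtimes>\<^bsub>PP\<^esub> (q \<otimes>\<^bsub>P\<^esub> r)) \<boxtimes>\<^bsub>PP_H\<^esub> \<one>\<^bsub>H\<^esub>) \<boxtimes>\<^bsub>PPHP\<^esub> u))"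
    by (intro sw_cong refl sw_coinv[OF y, where f = "\<lambda>a e h. ((_ \<boxtimes>\<^bsub>PP\<^esub> (_ \<otimes>\<^bsub>P\<^esub> a)) \<boxtimes>\<^bsub>PP_H\<^esub> h) \<boxtimes>\<^bsub>PPHP\<^esub> e"])
      (simp_all add: trilinear_def)
  also have "\<dots> = sw P P PPHP y (\<lambda>r u. sw P P PPHP x (\<lambda>p q.
      ((p \<boxtimes>\<^bsub>PP\<^esub> (q \<otimes>\<^bsub>P\<^esub> r)) \<boxtimes>\<^bsub>PP_H\<^esub> \<one>\<^bsub>H\<^esub>) \<boxtimes>\<^bsub>PPHP\<^esub> u))"
    by (rule sw_swap) simp_all
  also have "\<dots> = sw P P PPHP y (\<lambda>r u. triv3 (actR P x r \<boxtimes>\<^bsub>PPP\<^esub> u))"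
    by (intro sw_cong refl) (simp add: triv3_def actR_def[of P x] sw_pull)
  also have "\<dots> = triv3 (mu (x \<boxtimes>\<^bsub>LL\<^esub> y))"
    unfolding mu_pure[OF x y] by (rule sw_linear[symmetric]) simp_all
  finally show "diag3 (mu (x \<boxtimes>\<^bsub>LL\<^esub> y)) = triv3 (mu (x \<boxtimes>\<^bsub>LL\<^esub> y))" .
qed simp_all

text \<open>One inclusion is functoriality and \<open>diag3_mu\<close>. For the other,
  \<open>unmu (multV PP w)\<close> is a preimage of \<open>w\<close>, because \<open>canV PP\<close>
  takes the same value on its image and on \<open>w\<close>, and \<open>canV PP\<close> is
  injective.\<close>

lemma mapmu_image: "mapmu ` carrier LLBP = {w \<in> carrier (VBP PP). tmap3 diag3 w = tmap3 triv3 w}"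
proof (intro equalityI subsetI)
  fix w assume "w \<in> mapmu ` carrier LLBP"
  then obtain t where t: "t \<in> carrier LLBP" "w = mapmu t" by (rule imageE)
  have "tmap3 diag3 (mapmu t) = tmap3 triv3 (mapmu t)"
    unfolding mapB_comp[OF rmodB_LL rmodB_actR[OF module_tensor[OF module_P module_P]] rmodB_actR homB_mu homB_diag3 t(1), simplified]
      mapB_comp[OF rmodB_LL rmodB_actR[OF module_tensor[OF module_P module_P]] rmodB_actR homB_mu homB_triv3 t(1), simplified]
    by (rule fun_cong[OF mapB_cong]) (rule diag3_mu)
  moreover have "w \<in> carrier (VBP PP)" unfolding t(2) by (rule linear_mapD(1)[OF mapB_mu_lin t(1)])
  ultimately show "w \<in> {w \<in> carrier (VBP PP). tmap3 diag3 w = tmap3 triv3 w}" unfolding t(2) by (intro CollectI conjI)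
next
  fix w assume "w \<in> {w \<in> carrier (VBP PP). tmap3 diag3 w = tmap3 triv3 w}"
  then have w: "w \<in> carrier (VBP PP)" "tmap3 diag3 w = tmap3 triv3 w" by (simp_all only: mem_Collect_eq)
  let ?z = "multV PP w"
  have z: "?z \<in> carrier PPP" by (rule linear_mapD(1)[OF lin_multV[OF _ lin_id] w(1)]) simp
  have t: "unmu ?z \<in> carrier LLBP" by (rule linear_mapD(1)[OF lin_unmu0 z])
  have "canV PP (mapmu (unmu ?z)) = canV PP w"
    unfolding canV_mapmu_unmu[OF z] canV_kernel3[OF w] ..
  then have "canVinv PP (canV PP (mapmu (unmu ?z))) = canVinv PP (canV PP w)" by (rule arg_cong)
  then have "mapmu (unmu ?z) = w"
    using w(1) linear_mapD(1)[OF mapB_mu_lin t] by (simp only: canVinv_canV module_tensor module_P)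
  with t show "w \<in> mapmu ` carrier LLBP" by (intro image_eqI) (rule sym)
qed

text \<open>Here faithfulness is used in the direction of descent: the sequence is exact after
  tensoring by \<open>mapmu_image\<close>, hence it was exact before.\<close>

lemma mu_image: "mu ` carrier LL = {z \<in> carrier PPP. diag3 z = triv3 z}"
proof -
  have "module K PP" "module K PP_H" by simp_all
  moreover from this have "small PPHP" by (intro small_VP small_VH small_P module_P)
  ultimately show ?thesis
    using ff_equalizer[OF rmodB_LL rmodB_actR rmodB_actR small_LL small_PPP _ homB_mu homB_diag3 homB_triv3] mapmu_image
    by (simp only:)
qed

text \<open>The shadow of the coproduct under \<open>mu\<close>: multiplying the two legs of
  \<open>\<tau> h\<close> gives \<open>\<epsilon> h\<close> times \<open>\<one>\<close>, so the
  translation map disappears from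
  \<open>p\<^sub>0 \<otimes> \<tau> p\<^sub>1 \<otimes> q\<close>.\<close>

definition insert_one :: "('p, 'p) tens \<Rightarrow> (('p, 'p) tens, 'p) tens"
  where "insert_one x = sw P P PPP x (\<lambda>p q. (p \<boxtimes>\<^bsub>PP\<^esub> \<one>\<^bsub>P\<^esub>) \<boxtimes>\<^bsub>PPP\<^esub> q)"

lemma insert_one_closed [simp]: "insert_one x \<in> carrier PPP"
  by (simp add: insert_one_def)

lemma insert_one_in_image:
  assumes x: "x \<in> carrier L"
  shows "\<exists>d\<in>carrier LL. mu d = insert_one x"
proof -
  have "diag3 (insert_one x) = sw P P PPHP x (\<lambda>p q. diag3 ((p \<boxtimes>\<^bsub>PP\<^esub> \<one>\<^bsub>P\<^esub>) \<boxtimes>\<^bsub>PPP\<^esub> q))"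
    unfolding insert_one_def by (rule sw_linear) simp_all
  also have "\<dots> = sw P P PPHP x (\<lambda>p q. sw P H PPHP (\<rho> p) (\<lambda>a b. sw P H PPHP (\<rho> q) (\<lambda>c d.
      ((a \<boxtimes>\<^bsub>PP\<^esub> \<one>\<^bsub>P\<^esub>) \<boxtimes>\<^bsub>PP_H\<^esub> (b \<otimes>\<^bsub>H\<^esub> d)) \<boxtimes>\<^bsub>PPHP\<^esub> c)))"
    by (intro sw_cong refl) (simp add: diag_triv3_pure codiag_pure sw_pull)
  also have "\<dots> = sw P P PPHP x (\<lambda>p q. ((p \<boxtimes>\<^bsub>PP\<^esub> \<one>\<^bsub>P\<^esub>) \<boxtimes>\<^bsub>PP_H\<^esub> \<one>\<^bsub>H\<^esub>) \<boxtimes>\<^bsub>PPHP\<^esub> q)"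
    by (rule sw_coinv[OF x]) (simp_all add: trilinear_def)
  also have "\<dots> = triv3 (insert_one x)"
    unfolding insert_one_def by (subst sw_linear[of PPP PPHP triv3]) (simp_all add: diag_triv3_pure)
  finally have "insert_one x \<in> mu ` carrier LL"
    unfolding mu_image by (intro CollectI conjI insert_one_closed)
  then obtain d where "d \<in> carrier LL" "insert_one x = mu d" by (rule imageE)
  then show ?thesis by (intro bexI[of _ d]) (rule sym)
qed

end

text \<open>The bialgebroid acts by products with sources and targets, while \<open>tensB\<close>
  uses \<open>actR\<close> and \<open>actL\<close>. These functions agree only on the carriers,
  which is all that the relators see.\<close>

lemma tensor_over_act_cong:
  assumes "\<And>m r. m \<in> carrier M \<Longrightarrow> r \<in> R \<Longrightarrow> rho m r = rho' m r"
    and "\<And>n r. n \<in> carrier N \<Longrightarrow> r \<in> R \<Longrightarrow> lam r n = lam' r n"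
  shows "tensor_over R M rho N lam = tensor_over R M rho' N lam'"
proof -
  have "{frag_of (rho m r, n) - frag_of (m, lam r n) | m r n. m \<in> carrier M \<and> r \<in> R \<and> n \<in> carrier N} =
      {frag_of (rho' m r, n) - frag_of (m, lam' r n) | m r n. m \<in> carrier M \<and> r \<in> R \<and> n \<in> carrier N}"
    by (rule Collect_cong, (rule iff_exI)+) (auto simp: assms)
  then show ?thesis
    by (simp add: tensor_over_def tensor_relators_def)
qed

context galois_ff
begin

section \<open>The coproduct\<close>

abbreviation E :: "('k, (('p, 'p) tens, ('p, 'p) tens) tens) module"
  where "E \<equiv> tensB PP (actR P) PP actL"

lemma E_balanced: "x \<in> carrier PP \<Longrightarrow> b \<in> Bc \<Longrightarrow> y \<in> carrier PP \<Longrightarrow>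
    actR P x b \<boxtimes>\<^bsub>E\<^esub> y = x \<boxtimes>\<^bsub>E\<^esub> actL b y"
  by (rule tensB_balanced) simp_all

lemmas lin_swu_E [simp] = lin_swu_tensB[OF rmodB_actR[OF module_P] lmodB_actL]
lemmas sw_E_sw = sw_tensB_sw[OF rmodB_actR[OF module_P] lmodB_actL]

definition iota :: "(('p, 'p) tens, ('p, 'p) tens) tens \<Rightarrow> (('p, 'p) tens, ('p, 'p) tens) tens"
  where "iota d = sw L L E d (\<lambda>x y. x \<boxtimes>\<^bsub>E\<^esub> y)"

definition delta :: "('p, 'p) tens \<Rightarrow> (('p, 'p) tens, ('p, 'p) tens) tens"
  where "delta x = sw P P E x (\<lambda>p q. sw P H E (\<rho> p) (\<lambda>a b.
    sw P P E (caninv (\<one>\<^bsub>P\<^esub> \<boxtimes>\<^bsub>PH\<^esub> b)) (\<lambda>u v. (a \<boxtimes>\<^bsub>PP\<^esub> u) \<boxtimes>\<^bsub>E\<^esub> (v \<boxtimes>\<^bsub>PP\<^esub> q))))"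

text \<open>
  Recovers \<open>iota d\<close> from \<open>mu d\<close>, since \<open>canVinv P (codiag (x r)) = x \<otimes> r\<close> for \<open>x \<in> L\<close>.
\<close>

definition omega :: "(('p, 'p) tens, 'p) tens \<Rightarrow> (('p, 'p) tens, ('p, 'p) tens) tens"
  where "omega z = sw PP P E z (\<lambda>y u. sw PP P E (canVinv P (codiag y)) (\<lambda>x r. x \<boxtimes>\<^bsub>E\<^esub> (r \<boxtimes>\<^bsub>PP\<^esub> u)))"

text \<open>An extension of \<open>mu\<close> to the ambient product, through which
  \<open>mu\<close> factors by \<open>muE_iota\<close>. Injectivity of \<open>mu\<close> therefore
  gives injectivity of \<open>iota\<close>, that is, uniqueness of the coproduct.\<close>

definition muE :: "(('p, 'p) tens, ('p, 'p) tens) tens \<Rightarrow> (('p, 'p) tens, 'p) tens"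
  where "muE e = sw PP PP PPP e (\<lambda>x y. sw P P PPP y (\<lambda>r u. actR P x r \<boxtimes>\<^bsub>PPP\<^esub> u))"

lemma iota_bal: "bilB L (actR P) L actL E (\<lambda>x y. x \<boxtimes>\<^bsub>E\<^esub> y)"
  by (simp add: E_balanced)

lemma lin_iota [simp]: "linear_map K X LL F \<Longrightarrow> linear_map K X E (\<lambda>d. iota (F d))"
  unfolding iota_def by (rule lin_swu_tensB[OF rmodB_L lmodB_L _ _ iota_bal]) simp_all

lemma iota_pure [simp]: "x \<in> carrier L \<Longrightarrow> y \<in> carrier L \<Longrightarrow> iota (x \<boxtimes>\<^bsub>LL\<^esub> y) = x \<boxtimes>\<^bsub>E\<^esub> y"
  unfolding iota_def by (rule sw_tensB_pure[OF rmodB_L lmodB_L _ _ _ iota_bal]) simp_all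

lemma muE_bal: "bilB PP (actR P) PP actL PPP (\<lambda>x y. sw P P PPP y (\<lambda>r u. actR P x r \<boxtimes>\<^bsub>PPP\<^esub> u))"
  by (simp add: actL_def sw_pull)

lemma lin_muE [simp]: "linear_map K X E F \<Longrightarrow> linear_map K X PPP (\<lambda>e. muE (F e))"
  unfolding muE_def by (rule lin_swu_E[OF _ _ muE_bal]) simp_all

lemma muE_pure: "x \<in> carrier PP \<Longrightarrow> y \<in> carrier PP \<Longrightarrow>
    muE (x \<boxtimes>\<^bsub>E\<^esub> y) = sw P P PPP y (\<lambda>r u. actR P x r \<boxtimes>\<^bsub>PPP\<^esub> u)"
  unfolding muE_def by (rule sw_tensB_pure[OF rmodB_actR[OF module_P] lmodB_actL _ _ _ muE_bal]) simp_all

lemma muE_iota: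
  assumes d: "d \<in> carrier LL"
  shows "muE (iota d) = mu d"
  by (rule tensB_eqI[where A = PPP, OF rmodB_L lmodB_L _ _ d]) (simp_all add: muE_pure)

lemma lin_omega [simp]: "linear_map K X PPP F \<Longrightarrow> linear_map K X E (\<lambda>x. omega (F x))"
  unfolding omega_def by (rule lin_swu) (simp_all add: E_balanced)

lemma omega_pure: "y \<in> carrier PP \<Longrightarrow> u \<in> carrier P \<Longrightarrow>
    omega (y \<boxtimes>\<^bsub>PPP\<^esub> u) = sw PP P E (canVinv P (codiag y)) (\<lambda>x r. x \<boxtimes>\<^bsub>E\<^esub> (r \<boxtimes>\<^bsub>PP\<^esub> u))"
  unfolding omega_def by (rule sw_pure_tensor) (simp_all add: E_balanced)

lemma lin_omega' [simp]: "linear_map K PPP E omega"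
  using lin_omega[OF lin_id] by simp

lemma omega_mu:
  assumes d: "d \<in> carrier LL"
  shows "omega (mu d) = iota d"
proof (rule tensB_eqI[where A = E, OF rmodB_L lmodB_L _ _ d])
  fix x y assume x: "x \<in> carrier L" and y: "y \<in> carrier L"
  have "omega (mu (x \<boxtimes>\<^bsub>LL\<^esub> y)) = sw P P E y (\<lambda>r u. omega (actR P x r \<boxtimes>\<^bsub>PPP\<^esub> u))"
    unfolding mu_pure[OF x y] by (rule sw_linear) simp_all
  also have "\<dots> = sw P P E y (\<lambda>r u. x \<boxtimes>\<^bsub>E\<^esub> (r \<boxtimes>\<^bsub>PP\<^esub> u))"
    using x by (intro sw_cong refl) (simp add: omega_pure codiag_actR_L E_balanced del: canV_pure)
  also have "\<dots> = x \<boxtimes>\<^bsub>E\<^esub> sw P P PP y (\<lambda>r u. r \<boxtimes>\<^bsub>PP\<^esub> u)"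
    using x by (subst sw_tensBR[OF rmodB_actR[OF module_P] lmodB_actL]) simp_all
  also have "\<dots> = iota (x \<boxtimes>\<^bsub>LL\<^esub> y)" using x y by simp
  finally show "omega (mu (x \<boxtimes>\<^bsub>LL\<^esub> y)) = iota (x \<boxtimes>\<^bsub>LL\<^esub> y)" .
qed simp_all

text \<open>The formula for the coproduct emerges by computation:
  \<open>codiag (p \<otimes> \<one>)\<close> is
  \<open>p\<^sub>0 \<otimes> \<one> \<otimes> p\<^sub>1\<close>, and \<open>canVinv\<close> replaces
  its last two factors by \<open>\<tau> p\<^sub>1\<close>.\<close>

lemma omega_insert_one: "omega (insert_one x) = delta x"
proof -
  have "omega (insert_one x) = sw P P E x (\<lambda>p q. omega ((p \<boxtimes>\<^bsub>PP\<^esub> \<one>\<^bsub>P\<^esub>) \<boxtimes>\<^bsub>PPP\<^esub> q))"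
    unfolding insert_one_def by (rule sw_linear) simp_all
  also have "\<dots> = delta x"
    unfolding delta_def
  proof (intro sw_cong refl)
    fix p q assume pq [simp]: "p \<in> carrier P" "q \<in> carrier P"
    have "canVinv P (codiag (p \<boxtimes>\<^bsub>PP\<^esub> \<one>\<^bsub>P\<^esub>)) = canVinv P (sw P H PPH (\<rho> p) (\<lambda>a b. a \<boxtimes>\<^bsub>PPH\<^esub> (\<one>\<^bsub>P\<^esub> \<boxtimes>\<^bsub>PH\<^esub> b)))"
      by (simp add: codiag_pure)
    also have "\<dots> = sw P H (VBP P) (\<rho> p) (\<lambda>a b. canVinv P (a \<boxtimes>\<^bsub>PPH\<^esub> (\<one>\<^bsub>P\<^esub> \<boxtimes>\<^bsub>PH\<^esub> b)))"
      by (rule sw_linear) simp_all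
    finally have "canVinv P (codiag (p \<boxtimes>\<^bsub>PP\<^esub> \<one>\<^bsub>P\<^esub>)) = sw P H (VBP P) (\<rho> p) (\<lambda>a b. sw P P (VBP P) (caninv (\<one>\<^bsub>P\<^esub> \<boxtimes>\<^bsub>PH\<^esub> b))
        (\<lambda>u v. (a \<boxtimes>\<^bsub>PP\<^esub> u) \<boxtimes>\<^bsub>VBP P\<^esub> v))"
      by simp
    then show "omega ((p \<boxtimes>\<^bsub>PP\<^esub> \<one>\<^bsub>P\<^esub>) \<boxtimes>\<^bsub>PPP\<^esub> q) = sw P H E (\<rho> p) (\<lambda>a b.
        sw P P E (caninv (\<one>\<^bsub>P\<^esub> \<boxtimes>\<^bsub>PH\<^esub> b)) (\<lambda>u v. (a \<boxtimes>\<^bsub>PP\<^esub> u) \<boxtimes>\<^bsub>E\<^esub> (v \<boxtimes>\<^bsub>PP\<^esub> q)))"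
      by (simp add: omega_pure sw_tensB_sw[OF rmodB_actR[OF module_P] lmodB_P] E_balanced)
  qed
  finally show ?thesis .
qed

text \<open>Existence: take \<open>d0\<close> with \<open>mu d0 = insert_one x\<close> and apply
  \<open>omega\<close> to this equation. Uniqueness: \<open>muE\<close> recovers \<open>mu d\<close>
  from \<open>iota d\<close>, and \<open>mu\<close> is injective. The second claim records the value
  of \<open>mu\<close>, by which the coproduct is handled from now on.\<close>

lemma ex1_comult:
  assumes x: "x \<in> carrier L"
  shows "\<exists>!d. d \<in> carrier LL \<and> iota d = delta x"
    and "d \<in> carrier LL \<Longrightarrow> iota d = delta x \<Longrightarrow> mu d = insert_one x"
proof -
  obtain d0 where d0: "d0 \<in> carrier LL" "mu d0 = insert_one x"
    using insert_one_in_image[OF x] by (rule bexE)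
  have i0: "iota d0 = delta x"
    unfolding omega_mu[OF d0(1), symmetric] d0(2) by (rule omega_insert_one)
  have uniq: "d = d0" if d: "d \<in> carrier LL" "iota d = delta x" for d
  proof -
    have "muE (iota d) = muE (iota d0)" unfolding d(2) i0 ..
    then have "mu d = mu d0" unfolding muE_iota[OF d(1)] muE_iota[OF d0(1)] .
    then show ?thesis using d(1) d0(1) by (rule inj_onD[OF mu_inj])
  qed
  show "\<exists>!d. d \<in> carrier LL \<and> iota d = delta x"
    using d0(1) i0 uniq by (intro ex1I[of _ d0] conjI) (assumption | erule conjE)+
  show "d \<in> carrier LL \<Longrightarrow> iota d = delta x \<Longrightarrow> mu d = insert_one x"
    using uniq d0(2) by (simp only:)
qed

definition emult :: "('p, 'p) tens \<Rightarrow> ('p, 'p) tens \<Rightarrow> ('p, 'p) tens"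
  where "emult x y = sw P P PP x (\<lambda>p q. sw P P PP y (\<lambda>r u. (p \<otimes>\<^bsub>P\<^esub> r) \<boxtimes>\<^bsub>PP\<^esub> (u \<otimes>\<^bsub>P\<^esub> q)))"

lemma emult_ambient: "x \<in> carrier PP \<Longrightarrow> y \<in> carrier PP \<Longrightarrow> x \<otimes>\<^bsub>es_ambient K P\<^esub> y = emult x y"
  by (simp add: es_ambient_def emult_def sweedler_PP)

lemma emult_L: "x \<in> carrier PP \<Longrightarrow> y \<in> carrier PP \<Longrightarrow> x \<otimes>\<^bsub>L\<^esub> y = emult x y"
proof -
  have r: "monoid.mult (A\<lparr>carrier := c\<rparr>) = monoid.mult A" for A :: "('k, ('p, 'p) tens) module" and c
    by simp
  have "monoid.mult L = monoid.mult (es_ambient K P)"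
    unfolding L_def es_total_def Let_def by (rule r)
  then show "x \<in> carrier PP \<Longrightarrow> y \<in> carrier PP \<Longrightarrow> x \<otimes>\<^bsub>L\<^esub> y = emult x y"
    by (simp only: emult_ambient)
qed

lemma lin_emult1 [simp]: "linear_map K X PP F \<Longrightarrow> linear_map K X PP (\<lambda>x. emult (F x) y)"
  by (simp add: emult_def)

lemma emult_closed [simp]: "emult x y \<in> carrier PP"
  by (simp add: emult_def)

lemma emult_target: "x \<in> carrier PP \<Longrightarrow> b \<in> carrier P \<Longrightarrow> emult (\<one>\<^bsub>P\<^esub> \<boxtimes>\<^bsub>PP\<^esub> b) x = actR P x b"
  and emult_source: "x \<in> carrier PP \<Longrightarrow> b \<in> carrier P \<Longrightarrow> emult (b \<boxtimes>\<^bsub>PP\<^esub> \<one>\<^bsub>P\<^esub>) x = actL b x"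
  by (simp_all add: emult_def actR_def actL_def)

lemma LL_raw: "balanced_tensor (coinvariants K H P \<rho>) L (es_source K P) (es_target K P) = tensor_over Bc L (actR P) L actL"
  unfolding balanced_tensor_def Bc_def[symmetric]
  by (rule tensor_over_act_cong) (simp_all add: es_source_def es_target_def emult_L emult_target emult_source)

lemma E_raw: "balanced_tensor (coinvariants K H P \<rho>) (es_ambient K P) (es_source K P) (es_target K P) =
    tensor_over Bc PP (actR P) PP actL"
proof -
  have c: "carrier (es_ambient K P) = carrier PP" "add (es_ambient K P) = add PP"
    by (simp_all add: es_ambient_def)
  have "tensor_over Bc (es_ambient K P) rho (es_ambient K P) lam = tensor_over Bc PP rho PP lam" for rho lam
    using c by (simp add: tensor_over_def tensor_relators_def)
  then show ?thesis
    unfolding balanced_tensor_def Bc_def[symmetric]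
    by (simp only:, intro tensor_over_act_cong)
      (simp_all add: es_source_def es_target_def emult_ambient emult_target emult_source)
qed

definition comul :: "('p, 'p) tens \<Rightarrow> (('p, 'p) tens, ('p, 'p) tens) tens"
  where "comul = es_comult K H P \<rho>"

lemma comul_eq:
  assumes x: "x \<in> carrier L"
  shows "comul x = (THE d. d \<in> carrier LL \<and> iota d = delta x)"
proof -
  have i: "sweedler (tensor_over Bc PP (actR P) PP actL) d
      (\<lambda>y z. y \<boxtimes>\<^bsub>tensor_over Bc PP (actR P) PP actL\<^esub> z) = iota d" if "d \<in> carrier LL" for d
  proof -
    have "sweedler E d (\<lambda>y z. y \<boxtimes>\<^bsub>E\<^esub> z) = iota d"
      unfolding iota_def by (rule sweedler_tensB[OF rmodB_L lmodB_L _ that]) simp_all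
    then show ?thesis by (simp add: tmod_simps)
  qed
  have dl: "sweedler (tensor_over Bc PP (actR P) PP actL) x (\<lambda>p q. sweedler (tensor_over Bc PP (actR P) PP actL) (\<rho> p) (\<lambda>p0 p1.
      sweedler (tensor_over Bc PP (actR P) PP actL) (translation_map K H P \<rho> p1) (\<lambda>u v.
        (p0 \<boxtimes>\<^bsub>PP\<^esub> u) \<boxtimes>\<^bsub>tensor_over Bc PP (actR P) PP actL\<^esub> (v \<boxtimes>\<^bsub>PP\<^esub> q)))) = delta x"
  proof -
    have t: "sweedler E (caninv (\<one>\<^bsub>P\<^esub> \<boxtimes>\<^bsub>PH\<^esub> b)) f = sw P P E (caninv (\<one>\<^bsub>P\<^esub> \<boxtimes>\<^bsub>PH\<^esub> b)) f"
      if "b \<in> carrier H" "\<And>u v. u \<in> carrier P \<Longrightarrow> v \<in> carrier P \<Longrightarrow> f u v \<in> carrier E" for b f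
      by (rule sweedler_tensB[OF rmodB_P lmodB_P]) (use that in simp_all)
    have "sweedler E x (\<lambda>p q. sweedler E (\<rho> p) (\<lambda>p0 p1.
      sweedler E (translation_map K H P \<rho> p1) (\<lambda>u v.
        (p0 \<boxtimes>\<^bsub>PP\<^esub> u) \<boxtimes>\<^bsub>E\<^esub> (v \<boxtimes>\<^bsub>PP\<^esub> q)))) = delta x"
      unfolding delta_def translation_map_eq using x by (simp add: sweedler_PP sweedler_\<rho> t)
    then show ?thesis by (simp add: tmod_simps)
  qed
  have "comul x = (THE d. d \<in> carrier LL \<and> sweedler (tensor_over Bc PP (actR P) PP actL) d
      (\<lambda>y z. y \<boxtimes>\<^bsub>tensor_over Bc PP (actR P) PP actL\<^esub> z) = delta x)"
    unfolding comul_def es_comult_def Let_def L_def[symmetric] LL_raw E_raw dl tmod_simps(1) ..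
  also have "\<dots> = (THE d. d \<in> carrier LL \<and> iota d = delta x)"
    using i by (intro arg_cong[where f = The] ext conj_cong refl) simp
  finally show ?thesis .
qed

lemma comul:
  assumes x: "x \<in> carrier L"
  shows "comul x \<in> carrier LL" "iota (comul x) = delta x" "mu (comul x) = insert_one x"
proof -
  have "comul x \<in> carrier LL \<and> iota (comul x) = delta x"
    unfolding comul_eq[OF x] by (rule theI'[OF ex1_comult(1)[OF x]])
  then show "comul x \<in> carrier LL" "iota (comul x) = delta x" by simp_all
  then show "mu (comul x) = insert_one x" by (rule ex1_comult(2)[OF x])
qed

end

context base_field
begin

lemma lin_Kmult [simp]:
  assumes "linear_map K X (self_module K) F" "c \<in> carrier K"
  shows "linear_map K X (self_module K) (\<lambda>x. F x \<otimes>\<^bsub>K\<^esub> c)" "linear_map K X (self_module K) (\<lambda>x. c \<otimes>\<^bsub>K\<^esub> F x)"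
  using lin_smult_left[OF module_self assms(1), of c] lin_smult[OF module_self assms] assms(2) by simp_all

lemma sw_closed_self [simp]:
  "(\<And>m n. m \<in> carrier M \<Longrightarrow> n \<in> carrier N \<Longrightarrow> f m n \<in> carrier K) \<Longrightarrow> sw M N (self_module K) u f \<in> carrier K"
  using sw_closed_module[OF module_self, of M N f u] by simp

lemma sw_smult_u:
  assumes "module K V" "module K W" "module K A" "c \<in> carrier K" "u \<in> carrier (V \<otimes>\<^sub>K W)" "bil K V W A f"
  shows "sw V W A (c \<odot>\<^bsub>V \<otimes>\<^sub>K W\<^esub> u) f = c \<odot>\<^bsub>A\<^esub> sw V W A u f"
  by (rule linear_mapD(3)[OF lin_sw_tensor]) fact+

end

context galois_ff
begin

abbreviation "KK \<equiv> self_module K"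

section \<open>The antipode\<close>

text \<open>The comodule braiding with the universal form replaced by an arbitrary
  \<open>\<phi>\<close>, so that the antipode and its inverse are two instances.\<close>

definition flip_form :: "('h \<Rightarrow> 'h \<Rightarrow> 'k) \<Rightarrow> ('p, 'p) tens \<Rightarrow> ('p, 'p) tens"
  where "flip_form \<phi> x = sw P P PP x (\<lambda>p q. sw P H PP (\<rho> p) (\<lambda>a b. sw P H PP (\<rho> q) (\<lambda>c d.
    \<phi> b d \<odot>\<^bsub>PP\<^esub> (c \<boxtimes>\<^bsub>PP\<^esub> a))))"

text \<open>Two successive flips leave every leg of \<open>p\<close> and \<open>q\<close> coacted
  upon twice, in an interleaved order. Here coassociativity is applied to both elements at once, so
  that forms and products can be evaluated inside two coproducts.\<close>

lemma sw_coact_coassoc2: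
  fixes A :: "('k, 'a) module"
  assumes A: "module K A" and p: "p \<in> carrier P" and q: "q \<in> carrier P"
    and Z: "\<And>a1 b c c1 d. a1 \<in> carrier H \<Longrightarrow> b \<in> carrier H \<Longrightarrow> c \<in> carrier P \<Longrightarrow> c1 \<in> carrier H \<Longrightarrow> d \<in> carrier H \<Longrightarrow>
        linear_map K P A (\<lambda>a. Z a a1 b c c1 d)"
      "\<And>a b c c1 d. a \<in> carrier P \<Longrightarrow> b \<in> carrier H \<Longrightarrow> c \<in> carrier P \<Longrightarrow> c1 \<in> carrier H \<Longrightarrow> d \<in> carrier H \<Longrightarrow>
        linear_map K H A (\<lambda>a1. Z a a1 b c c1 d)"
      "\<And>a a1 c c1 d. a \<in> carrier P \<Longrightarrow> a1 \<in> carrier H \<Longrightarrow> c \<in> carrier P \<Longrightarrow> c1 \<in> carrier H \<Longrightarrow> d \<in> carrier H \<Longrightarrow>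
        linear_map K H A (\<lambda>b. Z a a1 b c c1 d)"
      "\<And>a a1 b c1 d. a \<in> carrier P \<Longrightarrow> a1 \<in> carrier H \<Longrightarrow> b \<in> carrier H \<Longrightarrow> c1 \<in> carrier H \<Longrightarrow> d \<in> carrier H \<Longrightarrow>
        linear_map K P A (\<lambda>c. Z a a1 b c c1 d)"
      "\<And>a a1 b c d. a \<in> carrier P \<Longrightarrow> a1 \<in> carrier H \<Longrightarrow> b \<in> carrier H \<Longrightarrow> c \<in> carrier P \<Longrightarrow> d \<in> carrier H \<Longrightarrow>
        linear_map K H A (\<lambda>c1. Z a a1 b c c1 d)"
      "\<And>a a1 b c c1. a \<in> carrier P \<Longrightarrow> a1 \<in> carrier H \<Longrightarrow> b \<in> carrier H \<Longrightarrow> c \<in> carrier P \<Longrightarrow> c1 \<in> carrier H \<Longrightarrow>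
        linear_map K H A (Z a a1 b c c1)"
  shows "sw P H A (\<rho> p) (\<lambda>a b. sw P H A (\<rho> q) (\<lambda>c d. sw P H A (\<rho> c) (\<lambda>c0 c1. sw P H A (\<rho> a) (\<lambda>a0 a1. Z a0 a1 b c0 c1 d)))) =
    sw P H A (\<rho> p) (\<lambda>a x. sw P H A (\<rho> q) (\<lambda>c y. sw H H A (\<Delta> x) (\<lambda>a1 b. sw H H A (\<Delta> y) (\<lambda>c1 d. Z a a1 b c c1 d))))"
proof -
  have [simp]: "Z a a1 b c c1 d \<in> carrier A" if "a \<in> carrier P" "a1 \<in> carrier H" "b \<in> carrier H" "c \<in> carrier P"
    "c1 \<in> carrier H" "d \<in> carrier H" for a a1 b c c1 d
    using linear_mapD(1)[OF Z(6)] that by blast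
  note [simp] = A p q Z trilinear_def
  have q_coassoc: "sw P H A (\<rho> q) (\<lambda>c d. sw P H A (\<rho> c) (\<lambda>c0 c1. Z a a1 b c0 c1 d)) =
      sw P H A (\<rho> q) (\<lambda>c y. sw H H A (\<Delta> y) (\<lambda>c1 d. Z a a1 b c c1 d))"
    if "a \<in> carrier P" "a1 \<in> carrier H" "b \<in> carrier H" for a a1 b
    by (rule sw_coact_coassoc[where f = "\<lambda>c c1 d. Z a a1 b c c1 d", symmetric]) (use that in simp_all)
  have "sw P H A (\<rho> p) (\<lambda>a b. sw P H A (\<rho> q) (\<lambda>c d. sw P H A (\<rho> c) (\<lambda>c0 c1. sw P H A (\<rho> a) (\<lambda>a0 a1. Z a0 a1 b c0 c1 d)))) =
      sw P H A (\<rho> p) (\<lambda>a b. sw P H A (\<rho> q) (\<lambda>c d. sw P H A (\<rho> a) (\<lambda>a0 a1. sw P H A (\<rho> c) (\<lambda>c0 c1. Z a0 a1 b c0 c1 d))))"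
    by (intro sw_cong refl sw_swap) simp_all
  also have "\<dots> = sw P H A (\<rho> p) (\<lambda>a b. sw P H A (\<rho> a) (\<lambda>a0 a1. sw P H A (\<rho> q) (\<lambda>c d. sw P H A (\<rho> c) (\<lambda>c0 c1. Z a0 a1 b c0 c1 d))))"
    by (intro sw_cong refl sw_swap) simp_all
  also have "\<dots> = sw P H A (\<rho> p) (\<lambda>a b. sw P H A (\<rho> a) (\<lambda>a0 a1. sw P H A (\<rho> q) (\<lambda>c y. sw H H A (\<Delta> y) (\<lambda>c1 d. Z a0 a1 b c c1 d))))"
    by (simp add: q_coassoc)
  also have "\<dots> = sw P H A (\<rho> p) (\<lambda>a x. sw H H A (\<Delta> x) (\<lambda>a1 b. sw P H A (\<rho> q) (\<lambda>c y. sw H H A (\<Delta> y) (\<lambda>c1 d. Z a a1 b c c1 d))))"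
    by (rule sw_coact_coassoc[where f = "\<lambda>a a1 b. sw P H A (\<rho> q) (\<lambda>c y. sw H H A (\<Delta> y) (\<lambda>c1 d. Z a a1 b c c1 d))", symmetric]) simp_all
  also have "\<dots> = sw P H A (\<rho> p) (\<lambda>a x. sw P H A (\<rho> q) (\<lambda>c y. sw H H A (\<Delta> x) (\<lambda>a1 b. sw H H A (\<Delta> y) (\<lambda>c1 d. Z a a1 b c c1 d))))"
    by (intro sw_cong refl sw_swap) simp_all
  finally show ?thesis .
qed

context
  fixes \<phi> :: "'h \<Rightarrow> 'h \<Rightarrow> 'k"
  assumes \<phi>: "bil K H H KK \<phi>"
begin

lemma form_closed: "g \<in> carrier H \<Longrightarrow> h \<in> carrier H \<Longrightarrow> \<phi> g h \<in> carrier K"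
  using bilD(1)[OF \<phi>] by simp

lemma lin_form1: "linear_map K X H F \<Longrightarrow> h \<in> carrier H \<Longrightarrow> linear_map K X KK (\<lambda>x. \<phi> (F x) h)"
  using \<phi> by (intro linear_map_comp[of K X H F KK "\<lambda>g. \<phi> g h"]) simp_all

lemma lin_form2: "linear_map K X H F \<Longrightarrow> h \<in> carrier H \<Longrightarrow> linear_map K X KK (\<lambda>x. \<phi> h (F x))"
  using \<phi> by (intro linear_map_comp[of K X H F KK "\<phi> h"]) simp_all

lemmas form_simps = form_closed lin_form1 lin_form2

lemma lin_flip_form: "linear_map K X PP F \<Longrightarrow> linear_map K X PP (\<lambda>x. flip_form \<phi> (F x))"
  by (simp add: flip_form_def form_simps)

lemma flip_form_closed: "flip_form \<phi> x \<in> carrier PP"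
  by (simp add: flip_form_def form_simps)

lemma flip_form_pure: "p \<in> carrier P \<Longrightarrow> q \<in> carrier P \<Longrightarrow>
    flip_form \<phi> (p \<boxtimes>\<^bsub>PP\<^esub> q) = sw P H PP (\<rho> p) (\<lambda>a b. sw P H PP (\<rho> q) (\<lambda>c d. \<phi> b d \<odot>\<^bsub>PP\<^esub> (c \<boxtimes>\<^bsub>PP\<^esub> a)))"
  by (simp add: flip_form_def form_simps)

text \<open>A coinvariant contributes nothing to the argument of the form, and the flip carries it
  from the last leg to the first. This is the shape of the first antipode axiom, with target on one
  side and source on the other.\<close>

lemma flip_form_actR:
  assumes x: "x \<in> carrier PP" and b: "b \<in> Bc"
  shows "flip_form \<phi> (actR P x b) = emult (flip_form \<phi> x) (b \<boxtimes>\<^bsub>PP\<^esub> \<one>\<^bsub>P\<^esub>)"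
  by (rule tensor_eqI[where A = PP, OF _ _ x])
    (use b in \<open>simp_all add: lin_flip_form flip_form_pure form_simps sw_coact_coinv(1) emult_def sw_pull sw_smult_u\<close>)

lemma flip_form_actL:
  assumes x: "x \<in> carrier PP" and b: "b \<in> Bc"
  shows "flip_form \<phi> (actL b x) = emult (flip_form \<phi> x) (\<one>\<^bsub>P\<^esub> \<boxtimes>\<^bsub>PP\<^esub> b)"
  by (rule tensor_eqI[where A = PP, OF _ _ x])
    (use b in \<open>simp_all add: lin_flip_form flip_form_pure form_simps sw_coact_coinv(2) emult_def sw_pull sw_smult_u\<close>)

end

text \<open>After the first flip the two legs have changed places, so \<open>\<psi>\<close> meets
  its arguments in the opposite order; hence the exchanged arguments of \<open>\<psi>\<close> in
  \<open>conv\<close>. Both counits are then absorbed by the coactions.\<close>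

lemma flip_form_inverse:
  assumes \<phi>: "bil K H H KK \<phi>" and \<psi>: "bil K H H KK \<psi>"
    and conv: "\<And>g h. g \<in> carrier H \<Longrightarrow> h \<in> carrier H \<Longrightarrow>
      sw H H KK (\<Delta> g) (\<lambda>g1 g2. sw H H KK (\<Delta> h) (\<lambda>h1 h2. \<psi> h1 g1 \<otimes>\<^bsub>K\<^esub> \<phi> g2 h2)) = \<epsilon> g \<otimes>\<^bsub>K\<^esub> \<epsilon> h"
    and x: "x \<in> carrier PP"
  shows "flip_form \<psi> (flip_form \<phi> x) = x"
proof (rule tensor_eqI[where A = PP, OF _ _ x])
  note [simp] = form_simps[OF \<phi>] form_simps[OF \<psi>] lin_flip_form[OF \<phi>] lin_flip_form[OF \<psi>]
  show "linear_map K PP PP (\<lambda>x. flip_form \<psi> (flip_form \<phi> x))" by simp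
  fix p q assume pq [simp]: "p \<in> carrier P" "q \<in> carrier P"
  have "flip_form \<psi> (flip_form \<phi> (p \<boxtimes>\<^bsub>PP\<^esub> q)) = sw P H PP (\<rho> p) (\<lambda>a b. sw P H PP (\<rho> q) (\<lambda>c d.
      sw P H PP (\<rho> c) (\<lambda>c0 c1. sw P H PP (\<rho> a) (\<lambda>a0 a1. (\<psi> c1 a1 \<otimes>\<^bsub>K\<^esub> \<phi> b d) \<odot>\<^bsub>PP\<^esub> (a0 \<boxtimes>\<^bsub>PP\<^esub> c0)))))"
    by (simp add: flip_form_def sw_pull sw_smult_u K.m_comm)
  also have "\<dots> = sw P H PP (\<rho> p) (\<lambda>a x. sw P H PP (\<rho> q) (\<lambda>c y.
      sw H H PP (\<Delta> x) (\<lambda>a1 b. sw H H PP (\<Delta> y) (\<lambda>c1 d. (\<psi> c1 a1 \<otimes>\<^bsub>K\<^esub> \<phi> b d) \<odot>\<^bsub>PP\<^esub> (a \<boxtimes>\<^bsub>PP\<^esub> c)))))"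
    by (rule sw_coact_coassoc2) simp_all
  also have "\<dots> = sw P H PP (\<rho> p) (\<lambda>a x. sw P H PP (\<rho> q) (\<lambda>c y. (\<epsilon> x \<otimes>\<^bsub>K\<^esub> \<epsilon> y) \<odot>\<^bsub>PP\<^esub> (a \<boxtimes>\<^bsub>PP\<^esub> c)))"
  proof (intro sw_cong refl)
    fix a x c y assume c: "a \<in> carrier P" "x \<in> carrier H" "c \<in> carrier P" "y \<in> carrier H"
    show "sw H H PP (\<Delta> x) (\<lambda>a1 b. sw H H PP (\<Delta> y) (\<lambda>c1 d. (\<psi> c1 a1 \<otimes>\<^bsub>K\<^esub> \<phi> b d) \<odot>\<^bsub>PP\<^esub> (a \<boxtimes>\<^bsub>PP\<^esub> c))) =
        (\<epsilon> x \<otimes>\<^bsub>K\<^esub> \<epsilon> y) \<odot>\<^bsub>PP\<^esub> (a \<boxtimes>\<^bsub>PP\<^esub> c)"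
      using c by (simp add: conv[symmetric] sw_smultL)
  qed
  also have "\<dots> = sw P H PP (\<rho> p) (\<lambda>a x. sw P H PP (\<rho> q) (\<lambda>c y. \<epsilon> y \<odot>\<^bsub>PP\<^esub> (\<epsilon> x \<odot>\<^bsub>PP\<^esub> (a \<boxtimes>\<^bsub>PP\<^esub> c))))"
    by (intro sw_cong refl) (simp add: K.m_comm)
  also have "\<dots> = sw P H PP (\<rho> p) (\<lambda>a x. \<epsilon> x \<odot>\<^bsub>PP\<^esub> (a \<boxtimes>\<^bsub>PP\<^esub> q))"
    by (intro sw_cong refl sw_coact_counit) simp_all
  also have "\<dots> = p \<boxtimes>\<^bsub>PP\<^esub> q"
    by (rule sw_coact_counit) simp_all
  finally show "flip_form \<psi> (flip_form \<phi> (p \<boxtimes>\<^bsub>PP\<^esub> q)) = p \<boxtimes>\<^bsub>PP\<^esub> q" .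
qed simp_all

text \<open>The content of \<open>codiag\<close>, bracketed as a coaction on the comodule
  \<open>PP\<close>. Equivariance of a map of \<open>PP\<close> can then be stated by letting it act
  on the first factor.\<close>

definition diag_coact :: "('p, 'p) tens \<Rightarrow> (('p, 'p) tens, 'h) tens"
  where "diag_coact x = sw P P PP_H x (\<lambda>p q. sw P H PP_H (\<rho> p) (\<lambda>a b. sw P H PP_H (\<rho> q) (\<lambda>c d.
    (a \<boxtimes>\<^bsub>PP\<^esub> c) \<boxtimes>\<^bsub>PP_H\<^esub> (b \<otimes>\<^bsub>H\<^esub> d))))"

lemma lin_diag_coact [simp]: "linear_map K X PP F \<Longrightarrow> linear_map K X PP_H (\<lambda>x. diag_coact (F x))"
  by (simp add: diag_coact_def)

lemma diag_coact_closed [simp]: "diag_coact x \<in> carrier PP_H"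
  by (simp add: diag_coact_def)

lemma diag_coact_pure: "p \<in> carrier P \<Longrightarrow> q \<in> carrier P \<Longrightarrow>
    diag_coact (p \<boxtimes>\<^bsub>PP\<^esub> q) = sw P H PP_H (\<rho> p) (\<lambda>a b. sw P H PP_H (\<rho> q) (\<lambda>c d.
    (a \<boxtimes>\<^bsub>PP\<^esub> c) \<boxtimes>\<^bsub>PP_H\<^esub> (b \<otimes>\<^bsub>H\<^esub> d)))"
  by (simp add: diag_coact_def)

lemma L_iff_diag_coact: "x \<in> carrier L \<longleftrightarrow> x \<in> carrier PP \<and> diag_coact x = x \<boxtimes>\<^bsub>PP_H\<^esub> \<one>\<^bsub>H\<^esub>"
proof -
  let ?r = "\<lambda>z. sw P PH PP_H z (\<lambda>p y. sw P H PP_H y (\<lambda>q h. (p \<boxtimes>\<^bsub>PP\<^esub> q) \<boxtimes>\<^bsub>PP_H\<^esub> h))"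
  let ?s = "\<lambda>z. sw PP H PPH z (\<lambda>y h. sw P P PPH y (\<lambda>p q.
    p \<boxtimes>\<^bsub>PPH\<^esub> (q \<boxtimes>\<^bsub>PH\<^esub> h)))"
  have 1: "?r (codiag x) = diag_coact x" "?s (diag_coact x) = codiag x"
    by (simp_all add: codiag_def diag_coact_def sw_pull)
  have 2: "?r (cotriv x) = x \<boxtimes>\<^bsub>PP_H\<^esub> \<one>\<^bsub>H\<^esub>" "?s (x \<boxtimes>\<^bsub>PP_H\<^esub> \<one>\<^bsub>H\<^esub>) = cotriv x" if x: "x \<in> carrier PP"
  proof -
    have "?r (cotriv x) = sw P P PP_H x (\<lambda>p q. (p \<boxtimes>\<^bsub>PP\<^esub> q) \<boxtimes>\<^bsub>PP_H\<^esub> \<one>\<^bsub>H\<^esub>)"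
      by (simp add: cotriv_def sw_pull)
    also have "\<dots> = sw P P PP x (pure_tensor PP) \<boxtimes>\<^bsub>PP_H\<^esub> \<one>\<^bsub>H\<^esub>"
      by (subst sw_pureL) simp_all
    finally show "?r (cotriv x) = x \<boxtimes>\<^bsub>PP_H\<^esub> \<one>\<^bsub>H\<^esub>" using x by simp
    show "?s (x \<boxtimes>\<^bsub>PP_H\<^esub> \<one>\<^bsub>H\<^esub>) = cotriv x" using x by (simp add: cotriv_def)
  qed
  show ?thesis
  proof
    assume "x \<in> carrier L"
    then have x: "x \<in> carrier PP" "codiag x = cotriv x" by (simp_all add: L_iff)
    show "x \<in> carrier PP \<and> diag_coact x = x \<boxtimes>\<^bsub>PP_H\<^esub> \<one>\<^bsub>H\<^esub>"
      using x(1) unfolding 1(1)[symmetric] 2(1)[OF x(1), symmetric] x(2) by (intro conjI refl)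
  next
    assume x: "x \<in> carrier PP \<and> diag_coact x = x \<boxtimes>\<^bsub>PP_H\<^esub> \<one>\<^bsub>H\<^esub>"
    then have "?s (diag_coact x) = ?s (x \<boxtimes>\<^bsub>PP_H\<^esub> \<one>\<^bsub>H\<^esub>)" by (simp only:)
    then have "codiag x = cotriv x" unfolding 1(2) 2(2)[OF conjunct1[OF x]] .
    then show "x \<in> carrier L" using x by (simp only: L_iff)
  qed
qed

lemma emult_actR:
  assumes y: "y \<in> carrier PP" and r: "r \<in> carrier P"
  shows "emult (actR P y r) x = actR P (emult y x) r"
  by (rule tensor_eqI[where A = PP, OF _ _ y]) (use r in \<open>simp_all add: emult_def actR_sw\<close>)

text \<open>In \<open>(p \<otimes> q) (r \<otimes> u) = p r \<otimes> u q\<close> the factors of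
  \<open>y = r \<otimes> u\<close> are enclosed by those of \<open>x\<close>. Their
  \<open>H\<close>-legs are adjacent in the product
  \<open>p\<^sub>1 r\<^sub>1 u\<^sub>1 q\<^sub>1\<close>, and coinvariance of \<open>y\<close>
  deletes them.\<close>

lemma diag_coact_emult:
  assumes x: "x \<in> carrier PP" and y: "y \<in> carrier L"
  shows "diag_coact (emult x y) = sw PP H PP_H (diag_coact x) (\<lambda>w h. emult w y \<boxtimes>\<^bsub>PP_H\<^esub> h)"
proof (rule tensor_eqI[where A = PP_H, OF _ _ x])
  fix p q assume pq [simp]: "p \<in> carrier P" "q \<in> carrier P"
  let ?Z = "\<lambda>a b c d e f g h. ((a \<otimes>\<^bsub>P\<^esub> e) \<boxtimes>\<^bsub>PP\<^esub> (g \<otimes>\<^bsub>P\<^esub> c)) \<boxtimes>\<^bsub>PP_H\<^esub> (b \<otimes>\<^bsub>H\<^esub> ((f \<otimes>\<^bsub>H\<^esub> h) \<otimes>\<^bsub>H\<^esub> d))"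
  have "diag_coact (emult (p \<boxtimes>\<^bsub>PP\<^esub> q) y) = sw P P PP_H y (\<lambda>r u. diag_coact ((p \<otimes>\<^bsub>P\<^esub> r) \<boxtimes>\<^bsub>PP\<^esub> (u \<otimes>\<^bsub>P\<^esub> q)))"
    by (simp add: emult_def) (rule sw_linear, simp_all)
  also have "\<dots> = sw P P PP_H y (\<lambda>r u. sw P H PP_H (\<rho> p) (\<lambda>a b. sw P H PP_H (\<rho> r) (\<lambda>e f. sw P H PP_H (\<rho> u) (\<lambda>g h.
      sw P H PP_H (\<rho> q) (\<lambda>c d. ?Z a b c d e f g h)))))"
    by (intro sw_cong refl) (simp add: diag_coact_pure sw_coact_mult)
  also have "\<dots> = sw P H PP_H (\<rho> p) (\<lambda>a b. sw P P PP_H y (\<lambda>r u. sw P H PP_H (\<rho> r) (\<lambda>e f. sw P H PP_H (\<rho> u) (\<lambda>g h.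
      sw P H PP_H (\<rho> q) (\<lambda>c d. ?Z a b c d e f g h)))))"
    by (rule sw_swap) simp_all
  also have "\<dots> = sw P H PP_H (\<rho> p) (\<lambda>a b. sw P P PP_H y (\<lambda>r u. sw P H PP_H (\<rho> r) (\<lambda>e f. sw P H PP_H (\<rho> q) (\<lambda>c d.
      sw P H PP_H (\<rho> u) (\<lambda>g h. ?Z a b c d e f g h)))))"
    by (intro sw_cong refl sw_swap) simp_all
  also have "\<dots> = sw P H PP_H (\<rho> p) (\<lambda>a b. sw P P PP_H y (\<lambda>r u. sw P H PP_H (\<rho> q) (\<lambda>c d. sw P H PP_H (\<rho> r) (\<lambda>e f.
      sw P H PP_H (\<rho> u) (\<lambda>g h. ?Z a b c d e f g h)))))"
    by (intro sw_cong refl sw_swap) simp_all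
  also have "\<dots> = sw P H PP_H (\<rho> p) (\<lambda>a b. sw P H PP_H (\<rho> q) (\<lambda>c d. sw P P PP_H y (\<lambda>r u. sw P H PP_H (\<rho> r) (\<lambda>e f.
      sw P H PP_H (\<rho> u) (\<lambda>g h. ?Z a b c d e f g h)))))"
    by (intro sw_cong refl sw_swap) simp_all
  also have "\<dots> = sw P H PP_H (\<rho> p) (\<lambda>a b. sw P H PP_H (\<rho> q) (\<lambda>c d. sw P P PP_H y (\<lambda>r u.
      ((a \<otimes>\<^bsub>P\<^esub> r) \<boxtimes>\<^bsub>PP\<^esub> (u \<otimes>\<^bsub>P\<^esub> c)) \<boxtimes>\<^bsub>PP_H\<^esub> (b \<otimes>\<^bsub>H\<^esub> (\<one>\<^bsub>H\<^esub> \<otimes>\<^bsub>H\<^esub> d)))))"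
    by (intro sw_cong refl sw_coinv[OF y, where f = "\<lambda>e g k. ((_ \<otimes>\<^bsub>P\<^esub> e) \<boxtimes>\<^bsub>PP\<^esub> (g \<otimes>\<^bsub>P\<^esub> _)) \<boxtimes>\<^bsub>PP_H\<^esub> (_ \<otimes>\<^bsub>H\<^esub> (k \<otimes>\<^bsub>H\<^esub> _))"])
      (simp_all add: trilinear_def)
  also have "\<dots> = sw PP H PP_H (diag_coact (p \<boxtimes>\<^bsub>PP\<^esub> q)) (\<lambda>w h. emult w y \<boxtimes>\<^bsub>PP_H\<^esub> h)"
    by (simp add: diag_coact_pure emult_def sw_pull)
  finally show "diag_coact (emult (p \<boxtimes>\<^bsub>PP\<^esub> q) y) = sw PP H PP_H (diag_coact (p \<boxtimes>\<^bsub>PP\<^esub> q)) (\<lambda>w h. emult w y \<boxtimes>\<^bsub>PP_H\<^esub> h)" .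
qed simp_all

lemma emult_L_closed [simp]:
  assumes x: "x \<in> carrier L" and y: "y \<in> carrier L"
  shows "emult x y \<in> carrier L"
proof -
  have "diag_coact (emult x y) = emult x y \<boxtimes>\<^bsub>PP_H\<^esub> \<one>\<^bsub>H\<^esub>"
    using x by (simp add: diag_coact_emult[OF L_carrier[OF x] y] L_iff_diag_coact)
  then show ?thesis by (simp add: L_iff_diag_coact)
qed

lemma one_L [simp]: "\<one>\<^bsub>P\<^esub> \<boxtimes>\<^bsub>PP\<^esub> \<one>\<^bsub>P\<^esub> \<in> carrier L"
  by (simp add: L_iff codiag_pure cotriv_pure)

section \<open>Evaluating sums over the coproduct\<close>

lemma sw_delta:
  assumes A: "module K A" and F: "bilB PP (actR P) PP actL A F"
  shows "sw PP PP A (delta x) F = sw P P A x (\<lambda>p q. sw P H A (\<rho> p) (\<lambda>a b.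
    sw P P A (caninv (\<one>\<^bsub>P\<^esub> \<boxtimes>\<^bsub>PH\<^esub> b)) (\<lambda>u v. F (a \<boxtimes>\<^bsub>PP\<^esub> u) (v \<boxtimes>\<^bsub>PP\<^esub> q))))"
proof -
  note T_sw = sw_E_sw[OF A _ F]
  have T_pure: "sw PP PP A (x \<boxtimes>\<^bsub>E\<^esub> y) F = F x y" if "x \<in> carrier PP" "y \<in> carrier PP" for x y
    by (rule sw_tensB_pure[OF rmodB_actR[OF module_P] lmodB_actL A that F])
  show ?thesis unfolding delta_def by (simp add: T_sw T_pure)
qed

text \<open>The coproduct in \<open>LL\<close> is known only as the solution of an equation, but its
  image under \<open>iota\<close> is explicit. If the integrand is balanced on all of
  \<open>PP\<close>, the sum over \<open>L\<close> may be taken over that image, where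
  \<open>sw_delta\<close> evaluates it.\<close>

lemma sw_iota:
  assumes A: "module K A" and F: "bilB PP (actR P) PP actL A F"
  shows "sw PP PP A (iota d) F = sw L L A d F"
proof -
  have T_pure: "sw PP PP A (x \<boxtimes>\<^bsub>E\<^esub> y) F = F x y" if "x \<in> carrier PP" "y \<in> carrier PP" for x y
    by (rule sw_tensB_pure[OF rmodB_actR[OF module_P] lmodB_actL A that F])
  show ?thesis unfolding iota_def by (simp add: sw_E_sw[OF A _ F] T_pure)
qed

lemma sw_LL_id:
  assumes d: "d \<in> carrier LL"
  shows "sw L L LL d (\<lambda>x y. x \<boxtimes>\<^bsub>LL\<^esub> y) = d"
  by (rule tensB_eqI[where A = LL, OF rmodB_L lmodB_L _ _ d]) (simp_all add: LL_balanced)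

lemma sw_mu:
  assumes A: "module K A" and th: "linear_map K PPP A th" and d: "d \<in> carrier LL"
  shows "sw L L A d (\<lambda>x y. th (mu (x \<boxtimes>\<^bsub>LL\<^esub> y))) = th (mu d)"
proof -
  have "linear_map K LL A (\<lambda>d. th (mu d))" by (rule linear_map_comp[OF lin_mu0 th])
  from sw_linear[OF this _ A, of L L "\<lambda>x y. x \<boxtimes>\<^bsub>LL\<^esub> y" d] show ?thesis
    by (simp add: sw_LL_id[OF d] del: mu_pure)
qed

text \<open>Multiplying the first leg by \<open>z\<close> touches only its outer sides and commutes
  with the contraction in \<open>mu\<close>, by \<open>emult_actR\<close>. The expression is thus
  \<open>?th\<close> applied to \<open>mu (comul y)\<close>, where \<open>insert_one\<close> is
  available and the coproduct need not be known.\<close>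

lemma mu_left:
  assumes y: "y \<in> carrier L" and z: "z \<in> carrier L"
  shows "mu (sw L L LL (comul y) (\<lambda>y1 y2. emult y1 z \<boxtimes>\<^bsub>LL\<^esub> y2)) =
    sw P P PPP y (\<lambda>a c. emult (a \<boxtimes>\<^bsub>PP\<^esub> \<one>\<^bsub>P\<^esub>) z \<boxtimes>\<^bsub>PPP\<^esub> c)"
proof -
  let ?th = "\<lambda>v. sw PP P PPP v (\<lambda>w c. emult w z \<boxtimes>\<^bsub>PPP\<^esub> c)"
  have "mu (sw L L LL (comul y) (\<lambda>y1 y2. emult y1 z \<boxtimes>\<^bsub>LL\<^esub> y2)) =
      sw L L PPP (comul y) (\<lambda>y1 y2. mu (emult y1 z \<boxtimes>\<^bsub>LL\<^esub> y2))"
    using z by (intro sw_linear) simp_all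
  also have "\<dots> = sw L L PPP (comul y) (\<lambda>y1 y2. ?th (mu (y1 \<boxtimes>\<^bsub>LL\<^esub> y2)))"
    using z by (intro sw_cong refl) (simp add: sw_pull emult_actR)
  also have "\<dots> = ?th (mu (comul y))"
    by (rule sw_mu[OF _ _ comul(1)[OF y]]) simp_all
  also have "\<dots> = sw P P PPP y (\<lambda>a c. emult (a \<boxtimes>\<^bsub>PP\<^esub> \<one>\<^bsub>P\<^esub>) z \<boxtimes>\<^bsub>PPP\<^esub> c)"
    by (simp add: comul(3)[OF y] insert_one_def sw_pull)
  finally show ?thesis .
qed

lemma mu_right:
  assumes y: "y \<in> carrier L" and z: "z \<in> carrier L"
  shows "mu (sw L L LL (comul y) (\<lambda>y1 y2. y1 \<boxtimes>\<^bsub>LL\<^esub> emult y2 z)) =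
    sw P P PPP y (\<lambda>a c. sw P P PPP z (\<lambda>p q. (a \<boxtimes>\<^bsub>PP\<^esub> p) \<boxtimes>\<^bsub>PPP\<^esub> (q \<otimes>\<^bsub>P\<^esub> c)))"
proof -
  let ?th = "\<lambda>v. sw PP P PPP v (\<lambda>w c. sw P P PPP z (\<lambda>p q. actR P w p \<boxtimes>\<^bsub>PPP\<^esub> (q \<otimes>\<^bsub>P\<^esub> c)))"
  have "mu (sw L L LL (comul y) (\<lambda>y1 y2. y1 \<boxtimes>\<^bsub>LL\<^esub> emult y2 z)) =
      sw L L PPP (comul y) (\<lambda>y1 y2. mu (y1 \<boxtimes>\<^bsub>LL\<^esub> emult y2 z))"
    using z by (intro sw_linear) simp_all
  also have "\<dots> = sw L L PPP (comul y) (\<lambda>y1 y2. ?th (mu (y1 \<boxtimes>\<^bsub>LL\<^esub> y2)))"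
    using z by (intro sw_cong refl) (simp add: sw_pull, simp add: emult_def sw_pull)
  also have "\<dots> = ?th (mu (comul y))"
    by (rule sw_mu[OF _ _ comul(1)[OF y]]) simp_all
  also have "\<dots> = sw P P PPP y (\<lambda>a c. sw P P PPP z (\<lambda>p q. (a \<boxtimes>\<^bsub>PP\<^esub> p) \<boxtimes>\<^bsub>PPP\<^esub> (q \<otimes>\<^bsub>P\<^esub> c)))"
    by (simp add: comul(3)[OF y] insert_one_def sw_pull)
  finally show ?thesis .
qed

end

section \<open>The braiding and its antipode identities\<close>

locale coquasitriangular_galois = galois_ff K H \<Delta> \<epsilon> antip P \<rho>
  for K :: "'k ring" and H :: "('k, 'h) module" and \<Delta> \<epsilon> antip and P :: "('k, 'p) module" and \<rho> +
  fixes Rf Rf' :: "('h, 'h) tens \<Rightarrow> 'k"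
  assumes conv: "convolution_inverse_forms K H \<Delta> \<epsilon> Rf Rf'"
    and comm: "\<And>g h. g \<in> carrier H \<Longrightarrow> h \<in> carrier H \<Longrightarrow>
        sweedler H (\<Delta> g) (\<lambda>g\<^sub>1 g\<^sub>2. sweedler H (\<Delta> h) (\<lambda>h\<^sub>1 h\<^sub>2.
          Rf (h\<^sub>2 \<boxtimes>\<^bsub>tensor K H H\<^esub> g\<^sub>2) \<odot>\<^bsub>H\<^esub> (g\<^sub>1 \<otimes>\<^bsub>H\<^esub> h\<^sub>1))) =
        sweedler H (\<Delta> g) (\<lambda>g\<^sub>1 g\<^sub>2. sweedler H (\<Delta> h) (\<lambda>h\<^sub>1 h\<^sub>2.
          Rf (h\<^sub>1 \<boxtimes>\<^bsub>tensor K H H\<^esub> g\<^sub>1) \<odot>\<^bsub>H\<^esub> (h\<^sub>2 \<otimes>\<^bsub>H\<^esub> g\<^sub>2)))"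
begin

definition rf :: "'h \<Rightarrow> 'h \<Rightarrow> 'k" where "rf g h = Rf (g \<boxtimes>\<^bsub>HH\<^esub> h)"
text \<open>The arguments are exchanged because the inverse braiding meets the two legs in the
  opposite order.\<close>

definition rf' :: "'h \<Rightarrow> 'h \<Rightarrow> 'k" where "rf' g h = Rf' (h \<boxtimes>\<^bsub>HH\<^esub> g)"

lemma rf_bil: "bil K H H KK rf" "bil K H H KK rf'"
proof -
  have R: "linear_map K HH KK Rf" "linear_map K HH KK Rf'"
    using conv by (simp_all add: convolution_inverse_forms_def)
  have [simp]: "linear_map K X KK (\<lambda>x. Rf (F x))" "linear_map K X KK (\<lambda>x. Rf' (F x))"
    if "linear_map K X HH F" for X :: "('k, 'x) module" and F
    by (rule linear_map_comp[OF that R(1)] linear_map_comp[OF that R(2)])+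
  show "bil K H H KK rf" "bil K H H KK rf'"
    unfolding rf_def[abs_def] rf'_def[abs_def] by simp_all
qed

lemmas rf_simps [simp] = form_simps[OF rf_bil(1)] form_simps[OF rf_bil(2)]

lemma rf_conv:
  assumes [simp]: "g \<in> carrier H" "h \<in> carrier H"
  shows "sw H H KK (\<Delta> g) (\<lambda>g1 g2. sw H H KK (\<Delta> h) (\<lambda>h1 h2. rf' h1 g1 \<otimes>\<^bsub>K\<^esub> rf g2 h2)) = \<epsilon> g \<otimes>\<^bsub>K\<^esub> \<epsilon> h"
    and "sw H H KK (\<Delta> g) (\<lambda>g1 g2. sw H H KK (\<Delta> h) (\<lambda>h1 h2. rf h1 g1 \<otimes>\<^bsub>K\<^esub> rf' g2 h2)) = \<epsilon> g \<otimes>\<^bsub>K\<^esub> \<epsilon> h"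
proof -
  have 1: "sweedler KK (\<Delta> g) (\<lambda>g1 g2. sweedler KK (\<Delta> h) (\<lambda>h1 h2. rf' h1 g1 \<otimes>\<^bsub>K\<^esub> rf g2 h2)) = \<epsilon> g \<otimes>\<^bsub>K\<^esub> \<epsilon> h"
    and 2: "sweedler KK (\<Delta> h) (\<lambda>h1 h2. sweedler KK (\<Delta> g) (\<lambda>g1 g2. rf h1 g1 \<otimes>\<^bsub>K\<^esub> rf' g2 h2)) = \<epsilon> h \<otimes>\<^bsub>K\<^esub> \<epsilon> g"
    using conv assms unfolding convolution_inverse_forms_def sweedler_self_module rf_def rf'_def by blast+
  show "sw H H KK (\<Delta> g) (\<lambda>g1 g2. sw H H KK (\<Delta> h) (\<lambda>h1 h2. rf' h1 g1 \<otimes>\<^bsub>K\<^esub> rf g2 h2)) = \<epsilon> g \<otimes>\<^bsub>K\<^esub> \<epsilon> h"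
    using 1 by (simp add: sweedler_\<Delta>)
  have "sw H H KK (\<Delta> g) (\<lambda>g1 g2. sw H H KK (\<Delta> h) (\<lambda>h1 h2. rf h1 g1 \<otimes>\<^bsub>K\<^esub> rf' g2 h2)) =
      sw H H KK (\<Delta> h) (\<lambda>h1 h2. sw H H KK (\<Delta> g) (\<lambda>g1 g2. rf h1 g1 \<otimes>\<^bsub>K\<^esub> rf' g2 h2))"
    by (rule sw_swap) simp_all
  also have "\<dots> = \<epsilon> g \<otimes>\<^bsub>K\<^esub> \<epsilon> h"
    using 2 by (simp add: sweedler_\<Delta> K.m_comm)
  finally show "sw H H KK (\<Delta> g) (\<lambda>g1 g2. sw H H KK (\<Delta> h) (\<lambda>h1 h2. rf h1 g1 \<otimes>\<^bsub>K\<^esub> rf' g2 h2)) = \<epsilon> g \<otimes>\<^bsub>K\<^esub> \<epsilon> h" .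
qed

lemma rf_comm:
  assumes x [simp]: "x \<in> carrier H" and y [simp]: "y \<in> carrier H"
    and A [simp]: "module K A" and f: "linear_map K H A f"
  shows "sw H H A (\<Delta> x) (\<lambda>x1 x2. sw H H A (\<Delta> y) (\<lambda>y1 y2. rf x2 y2 \<odot>\<^bsub>A\<^esub> f (y1 \<otimes>\<^bsub>H\<^esub> x1))) =
    sw H H A (\<Delta> x) (\<lambda>x1 x2. sw H H A (\<Delta> y) (\<lambda>y1 y2. rf x1 y1 \<odot>\<^bsub>A\<^esub> f (x2 \<otimes>\<^bsub>H\<^esub> y2)))"
proof -
  note [simp] = linear_mapD(1,3)[OF f]
  have "sw H H A (\<Delta> y) (\<lambda>y1 y2. sw H H A (\<Delta> x) (\<lambda>x1 x2. rf x2 y2 \<odot>\<^bsub>A\<^esub> f (y1 \<otimes>\<^bsub>H\<^esub> x1))) =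
      f (sw H H H (\<Delta> y) (\<lambda>y1 y2. sw H H H (\<Delta> x) (\<lambda>x1 x2. rf x2 y2 \<odot>\<^bsub>H\<^esub> (y1 \<otimes>\<^bsub>H\<^esub> x1))))"
    by (simp add: sw_linear[OF f])
  also have "\<dots> = f (sw H H H (\<Delta> y) (\<lambda>y1 y2. sw H H H (\<Delta> x) (\<lambda>x1 x2. rf x1 y1 \<odot>\<^bsub>H\<^esub> (x2 \<otimes>\<^bsub>H\<^esub> y2))))"
    using comm[OF y x] by (simp add: sweedler_\<Delta> rf_def[symmetric])
  also have "\<dots> = sw H H A (\<Delta> y) (\<lambda>y1 y2. sw H H A (\<Delta> x) (\<lambda>x1 x2. rf x1 y1 \<odot>\<^bsub>A\<^esub> f (x2 \<otimes>\<^bsub>H\<^esub> y2)))"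
    by (simp add: sw_linear[OF f])
  finally have eq: "sw H H A (\<Delta> y) (\<lambda>y1 y2. sw H H A (\<Delta> x) (\<lambda>x1 x2. rf x2 y2 \<odot>\<^bsub>A\<^esub> f (y1 \<otimes>\<^bsub>H\<^esub> x1))) =
      sw H H A (\<Delta> y) (\<lambda>y1 y2. sw H H A (\<Delta> x) (\<lambda>x1 x2. rf x1 y1 \<odot>\<^bsub>A\<^esub> f (x2 \<otimes>\<^bsub>H\<^esub> y2)))" .
  have "sw H H A (\<Delta> x) (\<lambda>x1 x2. sw H H A (\<Delta> y) (\<lambda>y1 y2. rf x2 y2 \<odot>\<^bsub>A\<^esub> f (y1 \<otimes>\<^bsub>H\<^esub> x1))) =
      sw H H A (\<Delta> y) (\<lambda>y1 y2. sw H H A (\<Delta> x) (\<lambda>x1 x2. rf x2 y2 \<odot>\<^bsub>A\<^esub> f (y1 \<otimes>\<^bsub>H\<^esub> x1)))"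
    by (rule sw_swap) simp_all
  also note eq
  also have "sw H H A (\<Delta> y) (\<lambda>y1 y2. sw H H A (\<Delta> x) (\<lambda>x1 x2. rf x1 y1 \<odot>\<^bsub>A\<^esub> f (x2 \<otimes>\<^bsub>H\<^esub> y2))) =
      sw H H A (\<Delta> x) (\<lambda>x1 x2. sw H H A (\<Delta> y) (\<lambda>y1 y2. rf x1 y1 \<odot>\<^bsub>A\<^esub> f (x2 \<otimes>\<^bsub>H\<^esub> y2)))"
    by (rule sw_swap) simp_all
  finally show ?thesis .
qed

definition sigma where "sigma = flip_form rf"
definition sigma' where "sigma' = flip_form rf'"

lemma lin_sigma [simp]: "linear_map K X PP F \<Longrightarrow> linear_map K X PP (\<lambda>x. sigma (F x))"
  and lin_sigma' [simp]: "linear_map K X PP F \<Longrightarrow> linear_map K X PP (\<lambda>x. sigma' (F x))"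
  unfolding sigma_def sigma'_def by (rule lin_flip_form[OF rf_bil(1)] lin_flip_form[OF rf_bil(2)]; assumption)+

lemma lin_sigma0 [simp]: "linear_map K PP PP sigma" and lin_sigma'0 [simp]: "linear_map K PP PP sigma'"
  using lin_sigma[OF lin_id] lin_sigma'[OF lin_id] by simp_all

lemma sigma_closed [simp]: "sigma x \<in> carrier PP" "sigma' x \<in> carrier PP"
  unfolding sigma_def sigma'_def by (rule flip_form_closed[OF rf_bil(1)] flip_form_closed[OF rf_bil(2)])+

lemma sigma_pure: "p \<in> carrier P \<Longrightarrow> q \<in> carrier P \<Longrightarrow>
    sigma (p \<boxtimes>\<^bsub>PP\<^esub> q) = sw P H PP (\<rho> p) (\<lambda>a b. sw P H PP (\<rho> q) (\<lambda>c d. rf b d \<odot>\<^bsub>PP\<^esub> (c \<boxtimes>\<^bsub>PP\<^esub> a)))"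
  and sigma'_pure: "p \<in> carrier P \<Longrightarrow> q \<in> carrier P \<Longrightarrow>
    sigma' (p \<boxtimes>\<^bsub>PP\<^esub> q) = sw P H PP (\<rho> p) (\<lambda>a b. sw P H PP (\<rho> q) (\<lambda>c d. rf' b d \<odot>\<^bsub>PP\<^esub> (c \<boxtimes>\<^bsub>PP\<^esub> a)))"
  unfolding sigma_def sigma'_def by (rule flip_form_pure[OF rf_bil(1)] flip_form_pure[OF rf_bil(2)]; assumption)+

lemma sigma'_sigma [simp]: "x \<in> carrier PP \<Longrightarrow> sigma' (sigma x) = x"
  and sigma_sigma' [simp]: "x \<in> carrier PP \<Longrightarrow> sigma (sigma' x) = x"
  unfolding sigma_def sigma'_def
  by (rule flip_form_inverse[OF rf_bil(1,2) rf_conv(1)] flip_form_inverse[OF rf_bil(2,1) rf_conv(2)]; assumption)+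

lemmas sigma_actR = flip_form_actR[OF rf_bil(1), folded sigma_def]
lemmas sigma'_actL = flip_form_actL[OF rf_bil(2), folded sigma'_def]

text \<open>After coassociativity, the form and the product \<open>c1 \<otimes> a1\<close> sit in
  the coproducts of \<open>x\<close> and \<open>y\<close> exactly as on one side of the commutation
  relation \<open>rf_comm\<close>. Replacing it by the other side and undoing coassociativity shows
  that \<open>sigma\<close> is a comodule map.\<close>

lemma diag_coact_sigma:
  assumes x: "x \<in> carrier PP"
  shows "diag_coact (sigma x) = sw PP H PP_H (diag_coact x) (\<lambda>y h. sigma y \<boxtimes>\<^bsub>PP_H\<^esub> h)"
proof (rule tensor_eqI[where A = PP_H, OF _ _ x])
  fix p q assume pq [simp]: "p \<in> carrier P" "q \<in> carrier P"
  have "diag_coact (sigma (p \<boxtimes>\<^bsub>PP\<^esub> q)) = sw P H PP_H (\<rho> p) (\<lambda>a b. sw P H PP_H (\<rho> q) (\<lambda>c d.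
      sw P H PP_H (\<rho> c) (\<lambda>c0 c1. sw P H PP_H (\<rho> a) (\<lambda>a0 a1. rf b d \<odot>\<^bsub>PP_H\<^esub> ((c0 \<boxtimes>\<^bsub>PP\<^esub> a0) \<boxtimes>\<^bsub>PP_H\<^esub> (c1 \<otimes>\<^bsub>H\<^esub> a1))))))"
    by (simp add: sigma_pure diag_coact_def sw_pull sw_smult_u)
  also have "\<dots> = sw P H PP_H (\<rho> p) (\<lambda>a x. sw P H PP_H (\<rho> q) (\<lambda>c y. sw H H PP_H (\<Delta> x) (\<lambda>a1 b. sw H H PP_H (\<Delta> y) (\<lambda>c1 d.
      rf b d \<odot>\<^bsub>PP_H\<^esub> ((c \<boxtimes>\<^bsub>PP\<^esub> a) \<boxtimes>\<^bsub>PP_H\<^esub> (c1 \<otimes>\<^bsub>H\<^esub> a1))))))"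
    by (rule sw_coact_coassoc2) simp_all
  also have "\<dots> = sw P H PP_H (\<rho> p) (\<lambda>a x. sw P H PP_H (\<rho> q) (\<lambda>c y. sw H H PP_H (\<Delta> x) (\<lambda>a1 b. sw H H PP_H (\<Delta> y) (\<lambda>c1 d.
      rf a1 c1 \<odot>\<^bsub>PP_H\<^esub> ((c \<boxtimes>\<^bsub>PP\<^esub> a) \<boxtimes>\<^bsub>PP_H\<^esub> (b \<otimes>\<^bsub>H\<^esub> d))))))"
  proof -
    have "sw H H PP_H (\<Delta> x) (\<lambda>a1 b. sw H H PP_H (\<Delta> y) (\<lambda>c1 d. rf b d \<odot>\<^bsub>PP_H\<^esub> ((c \<boxtimes>\<^bsub>PP\<^esub> a) \<boxtimes>\<^bsub>PP_H\<^esub> (c1 \<otimes>\<^bsub>H\<^esub> a1)))) =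
        sw H H PP_H (\<Delta> x) (\<lambda>a1 b. sw H H PP_H (\<Delta> y) (\<lambda>c1 d. rf a1 c1 \<odot>\<^bsub>PP_H\<^esub> ((c \<boxtimes>\<^bsub>PP\<^esub> a) \<boxtimes>\<^bsub>PP_H\<^esub> (b \<otimes>\<^bsub>H\<^esub> d))))"
      if "a \<in> carrier P" "c \<in> carrier P" "x \<in> carrier H" "y \<in> carrier H" for a c x y
      using that by (intro rf_comm[where f = "\<lambda>h. (c \<boxtimes>\<^bsub>PP\<^esub> a) \<boxtimes>\<^bsub>PP_H\<^esub> h"]) simp_all
    then show ?thesis by simp
  qed
  also have "\<dots> = sw P H PP_H (\<rho> p) (\<lambda>a b. sw P H PP_H (\<rho> q) (\<lambda>c d.
      sw P H PP_H (\<rho> c) (\<lambda>c0 c1. sw P H PP_H (\<rho> a) (\<lambda>a0 a1. rf a1 c1 \<odot>\<^bsub>PP_H\<^esub> ((c0 \<boxtimes>\<^bsub>PP\<^esub> a0) \<boxtimes>\<^bsub>PP_H\<^esub> (b \<otimes>\<^bsub>H\<^esub> d))))))"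
    by (rule sw_coact_coassoc2[symmetric]) simp_all
  also have "\<dots> = sw P H PP_H (\<rho> p) (\<lambda>a b. sw P H PP_H (\<rho> q) (\<lambda>c d.
      sw P H PP_H (\<rho> a) (\<lambda>a0 a1. sw P H PP_H (\<rho> c) (\<lambda>c0 c1. rf a1 c1 \<odot>\<^bsub>PP_H\<^esub> ((c0 \<boxtimes>\<^bsub>PP\<^esub> a0) \<boxtimes>\<^bsub>PP_H\<^esub> (b \<otimes>\<^bsub>H\<^esub> d))))))"
    by (intro sw_cong refl sw_swap) simp_all
  also have "\<dots> = sw PP H PP_H (diag_coact (p \<boxtimes>\<^bsub>PP\<^esub> q)) (\<lambda>y h. sigma y \<boxtimes>\<^bsub>PP_H\<^esub> h)"
    by (simp add: sigma_pure diag_coact_pure sw_pull)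
  finally show "diag_coact (sigma (p \<boxtimes>\<^bsub>PP\<^esub> q)) = sw PP H PP_H (diag_coact (p \<boxtimes>\<^bsub>PP\<^esub> q)) (\<lambda>y h. sigma y \<boxtimes>\<^bsub>PP_H\<^esub> h)" .
qed simp_all

lemma sigma_L [simp]:
  assumes x: "x \<in> carrier L"
  shows "sigma x \<in> carrier L"
proof -
  have "diag_coact (sigma x) = sigma x \<boxtimes>\<^bsub>PP_H\<^esub> \<one>\<^bsub>H\<^esub>"
    using x by (simp add: diag_coact_sigma L_iff_diag_coact)
  then show ?thesis by (simp add: L_iff_diag_coact)
qed

text \<open>The inverse of an equivariant bijection is equivariant, so no commutation relation for
  \<open>Rf'\<close> has to be derived.\<close>

lemma sigma'_L [simp]:
  assumes x: "x \<in> carrier L"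
  shows "sigma' x \<in> carrier L"
proof -
  let ?s = "\<lambda>z. sw PP H PP_H z (\<lambda>y h. sigma y \<boxtimes>\<^bsub>PP_H\<^esub> h)" and ?s' = "\<lambda>z. sw PP H PP_H z (\<lambda>y h. sigma' y \<boxtimes>\<^bsub>PP_H\<^esub> h)"
  have inv: "?s' (?s z) = z" if z: "z \<in> carrier PP_H" for z
    by (rule tensor_eqI[where A = PP_H, OF _ _ z]) simp_all
  have xP: "x \<in> carrier PP" using x by simp
  have "?s (diag_coact (sigma' x)) = diag_coact x"
    using xP by (simp add: diag_coact_sigma[symmetric])
  also have "\<dots> = ?s (sigma' x \<boxtimes>\<^bsub>PP_H\<^esub> \<one>\<^bsub>H\<^esub>)"
    using x by (simp add: L_iff_diag_coact)
  finally have "?s' (?s (diag_coact (sigma' x))) = ?s' (?s (sigma' x \<boxtimes>\<^bsub>PP_H\<^esub> \<one>\<^bsub>H\<^esub>))" by (rule arg_cong)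
  then have "diag_coact (sigma' x) = sigma' x \<boxtimes>\<^bsub>PP_H\<^esub> \<one>\<^bsub>H\<^esub>"
    by (simp only: inv diag_coact_closed tensor_pure_closed module_tensor module_P module_H sigma_closed
        unital_algebraD(3)[OF unital_algebra_H])
  then show ?thesis by (simp add: L_iff_diag_coact)
qed

text \<open>Under \<open>sigma'\<close> the right leg \<open>v\<close> of the translation map is
  coacted upon and its remainder is multiplied by the left leg \<open>u\<close>, the combination
  that \<open>can\<close> evaluates. Both sides become \<open>sigma' x \<boxtimes> \<one>\<close>
  under \<open>mu\<close>, which is injective.\<close>

lemma antipode_right:
  assumes x: "x \<in> carrier L"
  shows "sw L L LL (comul x) (\<lambda>x1 x2. sw L L LL (comul (sigma' x2)) (\<lambda>y1 y2. y1 \<boxtimes>\<^bsub>LL\<^esub> emult y2 x1)) =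
    sigma' x \<boxtimes>\<^bsub>LL\<^esub> (\<one>\<^bsub>P\<^esub> \<boxtimes>\<^bsub>PP\<^esub> \<one>\<^bsub>P\<^esub>)" (is "?l = ?r")
proof -
  \<comment> \<open>The right side of \<open>mu_right\<close> at \<open>sigma' x2\<close>, defined
    for all arguments in \<open>PP\<close>, so that \<open>sw_iota\<close> can replace
    \<open>comul x\<close> by \<open>delta x\<close>.\<close>
  define F where "F x1 x2 = sw P P PPP (sigma' x2) (\<lambda>a c. sw P P PPP x1 (\<lambda>p q. (a \<boxtimes>\<^bsub>PP\<^esub> p) \<boxtimes>\<^bsub>PPP\<^esub> (q \<otimes>\<^bsub>P\<^esub> c)))" for x1 x2
  have F: "bilB PP (actR P) PP actL PPP F"
    unfolding F_def[abs_def] by (simp add: sigma'_actL emult_def actR_def sw_pull)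
  have l: "?l \<in> carrier LL" and r: "?r \<in> carrier LL"
    using x by simp_all
  have "mu ?l = sw L L PPP (comul x) (\<lambda>x1 x2. mu (sw L L LL (comul (sigma' x2)) (\<lambda>y1 y2. y1 \<boxtimes>\<^bsub>LL\<^esub> emult y2 x1)))"
    by (rule sw_linear) simp_all
  also have "\<dots> = sw L L PPP (comul x) F"
    unfolding F_def by (intro sw_cong refl mu_right sigma'_L)
  also have "\<dots> = sw PP PP PPP (delta x) F"
    unfolding comul(2)[OF x, symmetric] by (rule sw_iota[symmetric, OF _ F]) simp
  also have "\<dots> = sw P P PPP x (\<lambda>p q. sw P H PPP (\<rho> p) (\<lambda>a b.
      sw P P PPP (caninv (\<one>\<^bsub>P\<^esub> \<boxtimes>\<^bsub>PH\<^esub> b)) (\<lambda>u v. F (a \<boxtimes>\<^bsub>PP\<^esub> u) (v \<boxtimes>\<^bsub>PP\<^esub> q))))"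
    by (rule sw_delta[OF _ F]) simp
  also have "\<dots> = sw P P PPP x (\<lambda>p q. sw P H PPP (\<rho> p) (\<lambda>a b.
      sw P P PPP (caninv (\<one>\<^bsub>P\<^esub> \<boxtimes>\<^bsub>PH\<^esub> b)) (\<lambda>u v. sw P H PPP (\<rho> v) (\<lambda>v0 v1. sw P H PPP (\<rho> q) (\<lambda>c d.
        rf' v1 d \<odot>\<^bsub>PPP\<^esub> ((c \<boxtimes>\<^bsub>PP\<^esub> a) \<boxtimes>\<^bsub>PPP\<^esub> (u \<otimes>\<^bsub>P\<^esub> v0)))))))"
    unfolding F_def by (simp add: sigma'_pure sw_pull sw_smult_u)
  \<comment> \<open>The integrand depends on the two legs only through \<open>u v\<^sub>0\<close>
    and \<open>v\<^sub>1\<close>, which may be replaced by \<open>\<one>\<close> and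
    \<open>b\<close>.\<close>
  also have "\<dots> = sw P P PPP x (\<lambda>p q. sw P H PPP (\<rho> p) (\<lambda>a b.
      sw P H PPP (\<one>\<^bsub>P\<^esub> \<boxtimes>\<^bsub>PH\<^esub> b) (\<lambda>m h. sw P H PPP (\<rho> q) (\<lambda>c d.
        rf' h d \<odot>\<^bsub>PPP\<^esub> ((c \<boxtimes>\<^bsub>PP\<^esub> a) \<boxtimes>\<^bsub>PPP\<^esub> m)))))"
    by (intro sw_cong refl sw_caninv[where f = "\<lambda>m h. sw P H PPP (\<rho> _) (\<lambda>c d. rf' h d \<odot>\<^bsub>PPP\<^esub> ((c \<boxtimes>\<^bsub>PP\<^esub> _) \<boxtimes>\<^bsub>PPP\<^esub> m))"]) simp_all
  also have "\<dots> = sw P P PPP x (\<lambda>p q. sw P H PPP (\<rho> p) (\<lambda>a b. sw P H PPP (\<rho> q) (\<lambda>c d.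
        rf' b d \<odot>\<^bsub>PPP\<^esub> ((c \<boxtimes>\<^bsub>PP\<^esub> a) \<boxtimes>\<^bsub>PPP\<^esub> \<one>\<^bsub>P\<^esub>))))"
    by simp
  also have "\<dots> = sigma' x \<boxtimes>\<^bsub>PPP\<^esub> \<one>\<^bsub>P\<^esub>"
    by (simp add: sigma'_def flip_form_def sw_pull)
  also have "\<dots> = mu ?r" using x by simp
  finally have "mu ?l = mu ?r" .
  then show ?thesis using l r by (rule inj_onD[OF mu_inj])
qed

text \<open>Here the left leg of the translation map is coacted upon, and evaluation leaves
  \<open>rf\<close> at \<open>p\<^sub>1\<close> and \<open>antip p\<^sub>2\<close> instead of
  \<open>p\<^sub>1\<close> and \<open>q\<^sub>1\<close>. Since \<open>x\<close> is coinvariant, the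
  product \<open>p\<^sub>3 q\<^sub>1\<close> can be inserted after the antipode, where
  \<open>p\<^sub>2\<close> and \<open>p\<^sub>3\<close> cancel and \<open>q\<^sub>1\<close>
  remains.\<close>

lemma antipode_left:
  assumes x: "x \<in> carrier L"
  shows "sw L L LL (comul x) (\<lambda>x1 x2. sw L L LL (comul (sigma x1)) (\<lambda>y1 y2. emult y1 x2 \<boxtimes>\<^bsub>LL\<^esub> y2)) =
    (\<one>\<^bsub>P\<^esub> \<boxtimes>\<^bsub>PP\<^esub> \<one>\<^bsub>P\<^esub>) \<boxtimes>\<^bsub>LL\<^esub> sigma x" (is "?l = ?r")
proof -
  define F where "F x1 x2 = sw P P PPP (sigma x1) (\<lambda>a c. emult (a \<boxtimes>\<^bsub>PP\<^esub> \<one>\<^bsub>P\<^esub>) x2 \<boxtimes>\<^bsub>PPP\<^esub> c)" for x1 x2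
  have F: "bilB PP (actR P) PP actL PPP F"
    unfolding F_def[abs_def] by (simp add: sigma_actR emult_def actL_def sw_pull)
  have l: "?l \<in> carrier LL" and r: "?r \<in> carrier LL"
    using x by simp_all
  let ?W = "\<lambda>c a. (\<one>\<^bsub>P\<^esub> \<boxtimes>\<^bsub>PP\<^esub> c) \<boxtimes>\<^bsub>PPP\<^esub> a"
  \<comment> \<open>The sum over the coaction of \<open>u\<close> has to stand outside that of
    \<open>a\<close> before \<open>sw_caninv_left\<close> applies; it yields \<open>antip b\<close>
    because the coaction of \<open>\<one>\<close> is trivial.\<close>
  have caninv: "sw P P PPP (caninv (\<one>\<^bsub>P\<^esub> \<boxtimes>\<^bsub>PH\<^esub> b)) (\<lambda>u v. sw P H PPP (\<rho> a) (\<lambda>a0 a1. sw P H PPP (\<rho> u) (\<lambda>u0 u1.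
        rf a1 u1 \<odot>\<^bsub>PPP\<^esub> (((u0 \<otimes>\<^bsub>P\<^esub> v) \<boxtimes>\<^bsub>PP\<^esub> q) \<boxtimes>\<^bsub>PPP\<^esub> a0)))) =
      sw P H PPP (\<rho> a) (\<lambda>a0 a1. rf a1 (antip b) \<odot>\<^bsub>PPP\<^esub> ?W q a0)"
    if [simp]: "a \<in> carrier P" "b \<in> carrier H" "q \<in> carrier P" for a b q
  proof -
    have "sw P P PPP (caninv (\<one>\<^bsub>P\<^esub> \<boxtimes>\<^bsub>PH\<^esub> b)) (\<lambda>u v. sw P H PPP (\<rho> a) (\<lambda>a0 a1. sw P H PPP (\<rho> u) (\<lambda>u0 u1.
          rf a1 u1 \<odot>\<^bsub>PPP\<^esub> (((u0 \<otimes>\<^bsub>P\<^esub> v) \<boxtimes>\<^bsub>PP\<^esub> q) \<boxtimes>\<^bsub>PPP\<^esub> a0)))) =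
        sw P P PPP (caninv (\<one>\<^bsub>P\<^esub> \<boxtimes>\<^bsub>PH\<^esub> b)) (\<lambda>u v. sw P H PPP (\<rho> u) (\<lambda>u0 u1. sw P H PPP (\<rho> a) (\<lambda>a0 a1.
          rf a1 u1 \<odot>\<^bsub>PPP\<^esub> (((u0 \<otimes>\<^bsub>P\<^esub> v) \<boxtimes>\<^bsub>PP\<^esub> q) \<boxtimes>\<^bsub>PPP\<^esub> a0))))"
      by (intro sw_cong refl sw_swap) simp_all
    also have "\<dots> = sw P H PPP (\<one>\<^bsub>P\<^esub> \<boxtimes>\<^bsub>PH\<^esub> b) (\<lambda>m h. sw P H PPP (\<rho> m) (\<lambda>s t. sw P H PPP (\<rho> a) (\<lambda>a0 a1.
          rf a1 (t \<otimes>\<^bsub>H\<^esub> antip h) \<odot>\<^bsub>PPP\<^esub> ((s \<boxtimes>\<^bsub>PP\<^esub> q) \<boxtimes>\<^bsub>PPP\<^esub> a0))))"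
      by (rule sw_caninv_left[where f = "\<lambda>m h. sw P H PPP (\<rho> a) (\<lambda>a0 a1. rf a1 h \<odot>\<^bsub>PPP\<^esub> ((m \<boxtimes>\<^bsub>PP\<^esub> q) \<boxtimes>\<^bsub>PPP\<^esub> a0))"]) simp_all
    also have "\<dots> = sw P H PPP (\<rho> a) (\<lambda>a0 a1. rf a1 (antip b) \<odot>\<^bsub>PPP\<^esub> ?W q a0)" by simp
    finally show ?thesis .
  qed
  have move: "sw P H PPP (\<rho> p) (\<lambda>a' b'. sw P H PPP (\<rho> q) (\<lambda>c d. sw P H PPP (\<rho> a') (\<lambda>a b. sw P H PPP (\<rho> a) (\<lambda>a0 a1.
        rf a1 (antip b \<otimes>\<^bsub>H\<^esub> (b' \<otimes>\<^bsub>H\<^esub> d)) \<odot>\<^bsub>PPP\<^esub> ?W c a0)))) =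
      sw P H PPP (\<rho> p) (\<lambda>a b. sw P H PPP (\<rho> q) (\<lambda>c d. rf b d \<odot>\<^bsub>PPP\<^esub> ?W c a))"
    if [simp]: "p \<in> carrier P" "q \<in> carrier P" for p q
  proof -
    \<comment> \<open>The three \<open>H\<close>-legs of \<open>p\<close> are consecutive: the first
      stays in the form, while the second, under the antipode, cancels the third.\<close>
    have inner: "sw P H PPP (\<rho> p) (\<lambda>a' b'. sw P H PPP (\<rho> a') (\<lambda>a b. sw P H PPP (\<rho> a) (\<lambda>a0 a1.
          rf a1 (antip b \<otimes>\<^bsub>H\<^esub> (b' \<otimes>\<^bsub>H\<^esub> d)) \<odot>\<^bsub>PPP\<^esub> ?W c a0))) =
        sw P H PPP (\<rho> p) (\<lambda>a b. rf b d \<odot>\<^bsub>PPP\<^esub> ?W c a)"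
      if [simp]: "c \<in> carrier P" "d \<in> carrier H" for c d
    proof -
      let ?G = "\<lambda>a k. sw P H PPP (\<rho> a) (\<lambda>a0 a1. rf a1 k \<odot>\<^bsub>PPP\<^esub> ?W c a0)"
      have "sw P H PPP (\<rho> p) (\<lambda>a' b'. sw P H PPP (\<rho> a') (\<lambda>a b. ?G a (antip b \<otimes>\<^bsub>H\<^esub> (b' \<otimes>\<^bsub>H\<^esub> d)))) =
          sw P H PPP (\<rho> p) (\<lambda>a y. sw H H PPP (\<Delta> y) (\<lambda>b b'. ?G a (antip b \<otimes>\<^bsub>H\<^esub> (b' \<otimes>\<^bsub>H\<^esub> d))))"
        by (rule sw_coact_coassoc[where f = "\<lambda>a b b'. ?G a (antip b \<otimes>\<^bsub>H\<^esub> (b' \<otimes>\<^bsub>H\<^esub> d))", symmetric])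
          (simp_all add: trilinear_def)
      also have "\<dots> = sw P H PPP (\<rho> p) (\<lambda>a y. sw H H PPP (\<Delta> y) (\<lambda>b b'. ?G a ((antip b \<otimes>\<^bsub>H\<^esub> b') \<otimes>\<^bsub>H\<^esub> d)))"
        by simp
      also have "\<dots> = sw P H PPP (\<rho> p) (\<lambda>a y. \<epsilon> y \<odot>\<^bsub>PPP\<^esub> ?G a (\<one>\<^bsub>H\<^esub> \<otimes>\<^bsub>H\<^esub> d))"
      proof (rule sw_cong[OF refl refl refl refl])
        fix a y assume [simp]: "a \<in> carrier P" "y \<in> carrier H"
        show "sw H H PPP (\<Delta> y) (\<lambda>b b'. ?G a ((antip b \<otimes>\<^bsub>H\<^esub> b') \<otimes>\<^bsub>H\<^esub> d)) = \<epsilon> y \<odot>\<^bsub>PPP\<^esub> ?G a (\<one>\<^bsub>H\<^esub> \<otimes>\<^bsub>H\<^esub> d)"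
          by (rule sw_antip(1)[where f = "\<lambda>k. ?G a (k \<otimes>\<^bsub>H\<^esub> d)"]) simp_all
      qed
      also have "\<dots> = ?G p (\<one>\<^bsub>H\<^esub> \<otimes>\<^bsub>H\<^esub> d)"
        by (rule sw_coact_counit[where f = "\<lambda>a. ?G a (\<one>\<^bsub>H\<^esub> \<otimes>\<^bsub>H\<^esub> d)"]) simp_all
      finally show ?thesis by simp
    qed
    have "sw P H PPP (\<rho> p) (\<lambda>a' b'. sw P H PPP (\<rho> q) (\<lambda>c d. sw P H PPP (\<rho> a') (\<lambda>a b. sw P H PPP (\<rho> a) (\<lambda>a0 a1.
          rf a1 (antip b \<otimes>\<^bsub>H\<^esub> (b' \<otimes>\<^bsub>H\<^esub> d)) \<odot>\<^bsub>PPP\<^esub> ?W c a0)))) =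
        sw P H PPP (\<rho> q) (\<lambda>c d. sw P H PPP (\<rho> p) (\<lambda>a' b'. sw P H PPP (\<rho> a') (\<lambda>a b. sw P H PPP (\<rho> a) (\<lambda>a0 a1.
          rf a1 (antip b \<otimes>\<^bsub>H\<^esub> (b' \<otimes>\<^bsub>H\<^esub> d)) \<odot>\<^bsub>PPP\<^esub> ?W c a0))))"
      by (rule sw_swap) simp_all
    also have "\<dots> = sw P H PPP (\<rho> q) (\<lambda>c d. sw P H PPP (\<rho> p) (\<lambda>a b. rf b d \<odot>\<^bsub>PPP\<^esub> ?W c a))"
      by (intro sw_cong[OF refl refl refl refl] inner)
    also have "\<dots> = sw P H PPP (\<rho> p) (\<lambda>a b. sw P H PPP (\<rho> q) (\<lambda>c d. rf b d \<odot>\<^bsub>PPP\<^esub> ?W c a))"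
      by (rule sw_swap) simp_all
    finally show ?thesis .
  qed
  have "mu ?l = sw L L PPP (comul x) (\<lambda>x1 x2. mu (sw L L LL (comul (sigma x1)) (\<lambda>y1 y2. emult y1 x2 \<boxtimes>\<^bsub>LL\<^esub> y2)))"
    by (rule sw_linear) simp_all
  also have "\<dots> = sw L L PPP (comul x) F"
    unfolding F_def by (intro sw_cong refl mu_left sigma_L)
  also have "\<dots> = sw PP PP PPP (delta x) F"
    unfolding comul(2)[OF x, symmetric] by (rule sw_iota[symmetric, OF _ F]) simp
  also have "\<dots> = sw P P PPP x (\<lambda>p q. sw P H PPP (\<rho> p) (\<lambda>a b.
      sw P P PPP (caninv (\<one>\<^bsub>P\<^esub> \<boxtimes>\<^bsub>PH\<^esub> b)) (\<lambda>u v. F (a \<boxtimes>\<^bsub>PP\<^esub> u) (v \<boxtimes>\<^bsub>PP\<^esub> q))))"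
    by (rule sw_delta[OF _ F]) simp
  also have "\<dots> = sw P P PPP x (\<lambda>p q. sw P H PPP (\<rho> p) (\<lambda>a b.
      sw P P PPP (caninv (\<one>\<^bsub>P\<^esub> \<boxtimes>\<^bsub>PH\<^esub> b)) (\<lambda>u v. sw P H PPP (\<rho> a) (\<lambda>a0 a1. sw P H PPP (\<rho> u) (\<lambda>u0 u1.
        rf a1 u1 \<odot>\<^bsub>PPP\<^esub> (((u0 \<otimes>\<^bsub>P\<^esub> v) \<boxtimes>\<^bsub>PP\<^esub> q) \<boxtimes>\<^bsub>PPP\<^esub> a0))))))"
    unfolding F_def by (simp add: sigma_pure emult_def sw_pull sw_smult_u)
  also have "\<dots> = sw P P PPP x (\<lambda>p q. sw P H PPP (\<rho> p) (\<lambda>a b. sw P H PPP (\<rho> a) (\<lambda>a0 a1.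
      rf a1 (antip b \<otimes>\<^bsub>H\<^esub> \<one>\<^bsub>H\<^esub>) \<odot>\<^bsub>PPP\<^esub> ?W q a0)))"
    by (simp add: caninv)
  \<comment> \<open>Coinvariance is used backwards: the factor \<open>\<one>\<close> kept beside
    \<open>antip b\<close> becomes the product of the \<open>H\<close>-legs of \<open>p\<close> and
    \<open>q\<close>.\<close>
  also have "\<dots> = sw P P PPP x (\<lambda>p q. sw P H PPP (\<rho> p) (\<lambda>a' b'. sw P H PPP (\<rho> q) (\<lambda>c d. sw P H PPP (\<rho> a') (\<lambda>a b. sw P H PPP (\<rho> a) (\<lambda>a0 a1.
        rf a1 (antip b \<otimes>\<^bsub>H\<^esub> (b' \<otimes>\<^bsub>H\<^esub> d)) \<odot>\<^bsub>PPP\<^esub> ?W c a0)))))"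
    by (rule sw_coinv[OF x, where f = "\<lambda>p q h. sw P H PPP (\<rho> p) (\<lambda>a b. sw P H PPP (\<rho> a) (\<lambda>a0 a1.
        rf a1 (antip b \<otimes>\<^bsub>H\<^esub> h) \<odot>\<^bsub>PPP\<^esub> ?W q a0))", symmetric]) (simp_all add: trilinear_def)
  also have "\<dots> = sw P P PPP x (\<lambda>p q. sw P H PPP (\<rho> p) (\<lambda>a b. sw P H PPP (\<rho> q) (\<lambda>c d. rf b d \<odot>\<^bsub>PPP\<^esub> ?W c a)))"
    by (intro sw_cong[OF refl refl refl refl] move)
  also have "\<dots> = sw P P PPP (sigma x) (\<lambda>r u. (\<one>\<^bsub>P\<^esub> \<boxtimes>\<^bsub>PP\<^esub> r) \<boxtimes>\<^bsub>PPP\<^esub> u)"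
    by (simp add: sigma_def flip_form_def sw_pull sw_smult_u)
  also have "\<dots> = mu ?r" using x by simp
  finally have "mu ?l = mu ?r" .
  then show ?thesis using l r by (rule inj_onD[OF mu_inj])
qed

lemma sigma_bij: "bij_betw sigma (carrier L) (carrier L)"
  by (rule bij_betw_byWitness[where f' = sigma']) (auto intro: sigma_L sigma'_L)

lemma inv_sigma: "x \<in> carrier L \<Longrightarrow> inv_into (carrier L) sigma x = sigma' x"
  by (rule inv_into_f_eq[OF bij_betw_imp_inj_on[OF sigma_bij]]) simp_all

text \<open>Only a change of language is left: inside the sums, \<open>inv_into\<close> becomes
  \<open>sigma'\<close>, the product of \<open>L\<close> becomes \<open>emult\<close>, and
  \<open>sweedler\<close> becomes \<open>sw\<close>, each on the carriers.\<close>

lemma left_antipode_sigma: "left_antipode K (es_bialgebroid K H P \<rho>) sigma"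
proof -
  let ?LL = "tensor_over Bc L (actR P) L actL"
  have LL: "sweedler ?LL = sweedler LL" "pure_tensor ?LL = pure_tensor LL"
    by (simp_all add: tmod_simps)
  have r: "\<one>\<^bsub>A\<lparr>monoid.mult := m, monoid.one := e, carrier := c\<rparr>\<^esub> = e"
    for A :: "('k, ('p, 'p) tens) module" and m e c by simp
  have one: "\<one>\<^bsub>L\<^esub> = \<one>\<^bsub>P\<^esub> \<boxtimes>\<^bsub>PP\<^esub> \<one>\<^bsub>P\<^esub>"
    unfolding L_def es_total_def es_ambient_def Let_def by (rule r)
  note sweedler_LL = sweedler_tensB[OF rmodB_L lmodB_L module_imp_abelian_group[OF module_tensB[OF rmodB_L lmodB_L]]]
  have 1: "linear_map K L L sigma"
    by (rule linear_map_LL) simp_all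
  have 2: "sigma (es_target K P b \<otimes>\<^bsub>L\<^esub> x) = sigma x \<otimes>\<^bsub>L\<^esub> es_source K P b"
    "inv_into (carrier L) sigma (es_source K P b \<otimes>\<^bsub>L\<^esub> x) = inv_into (carrier L) sigma x \<otimes>\<^bsub>L\<^esub> es_target K P b"
    if x: "x \<in> carrier L" and b: "b \<in> Bc" for x b
    using x b
    by (simp_all add: es_target_def es_source_def emult_L emult_target emult_source sigma_actR sigma'_actL inv_sigma)
  have 3: "sweedler LL (comul x) (\<lambda>x1 x2. sweedler LL (comul (inv_into (carrier L) sigma x2)) (\<lambda>y1 y2.
      y1 \<boxtimes>\<^bsub>LL\<^esub> (y2 \<otimes>\<^bsub>L\<^esub> x1))) = inv_into (carrier L) sigma x \<boxtimes>\<^bsub>LL\<^esub> \<one>\<^bsub>L\<^esub>"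
    if x: "x \<in> carrier L" for x
  proof -
    have inner: "sweedler LL (comul (inv_into (carrier L) sigma x2)) (\<lambda>y1 y2. y1 \<boxtimes>\<^bsub>LL\<^esub> (y2 \<otimes>\<^bsub>L\<^esub> x1)) =
        sw L L LL (comul (sigma' x2)) (\<lambda>y1 y2. y1 \<boxtimes>\<^bsub>LL\<^esub> emult y2 x1)"
      if "x1 \<in> carrier L" "x2 \<in> carrier L" for x1 x2
      using that by (subst sweedler_LL) (simp_all add: inv_sigma comul emult_L)
    have "sweedler LL (comul x) (\<lambda>x1 x2. sweedler LL (comul (inv_into (carrier L) sigma x2)) (\<lambda>y1 y2.
        y1 \<boxtimes>\<^bsub>LL\<^esub> (y2 \<otimes>\<^bsub>L\<^esub> x1))) =
      sw L L LL (comul x) (\<lambda>x1 x2. sweedler LL (comul (inv_into (carrier L) sigma x2)) (\<lambda>y1 y2.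
        y1 \<boxtimes>\<^bsub>LL\<^esub> (y2 \<otimes>\<^bsub>L\<^esub> x1)))"
      by (rule sweedler_LL[OF comul(1)[OF x]]) (simp add: inner)
    also have "\<dots> = sw L L LL (comul x) (\<lambda>x1 x2. sw L L LL (comul (sigma' x2)) (\<lambda>y1 y2. y1 \<boxtimes>\<^bsub>LL\<^esub> emult y2 x1))"
      by (intro sw_cong[OF refl refl refl refl] inner)
    finally show ?thesis unfolding antipode_right[OF x] inv_sigma[OF x] one .
  qed
  have 4: "sweedler LL (comul x) (\<lambda>x1 x2. sweedler LL (comul (sigma x1)) (\<lambda>y1 y2.
      (y1 \<otimes>\<^bsub>L\<^esub> x2) \<boxtimes>\<^bsub>LL\<^esub> y2)) = \<one>\<^bsub>L\<^esub> \<boxtimes>\<^bsub>LL\<^esub> sigma x"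
    if x: "x \<in> carrier L" for x
  proof -
    have inner: "sweedler LL (comul (sigma x1)) (\<lambda>y1 y2. (y1 \<otimes>\<^bsub>L\<^esub> x2) \<boxtimes>\<^bsub>LL\<^esub> y2) =
        sw L L LL (comul (sigma x1)) (\<lambda>y1 y2. emult y1 x2 \<boxtimes>\<^bsub>LL\<^esub> y2)"
      if "x1 \<in> carrier L" "x2 \<in> carrier L" for x1 x2
      using that by (subst sweedler_LL) (simp_all add: comul emult_L)
    have "sweedler LL (comul x) (\<lambda>x1 x2. sweedler LL (comul (sigma x1)) (\<lambda>y1 y2. (y1 \<otimes>\<^bsub>L\<^esub> x2) \<boxtimes>\<^bsub>LL\<^esub> y2)) =
      sw L L LL (comul x) (\<lambda>x1 x2. sweedler LL (comul (sigma x1)) (\<lambda>y1 y2. (y1 \<otimes>\<^bsub>L\<^esub> x2) \<boxtimes>\<^bsub>LL\<^esub> y2))"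
      by (rule sweedler_LL[OF comul(1)[OF x]]) (simp add: inner)
    also have "\<dots> = sw L L LL (comul x) (\<lambda>x1 x2. sw L L LL (comul (sigma x1)) (\<lambda>y1 y2. emult y1 x2 \<boxtimes>\<^bsub>LL\<^esub> y2))"
      by (intro sw_cong[OF refl refl refl refl] inner)
    finally show ?thesis unfolding antipode_left[OF x] one .
  qed
  show ?thesis
    unfolding left_antipode_def es_bialgebroid_def Let_def bialgebroid.simps L_def[symmetric] LL_raw LL
      comul_def[symmetric] Bc_def[symmetric]
    using 1 sigma_bij 2 3 4 by (intro conjI ballI)
qed

end

theorem proposition4p6:
  fixes K :: "'k ring"
    and H :: "('k, 'h) module"
    and \<Delta> :: "'h \<Rightarrow> ('h, 'h) tens"
    and \<epsilon> :: "'h \<Rightarrow> 'k"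
    and antip :: "'h \<Rightarrow> 'h"
    and P :: "('k, 'p) module"
    and \<rho> :: "'p \<Rightarrow> ('p, 'h) tens"
  assumes "field K"
    and "hopf_algebra K H \<Delta> \<epsilon> antip"
    and "coquasitriangular K H \<Delta> \<epsilon>"
    and "hopf_galois K H \<Delta> \<epsilon> antip P \<rho>"
    and "faithfully_flat TYPE(('p \<times> 'h) list set set)
           (coinvariants K H P \<rho>) P (\<lambda>b p. b \<otimes>\<^bsub>P\<^esub> p)"
  shows "\<exists>S. left_antipode K (es_bialgebroid K H P \<rho>) S"
proof -
  obtain Rf Rf' where conv: "convolution_inverse_forms K H \<Delta> \<epsilon> Rf Rf'"
    and comm: "\<forall>g\<in>carrier H. \<forall>h\<in>carrier H.
        sweedler H (\<Delta> g) (\<lambda>g\<^sub>1 g\<^sub>2. sweedler H (\<Delta> h) (\<lambda>h\<^sub>1 h\<^sub>2.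
          Rf (h\<^sub>2 \<boxtimes>\<^bsub>tensor K H H\<^esub> g\<^sub>2) \<odot>\<^bsub>H\<^esub> (g\<^sub>1 \<otimes>\<^bsub>H\<^esub> h\<^sub>1))) =
        sweedler H (\<Delta> g) (\<lambda>g\<^sub>1 g\<^sub>2. sweedler H (\<Delta> h) (\<lambda>h\<^sub>1 h\<^sub>2.
          Rf (h\<^sub>1 \<boxtimes>\<^bsub>tensor K H H\<^esub> g\<^sub>1) \<odot>\<^bsub>H\<^esub> (h\<^sub>2 \<otimes>\<^bsub>H\<^esub> g\<^sub>2)))"
    using assms(3) unfolding coquasitriangular_def by (elim exE conjE) (rule that)
  interpret coquasitriangular_galois K H \<Delta> \<epsilon> antip P \<rho> Rf Rf'
    by (intro coquasitriangular_galois.intro galois_ff.intro galois_ext.intro base_field.intro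
        galois_ext_axioms.intro galois_ff_axioms.intro coquasitriangular_galois_axioms.intro assms conv
        comm[rule_format])
  show ?thesis by (rule exI[of _ sigma]) (rule left_antipode_sigma)
qed

end
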